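(* Let $G$ be a simple graph with vertex set $[\ell]=\{1,\dots,\ell\}$ and $G\ne K_\ell$, where $K_\ell$ is the complete graph on $[\ell]$. Then $$\mathrm{pd}_S(\Omega^1(\mathcal{A}_G))=\mathrm{reg}(I(G^c))-2,$$ where $G^c$ is the complementary graph of $G$ and $I(G^c)$ is its edge ideal.
   Context: Let $\mathbb{K}$ be a field, $V=\mathbb{K}^\ell$ and $S=\mathbb{K}[x_1,\dots,x_\ell]$ with $\deg x_i=1$, where $x_1,\dots,x_\ell$ are the coordinate functions. For a simple graph $G$ with vertex set $[\ell]$ and edge set $E(G)$, the graphic arrangement is $\mathcal{A}_G=\{\{x_u=x_v\}\mid\{u,v\}\in E(G)\}$. $G^c$ has vertex set $[\ell]$ and its edges are the two-element subsets of $[\ell]$ that are not edges of $G$. The edge ideal of a graph $\Gamma$ on $[\ell]$ is $I(\Gamma)=(x_ux_v\mid\{u,v\}\in E(\Gamma))\subset S$. For a finitely generated graded $S$-module $M$, $\beta_{i,j}(M)=\dim_{\mathbb{K}}\mathrm{Tor}_i^S(M,\mathbb{K})_j$ and $\mathrm{reg}(M)=\max\{j\mid\beta_{i,i+j}(M)\ne0\text{ for some }i\}$ is the Castelnuovo–Mumford regularity. $\mathrm{pd}_S$ is projective dimension over $S$. For a finite set $\mathcal{A}$ of linear hyperplanes in $V$, $\alpha_H\in V^*$ denotes a defining linear form of $H\in\mathcal{A}$ and $Q(\mathcal{A})=\prod_{H\in\mathcal{A}}\alpha_H$. Let $\Omega_V^1=\bigoplus_i S\,dx_i$, $\Omega_V^2=\bigwedge^2\Omega_V^1$,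 and for $\alpha=\sum c_ix_i$ let $d\alpha=\sum c_i\,dx_i$. Define $$\Omega^1(\mathcal{A})=\{\omega\in \tfrac{1}{Q(\mathcal{A})}\Omega^1_V \mid Q(\mathcal{A})\,\omega\wedge d\alpha_H\in\alpha_H\Omega_V^2\ \text{for all } H\in\mathcal{A}\}.$$ *)

theory Defs
  imports
    "HOL-Library.Poly_Mapping"
    "HOL-Library.Extended_Real"
    "HOL-Computational_Algebra.Polynomial_Factorial"
    "HOL-Analysis.Finite_Cartesian_Product"
begin

section \<open>The polynomial ring\<close>

text \<open>
  The index set \<open>[\<ell>]\<close> is a finite linearly ordered type \<open>'n\<close>, so that \<open>\<ell> = CARD('n)\<close>. The order
  only serves to make the polynomial ring an instance of \<^class>\<open>idom\<close>.
\<close>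

type_synonym ('n, 'k) mpoly = "('n \<Rightarrow>\<^sub>0 nat) \<Rightarrow>\<^sub>0 'k"

definition Const :: "'k \<Rightarrow> ('n, 'k::comm_ring_1) mpoly" where
  "Const c = Poly_Mapping.single 0 c"

definition Var :: "'n \<Rightarrow> ('n, 'k::comm_ring_1) mpoly" where
  "Var i = Poly_Mapping.single (Poly_Mapping.single i 1) 1"

definition mon_degree :: "('n \<Rightarrow>\<^sub>0 nat) \<Rightarrow> nat" where
  "mon_degree m = (\<Sum>i\<in>Poly_Mapping.keys m. Poly_Mapping.lookup m i)"

definition homog :: "int \<Rightarrow> ('n, 'k::comm_ring_1) mpoly set" where
  "homog j = {p. \<forall>m\<in>Poly_Mapping.keys p. int (mon_degree m) = j}"


section \<open>Modules, resolutions and projective dimension\<close>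

text \<open>
  A module is a submodule (\<^const>\<open>module.subspace\<close>) of a type that is a module via a scalar
  multiplication; homomorphisms only have to be linear on the submodule.
\<close>

definition module_hom_on ::
  "('r \<Rightarrow> 'a \<Rightarrow> 'a) \<Rightarrow> ('r \<Rightarrow> 'b \<Rightarrow> 'b) \<Rightarrow> 'a::ab_group_add set \<Rightarrow> 'b::ab_group_add set
    \<Rightarrow> ('a \<Rightarrow> 'b) \<Rightarrow> bool" where
  "module_hom_on s t M N f \<longleftrightarrow>
     f ` M \<subseteq> N \<and>
     (\<forall>x\<in>M. \<forall>y\<in>M. f (x + y) = f x + f y) \<and>
     (\<forall>r. \<forall>x\<in>M. f (s r x) = t r (f x))"

text \<open>The type \<open>'x \<Rightarrow>\<^sub>0 'r\<close> is the free \<open>'r\<close>-module on \<open>'x\<close>.\<close>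

definition fscale :: "'r::comm_ring_1 \<Rightarrow> ('x \<Rightarrow>\<^sub>0 'r) \<Rightarrow> ('x \<Rightarrow>\<^sub>0 'r)" where
  "fscale r z = Poly_Mapping.map ((*) r) z"

lemma lookup_fscale: "Poly_Mapping.lookup (fscale r z) x = r * Poly_Mapping.lookup z x"
  by (simp add: fscale_def map.rep_eq when_def)

lemma module_fscale: "module fscale"
  by unfold_locales
    (auto intro!: poly_mapping_eqI simp: lookup_fscale lookup_add algebra_simps)

text \<open>
  Projective means direct summand of a free module; the free module on the underlying type of
  \<open>P\<close> suffices, since it surjects onto \<open>P\<close>.
\<close>

definition projective ::
  "('r::comm_ring_1 \<Rightarrow> 'a \<Rightarrow> 'a) \<Rightarrow> 'a::ab_group_add set \<Rightarrow> bool" where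
  "projective s P \<longleftrightarrow>
     module.subspace s P \<and>
     (\<exists>(i :: 'a \<Rightarrow> ('a \<Rightarrow>\<^sub>0 'r)) \<pi>.
        module_hom_on s fscale P UNIV i \<and> module_hom_on fscale s UNIV P \<pi> \<and>
        (\<forall>x\<in>P. \<pi> (i x) = x))"

text \<open>\<open>\<dots> \<rightarrow> P 2 \<rightarrow> P 1 \<rightarrow> P 0 \<rightarrow> M \<rightarrow> 0\<close> with \<open>d i : P (i+1) \<rightarrow> P i\<close> and augmentation \<open>\<epsilon>\<close>.\<close>

definition resolution ::
  "('r \<Rightarrow> 'a \<Rightarrow> 'a) \<Rightarrow> ('r \<Rightarrow> 'b \<Rightarrow> 'b) \<Rightarrow> 'a::ab_group_add set
    \<Rightarrow> (nat \<Rightarrow> 'b::ab_group_add set) \<Rightarrow> (nat \<Rightarrow> 'b \<Rightarrow> 'b) \<Rightarrow> ('b \<Rightarrow> 'a) \<Rightarrow> bool" where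
  "resolution s t M P d \<epsilon> \<longleftrightarrow>
     module_hom_on t s (P 0) M \<epsilon> \<and>
     (\<forall>i. module_hom_on t t (P (Suc i)) (P i) (d i)) \<and>
     \<epsilon> ` P 0 = M \<and>
     {x \<in> P 0. \<epsilon> x = 0} = d 0 ` P 1 \<and>
     (\<forall>i. {x \<in> P (Suc i). d i x = 0} = d (Suc i) ` P (Suc (Suc i)))"

text \<open>
  The terms of the resolutions are submodules of the free module of countable rank. Every
  countably generated projective module embeds there, so for finitely generated modules over a
  Noetherian ring no projective resolution is missed up to isomorphism and length.
\<close>

definition proj_dim ::
  "('r::comm_ring_1 \<Rightarrow> 'a \<Rightarrow> 'a) \<Rightarrow> 'a::ab_group_add set \<Rightarrow> enat" where
  "proj_dim s M = Inf {enat n | n.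
     \<exists>(P :: nat \<Rightarrow> (nat \<Rightarrow>\<^sub>0 'r) set) d \<epsilon>.
       resolution s fscale M P d \<epsilon> \<and> (\<forall>i. projective fscale (P i)) \<and> (\<forall>i>n. P i = {0})}"


section \<open>Graded free resolutions\<close>

text \<open>
  The list \<open>a\<close> of integers encodes the graded free module \<open>\<Oplus>\<^sub>k S(-a\<^sub>k)\<close>, whose \<open>k\<close>-th basis
  element has degree \<open>a\<^sub>k\<close>.
\<close>

definition gfree :: "int list \<Rightarrow> (nat \<Rightarrow>\<^sub>0 ('n, 'k::comm_ring_1) mpoly) set" where
  "gfree a = {x. Poly_Mapping.keys x \<subseteq> {..<length a}}"

definition gfree_comp :: "int list \<Rightarrow> int \<Rightarrow> (nat \<Rightarrow>\<^sub>0 ('n, 'k::comm_ring_1) mpoly) set" where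
  "gfree_comp a j = {x \<in> gfree a. \<forall>k<length a. Poly_Mapping.lookup x k \<in> homog (j - a ! k)}"

text \<open>Here \<open>gr j\<close> is the homogeneous component of degree \<open>j\<close> of the graded module \<open>M\<close>.\<close>

definition graded_free_resolution ::
  "(('n, 'k::comm_ring_1) mpoly \<Rightarrow> 'a \<Rightarrow> 'a) \<Rightarrow> 'a::ab_group_add set \<Rightarrow> (int \<Rightarrow> 'a set)
    \<Rightarrow> (nat \<Rightarrow> int list)
    \<Rightarrow> (nat \<Rightarrow> (nat \<Rightarrow>\<^sub>0 ('n, 'k) mpoly) \<Rightarrow> (nat \<Rightarrow>\<^sub>0 ('n, 'k) mpoly))
    \<Rightarrow> ((nat \<Rightarrow>\<^sub>0 ('n, 'k) mpoly) \<Rightarrow> 'a) \<Rightarrow> bool" where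
  "graded_free_resolution s M gr a d \<epsilon> \<longleftrightarrow>
     resolution s fscale M (\<lambda>i. gfree (a i)) d \<epsilon> \<and>
     (\<forall>j. \<epsilon> ` gfree_comp (a 0) j \<subseteq> gr j) \<and>
     (\<forall>i j. d i ` gfree_comp (a (Suc i)) j \<subseteq> gfree_comp (a i) j)"


section \<open>Tensor products, Tor and Betti numbers\<close>

text \<open>
  \<open>M \<otimes> N\<close> is the quotient of the free module on \<open>M \<times> N\<close> by the bilinear relations. Quotients are
  not formed as sets of cosets: a quotient \<open>Z/B\<close> is represented by the pair of \<open>Z\<close> and \<open>B\<close>.
\<close>

definition tensor :: "'a \<Rightarrow> 'b \<Rightarrow> ('a \<times> 'b \<Rightarrow>\<^sub>0 'r::comm_ring_1)" where
  "tensor x y = Poly_Mapping.single (x, y) 1"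

definition tensor_rel ::
  "('r::comm_ring_1 \<Rightarrow> 'a \<Rightarrow> 'a) \<Rightarrow> ('r \<Rightarrow> 'b \<Rightarrow> 'b) \<Rightarrow> 'a::ab_group_add set
    \<Rightarrow> 'b::ab_group_add set \<Rightarrow> ('a \<times> 'b \<Rightarrow>\<^sub>0 'r) set" where
  "tensor_rel s t M N = module.span fscale
     ({tensor (x + x') y - tensor x y - tensor x' y | x x' y. x \<in> M \<and> x' \<in> M \<and> y \<in> N} \<union>
      {tensor x (y + y') - tensor x y - tensor x y' | x y y'. x \<in> M \<and> y \<in> N \<and> y' \<in> N} \<union>
      {tensor (s r x) y - fscale r (tensor x y) | r x y. x \<in> M \<and> y \<in> N} \<union>
      {tensor x (t r y) - fscale r (tensor x y) | r x y. x \<in> M \<and> y \<in> N})"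

text \<open>The map \<open>f \<otimes> id\<close>, on representatives.\<close>

definition tensor_map ::
  "('a \<Rightarrow> 'c) \<Rightarrow> ('a \<times> 'b \<Rightarrow>\<^sub>0 'r::comm_ring_1) \<Rightarrow> ('c \<times> 'b \<Rightarrow>\<^sub>0 'r)" where
  "tensor_map f z = (\<Sum>p\<in>Poly_Mapping.keys z.
     fscale (Poly_Mapping.lookup z p) (tensor (f (fst p)) (snd p)))"

text \<open>
  The residue field \<open>K\<close>, on which a polynomial acts through its constant term. It is concentrated
  in degree \<open>0\<close>, so \<open>(F \<otimes> K)\<^sub>j\<close> is spanned by the \<open>x \<otimes> c\<close> with \<open>x\<close> homogeneous of degree \<open>j\<close>.
\<close>

definition res_scale :: "('n, 'k::comm_ring_1) mpoly \<Rightarrow> 'k \<Rightarrow> 'k" where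
  "res_scale p c = Poly_Mapping.lookup p 0 * c"

definition kscale :: "'k::comm_ring_1 \<Rightarrow> ('x \<Rightarrow>\<^sub>0 ('n, 'k) mpoly) \<Rightarrow> ('x \<Rightarrow>\<^sub>0 ('n, 'k) mpoly)" where
  "kscale c = fscale (Const c)"

definition tensK_rel ::
  "int list \<Rightarrow> ((nat \<Rightarrow>\<^sub>0 ('n, 'k::field) mpoly) \<times> 'k \<Rightarrow>\<^sub>0 ('n, 'k) mpoly) set" where
  "tensK_rel a = tensor_rel fscale res_scale (gfree a) UNIV"

definition tensK_comp ::
  "int list \<Rightarrow> int \<Rightarrow> ((nat \<Rightarrow>\<^sub>0 ('n, 'k::field) mpoly) \<times> 'k \<Rightarrow>\<^sub>0 ('n, 'k) mpoly) set" where
  "tensK_comp a j = module.span kscale {tensor x c | x c. x \<in> gfree_comp a j}"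

text \<open>
  \<open>Tor\<^sub>i(M, K)\<^sub>j\<close> is the degree \<open>j\<close> part of the homology of \<open>F\<^sub>\<bullet> \<otimes> K\<close> at position \<open>i\<close>. The cycles
  and the boundaries below are the preimages in the free module on \<open>F\<^sub>i \<times> K\<close>.
\<close>

definition tor_cycles ::
  "(nat \<Rightarrow> int list)
    \<Rightarrow> (nat \<Rightarrow> (nat \<Rightarrow>\<^sub>0 ('n, 'k::field) mpoly) \<Rightarrow> (nat \<Rightarrow>\<^sub>0 ('n, 'k) mpoly))
    \<Rightarrow> nat \<Rightarrow> int \<Rightarrow> ((nat \<Rightarrow>\<^sub>0 ('n, 'k) mpoly) \<times> 'k \<Rightarrow>\<^sub>0 ('n, 'k) mpoly) set" where
  "tor_cycles a d i j =
     {z + w | z w. z \<in> tensK_comp (a i) j \<and> w \<in> tensK_rel (a i)} \<inter>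
     {z. case i of 0 \<Rightarrow> True | Suc i' \<Rightarrow> tensor_map (d i') z \<in> tensK_rel (a i')}"

definition tor_boundaries ::
  "(nat \<Rightarrow> int list)
    \<Rightarrow> (nat \<Rightarrow> (nat \<Rightarrow>\<^sub>0 ('n, 'k::field) mpoly) \<Rightarrow> (nat \<Rightarrow>\<^sub>0 ('n, 'k) mpoly))
    \<Rightarrow> nat \<Rightarrow> int \<Rightarrow> ((nat \<Rightarrow>\<^sub>0 ('n, 'k) mpoly) \<times> 'k \<Rightarrow>\<^sub>0 ('n, 'k) mpoly) set" where
  "tor_boundaries a d i j =
     {tensor_map (d i) z + w | z w. z \<in> tensK_comp (a (Suc i)) j \<and> w \<in> tensK_rel (a i)}"

text \<open>
  \<open>dim (Z/B)\<close>: the set \<open>C\<close> extends a basis \<open>C'\<close> of \<open>B\<close> to a basis of \<open>Z\<close>, so its classes form a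
  basis of \<open>Z/B\<close>. As for \<^const>\<open>card\<close>, the value is \<open>0\<close> if the quotient has infinite dimension.
\<close>

definition quot_dim :: "('k::field \<Rightarrow> 'a \<Rightarrow> 'a) \<Rightarrow> 'a::ab_group_add set \<Rightarrow> 'a set \<Rightarrow> nat" where
  "quot_dim s Z B = card (SOME C. \<exists>C'. C \<inter> C' = {} \<and> \<not> module.dependent s (C \<union> C') \<and>
     module.span s C' = B \<and> module.span s (C \<union> C') = Z)"

text \<open>The Betti numbers do not depend on the resolution chosen here.\<close>

definition betti ::
  "(('n, 'k::field) mpoly \<Rightarrow> 'a \<Rightarrow> 'a) \<Rightarrow> 'a::ab_group_add set \<Rightarrow> (int \<Rightarrow> 'a set)
    \<Rightarrow> nat \<Rightarrow> int \<Rightarrow> nat" where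
  "betti s M gr i j =
     (let (a, d, \<epsilon>) = (SOME (a, d, \<epsilon>). graded_free_resolution s M gr a d \<epsilon>)
      in quot_dim kscale (tor_cycles a d i j) (tor_boundaries a d i j))"

definition regularity ::
  "(('n, 'k::field) mpoly \<Rightarrow> 'a \<Rightarrow> 'a) \<Rightarrow> 'a::ab_group_add set \<Rightarrow> (int \<Rightarrow> 'a set) \<Rightarrow> int" where
  "regularity s M gr = Max {j. \<exists>i. betti s M gr i (int i + j) \<noteq> 0}"

definition ideal_regularity :: "('n::{finite, linorder}, 'k::field) mpoly set \<Rightarrow> int" where
  "ideal_regularity I = regularity (*) I (\<lambda>j. I \<inter> homog j)"


section \<open>Graphs and edge ideals\<close>

text \<open>Simple graphs on the vertex set \<^term>\<open>UNIV :: 'n set\<close>, given by their sets of edges.\<close>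

definition complete_graph :: "'n set set" where
  "complete_graph = {e. card e = 2}"

definition simple_graph :: "'n set set \<Rightarrow> bool" where
  "simple_graph E \<longleftrightarrow> E \<subseteq> complete_graph"

definition graph_complement :: "'n set set \<Rightarrow> 'n set set" where
  "graph_complement E = complete_graph - E"

definition edge_ideal :: "'n set set \<Rightarrow> ('n, 'k::field) mpoly set" where
  "edge_ideal E = module.span (*) {Var u * Var v | u v. {u, v} \<in> E}"


section \<open>Arrangements and logarithmic forms\<close>

definition graphic_arrangement :: "'n set set \<Rightarrow> ('k::field ^ 'n::finite) set set" where
  "graphic_arrangement E = {{x. x $ u = x $ v} | u v. {u, v} \<in> E}"

text \<open>The coefficient vector of a defining linear form of a hyperplane, unique up to a unit.\<close>

definition normal_vec :: "('k::field ^ 'n::finite) set \<Rightarrow> 'k ^ 'n" where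
  "normal_vec H = (SOME c. c \<noteq> 0 \<and> H = {x. (\<Sum>i\<in>UNIV. c $ i * x $ i) = 0})"

definition def_form :: "('k::field ^ 'n::finite) set \<Rightarrow> ('n, 'k) mpoly" where
  "def_form H = (\<Sum>i\<in>UNIV. Const (normal_vec H $ i) * Var i)"

definition d_def_form :: "('k::field ^ 'n::finite) set \<Rightarrow> ('n, 'k) mpoly ^ 'n" where
  "d_def_form H = (\<chi> i. Const (normal_vec H $ i))"

definition arr_poly :: "('k::field ^ 'n::finite) set set \<Rightarrow> ('n, 'k) mpoly" where
  "arr_poly \<A> = (\<Prod>H\<in>\<A>. def_form H)"

text \<open>
  The \<open>1\<close>-form \<open>\<Sum> \<eta>\<^sub>i dx\<^sub>i\<close> is the vector of its coefficients; a \<open>2\<close>-form is the alternating matrix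
  whose \<open>(i, j)\<close> entry for \<open>i < j\<close> is the coefficient of \<open>dx\<^sub>i \<and> dx\<^sub>j\<close>.
\<close>

definition two_forms :: "('r::comm_ring_1 ^ 'n ^ 'n::finite) set" where
  "two_forms = {\<tau>. (\<forall>i. \<tau> $ i $ i = 0) \<and> (\<forall>i j. \<tau> $ j $ i = - (\<tau> $ i $ j))}"

definition wedge :: "'r::comm_ring_1 ^ 'n \<Rightarrow> 'r ^ 'n \<Rightarrow> 'r ^ 'n ^ 'n::finite" where
  "wedge \<eta> \<theta> = (\<chi> i j. \<eta> $ i * \<theta> $ j - \<eta> $ j * \<theta> $ i)"

text \<open>The action of polynomials on rational \<open>1\<close>-forms.\<close>

definition form_scale ::
  "('n::{finite, linorder}, 'k::field) mpoly \<Rightarrow> ('n, 'k) mpoly fract ^ 'n::_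
    \<Rightarrow> ('n, 'k) mpoly fract ^ 'n::_" where
  "form_scale p \<omega> = (\<chi> i. to_fract p * \<omega> $ i)"

lemma module_form_scale: "module form_scale"
  by unfold_locales (auto simp: form_scale_def vec_eq_iff algebra_simps)

definition log_forms ::
  "('k::field ^ 'n::{finite, linorder}) set set \<Rightarrow> (('n, 'k) mpoly fract ^ 'n::_) set" where
  "log_forms \<A> = {\<omega>. \<exists>\<eta> :: ('n, 'k) mpoly ^ 'n::_.
     form_scale (arr_poly \<A>) \<omega> = (\<chi> i. to_fract (\<eta> $ i)) \<and>
     (\<forall>H\<in>\<A>. \<exists>\<tau>\<in>two_forms. wedge \<eta> (d_def_form H) = (\<chi> i j. def_form H * \<tau> $ i $ j))}"

end

theory Submission
  imports Defs "HOL-Library.Function_Algebras"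
begin

text \<open>
  Write \<open>\<Delta>\<close> for the complex of cliques of \<open>G\<close>, whose Stanley--Reisner ideal is \<open>I(G\<^sup>c)\<close>. Multiplying
  the coefficient \<open>\<omega>\<^sub>i\<close> of a logarithmic form by \<open>\<Prod>\<^sub>j (x\<^sub>i - x\<^sub>j)\<close>, \<open>j \<noteq> i\<close>, identifies \<open>\<Omega>\<^sup>1(\<A>\<^sub>G)\<close> with
  the families of polynomials \<open>g\<^sub>i\<close> such that \<open>x\<^sub>i - x\<^sub>j\<close> divides \<open>g\<^sub>i - g\<^sub>j\<close> always, and \<open>g\<^sub>i\<close> if
  \<open>ij\<close> is not an edge. By Newton interpolation such a family is given by \<open>g\<^sub>i = f(x\<^sub>i, x\<^sub>i - x\<^sub>1, \<dots>, x\<^sub>i - x\<^sub>\<ell>)\<close>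
  for a unique \<open>f \<in> M\<^sub>0[t]\<close>, where \<open>M\<^sub>0\<close> is spanned by the monomials in \<open>y\<^sub>1, \<dots>, y\<^sub>\<ell>\<close> whose support
  is a vertex cover of \<open>G\<^sup>c\<close> other than the whole vertex set, and \<open>x\<^sub>k\<close> acts as \<open>t - y\<^sub>k\<close>.

  Projective dimension and Betti numbers are read off from Koszul homology. The product of all \<open>y\<^sub>k\<close>
  annihilates \<open>M\<^sub>0\<close>, so that \<open>pd (M\<^sub>0[t])\<close> over \<open>S\<close> is one less than the top degree \<open>p\<close> of the Koszul
  homology of \<open>M\<^sub>0\<close>. In squarefree multidegrees the latter is the homology of the links of \<open>\<Delta>\<close>, while the
  Koszul homology of \<open>I(G\<^sup>c)\<close> is, up to Alexander duality, that of the induced subcomplexes of \<open>\<Delta>\<close>.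
  Links and induced subcomplexes have the same top degree of homology, which gives \<open>reg I(G\<^sup>c) = p + 1\<close>.
\<close>

section \<open>Koszul complexes of commuting operators\<close>

text \<open>One side of the formula quantifies over resolutions by arbitrary projective modules, the
  other uses Tor groups of an unspecified graded free resolution. Koszul homology is defined without
  a choice and controls both. Only its vanishing is ever compared, so the argument is a chain of
  equivalences between exactness statements, and no homology group is formed. The passage from M_0
  to M_0[t] rests on the sequence 0 -> M_0[t] -> M_0[t] -> M_0 -> 0 given by multiplication with t.
  Each t - y_k acts as zero on Koszul homology, so t acts there as every y_k, and its \<ell>-th
  power as their product, which is zero. Hence t is injective on a homology group only if that group
  vanishes, and the top degree drops by exactly one. The 2 in the formula is this one plus the shift
  caused by passing to the complement in a simplex under Alexander duality. Leaving out the full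
  support removes the empty face in the full multidegree. This is felt only in degrees at most 1, so
  projective dimension 0 gets an argument of its own. A missing edge makes I(G^c) nonzero, so that
  the regularity is the maximum of a nonempty set.\<close>

definition ksgn :: "'n::linorder \<Rightarrow> 'n set \<Rightarrow> 'a::ab_group_add \<Rightarrow> 'a" where
  "ksgn k \<sigma> a = (if even (card {l\<in>\<sigma>. l < k}) then a else - a)"

text \<open>The differential of the Koszul complex, an element of which is the family of its
  coefficients at the basis elements indexed by subsets. Coefficients lie in a bare abelian group,
  so signs are negations, and operators take the place of a sequence of ring elements.\<close>

definition kd :: "('n::{finite, linorder} \<Rightarrow> 'a \<Rightarrow> 'a) \<Rightarrow> ('n set \<Rightarrow> 'a) \<Rightarrow> 'n set \<Rightarrow> 'a::ab_group_add" where
  "kd X \<kappa> = (\<lambda>\<rho>. \<Sum>k\<in>-\<rho>. ksgn k \<rho> (X k (\<kappa> (insert k \<rho>))))"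

text \<open>Exterior multiplication by the k-th generator, the homotopy of
  \<open>kd_kw\<close>.\<close>

definition kw :: "'n::{finite, linorder} \<Rightarrow> ('n set \<Rightarrow> 'a) \<Rightarrow> 'n set \<Rightarrow> 'a::ab_group_add" where
  "kw k \<kappa> = (\<lambda>\<rho>. if k \<in> \<rho> then ksgn k (\<rho> - {k}) (\<kappa> (\<rho> - {k})) else 0)"

text \<open>
  The internal degree \<open>j\<close> is the total one: the basis element indexed by \<open>\<sigma>\<close> has degree \<open>card \<sigma>\<close>.
  For a constant family \<open>gr\<close> the grading disappears.
\<close>

definition kcomp :: "(int \<Rightarrow> 'a set) \<Rightarrow> nat \<Rightarrow> int \<Rightarrow> ('n::{finite, linorder} set \<Rightarrow> 'a::ab_group_add) set" where
  "kcomp gr i j = {\<kappa>. \<forall>\<sigma>. if card \<sigma> = i then \<kappa> \<sigma> \<in> gr (j - int i) else \<kappa> \<sigma> = 0}"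

text \<open>Vanishing of homology at position i in internal degree j. At position 0 the cycle
  condition holds by itself.\<close>

definition kexact :: "('n::{finite, linorder} \<Rightarrow> 'a \<Rightarrow> 'a) \<Rightarrow> (int \<Rightarrow> 'a::ab_group_add set) \<Rightarrow> nat \<Rightarrow> int \<Rightarrow> bool" where
  "kexact X gr i j \<longleftrightarrow>
     (\<forall>\<kappa>\<in>kcomp gr i j. kd X \<kappa> = (\<lambda>_. 0) \<longrightarrow> (\<exists>\<eta>\<in>kcomp gr (Suc i) j. kd X \<eta> = \<kappa>))"

text \<open>Additivity is the only linearity used, so the identities below serve multiplication by
  variables, truncated multiplication, the operators t - y_k and, with identity operators, the
  simplicial boundary.\<close>

locale koszul_ops =
  fixes X :: "'n::{finite, linorder} \<Rightarrow> 'a \<Rightarrow> 'a::ab_group_add"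
  assumes op_add: "X k (a + b) = X k a + X k b"
    and op_commute: "X k (X l a) = X l (X k a)"

locale koszul_fam = koszul_ops X
  for X :: "'n::{finite, linorder} \<Rightarrow> 'a \<Rightarrow> 'a::ab_group_add" +
  fixes gr :: "int \<Rightarrow> 'a set"
  assumes fam_zero: "0 \<in> gr j"
    and fam_add: "a \<in> gr j \<Longrightarrow> b \<in> gr j \<Longrightarrow> a + b \<in> gr j"
    and fam_uminus: "a \<in> gr j \<Longrightarrow> - a \<in> gr j"
    and fam_op: "a \<in> gr j \<Longrightarrow> X k a \<in> gr (j + 1)"

lemma ksgn_zero [simp]: "ksgn k \<sigma> 0 = 0"
  by (simp add: ksgn_def)

lemma ksgn_add: "ksgn k \<sigma> (a + b) = ksgn k \<sigma> a + ksgn k \<sigma> b"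
  by (simp add: ksgn_def)

lemma ksgn_diff: "ksgn k \<sigma> (a - b) = ksgn k \<sigma> a - ksgn k \<sigma> b"
  by (simp add: ksgn_def)

lemma ksgn_uminus: "ksgn k \<sigma> (- a) = - ksgn k \<sigma> a"
  by (simp add: ksgn_def)

lemma ksgn_ksgn [simp]: "ksgn k \<sigma> (ksgn k \<sigma> a) = a"
  by (simp add: ksgn_def)

lemma ksgn_commute: "ksgn k \<sigma> (ksgn l \<rho> a) = ksgn l \<rho> (ksgn k \<sigma> a)"
  by (simp add: ksgn_def)

lemma ksgn_sum: "ksgn k \<sigma> (\<Sum>x\<in>A. f x) = (\<Sum>x\<in>A. ksgn k \<sigma> (f x))"
  by (simp add: ksgn_def sum_negf)

lemma ksgn_eq_zero_iff [simp]: "ksgn k \<sigma> a = 0 \<longleftrightarrow> a = 0"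
  by (simp add: ksgn_def)

lemma ksgn_insert:
  fixes \<sigma> :: "'n::{finite, linorder} set"
  assumes "k \<notin> \<sigma>" "k \<noteq> l"
  shows "ksgn l (insert k \<sigma>) a = (if k < l then - ksgn l \<sigma> a else ksgn l \<sigma> a)"
proof (cases "k < l")
  case True
  then have "{m \<in> insert k \<sigma>. m < l} = insert k {m\<in>\<sigma>. m < l}" by auto
  with True assms show ?thesis by (simp add: ksgn_def)
next
  case False
  then have "{m \<in> insert k \<sigma>. m < l} = {m\<in>\<sigma>. m < l}" by auto
  with False show ?thesis by (simp add: ksgn_def)
qed

text \<open>Anticommutation of two exterior generators; it makes the double sum in
  \<open>kd_kd\<close> alternating.\<close>

lemma ksgn_insert_swap:
  fixes \<sigma> :: "'n::{finite, linorder} set"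
  assumes "k \<notin> \<sigma>" "l \<notin> \<sigma>" "k \<noteq> l"
  shows "ksgn k \<sigma> (ksgn l (insert k \<sigma>) a) = - ksgn l \<sigma> (ksgn k (insert l \<sigma>) a)"
  using assms by (auto simp: ksgn_insert ksgn_uminus ksgn_commute[of k] split: if_splits)

text \<open>The terms with k < l cancel those with l < k. The diagonal is left out, so this also
  holds where 2 is zero.\<close>

lemma sum_alternating_pairs:
  fixes f :: "'n::linorder \<Rightarrow> 'n \<Rightarrow> 'a::ab_group_add"
  assumes "finite A" and alt: "\<And>k l. k \<in> A \<Longrightarrow> l \<in> A \<Longrightarrow> k \<noteq> l \<Longrightarrow> f k l = - f l k"
  shows "(\<Sum>k\<in>A. \<Sum>l\<in>A - {k}. f k l) = 0"
proof -
  let ?L = "{p \<in> A \<times> A. fst p < snd p}" and ?G = "{p \<in> A \<times> A. snd p < fst p}"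
  have "(\<Sum>k\<in>A. \<Sum>l\<in>A - {k}. f k l) = (\<Sum>p\<in>(SIGMA k:A. A - {k}). f (fst p) (snd p))"
    using assms(1) by (subst sum.Sigma) (auto simp: case_prod_beta)
  also have "(SIGMA k:A. A - {k}) = ?L \<union> ?G"
    by auto
  also have "(\<Sum>p\<in>?L \<union> ?G. f (fst p) (snd p)) = (\<Sum>p\<in>?L. f (fst p) (snd p)) + (\<Sum>p\<in>?G. f (fst p) (snd p))"
    using assms(1) by (intro sum.union_disjoint) auto
  also have "(\<Sum>p\<in>?G. f (fst p) (snd p)) = (\<Sum>p\<in>?L. f (snd p) (fst p))"
    by (rule sum.reindex_bij_witness[of _ prod.swap prod.swap]) auto
  also have "\<dots> = (\<Sum>p\<in>?L. - f (fst p) (snd p))"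
    by (intro sum.cong refl alt) auto
  finally show ?thesis by (simp add: sum_negf)
qed

context koszul_ops
begin

lemma op_zero [simp]: "X k 0 = 0"
  using op_add[of k 0 0] by simp

lemma op_uminus: "X k (- a) = - X k a"
  using op_add[of k a "- a"] by (simp add: eq_neg_iff_add_eq_0 add.commute)

lemma op_diff: "X k (a - b) = X k a - X k b"
  using op_add[of k a "- b"] by (simp add: op_uminus)

lemma op_sum: "X k (\<Sum>x\<in>A. f x) = (\<Sum>x\<in>A. X k (f x))"
  by (induction A rule: infinite_finite_induct) (auto simp: op_add)

lemma op_ksgn: "X k (ksgn l \<sigma> a) = ksgn l \<sigma> (X k a)"
  by (simp add: ksgn_def op_uminus)

lemma kd_zero [simp]: "kd X (\<lambda>_. 0) = (\<lambda>_. 0)"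
  by (simp add: kd_def)

lemma kd_add: "kd X (\<lambda>\<sigma>. a \<sigma> + b \<sigma>) = (\<lambda>\<sigma>. kd X a \<sigma> + kd X b \<sigma>)"
  by (simp add: kd_def op_add ksgn_add sum.distrib)

lemma kd_diff: "kd X (\<lambda>\<sigma>. a \<sigma> - b \<sigma>) = (\<lambda>\<sigma>. kd X a \<sigma> - kd X b \<sigma>)"
  by (simp add: kd_def op_diff ksgn_diff sum_subtractf)

lemma kd_uminus: "kd X (\<lambda>\<sigma>. - a \<sigma>) = (\<lambda>\<sigma>. - kd X a \<sigma>)"
  by (simp add: kd_def op_uminus ksgn_uminus sum_negf)

lemma kd_op: "kd X (\<lambda>\<sigma>. X k (a \<sigma>)) = (\<lambda>\<sigma>. X k (kd X a \<sigma>))"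
  by (simp add: kd_def op_sum op_ksgn op_commute[of k])

lemma kd_kd: "kd X (kd X \<kappa>) = (\<lambda>_. 0)"
proof
  fix \<rho>
  have "kd X (kd X \<kappa>) \<rho> = (\<Sum>k\<in>-\<rho>. \<Sum>l\<in>-\<rho>-{k}.
      ksgn k \<rho> (ksgn l (insert k \<rho>) (X k (X l (\<kappa> (insert l (insert k \<rho>)))))))"
    by (auto simp: kd_def op_sum ksgn_sum op_ksgn Compl_insert intro!: sum.cong)
  also have "\<dots> = 0"
  proof (rule sum_alternating_pairs)
    fix k l assume "k \<in> - \<rho>" "l \<in> - \<rho>" "k \<noteq> l"
    then show "ksgn k \<rho> (ksgn l (insert k \<rho>) (X k (X l (\<kappa> (insert l (insert k \<rho>)))))) =
        - ksgn l \<rho> (ksgn k (insert l \<rho>) (X l (X k (\<kappa> (insert k (insert l \<rho>))))))"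
      by (simp add: ksgn_insert_swap[of k \<rho> l] op_commute[of k] insert_commute)
  qed simp
  finally show "kd X (kd X \<kappa>) \<rho> = 0" .
qed

text \<open>Cartan's homotopy formula. It makes every \<open>X k\<close> zero on homology and, with
  identity operators, contracts a cone.\<close>

lemma kd_kw: "kd X (kw k \<kappa>) \<rho> + kw k (kd X \<kappa>) \<rho> = X k (\<kappa> \<rho>)"
proof (cases "k \<in> \<rho>")
  case False
  have "kd X (kw k \<kappa>) \<rho> = (\<Sum>l\<in>-\<rho>. if l = k then X k (\<kappa> \<rho>) else 0)"
    unfolding kd_def using False by (intro sum.cong) (auto simp: kw_def op_ksgn)
  with False show ?thesis by (simp add: kw_def)
next
  case True
  \<comment> \<open>In \<open>kw k (kd X \<kappa>)\<close> the index k can be added back to \<tau>,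
    which gives \<open>X k (\<kappa> \<rho>)\<close>; the indices outside \<rho> occur in both terms
    with opposite signs.\<close>
  define \<tau> where "\<tau> = \<rho> - {k}"
  have \<rho>: "\<rho> = insert k \<tau>" "k \<notin> \<tau>" using True by (auto simp: \<tau>_def)
  have "kd X (kw k \<kappa>) \<rho> = (\<Sum>l\<in>-\<rho>. - ksgn k \<tau> (ksgn l \<tau> (X l (\<kappa> (insert l \<tau>)))))"
    unfolding kd_def
  proof (intro sum.cong refl)
    fix l assume l: "l \<in> - \<rho>"
    then have "insert l \<rho> - {k} = insert l \<tau>" using \<rho> by auto
    then have "ksgn l \<rho> (X l (kw k \<kappa> (insert l \<rho>))) =
        ksgn l (insert k \<tau>) (ksgn k (insert l \<tau>) (X l (\<kappa> (insert l \<tau>))))"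
      using l \<rho> by (simp add: kw_def op_ksgn)
    also have "\<dots> = ksgn k (insert l \<tau>) (ksgn l (insert k \<tau>) (X l (\<kappa> (insert l \<tau>))))"
      by (rule ksgn_commute)
    also have "\<dots> = - ksgn k \<tau> (ksgn l \<tau> (X l (\<kappa> (insert l \<tau>))))"
    proof -
      have "l \<notin> \<tau>" "k \<noteq> l" "k \<notin> \<tau>" using l \<rho> by auto
      then show ?thesis by (auto simp: ksgn_insert ksgn_uminus)
    qed
    finally show "ksgn l \<rho> (X l (kw k \<kappa> (insert l \<rho>))) = - ksgn k \<tau> (ksgn l \<tau> (X l (\<kappa> (insert l \<tau>))))" .
  qed
  moreover have "kw k (kd X \<kappa>) \<rho> = X k (\<kappa> \<rho>) + (\<Sum>l\<in>-\<rho>. ksgn k \<tau> (ksgn l \<tau> (X l (\<kappa> (insert l \<tau>)))))"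
  proof -
    have "- \<tau> = insert k (- \<rho>)" "k \<notin> - \<rho>" using \<rho> by auto
    then show ?thesis
      using True \<rho> by (simp add: kw_def kd_def \<tau>_def[symmetric] ksgn_add ksgn_sum)
  qed
  ultimately show ?thesis by (simp add: sum_negf)
qed

end

lemma kcomp_zero_off: "\<kappa> \<in> kcomp gr i j \<Longrightarrow> card \<sigma> \<noteq> i \<Longrightarrow> \<kappa> \<sigma> = 0"
  by (auto simp: kcomp_def split: if_splits)

lemma kcomp_mem: "\<kappa> \<in> kcomp gr i j \<Longrightarrow> card \<sigma> = i \<Longrightarrow> \<kappa> \<sigma> \<in> gr (j - int i)"
  by (auto simp: kcomp_def split: if_splits)

context koszul_fam
begin

lemma fam_diff: "a \<in> gr j \<Longrightarrow> b \<in> gr j \<Longrightarrow> a - b \<in> gr j"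
  using fam_add[of a j "- b"] fam_uminus[of b j] by simp

lemma fam_ksgn: "a \<in> gr j \<Longrightarrow> ksgn k \<sigma> a \<in> gr j"
  by (simp add: ksgn_def fam_uminus)

lemma fam_sum: "(\<And>x. x \<in> A \<Longrightarrow> f x \<in> gr j) \<Longrightarrow> (\<Sum>x\<in>A. f x) \<in> gr j"
  by (induction A rule: infinite_finite_induct) (auto simp: fam_zero fam_add)

lemma kcomp_zero: "(\<lambda>_. 0) \<in> kcomp gr i j"
  by (auto simp: kcomp_def fam_zero)

lemma kcomp_add: "a \<in> kcomp gr i j \<Longrightarrow> b \<in> kcomp gr i j \<Longrightarrow> (\<lambda>\<sigma>. a \<sigma> + b \<sigma>) \<in> kcomp gr i j"
  by (auto simp: kcomp_def fam_add)

lemma kcomp_uminus: "a \<in> kcomp gr i j \<Longrightarrow> (\<lambda>\<sigma>. - a \<sigma>) \<in> kcomp gr i j"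
  by (auto simp: kcomp_def fam_uminus)

lemma kcomp_diff: "a \<in> kcomp gr i j \<Longrightarrow> b \<in> kcomp gr i j \<Longrightarrow> (\<lambda>\<sigma>. a \<sigma> - b \<sigma>) \<in> kcomp gr i j"
  by (auto simp: kcomp_def fam_diff)

lemma kcomp_kd:
  assumes "\<kappa> \<in> kcomp gr (Suc i) j"
  shows "kd X \<kappa> \<in> kcomp gr i j"
  unfolding kcomp_def
proof (intro CollectI allI)
  fix \<sigma> :: "'n set"
  have eq: "card (insert k \<sigma>) = Suc i \<longleftrightarrow> card \<sigma> = i" if "k \<in> - \<sigma>" for k
    using that by simp
  show "if card \<sigma> = i then kd X \<kappa> \<sigma> \<in> gr (j - int i) else kd X \<kappa> \<sigma> = 0"
  proof (cases "card \<sigma> = i")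
    case True
    have "ksgn k \<sigma> (X k (\<kappa> (insert k \<sigma>))) \<in> gr (j - int i)" if "k \<in> -\<sigma>" for k
      using fam_op[OF kcomp_mem[OF assms, of "insert k \<sigma>"], of k] eq[OF that] True
      by (intro fam_ksgn) simp
    then show ?thesis using True by (auto simp: kd_def intro: fam_sum)
  next
    case False
    then show ?thesis using eq
      by (auto simp: kd_def intro!: sum.neutral) (metis ComplI False card_insert_disjoint finite kcomp_zero_off[OF assms] op_zero old.nat.inject)
  qed
qed

lemma kcomp_kw:
  fixes \<kappa> :: "'n set \<Rightarrow> 'a"
  assumes "\<kappa> \<in> kcomp gr i j"
  shows "kw k \<kappa> \<in> kcomp gr (Suc i) (j + 1)"
proof -
  have "card \<sigma> = Suc i \<longleftrightarrow> card (\<sigma> - {k}) = i" if "k \<in> \<sigma>" for \<sigma> :: "'n set"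
    using that by (metis One_nat_def Suc_pred card_Diff_singleton card_gt_0_iff empty_iff finite nat.inject)
  then show ?thesis
    using assms by (auto simp: kcomp_def kw_def fam_zero intro!: fam_ksgn split: if_splits)
qed

lemma kcomp_op:
  assumes "\<kappa> \<in> kcomp gr i j"
  shows "(\<lambda>\<sigma>. X k (\<kappa> \<sigma>)) \<in> kcomp gr i (j + 1)"
  using assms fam_op[of _ "j - int i" k] by (auto simp: kcomp_def algebra_simps split: if_splits)

end

lemma kexactD:
  assumes "kexact X gr i j" "\<kappa> \<in> kcomp gr i j" "kd X \<kappa> = (\<lambda>_. 0)"
  obtains \<eta> where "\<eta> \<in> kcomp gr (Suc i) j" "kd X \<eta> = \<kappa>"
  using assms by (auto simp: kexact_def)

text \<open>A chain at position 1 is a family of elements indexed by singletons, and the signs at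
  the empty set are trivial.\<close>

lemma (in koszul_fam) boundary_0_iff:
  assumes \<kappa>: "\<kappa> \<in> kcomp gr 0 j"
  shows "(\<exists>\<eta>\<in>kcomp gr (Suc 0) j. kd X \<eta> = \<kappa>) \<longleftrightarrow>
    (\<exists>w. (\<forall>k. w k \<in> gr (j - 1)) \<and> \<kappa> {} = (\<Sum>k\<in>UNIV. X k (w k)))"
proof
  assume "\<exists>\<eta>\<in>kcomp gr (Suc 0) j. kd X \<eta> = \<kappa>"
  then obtain \<eta> where \<eta>: "\<eta> \<in> kcomp gr (Suc 0) j" "kd X \<eta> = \<kappa>" by blast
  have "\<kappa> {} = (\<Sum>k\<in>UNIV. X k (\<eta> {k}))"
    unfolding \<eta>(2)[symmetric] by (simp add: kd_def ksgn_def)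
  then show "\<exists>w. (\<forall>k. w k \<in> gr (j - 1)) \<and> \<kappa> {} = (\<Sum>k\<in>UNIV. X k (w k))"
    using kcomp_mem[OF \<eta>(1)] by (intro exI[of _ "\<lambda>k. \<eta> {k}"]) auto
next
  assume "\<exists>w. (\<forall>k. w k \<in> gr (j - 1)) \<and> \<kappa> {} = (\<Sum>k\<in>UNIV. X k (w k))"
  then obtain w where w: "\<And>k. w k \<in> gr (j - 1)" "\<kappa> {} = (\<Sum>k\<in>UNIV. X k (w k))" by auto
  define \<eta> where "\<eta> = (\<lambda>\<sigma> :: 'n set. if card \<sigma> = 1 then w (the_elem \<sigma>) else 0)"
  have \<eta>: "\<eta> \<in> kcomp gr (Suc 0) j" using w(1) by (auto simp: \<eta>_def kcomp_def)
  have "kd X \<eta> \<sigma> = \<kappa> \<sigma>" for \<sigma>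
  proof (cases "\<sigma> = {}")
    case True
    then show ?thesis by (simp add: kd_def ksgn_def \<eta>_def w(2))
  next
    case False
    then have "card \<sigma> \<noteq> 0" by simp
    then show ?thesis
      using kcomp_zero_off[OF \<kappa>] kcomp_zero_off[OF kcomp_kd[of \<eta> 0 j]] \<eta> by simp
  qed
  with \<eta> show "\<exists>\<eta>\<in>kcomp gr (Suc 0) j. kd X \<eta> = \<kappa>" by (intro bexI[of _ \<eta>]) auto
qed

text \<open>Homology at position 0 is the module modulo the images of the operators, so exactness
  means that degree j contains no minimal generator.\<close>

lemma (in koszul_fam) kexact_0_iff:
  "kexact X gr 0 j \<longleftrightarrow>
     (\<forall>a\<in>gr j. \<exists>w. (\<forall>k. w k \<in> gr (j - 1)) \<and> a = (\<Sum>k\<in>UNIV. X k (w k)))"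
proof -
  have cyc: "kd X \<kappa> = (\<lambda>_. 0)" if "\<kappa> \<in> kcomp gr 0 j" for \<kappa>
  proof -
    have "\<kappa> (insert k \<rho>) = 0" for k \<rho> using kcomp_zero_off[OF that, of "insert k \<rho>"] by auto
    then show ?thesis by (simp add: kd_def)
  qed
  show ?thesis
  proof
    assume L: "kexact X gr 0 j"
    show "\<forall>a\<in>gr j. \<exists>w. (\<forall>k. w k \<in> gr (j - 1)) \<and> a = (\<Sum>k\<in>UNIV. X k (w k))"
    proof
      fix a assume a: "a \<in> gr j"
      let ?\<kappa> = "\<lambda>\<sigma> :: 'n set. if \<sigma> = {} then a else 0"
      have \<kappa>: "?\<kappa> \<in> kcomp gr 0 j" using a by (auto simp: kcomp_def)
      from L \<kappa> cyc[OF \<kappa>] have "\<exists>\<eta>\<in>kcomp gr (Suc 0) j. kd X \<eta> = ?\<kappa>"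
        unfolding kexact_def by blast
      then show "\<exists>w. (\<forall>k. w k \<in> gr (j - 1)) \<and> a = (\<Sum>k\<in>UNIV. X k (w k))"
        unfolding boundary_0_iff[OF \<kappa>] by simp
    qed
  next
    assume R: "\<forall>a\<in>gr j. \<exists>w. (\<forall>k. w k \<in> gr (j - 1)) \<and> a = (\<Sum>k\<in>UNIV. X k (w k))"
    show "kexact X gr 0 j"
      unfolding kexact_def
    proof (intro ballI impI)
      fix \<kappa> :: "'n set \<Rightarrow> 'a" assume \<kappa>: "\<kappa> \<in> kcomp gr 0 j"
      show "\<exists>\<eta>\<in>kcomp gr (Suc 0) j. kd X \<eta> = \<kappa>"
        unfolding boundary_0_iff[OF \<kappa>] using R kcomp_mem[OF \<kappa>, of "{}"] by simp
    qed
  qed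
qed

section \<open>Short exact sequences\<close>

text \<open>A short exact sequence of coefficient families with kernel \<open>gK\<close>. The map h
  is additive on the components only, because module homomorphisms are linear only on the submodule
  where they live.\<close>

locale koszul_epi = F: koszul_fam XF gF + M: koszul_fam XM gM
  for XF :: "'n::{finite, linorder} \<Rightarrow> 'b \<Rightarrow> 'b::ab_group_add" and gF :: "int \<Rightarrow> 'b set"
    and XM :: "'n \<Rightarrow> 'a \<Rightarrow> 'a::ab_group_add" and gM :: "int \<Rightarrow> 'a set" +
  fixes h :: "'b \<Rightarrow> 'a"
  assumes h_add: "a \<in> gF j \<Longrightarrow> b \<in> gF j \<Longrightarrow> h (a + b) = h a + h b"
    and h_op: "a \<in> gF j \<Longrightarrow> h (XF k a) = XM k (h a)"
    and h_surj: "h ` gF j = gM j"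
begin

lemma h_zero [simp]: "h 0 = 0"
  using h_add[OF F.fam_zero F.fam_zero] by simp

lemma h_uminus: "a \<in> gF j \<Longrightarrow> h (- a) = - h a"
  using h_add[of a j "- a"] F.fam_uminus[of a j] by (simp add: eq_neg_iff_add_eq_0 add.commute)

lemma h_diff: "a \<in> gF j \<Longrightarrow> b \<in> gF j \<Longrightarrow> h (a - b) = h a - h b"
  using h_add[of a j "- b"] F.fam_uminus[of b j] h_uminus[of b j] by simp

lemma h_sum: "(\<And>x. x \<in> A \<Longrightarrow> f x \<in> gF j) \<Longrightarrow> h (\<Sum>x\<in>A. f x) = (\<Sum>x\<in>A. h (f x))"
proof (induction A rule: infinite_finite_induct)
  case (insert x A)
  then show ?case using h_add[of "f x" j "sum f A"] F.fam_sum[of A f j] by auto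
qed auto

lemma kd_h:
  assumes "\<kappa> \<in> kcomp gF i j"
  shows "kd XM (\<lambda>\<sigma>. h (\<kappa> \<sigma>)) = (\<lambda>\<sigma>. h (kd XF \<kappa> \<sigma>))"
proof
  fix \<rho> :: "'n set"
  have m: "\<kappa> \<sigma> \<in> gF (j - int i)" for \<sigma>
    using assms F.fam_zero by (auto simp: kcomp_def split: if_splits)
  have "h (kd XF \<kappa> \<rho>) = (\<Sum>k\<in>-\<rho>. h (ksgn k \<rho> (XF k (\<kappa> (insert k \<rho>)))))"
    unfolding kd_def by (intro h_sum[of _ _ "j - int i + 1"] F.fam_ksgn F.fam_op m)
  also have "\<dots> = kd XM (\<lambda>\<sigma>. h (\<kappa> \<sigma>)) \<rho>"
    unfolding kd_def by (intro sum.cong refl) (simp add: ksgn_def h_uminus[OF F.fam_op[OF m]] h_op[OF m])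
  finally show "kd XM (\<lambda>\<sigma>. h (\<kappa> \<sigma>)) \<rho> = h (kd XF \<kappa> \<rho>)" ..
qed

lemma kcomp_h: "\<kappa> \<in> kcomp gF i j \<Longrightarrow> (\<lambda>\<sigma>. h (\<kappa> \<sigma>)) \<in> kcomp gM i j"
  unfolding kcomp_def using h_surj by (auto split: if_splits)

lemma kcomp_lift:
  assumes "\<mu> \<in> kcomp gM i j"
  obtains \<eta> where "\<eta> \<in> kcomp gF i j" "(\<lambda>\<sigma>. h (\<eta> \<sigma>)) = \<mu>"
proof -
  have "\<exists>a. (if card \<sigma> = i then a \<in> gF (j - int i) else a = 0) \<and> h a = \<mu> \<sigma>" for \<sigma>
  proof (cases "card \<sigma> = i")
    case True
    then have "\<mu> \<sigma> \<in> h ` gF (j - int i)" using kcomp_mem[OF assms] h_surj by simp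
    then show ?thesis using True by auto
  next
    case False
    then show ?thesis using kcomp_zero_off[OF assms] by auto
  qed
  then obtain \<eta> where "\<forall>\<sigma>. (if card \<sigma> = i then \<eta> \<sigma> \<in> gF (j - int i) else \<eta> \<sigma> = 0) \<and> h (\<eta> \<sigma>) = \<mu> \<sigma>"
    by metis
  then show ?thesis by (intro that[of \<eta>]) (auto simp: kcomp_def)
qed

definition gK :: "int \<Rightarrow> 'b set" where
  "gK j = {a \<in> gF j. h a = 0}"

lemma koszul_fam_gK: "koszul_fam XF gK"
proof unfold_locales
  fix a b :: 'b and j k
  show "0 \<in> gK j" by (simp add: gK_def F.fam_zero)
  show "a + b \<in> gK j" if "a \<in> gK j" "b \<in> gK j"
    using that h_add[of a j b] by (simp add: gK_def F.fam_add)
  show "- a \<in> gK j" if "a \<in> gK j"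
    using that h_uminus[of a j] by (simp add: gK_def F.fam_uminus)
  show "XF k a \<in> gK (j + 1)" if "a \<in> gK j"
    using that h_op[of a j k] by (simp add: gK_def F.fam_op)
qed

lemma kcomp_gK_iff: "\<kappa> \<in> kcomp gK i j \<longleftrightarrow> \<kappa> \<in> kcomp gF i j \<and> (\<lambda>\<sigma>. h (\<kappa> \<sigma>)) = (\<lambda>_. 0)"
proof
  assume L: "\<kappa> \<in> kcomp gK i j"
  then have "h (\<kappa> \<sigma>) = 0" for \<sigma>
    by (cases "card \<sigma> = i") (auto simp: kcomp_def gK_def split: if_splits)
  moreover have "if card \<sigma> = i then \<kappa> \<sigma> \<in> gF (j - int i) else \<kappa> \<sigma> = 0" for \<sigma>
    using kcomp_mem[OF L] kcomp_zero_off[OF L] by (auto simp: gK_def)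
  ultimately show "\<kappa> \<in> kcomp gF i j \<and> (\<lambda>\<sigma>. h (\<kappa> \<sigma>)) = (\<lambda>_. 0)"
    unfolding kcomp_def by blast
qed (auto simp: kcomp_def gK_def fun_eq_iff split: if_splits)

text \<open>The connecting homomorphism without exactness of F at position i: a chain of the kernel
  that bounds in F has to bound in the kernel. This form is for i = 0, where a free module has
  homology.\<close>

lemma kexact_Suc_iff_boundary:
  assumes "kexact XF gF (Suc i) j"
  shows "kexact XM gM (Suc i) j \<longleftrightarrow>
    (\<forall>\<kappa>\<in>kcomp gK i j. (\<exists>\<eta>\<in>kcomp gF (Suc i) j. kd XF \<eta> = \<kappa>) \<longrightarrow> (\<exists>\<eta>\<in>kcomp gK (Suc i) j. kd XF \<eta> = \<kappa>))"
proof
  assume L: "kexact XM gM (Suc i) j"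
  show "\<forall>\<kappa>\<in>kcomp gK i j. (\<exists>\<eta>\<in>kcomp gF (Suc i) j. kd XF \<eta> = \<kappa>) \<longrightarrow> (\<exists>\<eta>\<in>kcomp gK (Suc i) j. kd XF \<eta> = \<kappa>)"
  proof (intro ballI impI)
    fix \<kappa> assume \<kappa>: "\<kappa> \<in> kcomp gK i j" and "\<exists>\<eta>\<in>kcomp gF (Suc i) j. kd XF \<eta> = \<kappa>"
    then obtain \<eta> where \<eta>: "\<eta> \<in> kcomp gF (Suc i) j" "kd XF \<eta> = \<kappa>" by blast
    have "kd XM (\<lambda>\<sigma>. h (\<eta> \<sigma>)) = (\<lambda>_. 0)"
      using \<kappa> by (simp add: kd_h[OF \<eta>(1)] \<eta>(2) kcomp_gK_iff)
    then obtain \<theta> where \<theta>: "\<theta> \<in> kcomp gM (Suc (Suc i)) j" "kd XM \<theta> = (\<lambda>\<sigma>. h (\<eta> \<sigma>))"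
      using L kcomp_h[OF \<eta>(1)] by (auto elim: kexactD)
    obtain \<theta>' where \<theta>': "\<theta>' \<in> kcomp gF (Suc (Suc i)) j" "(\<lambda>\<sigma>. h (\<theta>' \<sigma>)) = \<theta>"
      using kcomp_lift[OF \<theta>(1)] by blast
    \<comment> \<open>Subtracting the boundary of a lift of the filling moves \<eta> into the kernel
      and leaves its own boundary unchanged.\<close>
    let ?\<eta> = "\<lambda>\<sigma>. \<eta> \<sigma> - kd XF \<theta>' \<sigma>"
    note k\<theta> = F.kcomp_kd[OF \<theta>'(1)]
    have hs: "h (?\<eta> \<sigma>) = 0" for \<sigma>
    proof (cases "card \<sigma> = Suc i")
      case True
      have "h (?\<eta> \<sigma>) = h (\<eta> \<sigma>) - h (kd XF \<theta>' \<sigma>)"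
        using kcomp_mem[OF \<eta>(1) True] kcomp_mem[OF k\<theta> True] by (rule h_diff)
      also have "h (kd XF \<theta>' \<sigma>) = h (\<eta> \<sigma>)"
        using kd_h[OF \<theta>'(1)] \<theta>(2) \<theta>'(2) by (metis (no_types))
      finally show ?thesis by simp
    next
      case False
      then show ?thesis by (simp add: kcomp_zero_off[OF \<eta>(1)] kcomp_zero_off[OF k\<theta>])
    qed
    have "?\<eta> \<in> kcomp gK (Suc i) j"
      unfolding kcomp_gK_iff using F.kcomp_diff[OF \<eta>(1) k\<theta>] hs by auto
    moreover have "kd XF ?\<eta> = \<kappa>"
      by (simp add: F.kd_diff F.kd_kd \<eta>(2))
    ultimately show "\<exists>\<eta>\<in>kcomp gK (Suc i) j. kd XF \<eta> = \<kappa>" by blast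
  qed
next
  assume R: "\<forall>\<kappa>\<in>kcomp gK i j. (\<exists>\<eta>\<in>kcomp gF (Suc i) j. kd XF \<eta> = \<kappa>) \<longrightarrow> (\<exists>\<eta>\<in>kcomp gK (Suc i) j. kd XF \<eta> = \<kappa>)"
  show "kexact XM gM (Suc i) j"
    unfolding kexact_def
  proof (intro ballI impI)
    fix \<mu> assume \<mu>: "\<mu> \<in> kcomp gM (Suc i) j" "kd XM \<mu> = (\<lambda>_. 0)"
    obtain \<eta> where \<eta>: "\<eta> \<in> kcomp gF (Suc i) j" "(\<lambda>\<sigma>. h (\<eta> \<sigma>)) = \<mu>"
      using kcomp_lift[OF \<mu>(1)] by blast
    have "kd XF \<eta> \<in> kcomp gK i j"
      unfolding kcomp_gK_iff using F.kcomp_kd[OF \<eta>(1)] kd_h[OF \<eta>(1)] \<mu>(2) \<eta>(2) by simp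
    then obtain \<eta>' where \<eta>': "\<eta>' \<in> kcomp gK (Suc i) j" "kd XF \<eta>' = kd XF \<eta>"
      using R \<eta>(1) by metis
    have \<eta>'F: "\<eta>' \<in> kcomp gF (Suc i) j" "\<And>\<sigma>. h (\<eta>' \<sigma>) = 0"
      using \<eta>'(1) by (auto simp: kcomp_gK_iff fun_eq_iff)
    have "kd XF (\<lambda>\<sigma>. \<eta> \<sigma> - \<eta>' \<sigma>) = (\<lambda>_. 0)"
      by (simp add: F.kd_diff \<eta>'(2))
    then obtain \<theta> where \<theta>: "\<theta> \<in> kcomp gF (Suc (Suc i)) j" "kd XF \<theta> = (\<lambda>\<sigma>. \<eta> \<sigma> - \<eta>' \<sigma>)"
      using assms F.kcomp_diff[OF \<eta>(1) \<eta>'F(1)] by (auto elim: kexactD)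
    have "h (\<eta> \<sigma> - \<eta>' \<sigma>) = \<mu> \<sigma>" for \<sigma>
    proof (cases "card \<sigma> = Suc i")
      case True
      have "h (\<eta> \<sigma> - \<eta>' \<sigma>) = h (\<eta> \<sigma>) - h (\<eta>' \<sigma>)"
        using kcomp_mem[OF \<eta>(1) True] kcomp_mem[OF \<eta>'F(1) True] by (rule h_diff)
      then show ?thesis using \<eta>(2) \<eta>'F(2)[of \<sigma>] by auto
    next
      case False
      then show ?thesis
        by (simp add: kcomp_zero_off[OF \<eta>(1)] kcomp_zero_off[OF \<eta>'F(1)] kcomp_zero_off[OF \<mu>(1)])
    qed
    then have "kd XM (\<lambda>\<sigma>. h (\<theta> \<sigma>)) = \<mu>"
      by (simp add: kd_h[OF \<theta>(1)] \<theta>(2))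
    then show "\<exists>\<eta>\<in>kcomp gM (Suc (Suc i)) j. kd XM \<eta> = \<mu>"
      using kcomp_h[OF \<theta>(1)] by blast
  qed
qed

text \<open>Dimension shifting: if F is exact at position i too, the chains of the kernel that bound
  in F are just its cycles.\<close>

lemma kexact_Suc_iff:
  assumes "kexact XF gF (Suc i) j" "kexact XF gF i j"
  shows "kexact XM gM (Suc i) j \<longleftrightarrow> kexact XF gK i j"
proof -
  have "(\<exists>\<eta>\<in>kcomp gF (Suc i) j. kd XF \<eta> = \<kappa>) \<longleftrightarrow> kd XF \<kappa> = (\<lambda>_. 0)"
    if "\<kappa> \<in> kcomp gK i j" for \<kappa>
  proof -
    have "\<kappa> \<in> kcomp gF i j" using that by (simp add: kcomp_gK_iff)
    then show ?thesis using assms(2) F.kd_kd by (auto elim: kexactD)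
  qed
  then show ?thesis
    unfolding kexact_Suc_iff_boundary[OF assms(1)] by (auto simp: kexact_def)
qed

lemma kexact_iso:
  assumes inj: "\<And>j a. a \<in> gF j \<Longrightarrow> h a = 0 \<Longrightarrow> a = 0"
  shows "kexact XM gM i j \<longleftrightarrow> kexact XF gF i j"
proof -
  have z: "\<kappa> = \<kappa>'" if "\<kappa> \<in> kcomp gF n j" "\<kappa>' \<in> kcomp gF n j" "(\<lambda>\<sigma>. h (\<kappa> \<sigma>)) = (\<lambda>\<sigma>. h (\<kappa>' \<sigma>))" for \<kappa> \<kappa>' :: "'n set \<Rightarrow> 'b" and n
  proof
    fix \<sigma> :: "'n set"
    show "\<kappa> \<sigma> = \<kappa>' \<sigma>"
    proof (cases "card \<sigma> = n")
      case True
      note m = kcomp_mem[OF that(1) True] kcomp_mem[OF that(2) True]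
      have "h (\<kappa> \<sigma> - \<kappa>' \<sigma>) = 0"
        using h_diff[OF m] fun_cong[OF that(3), of \<sigma>] by simp
      then show ?thesis using inj[OF F.fam_diff[OF m]] by simp
    qed (simp add: kcomp_zero_off[OF that(1)] kcomp_zero_off[OF that(2)])
  qed
  have b: "kd XM (\<lambda>\<sigma>. h (\<eta> \<sigma>)) = (\<lambda>\<sigma>. h (\<kappa> \<sigma>)) \<longleftrightarrow> kd XF \<eta> = \<kappa>"
    if "\<eta> \<in> kcomp gF (Suc n) j" "\<kappa> \<in> kcomp gF n j" for \<eta> \<kappa> n
    using z[OF F.kcomp_kd[OF that(1)] that(2)] by (auto simp: kd_h[OF that(1)])
  have c: "kd XM (\<lambda>\<sigma>. h (\<kappa> \<sigma>)) = (\<lambda>_. 0) \<longleftrightarrow> kd XF \<kappa> = (\<lambda>_. 0)" if "\<kappa> \<in> kcomp gF i j" for \<kappa>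
  proof (cases i)
    case 0
    then have "\<kappa> (insert k \<rho>) = 0" for k \<rho> using kcomp_zero_off[OF that, of "insert k \<rho>"] by auto
    then show ?thesis by (simp add: kd_def)
  next
    case (Suc n)
    then show ?thesis using b[OF _ F.kcomp_zero, of \<kappa> n] that by simp
  qed
  show ?thesis
  proof
    assume L: "kexact XM gM i j"
    show "kexact XF gF i j"
      unfolding kexact_def
    proof (intro ballI impI)
      fix \<kappa> assume \<kappa>: "\<kappa> \<in> kcomp gF i j" "kd XF \<kappa> = (\<lambda>_. 0)"
      then obtain \<theta> where \<theta>: "\<theta> \<in> kcomp gM (Suc i) j" "kd XM \<theta> = (\<lambda>\<sigma>. h (\<kappa> \<sigma>))"
        using L kcomp_h c by (metis kexactD)
      then show "\<exists>\<eta>\<in>kcomp gF (Suc i) j. kd XF \<eta> = \<kappa>"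
        using kcomp_lift[OF \<theta>(1)] b \<kappa>(1) by metis
    qed
  next
    assume L: "kexact XF gF i j"
    show "kexact XM gM i j"
      unfolding kexact_def
    proof (intro ballI impI)
      fix \<mu> assume \<mu>: "\<mu> \<in> kcomp gM i j" "kd XM \<mu> = (\<lambda>_. 0)"
      then obtain \<kappa> where \<kappa>: "\<kappa> \<in> kcomp gF i j" "(\<lambda>\<sigma>. h (\<kappa> \<sigma>)) = \<mu>"
        using kcomp_lift by metis
      then obtain \<eta> where "\<eta> \<in> kcomp gF (Suc i) j" "kd XF \<eta> = \<kappa>"
        using L c \<mu>(2) by (metis kexactD)
      then show "\<exists>\<eta>\<in>kcomp gM (Suc i) j. kd XM \<eta> = \<mu>"
        using b \<kappa> kcomp_h by metis
    qed
  qed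
qed

end

section \<open>Adjoining a variable\<close>

text \<open>If \<open>y\<^sub>k\<close> acts on \<open>M\<^sub>0\<close> by \<open>Y k\<close>, then \<open>polyop Y k\<close> is the action of \<open>t - y\<^sub>k\<close> on \<open>M\<^sub>0[t]\<close>.\<close>

definition polyop :: "('n \<Rightarrow> 'a \<Rightarrow> 'a) \<Rightarrow> 'n \<Rightarrow> 'a poly \<Rightarrow> 'a::ab_group_add poly" where
  "polyop Y k f = pCons 0 f - map_poly (Y k) f"

definition polygr :: "(int \<Rightarrow> 'a set) \<Rightarrow> int \<Rightarrow> 'a::ab_group_add poly set" where
  "polygr g j = {f. \<forall>n. coeff f n \<in> g (j - int n)}"

lemma polygr_pCons_0_iff:
  assumes "\<And>j. 0 \<in> g j"
  shows "pCons 0 f \<in> polygr g (j + 1) \<longleftrightarrow> f \<in> polygr g j"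
proof
  assume L: "pCons 0 f \<in> polygr g (j + 1)"
  have "coeff f n \<in> g (j - int n)" for n
    using L[unfolded polygr_def, simplified, rule_format, of "Suc n"] by simp
  then show "f \<in> polygr g j" by (simp add: polygr_def)
qed (use assms in \<open>auto simp: polygr_def coeff_pCons split: nat.splits\<close>)

context koszul_ops
begin

lemma coeff_polyop: "coeff (polyop X k f) n = (case n of 0 \<Rightarrow> 0 | Suc m \<Rightarrow> coeff f m) - X k (coeff f n)"
  by (simp add: polyop_def coeff_map_poly coeff_pCons)

lemma koszul_ops_polyop: "koszul_ops (polyop X)"
proof unfold_locales
  fix k l and a b :: "'a poly"
  show "polyop X k (a + b) = polyop X k a + polyop X k b"
    by (rule poly_eqI) (simp add: coeff_polyop op_add split: nat.split)
  show "polyop X k (polyop X l a) = polyop X l (polyop X k a)"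
    by (rule poly_eqI) (simp add: coeff_polyop op_diff op_commute[of k] split: nat.split)
qed

lemma polyop_pCons_0: "polyop X k (pCons 0 f) = pCons 0 (polyop X k f)"
  by (auto simp: poly_eq_iff coeff_polyop coeff_pCons split: nat.splits)

lemma kd_polyop_pCons_0: "kd (polyop X) (\<lambda>\<sigma>. pCons 0 (\<kappa> \<sigma>)) = (\<lambda>\<sigma>. pCons 0 (kd (polyop X) \<kappa> \<sigma>))"
proof -
  have "(\<Sum>x\<in>A. pCons 0 (f x)) = pCons 0 (\<Sum>x\<in>A. f x)" for A and f :: "'n \<Rightarrow> 'a poly"
    by (induction A rule: infinite_finite_induct) auto
  moreover have "ksgn k \<rho> (pCons 0 f) = pCons 0 (ksgn k \<rho> f)" for k :: 'n and \<rho> and f :: "'a poly"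
    by (simp add: ksgn_def)
  ultimately show ?thesis by (simp add: kd_def polyop_pCons_0)
qed

text \<open>Setting t to zero sends t - y_k to -y_k. So the complex of M_0 is, up to the sign of the
  differential, that of M_0[t] modulo t.\<close>

lemma coeff_0_kd_polyop: "coeff (kd (polyop X) \<kappa> \<rho>) 0 = - kd X (\<lambda>\<sigma>. coeff (\<kappa> \<sigma>) 0) \<rho>"
proof -
  have "coeff (ksgn k \<rho> (polyop X k f)) 0 = - ksgn k \<rho> (X k (coeff f 0))" for k f
    by (simp add: ksgn_def coeff_polyop)
  then show ?thesis by (simp add: kd_def coeff_sum sum_negf)
qed

end

context koszul_fam
begin

lemma koszul_fam_polygr: "koszul_fam (polyop X) (polygr gr)"
proof -
  interpret P: koszul_ops "polyop X" by (rule koszul_ops_polyop)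
  show ?thesis
  proof unfold_locales
    fix a j k assume a: "a \<in> polygr gr j"
    have "coeff (polyop X k a) n \<in> gr (j + 1 - int n)" for n
    proof -
      have "X k (coeff a n) \<in> gr (j + 1 - int n)"
        using a fam_op[of "coeff a n" "j - int n" k] by (simp add: polygr_def algebra_simps)
      moreover have "(case n of 0 \<Rightarrow> 0 | Suc m \<Rightarrow> coeff a m) \<in> gr (j + 1 - int n)"
        using a fam_zero by (auto simp: polygr_def split: nat.split)
      ultimately show ?thesis by (simp add: coeff_polyop fam_diff)
    qed
    then show "polyop X k a \<in> polygr gr (j + 1)" by (simp add: polygr_def)
  qed (auto simp: polygr_def fam_zero fam_add fam_uminus)
qed

lemma kcomp_pCons_0_iff: "(\<lambda>\<sigma>. pCons 0 (\<kappa> \<sigma>)) \<in> kcomp (polygr gr) i (j + 1) \<longleftrightarrow> \<kappa> \<in> kcomp (polygr gr) i j"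
proof -
  have "pCons 0 f \<in> polygr gr (j + 1 - int i) \<longleftrightarrow> f \<in> polygr gr (j - int i)" for f
    using polygr_pCons_0_iff[of gr f "j - int i"] fam_zero by (simp add: algebra_simps)
  then show ?thesis by (simp add: kcomp_def)
qed

lemma kcomp_const_poly: "\<eta> \<in> kcomp gr i j \<Longrightarrow> (\<lambda>\<sigma>. [:\<eta> \<sigma>:]) \<in> kcomp (polygr gr) i j"
  by (auto simp: kcomp_def polygr_def coeff_pCons fam_zero split: nat.split if_splits)

lemma kcomp_coeff_0: "\<kappa> \<in> kcomp (polygr gr) i j \<Longrightarrow> (\<lambda>\<sigma>. coeff (\<kappa> \<sigma>) 0) \<in> kcomp gr i j"
proof -
  have "coeff f 0 \<in> gr d" if "f \<in> polygr gr d" for f d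
    using that[unfolded polygr_def, simplified, rule_format, of 0] by simp
  then show "\<kappa> \<in> kcomp (polygr gr) i j \<Longrightarrow> ?thesis"
    unfolding kcomp_def by (simp split: if_splits)
qed

lemma kcomp_poly_divide:
  assumes "\<kappa> \<in> kcomp (polygr gr) i j" "\<And>\<sigma>. coeff (\<kappa> \<sigma>) 0 = 0"
  obtains \<kappa>' where "\<kappa>' \<in> kcomp (polygr gr) i (j - 1)" "\<kappa> = (\<lambda>\<sigma>. pCons 0 (\<kappa>' \<sigma>))"
proof -
  have "\<exists>f. \<kappa> \<sigma> = pCons 0 f" for \<sigma>
    using assms(2)[of \<sigma>] by (cases "\<kappa> \<sigma>") auto
  then obtain \<kappa>' where "\<kappa> = (\<lambda>\<sigma>. pCons 0 (\<kappa>' \<sigma>))" by metis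
  with assms(1) kcomp_pCons_0_iff[of \<kappa>' i "j - 1"] show ?thesis by (intro that[of \<kappa>']) auto
qed

text \<open>A chain whose constant term is a cycle is divisible by t up to a boundary: the constant
  term bounds by exactness, and its filling lifts to constant polynomials.\<close>

lemma poly_split_boundary:
  assumes ex: "kexact X gr i j" and v: "v \<in> kcomp (polygr gr) i j"
    and z: "kd X (\<lambda>\<sigma>. coeff (v \<sigma>) 0) = (\<lambda>_. 0)"
  obtains v' \<theta> where "v' \<in> kcomp (polygr gr) i (j - 1)" "\<theta> \<in> kcomp (polygr gr) (Suc i) j"
    "v = (\<lambda>\<sigma>. pCons 0 (v' \<sigma>) - kd (polyop X) \<theta> \<sigma>)"
proof -
  interpret P: koszul_fam "polyop X" "polygr gr" by (rule koszul_fam_polygr)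
  obtain \<eta> where \<eta>: "\<eta> \<in> kcomp gr (Suc i) j" "kd X \<eta> = (\<lambda>\<sigma>. coeff (v \<sigma>) 0)"
    using kexactD[OF ex kcomp_coeff_0[OF v] z] .
  let ?\<theta> = "\<lambda>\<sigma>. [:\<eta> \<sigma>:]"
  have \<theta>: "?\<theta> \<in> kcomp (polygr gr) (Suc i) j" by (rule kcomp_const_poly[OF \<eta>(1)])
  have "coeff (v \<sigma> + kd (polyop X) ?\<theta> \<sigma>) 0 = 0" for \<sigma>
    by (simp add: coeff_0_kd_polyop \<eta>(2))
  from kcomp_poly_divide[OF P.kcomp_add[OF v P.kcomp_kd[OF \<theta>]] this]
  obtain v' where v': "v' \<in> kcomp (polygr gr) i (j - 1)"
    "(\<lambda>\<sigma>. v \<sigma> + kd (polyop X) ?\<theta> \<sigma>) = (\<lambda>\<sigma>. pCons 0 (v' \<sigma>))" by blast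
  have "v = (\<lambda>\<sigma>. pCons 0 (v' \<sigma>) - kd (polyop X) ?\<theta> \<sigma>)"
    using v'(2) by (simp add: fun_eq_iff eq_diff_eq)
  with v'(1) \<theta> show ?thesis using that by blast
qed

text \<open>Injectivity of t on homology at position i when the coefficients have none at
  \<open>Suc i\<close>: the constant term of a filling of t z is a cycle, so that filling is
  divisible by t up to a boundary.\<close>

lemma poly_boundary_cancel:
  assumes ex: "kexact X gr (Suc i) j" and v: "v \<in> kcomp (polygr gr) (Suc i) j"
    and z: "kd (polyop X) v = (\<lambda>\<sigma>. pCons 0 (z \<sigma>))"
  obtains v' where "v' \<in> kcomp (polygr gr) (Suc i) (j - 1)" "kd (polyop X) v' = z"
proof -
  interpret P: koszul_fam "polyop X" "polygr gr" by (rule koszul_fam_polygr)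
  have "kd X (\<lambda>\<sigma>. coeff (v \<sigma>) 0) = (\<lambda>_. 0)"
    using coeff_0_kd_polyop[of v] z by (auto simp: fun_eq_iff)
  from poly_split_boundary[OF ex v this] obtain v' \<theta>
    where v': "v' \<in> kcomp (polygr gr) (Suc i) (j - 1)"
      "v = (\<lambda>\<sigma>. pCons 0 (v' \<sigma>) - kd (polyop X) \<theta> \<sigma>)" by blast
  have "kd (polyop X) v = (\<lambda>\<sigma>. pCons 0 (kd (polyop X) v' \<sigma>))"
    unfolding v'(2) P.kd_diff by (simp add: P.kd_kd kd_polyop_pCons_0)
  with z have "kd (polyop X) v' = z" by (simp add: fun_eq_iff)
  with v'(1) show ?thesis using that by blast
qed

text \<open>Surjectivity of t on homology in internal degrees where the coefficients are exact. Each
  division lowers the internal degree by one, hence the room of n above N.\<close>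

lemma poly_cycle_divide:
  assumes ex: "\<And>d. d > N \<Longrightarrow> kexact X gr i d"
    and z: "z \<in> kcomp (polygr gr) i j" "kd (polyop X) z = (\<lambda>_. 0)" "j > N + int n"
  shows "\<exists>z' \<theta>. z' \<in> kcomp (polygr gr) i (j - int n) \<and> kd (polyop X) z' = (\<lambda>_. 0) \<and>
    \<theta> \<in> kcomp (polygr gr) (Suc i) j \<and> z = (\<lambda>\<sigma>. (pCons 0 ^^ n) (z' \<sigma>) - kd (polyop X) \<theta> \<sigma>)"
proof -
  interpret P: koszul_fam "polyop X" "polygr gr" by (rule koszul_fam_polygr)
  show ?thesis using z
  proof (induction n arbitrary: z j)
    case 0
    then show ?case by (intro exI[of _ z] exI[of _ "\<lambda>_. 0"]) (simp add: P.kcomp_zero)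
  next
    case (Suc n)
    have z0: "kd X (\<lambda>\<sigma>. coeff (z \<sigma>) 0) = (\<lambda>_. 0)"
      using coeff_0_kd_polyop[of z] Suc.prems(2) by (auto simp: fun_eq_iff)
    have "j > N" using Suc.prems(3) by simp
    from ex[OF this] obtain z1 \<theta>1
      where 1: "z1 \<in> kcomp (polygr gr) i (j - 1)" "\<theta>1 \<in> kcomp (polygr gr) (Suc i) j"
        "z = (\<lambda>\<sigma>. pCons 0 (z1 \<sigma>) - kd (polyop X) \<theta>1 \<sigma>)"
      using Suc.prems(1) z0 by (rule poly_split_boundary)
    have "kd (polyop X) z = (\<lambda>\<sigma>. pCons 0 (kd (polyop X) z1 \<sigma>))"
      unfolding 1(3) P.kd_diff by (simp add: P.kd_kd kd_polyop_pCons_0)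
    then have z1: "kd (polyop X) z1 = (\<lambda>_. 0)" using Suc.prems(2) by (simp add: fun_eq_iff)
    have "j - 1 > N + int n" using Suc.prems(3) by simp
    from Suc.IH[OF 1(1) z1 this] obtain z' \<theta>
      where 2: "z' \<in> kcomp (polygr gr) i (j - 1 - int n)" "kd (polyop X) z' = (\<lambda>_. 0)"
        "\<theta> \<in> kcomp (polygr gr) (Suc i) (j - 1)"
        "z1 = (\<lambda>\<sigma>. (pCons 0 ^^ n) (z' \<sigma>) - kd (polyop X) \<theta> \<sigma>)"
      by blast
    let ?\<theta> = "\<lambda>\<sigma>. pCons 0 (\<theta> \<sigma>) + \<theta>1 \<sigma>"
    have "(\<lambda>\<sigma>. pCons 0 (\<theta> \<sigma>)) \<in> kcomp (polygr gr) (Suc i) j"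
      using kcomp_pCons_0_iff[of \<theta> "Suc i" "j - 1"] 2(3) by simp
    then have "?\<theta> \<in> kcomp (polygr gr) (Suc i) j" using 1(2) by (rule P.kcomp_add)
    moreover have "z = (\<lambda>\<sigma>. (pCons 0 ^^ Suc n) (z' \<sigma>) - kd (polyop X) ?\<theta> \<sigma>)"
    proof -
      have "pCons 0 (a - b) = pCons 0 a - pCons 0 b" for a b :: "'a poly" by simp
      then have e: "pCons 0 (z1 \<sigma>) = (pCons 0 ^^ Suc n) (z' \<sigma>) - pCons 0 (kd (polyop X) \<theta> \<sigma>)" for \<sigma>
        unfolding 2(4) by simp
      show ?thesis unfolding 1(3) P.kd_add kd_polyop_pCons_0 e diff_diff_eq ..
    qed
    ultimately show ?case using 2(1,2)
      by (intro exI[of _ z'] exI[of _ ?\<theta>]) (simp add: algebra_simps)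
  qed
qed

text \<open>On homology \<open>t - y\<^sub>k\<close> acts as zero, hence \<open>t\<^sup>n\<close> acts as the product of the \<open>y\<^sub>k\<close>.\<close>

lemma poly_nilpotent:
  assumes "z \<in> kcomp (polygr gr) i j" "kd (polyop X) z = (\<lambda>_. 0)"
    and "\<And>\<sigma>. fold (\<lambda>k. map_poly (X k)) ks (z \<sigma>) = 0"
  shows "\<exists>v\<in>kcomp (polygr gr) (Suc i) (j + int (length ks)).
    kd (polyop X) v = (\<lambda>\<sigma>. (pCons 0 ^^ length ks) (z \<sigma>))"
proof -
  interpret P: koszul_fam "polyop X" "polygr gr" by (rule koszul_fam_polygr)
  show ?thesis using assms
  proof (induction ks arbitrary: z j)
    case Nil
    then show ?case using P.kcomp_zero by (intro bexI[of _ "\<lambda>_. 0"]) (simp_all add: fun_eq_iff)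
  next
    case (Cons k ks)
    define w where "w = (\<lambda>\<sigma>. map_poly (X k) (z \<sigma>))"
    have w_eq: "w = (\<lambda>\<sigma>. pCons 0 (z \<sigma>) - polyop X k (z \<sigma>))"
      by (simp add: w_def polyop_def)
    have tz: "(\<lambda>\<sigma>. pCons 0 (z \<sigma>)) \<in> kcomp (polygr gr) i (j + 1)"
      by (simp add: kcomp_pCons_0_iff Cons.prems(1))
    have w: "w \<in> kcomp (polygr gr) i (j + 1)"
      unfolding w_eq by (rule P.kcomp_diff[OF tz P.kcomp_op[OF Cons.prems(1)]])
    have "kd (polyop X) w = (\<lambda>_. 0)"
      unfolding w_eq P.kd_diff kd_polyop_pCons_0 P.kd_op by (simp add: Cons.prems(2))
    from Cons.IH[OF w this] Cons.prems(3) obtain v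
      where v: "v \<in> kcomp (polygr gr) (Suc i) (j + 1 + int (length ks))"
        "kd (polyop X) v = (\<lambda>\<sigma>. (pCons 0 ^^ length ks) (w \<sigma>))" by (auto simp: w_def)
    have kw: "kd (polyop X) (kw k z) = (\<lambda>\<sigma>. polyop X k (z \<sigma>))"
    proof
      fix \<sigma>
      have "kw k (kd (polyop X) z) \<sigma> = 0" unfolding Cons.prems(2) by (simp add: kw_def)
      then show "kd (polyop X) (kw k z) \<sigma> = polyop X k (z \<sigma>)"
        using P.kd_kw[of k z \<sigma>] by simp
    qed
    have shift: "u \<in> kcomp (polygr gr) m d \<Longrightarrow> (\<lambda>\<sigma>. (pCons 0 ^^ n) (u \<sigma>)) \<in> kcomp (polygr gr) m (d + int n)"
      "kd (polyop X) (\<lambda>\<sigma>. (pCons 0 ^^ n) (u \<sigma>)) = (\<lambda>\<sigma>. (pCons 0 ^^ n) (kd (polyop X) u \<sigma>))" for u m d n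
    proof (induction n)
      case (Suc n)
      {
        case 1
        then show ?case using Suc(1) kcomp_pCons_0_iff[of "\<lambda>\<sigma>. (pCons 0 ^^ n) (u \<sigma>)" m "d + int n"]
          by (simp add: algebra_simps)
      next
        case 2
        then show ?case using Suc(2) by (simp add: kd_polyop_pCons_0)
      }
    qed auto
    \<comment> \<open>With n the length of ks, t^n (y_k z) + t^n (t - y_k) z = t^(n+1) z. The first
      summand bounds by induction, the second by the homotopy \<open>kw k\<close>.\<close>
    let ?v = "\<lambda>\<sigma>. v \<sigma> + (pCons 0 ^^ length ks) (kw k z \<sigma>)"
    have "?v \<in> kcomp (polygr gr) (Suc i) (j + 1 + int (length ks))"
      by (rule P.kcomp_add[OF v(1) shift(1)[OF P.kcomp_kw[OF Cons.prems(1)]]])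
    moreover have "(pCons 0 ^^ n) (a + b) = (pCons 0 ^^ n) a + (pCons 0 ^^ n) b" for n and a b :: "'a poly"
      by (induction n) auto
    then have "kd (polyop X) ?v = (\<lambda>\<sigma>. (pCons 0 ^^ length ks) (w \<sigma> + polyop X k (z \<sigma>)))"
      unfolding P.kd_add v(2) shift(2) kw by simp
    then have "kd (polyop X) ?v = (\<lambda>\<sigma>. (pCons 0 ^^ length (k # ks)) (z \<sigma>))"
      by (simp add: w_eq funpow_swap1)
    ultimately show ?case by (intro bexI[of _ ?v]) (auto simp: algebra_simps)
  qed
qed

lemma poly_boundary_cancel_power:
  assumes "\<And>j. kexact X gr (Suc i) j"
    and "v \<in> kcomp (polygr gr) (Suc i) (j + int n)" "kd (polyop X) v = (\<lambda>\<sigma>. (pCons 0 ^^ n) (z \<sigma>))"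
  shows "\<exists>v'\<in>kcomp (polygr gr) (Suc i) j. kd (polyop X) v' = z"
  using assms(2,3)
proof (induction n arbitrary: v)
  case (Suc n)
  have "kd (polyop X) v = (\<lambda>\<sigma>. pCons 0 ((pCons 0 ^^ n) (z \<sigma>)))"
    using Suc.prems(2) by simp
  from poly_boundary_cancel[OF assms(1) Suc.prems(1) this]
  obtain v' where "v' \<in> kcomp (polygr gr) (Suc i) (j + int (Suc n) - 1)"
    "kd (polyop X) v' = (\<lambda>\<sigma>. (pCons 0 ^^ n) (z \<sigma>))" .
  then show ?case using Suc.IH[of v'] by simp
qed (auto simp: fun_eq_iff)

text \<open>A power of t kills the homology at position i because the product of the operators in ks
  is zero, and t is injective there.\<close>

lemma kexact_polyop:
  assumes nil: "\<And>j a. a \<in> gr j \<Longrightarrow> fold X ks a = 0" and ex: "\<And>j. kexact X gr (Suc i) j"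
  shows "kexact (polyop X) (polygr gr) i j"
  unfolding kexact_def
proof (intro ballI impI)
  fix z assume z: "z \<in> kcomp (polygr gr) i j" "kd (polyop X) z = (\<lambda>_. 0)"
  have "coeff (fold (\<lambda>k. map_poly (X k)) ks f) n = fold X ks (coeff f n)" for f n
    by (induction ks arbitrary: f) (auto simp: coeff_map_poly)
  moreover have "coeff (z \<sigma>) n \<in> gr (j - int i - int n)" for \<sigma> n
    using z(1) by (cases "card \<sigma> = i") (auto simp: kcomp_def polygr_def fam_zero split: if_splits)
  then have "fold X ks (coeff (z \<sigma>) n) = 0" for \<sigma> n
    by (rule nil)
  ultimately have "fold (\<lambda>k. map_poly (X k)) ks (z \<sigma>) = 0" for \<sigma>
    by (intro poly_eqI) simp
  from poly_nilpotent[OF z this] show "\<exists>\<eta>\<in>kcomp (polygr gr) (Suc i) j. kd (polyop X) \<eta> = z"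
    using poly_boundary_cancel_power[OF ex] by blast
qed

text \<open>Surjectivity of t takes the place of injectivity: a cycle of large degree is a power of
  t times a cycle, up to a boundary, and that multiple bounds. This supplies the degree bound for
  resolutions by finitely generated modules.\<close>

lemma kexact_polyop_high_degree:
  assumes nil: "\<And>j a. a \<in> gr j \<Longrightarrow> fold X ks a = 0" and ex: "\<And>d. d > N \<Longrightarrow> kexact X gr i d"
    and j: "j > N + int (length ks)"
  shows "kexact (polyop X) (polygr gr) i j"
  unfolding kexact_def
proof (intro ballI impI)
  interpret P: koszul_fam "polyop X" "polygr gr" by (rule koszul_fam_polygr)
  fix z assume z: "z \<in> kcomp (polygr gr) i j" "kd (polyop X) z = (\<lambda>_. 0)"
  from poly_cycle_divide[OF ex z j] obtain z' \<theta>
    where z': "z' \<in> kcomp (polygr gr) i (j - int (length ks))" "kd (polyop X) z' = (\<lambda>_. 0)"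
      "\<theta> \<in> kcomp (polygr gr) (Suc i) j"
      "z = (\<lambda>\<sigma>. (pCons 0 ^^ length ks) (z' \<sigma>) - kd (polyop X) \<theta> \<sigma>)" by blast
  have "coeff (fold (\<lambda>k. map_poly (X k)) ks f) n = fold X ks (coeff f n)" for f n
    by (induction ks arbitrary: f) (auto simp: coeff_map_poly)
  moreover have "coeff (z' \<sigma>) n \<in> gr (j - int (length ks) - int i - int n)" for \<sigma> n
    using z'(1) by (cases "card \<sigma> = i") (auto simp: kcomp_def polygr_def fam_zero split: if_splits)
  then have "fold X ks (coeff (z' \<sigma>) n) = 0" for \<sigma> n
    by (rule nil)
  ultimately have "fold (\<lambda>k. map_poly (X k)) ks (z' \<sigma>) = 0" for \<sigma>
    by (intro poly_eqI) simp
  from poly_nilpotent[OF z'(1,2) this] obtain v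
    where v: "v \<in> kcomp (polygr gr) (Suc i) j" "kd (polyop X) v = (\<lambda>\<sigma>. (pCons 0 ^^ length ks) (z' \<sigma>))"
    by auto
  show "\<exists>\<eta>\<in>kcomp (polygr gr) (Suc i) j. kd (polyop X) \<eta> = z"
    using P.kcomp_diff[OF v(1) z'(3)]
    unfolding z'(4) by (intro bexI[of _ "\<lambda>\<sigma>. v \<sigma> - \<theta> \<sigma>"]) (simp_all only: P.kd_diff v(2))
qed

text \<open>The connecting map of multiplication by t is injective on homology of M_0 at
  \<open>Suc i\<close> once M_0[t] has none there. The boundary of a constant lift of a cycle is t
  times a cycle of degree j - 1, and this cycle cannot bound.\<close>

lemma not_kexact_polyop:
  assumes nex: "\<not> kexact X gr (Suc i) j" and ex: "kexact (polyop X) (polygr gr) (Suc i) j"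
  shows "\<not> kexact (polyop X) (polygr gr) i (j - 1)"
proof
  interpret P: koszul_fam "polyop X" "polygr gr" by (rule koszul_fam_polygr)
  assume L: "kexact (polyop X) (polygr gr) i (j - 1)"
  obtain \<zeta> where \<zeta>: "\<zeta> \<in> kcomp gr (Suc i) j" "kd X \<zeta> = (\<lambda>_. 0)"
    and nb: "\<And>\<eta>. \<eta> \<in> kcomp gr (Suc (Suc i)) j \<Longrightarrow> kd X \<eta> \<noteq> \<zeta>"
    using nex unfolding kexact_def by blast
  let ?\<zeta> = "\<lambda>\<sigma>. [:\<zeta> \<sigma>:]"
  have \<zeta>': "?\<zeta> \<in> kcomp (polygr gr) (Suc i) j" by (rule kcomp_const_poly[OF \<zeta>(1)])
  have "coeff (kd (polyop X) ?\<zeta> \<sigma>) 0 = 0" for \<sigma>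
    by (simp add: coeff_0_kd_polyop \<zeta>(2))
  from kcomp_poly_divide[OF P.kcomp_kd[OF \<zeta>'] this] obtain z
    where z: "z \<in> kcomp (polygr gr) i (j - 1)" "kd (polyop X) ?\<zeta> = (\<lambda>\<sigma>. pCons 0 (z \<sigma>))" by blast
  have "(\<lambda>\<sigma>. pCons 0 (kd (polyop X) z \<sigma>)) = (\<lambda>_. 0)"
    using P.kd_kd[of ?\<zeta>] unfolding z(2) kd_polyop_pCons_0 by simp
  then have "kd (polyop X) z = (\<lambda>_. 0)" by (simp add: fun_eq_iff)
  from kexactD[OF L z(1) this] obtain v
    where v: "v \<in> kcomp (polygr gr) (Suc i) (j - 1)" "kd (polyop X) v = z" by blast
  have "(\<lambda>\<sigma>. pCons 0 (v \<sigma>)) \<in> kcomp (polygr gr) (Suc i) j"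
    using kcomp_pCons_0_iff[of v "Suc i" "j - 1"] v(1) by simp
  note m = P.kcomp_diff[OF \<zeta>' this]
  have "kd (polyop X) (\<lambda>\<sigma>. ?\<zeta> \<sigma> - pCons 0 (v \<sigma>)) = (\<lambda>_. 0)"
    unfolding P.kd_diff z(2) kd_polyop_pCons_0 v(2) by simp
  from kexactD[OF ex m this] obtain w
    where w: "w \<in> kcomp (polygr gr) (Suc (Suc i)) j" "kd (polyop X) w = (\<lambda>\<sigma>. ?\<zeta> \<sigma> - pCons 0 (v \<sigma>))" by blast
  \<comment> \<open>The minus sign comes from the constant term of t - y_k and is absorbed into the
    filling.\<close>
  have "- kd X (\<lambda>\<sigma>. coeff (w \<sigma>) 0) \<sigma> = \<zeta> \<sigma>" for \<sigma>
    using coeff_0_kd_polyop[of w \<sigma>] by (simp add: w(2))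
  then have "kd X (\<lambda>\<sigma>. - coeff (w \<sigma>) 0) = \<zeta>" unfolding kd_uminus by (rule ext)
  moreover have "kd X (\<lambda>\<sigma>. - coeff (w \<sigma>) 0) \<noteq> \<zeta>"
    by (rule nb[OF kcomp_uminus[OF kcomp_coeff_0[OF w(1)]]])
  ultimately show False by contradiction
qed

end

section \<open>Chain complexes of set families\<close>

definition cchain :: "'n::{finite, linorder} set set \<Rightarrow> nat \<Rightarrow> ('n set \<Rightarrow> 'k::field) set" where
  "cchain \<X> i = {c. \<forall>\<sigma>. c \<sigma> \<noteq> 0 \<longrightarrow> \<sigma> \<in> \<X> \<and> card \<sigma> = i}"

text \<open>The simplicial boundary is the Koszul differential of identity operators. Values outside
  the family are cut off, so for a difference of two complexes this is the relative
  boundary.\<close>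

definition cbd :: "'n::{finite, linorder} set set \<Rightarrow> ('n set \<Rightarrow> 'k::field) \<Rightarrow> 'n set \<Rightarrow> 'k" where
  "cbd \<X> c = (\<lambda>\<rho>. if \<rho> \<in> \<X> then kd (\<lambda>_ a. a) c \<rho> else 0)"

text \<open>Vanishing of reduced homology, the empty set being a face of index 0. The index is the
  cardinality, one more than the dimension.\<close>

definition cexact :: "'k::field itself \<Rightarrow> 'n::{finite, linorder} set set \<Rightarrow> nat \<Rightarrow> bool" where
  "cexact _ \<X> i \<longleftrightarrow>
     (\<forall>c :: 'n set \<Rightarrow> 'k. c \<in> cchain \<X> i \<longrightarrow> cbd \<X> c = (\<lambda>_. 0) \<longrightarrow> (\<exists>e\<in>cchain \<X> (Suc i). cbd \<X> e = c))"

interpretation cb: koszul_ops "\<lambda>_ a. a"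
  by unfold_locales auto

\<comment> \<open>the instance \<open>0 = 0\<close> would make the simplifier loop\<close>
declare cb.op_zero [simp del]

abbreviation bd :: "('n::{finite, linorder} set \<Rightarrow> 'a::ab_group_add) \<Rightarrow> 'n set \<Rightarrow> 'a" where
  "bd \<equiv> kd (\<lambda>_ a. a)"

definition downset :: "'n set set \<Rightarrow> bool" where
  "downset \<X> \<longleftrightarrow> (\<forall>\<sigma>\<in>\<X>. \<forall>\<rho>\<subseteq>\<sigma>. \<rho> \<in> \<X>)"

lemma cchainD: "c \<in> cchain \<X> i \<Longrightarrow> c \<sigma> \<noteq> 0 \<Longrightarrow> \<sigma> \<in> \<X> \<and> card \<sigma> = i"
  unfolding cchain_def mem_Collect_eq by (erule allE, erule (1) mp)

lemma cchainI: "(\<And>\<sigma>. c \<sigma> \<noteq> 0 \<Longrightarrow> \<sigma> \<in> \<X> \<and> card \<sigma> = i) \<Longrightarrow> c \<in> cchain \<X> i"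
  unfolding cchain_def mem_Collect_eq by (intro allI impI)

lemma cchain_iff: "c \<in> cchain \<X> i \<longleftrightarrow> (\<forall>\<sigma>. \<not> (\<sigma> \<in> \<X> \<and> card \<sigma> = i) \<longrightarrow> c \<sigma> = 0)"
  using cchainD[of c \<X> i] cchainI[of c \<X> i] by metis

lemma cchain_off: "c \<in> cchain \<X> i \<Longrightarrow> \<sigma> \<notin> \<X> \<Longrightarrow> c \<sigma> = 0"
  using cchainD[of c \<X> i \<sigma>] by metis

lemma cchain_zero: "(\<lambda>_. 0) \<in> cchain \<X> i"
  by (simp add: cchain_def)

lemma cchain_add: "a \<in> cchain \<X> i \<Longrightarrow> b \<in> cchain \<X> i \<Longrightarrow> (\<lambda>\<sigma>. a \<sigma> + b \<sigma>) \<in> cchain \<X> i"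
  by (simp add: cchain_iff)

lemma cchain_diff: "a \<in> cchain \<X> i \<Longrightarrow> b \<in> cchain \<X> i \<Longrightarrow> (\<lambda>\<sigma>. a \<sigma> - b \<sigma>) \<in> cchain \<X> i"
  by (simp add: cchain_iff)

lemma cchain_uminus: "a \<in> cchain \<X> i \<Longrightarrow> (\<lambda>\<sigma>. - a \<sigma>) \<in> cchain \<X> i"
  by (simp add: cchain_iff)

lemma cchain_mono: "a \<in> cchain \<X> i \<Longrightarrow> \<X> \<subseteq> \<Y> \<Longrightarrow> a \<in> cchain \<Y> i"
  by (rule cchainI) (drule (1) cchainD, simp add: subset_iff)

lemma bd_nonzero:
  assumes "c \<in> cchain \<X> i" "bd c \<rho> \<noteq> 0"
  obtains k where "k \<notin> \<rho>" "insert k \<rho> \<in> \<X>" "card (insert k \<rho>) = i"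
proof -
  from assms(2) obtain k where "k \<in> -\<rho>" "ksgn k \<rho> (c (insert k \<rho>)) \<noteq> 0"
    unfolding kd_def by (meson sum.not_neutral_contains_not_neutral)
  with cchainD[OF assms(1), of "insert k \<rho>"] show ?thesis by (intro that[of k]) auto
qed

lemma cbd_mem: "c \<in> cchain \<X> (Suc i) \<Longrightarrow> cbd \<X> c \<in> cchain \<X> i"
proof -
  assume c: "c \<in> cchain \<X> (Suc i)"
  have "card \<rho> = i" if "bd c \<rho> \<noteq> 0" for \<rho>
    using bd_nonzero[OF c that] by (metis card_insert_disjoint finite nat.inject)
  then show ?thesis by (intro cchainI) (auto simp: cbd_def split: if_splits)
qed

lemma cbd_downset: "downset \<X> \<Longrightarrow> c \<in> cchain \<X> i \<Longrightarrow> cbd \<X> c = bd c"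
proof
  fix \<rho> assume \<X>: "downset \<X>" and c: "c \<in> cchain \<X> i"
  have "\<rho> \<in> \<X>" if "bd c \<rho> \<noteq> 0"
    using \<X> bd_nonzero[OF c that] unfolding downset_def by (metis subset_insertI)
  then show "cbd \<X> c \<rho> = bd c \<rho>" by (auto simp: cbd_def)
qed

lemma bd_mem: "downset \<X> \<Longrightarrow> c \<in> cchain \<X> (Suc i) \<Longrightarrow> bd c \<in> cchain \<X> i"
  using cbd_mem[of c \<X> i] cbd_downset[of \<X> c "Suc i"] by simp

lemma cexact_downset_iff:
  assumes "downset \<X>"
  shows "cexact TYPE('k::field) \<X> i \<longleftrightarrow>
    (\<forall>c :: 'n::{finite, linorder} set \<Rightarrow> 'k. c \<in> cchain \<X> i \<longrightarrow> bd c = (\<lambda>_. 0) \<longrightarrow> (\<exists>e\<in>cchain \<X> (Suc i). bd e = c))"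
proof -
  have "(\<exists>e\<in>cchain \<X> (Suc i). cbd \<X> e = c) \<longleftrightarrow> (\<exists>e\<in>cchain \<X> (Suc i). bd e = c)" for c :: "'n set \<Rightarrow> 'k"
    by (rule bex_cong[OF refl]) (simp add: cbd_downset[OF assms])
  then show ?thesis unfolding cexact_def by (auto simp: cbd_downset[OF assms])
qed

text \<open>The family is a cone with apex k, contracted by \<open>kw k\<close>. Being stable under
  adding and removing k makes the cut-off compatible with the homotopy, even for families that are
  not closed under subsets.\<close>

lemma cexact_cone:
  fixes \<X> :: "'n::{finite, linorder} set set"
  assumes "\<And>\<sigma>. insert k \<sigma> \<in> \<X> \<longleftrightarrow> \<sigma> \<in> \<X>"
  shows "cexact TYPE('k::field) \<X> i"
  unfolding cexact_def
proof (intro allI impI)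
  fix c :: "'n set \<Rightarrow> 'k" assume c: "c \<in> cchain \<X> i" "cbd \<X> c = (\<lambda>_. 0)"
  have m: "\<sigma> - {k} \<in> \<X> \<longleftrightarrow> \<sigma> \<in> \<X>" for \<sigma>
    using assms[of "\<sigma> - {k}"] assms[of \<sigma>] by simp
  have "kw k c \<in> cchain \<X> (Suc i)"
    unfolding cchain_def
  proof (intro CollectI allI impI)
    fix \<sigma> assume "kw k c \<sigma> \<noteq> 0"
    then have k: "k \<in> \<sigma>" "c (\<sigma> - {k}) \<noteq> 0" by (auto simp: kw_def split: if_splits)
    from cchainD[OF c(1) k(2)] k(1) m show "\<sigma> \<in> \<X> \<and> card \<sigma> = Suc i"
      by (metis card_Suc_Diff1 finite)
  qed
  moreover have "cbd \<X> (kw k c) \<rho> = c \<rho>" for \<rho>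
  proof (cases "\<rho> \<in> \<X>")
    case True
    have "bd c (\<rho> - {k}) = 0"
      using fun_cong[OF c(2), of "\<rho> - {k}"] m True by (simp add: cbd_def)
    then have "kw k (bd c) \<rho> = 0" by (simp add: kw_def)
    then show ?thesis using cb.kd_kw[of k c \<rho>] True by (simp add: cbd_def)
  next
    case False
    then show ?thesis using cchain_off[OF c(1)] by (simp add: cbd_def)
  qed
  ultimately show "\<exists>e\<in>cchain \<X> (Suc i). cbd \<X> e = c" by blast
qed

lemma cexact_Pow:
  assumes "(\<tau> :: 'n::{finite, linorder} set) \<noteq> {}"
  shows "cexact TYPE('k::field) (Pow \<tau>) i"
proof -
  from assms obtain k where "k \<in> \<tau>" by blast
  then show ?thesis by (intro cexact_cone[of k]) auto
qed

lemma cchain_kw: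
  assumes "b \<in> cchain \<X> i" "\<And>\<sigma>. \<sigma> \<in> \<X> \<Longrightarrow> v \<notin> \<sigma>" "\<And>\<sigma>. \<sigma> \<in> \<X> \<Longrightarrow> insert v \<sigma> \<in> \<Y>"
  shows "kw v b \<in> cchain \<Y> (Suc i)"
  unfolding cchain_def
proof (intro CollectI allI impI)
  fix \<sigma> assume "kw v b \<sigma> \<noteq> 0"
  then have k: "v \<in> \<sigma>" "b (\<sigma> - {v}) \<noteq> 0" by (auto simp: kw_def split: if_splits)
  from cchainD[OF assms(1) k(2)] k(1) assms(3)[of "\<sigma> - {v}"]
  show "\<sigma> \<in> \<Y> \<and> card \<sigma> = Suc i" by (metis card_Suc_Diff1 finite insert_Diff)
qed

text \<open>A chain is a chain of the deletion of v plus the cone from v over a chain of the link of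
  v.\<close>

lemma chain_split:
  fixes c :: "'n::{finite, linorder} set \<Rightarrow> 'k::field"
  assumes "c \<in> cchain \<X> (Suc i)"
  obtains a b where "a \<in> cchain {\<sigma>\<in>\<X>. v \<notin> \<sigma>} (Suc i)" "b \<in> cchain {\<sigma>. v \<notin> \<sigma> \<and> insert v \<sigma> \<in> \<X>} i"
    "c = (\<lambda>\<sigma>. a \<sigma> + kw v b \<sigma>)"
proof
  show "(\<lambda>\<sigma>. if v \<in> \<sigma> then 0 else c \<sigma>) \<in> cchain {\<sigma>\<in>\<X>. v \<notin> \<sigma>} (Suc i)"
    using cchainD[OF assms] by (intro cchainI) (auto split: if_splits)
  show "(\<lambda>\<sigma>. if v \<in> \<sigma> then 0 else ksgn v \<sigma> (c (insert v \<sigma>))) \<in> cchain {\<sigma>. v \<notin> \<sigma> \<and> insert v \<sigma> \<in> \<X>} i"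
    unfolding cchain_def
  proof (intro CollectI allI impI)
    fix \<sigma> assume "(if v \<in> \<sigma> then 0 else ksgn v \<sigma> (c (insert v \<sigma>))) \<noteq> 0"
    then have v: "v \<notin> \<sigma>" "c (insert v \<sigma>) \<noteq> 0" by (auto split: if_splits)
    from cchainD[OF assms v(2)] v(1)
    show "\<sigma> \<in> {\<sigma>. v \<notin> \<sigma> \<and> insert v \<sigma> \<in> \<X>} \<and> card \<sigma> = i" by simp
  qed
  show "c = (\<lambda>\<sigma>. (if v \<in> \<sigma> then 0 else c \<sigma>) +
      kw v (\<lambda>\<sigma>. if v \<in> \<sigma> then 0 else ksgn v \<sigma> (c (insert v \<sigma>))) \<sigma>)"
    by (auto simp: kw_def insert_absorb)
qed

lemma bd_avoids: "(\<And>\<sigma>. v \<in> \<sigma> \<Longrightarrow> c \<sigma> = 0) \<Longrightarrow> v \<in> \<rho> \<Longrightarrow> bd c \<rho> = 0"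
  by (auto simp: kd_def intro!: sum.neutral)

lemma kw_inj:
  assumes "\<And>\<sigma>. v \<in> \<sigma> \<Longrightarrow> a \<sigma> = 0" "\<And>\<sigma>. v \<in> \<sigma> \<Longrightarrow> b \<sigma> = 0" "\<And>\<sigma>. v \<in> \<sigma> \<Longrightarrow> kw v a \<sigma> = kw v b \<sigma>"
  shows "a = b"
proof
  fix \<sigma>
  show "a \<sigma> = b \<sigma>"
  proof (cases "v \<in> \<sigma>")
    case False
    have "ksgn v \<sigma> (a \<sigma>) = ksgn v \<sigma> (b \<sigma>)"
      using assms(3)[of "insert v \<sigma>"] False by (simp add: kw_def)
    then show ?thesis by (metis ksgn_ksgn)
  qed (use assms in simp)
qed

section \<open>Links and induced subcomplexes\<close>

text \<open>For disjoint F and \<tau>, the link of F in the subcomplex induced on F \<union> \<tau>.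
  It interpolates between induced subcomplexes (F empty) and full links (\<tau> the complement of
  F).\<close>

definition lk :: "'n set set \<Rightarrow> 'n set \<Rightarrow> 'n set \<Rightarrow> 'n set set" where
  "lk \<Delta> F \<tau> = {\<sigma>. \<sigma> \<subseteq> \<tau> \<and> F \<union> \<sigma> \<in> \<Delta>}"

lemma downset_lk: "downset \<Delta> \<Longrightarrow> downset (lk \<Delta> F \<tau>)"
proof -
  assume "downset \<Delta>"
  then have "F \<union> \<rho> \<in> \<Delta>" if "F \<union> \<sigma> \<in> \<Delta>" "\<rho> \<subseteq> \<sigma>" for \<sigma> \<rho>
    using that unfolding downset_def by (metis Un_mono subset_refl)
  then show ?thesis unfolding downset_def lk_def by blast
qed

lemma lk_insert_subset: "downset \<Delta> \<Longrightarrow> lk \<Delta> (insert v F) \<tau> \<subseteq> lk \<Delta> F \<tau>"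
  unfolding downset_def lk_def by (auto; metis Un_insert_left subset_insertI)

lemma lk_avoid: "v \<notin> \<tau> \<Longrightarrow> {\<sigma>\<in>lk \<Delta> F (insert v \<tau>). v \<notin> \<sigma>} = lk \<Delta> F \<tau>"
  by (auto simp: lk_def)

lemma lk_through: "v \<notin> \<tau> \<Longrightarrow> {\<sigma>. v \<notin> \<sigma> \<and> insert v \<sigma> \<in> lk \<Delta> F (insert v \<tau>)} = lk \<Delta> (insert v F) \<tau>"
  by (auto simp: lk_def)

text \<open>In the long exact sequence of the deletion of v, the link of v at index i lies between
  the whole complex at \<open>Suc i\<close> and the deletion \<open>lk \<Delta> F \<tau>\<close> at
  i.\<close>

lemma cexact_lk_insert:
  fixes \<Delta> :: "'n::{finite, linorder} set set"
  assumes \<Delta>: "downset \<Delta>" and v: "v \<notin> \<tau>"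
    and ex: "cexact TYPE('k::field) (lk \<Delta> F (insert v \<tau>)) (Suc i)" "cexact TYPE('k) (lk \<Delta> F \<tau>) i"
  shows "cexact TYPE('k) (lk \<Delta> (insert v F) \<tau>) i"
  unfolding cexact_downset_iff[OF downset_lk[OF \<Delta>]]
proof (intro allI impI)
  note ex' = ex[unfolded cexact_downset_iff[OF downset_lk[OF \<Delta>]]]
  fix b :: "'n set \<Rightarrow> 'k" assume b: "b \<in> cchain (lk \<Delta> (insert v F) \<tau>) i" "bd b = (\<lambda>_. 0)"
  have av: "c \<sigma> = 0" if "c \<in> cchain (lk \<Delta> G \<tau>) n" "v \<in> \<sigma>" for c :: "'n set \<Rightarrow> 'k" and \<sigma> G n
    using that v cchain_off[OF that(1), of \<sigma>] by (auto simp: lk_def)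
  have "b \<in> cchain (lk \<Delta> F \<tau>) i" using b(1) lk_insert_subset[OF \<Delta>] by (rule cchain_mono)
  with ex'(2) b(2) obtain a' where a': "a' \<in> cchain (lk \<Delta> F \<tau>) (Suc i)" "bd a' = b" by blast
  \<comment> \<open>The cone over b, glued along b to a filling of b in the deletion, is a
    cycle.\<close>
  let ?c = "\<lambda>\<sigma>. kw v b \<sigma> - a' \<sigma>"
  have kb: "kw v b \<in> cchain (lk \<Delta> F (insert v \<tau>)) (Suc i)"
    using v by (intro cchain_kw[OF b(1)]) (auto simp: lk_def)
  have kw0: "kw v (bd b) = (\<lambda>_. 0)" using b(2) by (simp add: kw_def fun_eq_iff)
  have "?c \<in> cchain (lk \<Delta> F (insert v \<tau>)) (Suc i)"
    using kb by (rule cchain_diff) (rule cchain_mono[OF a'(1)], auto simp: lk_def)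
  moreover have "bd ?c = (\<lambda>_. 0)"
    unfolding cb.kd_diff a'(2) using cb.kd_kw[of v b] by (simp add: kw0 fun_eq_iff)
  ultimately obtain e where e: "e \<in> cchain (lk \<Delta> F (insert v \<tau>)) (Suc (Suc i))" "bd e = ?c"
    using ex'(1) by blast
  obtain a'' b'' where s: "a'' \<in> cchain (lk \<Delta> F \<tau>) (Suc (Suc i))"
    "b'' \<in> cchain (lk \<Delta> (insert v F) \<tau>) (Suc i)" "e = (\<lambda>\<sigma>. a'' \<sigma> + kw v b'' \<sigma>)"
    using chain_split[OF e(1), of v] unfolding lk_avoid[OF v] lk_through[OF v] by blast
  have "kw v b \<sigma> = kw v (\<lambda>\<rho>. - bd b'' \<rho>) \<sigma>" if "v \<in> \<sigma>" for \<sigma>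
  proof -
    have "kw v b \<sigma> = bd e \<sigma>" using av[OF a'(1) that] by (simp add: e(2))
    also have "\<dots> = bd a'' \<sigma> + bd (kw v b'') \<sigma>" by (simp add: s(3) cb.kd_add)
    also have "bd a'' \<sigma> = 0" using av[OF s(1)] that by (rule bd_avoids)
    also have "bd (kw v b'') \<sigma> = - kw v (bd b'') \<sigma>"
      using cb.kd_kw[of v b'' \<sigma>] av[OF s(2) that] by (simp add: eq_neg_iff_add_eq_0)
    finally show ?thesis using that by (simp add: kw_def ksgn_uminus)
  qed
  then have "b = (\<lambda>\<rho>. - bd b'' \<rho>)"
    using av[OF b(1)] bd_avoids[OF av[OF s(2)]] by (intro kw_inj[of v]) auto
  then have "bd (\<lambda>\<rho>. - b'' \<rho>) = b" by (simp add: cb.kd_uminus)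
  with cchain_uminus[OF s(2)] show "\<exists>e\<in>cchain (lk \<Delta> (insert v F) \<tau>) (Suc i). bd e = b" by blast
qed

text \<open>The next segment of that sequence: the deletion at index i lies between the link of v
  and the whole complex, both at index i.\<close>

lemma cexact_lk_delete:
  fixes \<Delta> :: "'n::{finite, linorder} set set"
  assumes \<Delta>: "downset \<Delta>" and v: "v \<notin> \<tau>"
    and ex: "cexact TYPE('k::field) (lk \<Delta> F (insert v \<tau>)) i" "cexact TYPE('k) (lk \<Delta> (insert v F) \<tau>) i"
  shows "cexact TYPE('k) (lk \<Delta> F \<tau>) i"
  unfolding cexact_downset_iff[OF downset_lk[OF \<Delta>]]
proof (intro allI impI)
  note ex' = ex[unfolded cexact_downset_iff[OF downset_lk[OF \<Delta>]]]
  fix a :: "'n set \<Rightarrow> 'k" assume a: "a \<in> cchain (lk \<Delta> F \<tau>) i" "bd a = (\<lambda>_. 0)"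
  have av: "c \<sigma> = 0" if "c \<in> cchain (lk \<Delta> G \<tau>) n" "v \<in> \<sigma>" for c :: "'n set \<Rightarrow> 'k" and \<sigma> G n
    using that v cchain_off[OF that(1), of \<sigma>] by (auto simp: lk_def)
  have "a \<in> cchain (lk \<Delta> F (insert v \<tau>)) i" by (rule cchain_mono[OF a(1)]) (auto simp: lk_def)
  with ex'(1) a(2) obtain e where e: "e \<in> cchain (lk \<Delta> F (insert v \<tau>)) (Suc i)" "bd e = a" by blast
  obtain a' b' where s: "a' \<in> cchain (lk \<Delta> F \<tau>) (Suc i)"
    "b' \<in> cchain (lk \<Delta> (insert v F) \<tau>) i" "e = (\<lambda>\<sigma>. a' \<sigma> + kw v b' \<sigma>)"
    using chain_split[OF e(1), of v] unfolding lk_avoid[OF v] lk_through[OF v] by blast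
  \<comment> \<open>On sets containing v only the cone part remains, which forces b' to be a cycle.
    Its filling in the link, a subcomplex of the deletion, then replaces the cone.\<close>
  have a_eq: "a \<sigma> = bd a' \<sigma> + (b' \<sigma> - kw v (bd b') \<sigma>)" for \<sigma>
  proof -
    have "bd (kw v b') \<sigma> = b' \<sigma> - kw v (bd b') \<sigma>"
      using cb.kd_kw[of v b' \<sigma>] by (simp add: eq_diff_eq)
    then show ?thesis using fun_cong[OF e(2), of \<sigma>] by (simp add: s(3) cb.kd_add)
  qed
  have "kw v (bd b') \<sigma> = kw v (\<lambda>_. 0) \<sigma>" if "v \<in> \<sigma>" for \<sigma>
    using a_eq[of \<sigma>] av[OF a(1) that] av[OF s(2) that] bd_avoids[OF av[OF s(1)] that]
    by (simp add: kw_def)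
  then have "bd b' = (\<lambda>_. 0)"
    using bd_avoids[OF av[OF s(2)]] by (intro kw_inj[of v]) auto
  with ex'(2) s(2) obtain b'' where b'': "b'' \<in> cchain (lk \<Delta> (insert v F) \<tau>) (Suc i)" "bd b'' = b'" by blast
  have "bd (\<lambda>\<sigma>. a' \<sigma> + b'' \<sigma>) = a"
    using a_eq \<open>bd b' = (\<lambda>_. 0)\<close> by (simp add: cb.kd_add b''(2) fun_eq_iff kw_def)
  moreover have "(\<lambda>\<sigma>. a' \<sigma> + b'' \<sigma>) \<in> cchain (lk \<Delta> F \<tau>) (Suc i)"
    using s(1) cchain_mono[OF b''(1) lk_insert_subset[OF \<Delta>]] by (rule cchain_add)
  ultimately show "\<exists>e\<in>cchain (lk \<Delta> F \<tau>) (Suc i). bd e = a" by blast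
qed

text \<open>Both sides are extreme cases of exactness of all \<open>lk \<Delta> F \<tau>\<close>
  with F and \<tau> disjoint. Moving a vertex from \<tau> to F uses the larger complex at the next
  index, hence a range of indices instead of a single one. The converse is an induction on the
  number of vertices outside both sets.\<close>

theorem links_exact_iff_restrictions_exact:
  fixes \<Delta> :: "'n::{finite, linorder} set set"
  assumes \<Delta>: "downset \<Delta>"
  shows "(\<forall>\<tau>. \<forall>i\<ge>r. cexact TYPE('k::field) (lk \<Delta> {} \<tau>) i) \<longleftrightarrow>
    (\<forall>F. \<forall>i\<ge>r. cexact TYPE('k) (lk \<Delta> F (- F)) i)"
proof
  assume L: "\<forall>\<tau>. \<forall>i\<ge>r. cexact TYPE('k) (lk \<Delta> {} \<tau>) i"
  have "cexact TYPE('k) (lk \<Delta> F \<tau>) i" if "F \<inter> \<tau> = {}" "i \<ge> r" for F \<tau> i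
    using finite[of F] that
  proof (induction F arbitrary: \<tau> i rule: finite_induct)
    case (insert v F)
    then show ?case by (intro cexact_lk_insert[OF \<Delta>]) auto
  qed (use L in auto)
  then show "\<forall>F. \<forall>i\<ge>r. cexact TYPE('k) (lk \<Delta> F (- F)) i" by auto
next
  assume R: "\<forall>F. \<forall>i\<ge>r. cexact TYPE('k) (lk \<Delta> F (- F)) i"
  have "cexact TYPE('k) (lk \<Delta> F \<tau>) i" if "F \<inter> \<tau> = {}" "i \<ge> r" for F \<tau> i
    using that
  proof (induction "card (- F - \<tau>)" arbitrary: F \<tau> rule: less_induct)
    case less
    show ?case
    proof (cases "- F - \<tau> = {}")
      case True
      with less.prems(1) have "\<tau> = - F" by auto
      with R less.prems(2) show ?thesis by simp
    next
      case False
      then obtain v where v: "v \<notin> F" "v \<notin> \<tau>" by auto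
      have c: "card (- F - insert v \<tau>) < card (- F - \<tau>)"
        using v by (intro psubset_card_mono) auto
      have c': "card (- insert v F - \<tau>) < card (- F - \<tau>)"
        using v by (intro psubset_card_mono) auto
      have "cexact TYPE('k) (lk \<Delta> F (insert v \<tau>)) i"
        using c less.prems v by (intro less.hyps) auto
      moreover have "cexact TYPE('k) (lk \<Delta> (insert v F) \<tau>) i"
        using c' less.prems v by (intro less.hyps) auto
      ultimately show ?thesis by (rule cexact_lk_delete[OF \<Delta> v(2)])
    qed
  qed
  then show "\<forall>\<tau>. \<forall>i\<ge>r. cexact TYPE('k) (lk \<Delta> {} \<tau>) i" by auto
qed

section \<open>Alexander duality\<close>

text \<open>The sign in the pairing of \<rho> with its complement in \<tau>: each element of \<rho>
  contributes its position in \<tau>. That position counts the elements before it in \<rho> and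
  those before it outside, which are the signs of the two boundaries in
  \<open>bd_adjoint\<close>.\<close>

definition dual_sgn :: "'n::{finite, linorder} set \<Rightarrow> 'n set \<Rightarrow> 'k::field" where
  "dual_sgn \<tau> \<rho> = (\<Prod>k\<in>\<rho>. (- 1) ^ card {l\<in>\<tau>. l < k})"

lemma dual_sgn_square [simp]: "dual_sgn \<tau> \<rho> * dual_sgn \<tau> \<rho> = 1"
  unfolding dual_sgn_def prod.distrib[symmetric] by (simp add: power_add[symmetric])

lemma ksgn_eq_power: "ksgn k \<sigma> a = (- 1) ^ card {l\<in>\<sigma>. l < k} * (a :: 'k::field)"
  by (simp add: ksgn_def)

text \<open>Both sides are sums over a set and one of its elements: adding k to \<rho> on the left
  is adding k to the complement of \<sigma> = insert k \<rho> on the right.\<close>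

lemma bd_adjoint:
  fixes c e :: "'n::{finite, linorder} set \<Rightarrow> 'k::field"
  assumes e: "\<And>\<sigma>. \<not> \<sigma> \<subseteq> \<tau> \<Longrightarrow> e \<sigma> = 0"  and c: "\<And>\<sigma>. \<not> \<sigma> \<subseteq> \<tau> \<Longrightarrow> c \<sigma> = 0"
  shows "(\<Sum>\<rho>\<in>Pow \<tau>. dual_sgn \<tau> \<rho> * bd c \<rho> * e (\<tau> - \<rho>)) =
    (\<Sum>\<sigma>\<in>Pow \<tau>. dual_sgn \<tau> \<sigma> * c \<sigma> * bd e (\<tau> - \<sigma>))"
proof -
  let ?A = "SIGMA \<rho>:Pow \<tau>. \<tau> - \<rho>" and ?B = "SIGMA \<sigma>:Pow \<tau>. \<sigma>"
  have "(\<Sum>\<rho>\<in>Pow \<tau>. dual_sgn \<tau> \<rho> * bd c \<rho> * e (\<tau> - \<rho>)) =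
      (\<Sum>\<rho>\<in>Pow \<tau>. \<Sum>k\<in>\<tau> - \<rho>. dual_sgn \<tau> \<rho> * ksgn k \<rho> (c (insert k \<rho>)) * e (\<tau> - \<rho>))"
  proof (intro sum.cong refl)
    fix \<rho>
    have "bd c \<rho> = (\<Sum>k\<in>\<tau> - \<rho>. ksgn k \<rho> (c (insert k \<rho>)))"
    proof -
      have "c (insert k \<rho>) = 0" if "k \<notin> \<tau>" for k using c that by blast
      then show ?thesis unfolding kd_def by (intro sum.mono_neutral_right) auto
    qed
    then show "dual_sgn \<tau> \<rho> * bd c \<rho> * e (\<tau> - \<rho>) =
        (\<Sum>k\<in>\<tau> - \<rho>. dual_sgn \<tau> \<rho> * ksgn k \<rho> (c (insert k \<rho>)) * e (\<tau> - \<rho>))"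
      by (simp add: sum_distrib_left sum_distrib_right)
  qed
  also have "\<dots> = (\<Sum>(\<rho>, k)\<in>?A. dual_sgn \<tau> \<rho> * ksgn k \<rho> (c (insert k \<rho>)) * e (\<tau> - \<rho>))"
    by (rule sum.Sigma) auto
  also have "\<dots> = (\<Sum>(\<sigma>, k)\<in>?B. dual_sgn \<tau> \<sigma> * c \<sigma> * ksgn k (\<tau> - \<sigma>) (e (insert k (\<tau> - \<sigma>))))"
  proof (rule sum.reindex_bij_witness[of _ "\<lambda>(\<sigma>, k). (\<sigma> - {k}, k)" "\<lambda>(\<rho>, k). (insert k \<rho>, k)"])
    fix p assume "p \<in> ?A"
    then obtain \<rho> k where p: "p = (\<rho>, k)" "\<rho> \<subseteq> \<tau>" "k \<in> \<tau>" "k \<notin> \<rho>" by auto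
    have ins: "insert k (\<tau> - insert k \<rho>) = \<tau> - \<rho>" using p by auto
    have ds: "dual_sgn \<tau> (insert k \<rho>) = (- 1) ^ card {l\<in>\<tau>. l < k} * (dual_sgn \<tau> \<rho> :: 'k)"
      using p(4) by (simp add: dual_sgn_def)
    have "{l\<in>\<tau>. l < k} = {l\<in>\<rho>. l < k} \<union> {l\<in>\<tau> - insert k \<rho>. l < k}" using p by auto
    then have "card {l\<in>\<tau>. l < k} = card ({l\<in>\<rho>. l < k} \<union> {l\<in>\<tau> - insert k \<rho>. l < k})"
      by (rule arg_cong)
    also have "\<dots> = card {l\<in>\<rho>. l < k} + card {l\<in>\<tau> - insert k \<rho>. l < k}"
      by (rule card_Un_disjoint) auto
    finally have ce: "card {l\<in>\<tau>. l < k} = card {l\<in>\<rho>. l < k} + card {l\<in>\<tau> - insert k \<rho>. l < k}" .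
    have "(- 1 :: 'k) ^ card {l\<in>\<rho>. l < k} =
        (- 1) ^ card {l\<in>\<tau>. l < k} * (- 1) ^ card {l\<in>\<tau> - insert k \<rho>. l < k}"
      unfolding ce power_add mult.assoc minus_one_mult_self by simp
    then show "(case case p of (\<rho>, k) \<Rightarrow> (insert k \<rho>, k) of
        (\<sigma>, k) \<Rightarrow> dual_sgn \<tau> \<sigma> * c \<sigma> * ksgn k (\<tau> - \<sigma>) (e (insert k (\<tau> - \<sigma>)))) =
        (case p of (\<rho>, k) \<Rightarrow> dual_sgn \<tau> \<rho> * ksgn k \<rho> (c (insert k \<rho>)) * e (\<tau> - \<rho>))"
      by (simp add: p(1) ins ds ksgn_eq_power mult_ac)
  qed auto
  also have "\<dots> = (\<Sum>\<sigma>\<in>Pow \<tau>. \<Sum>k\<in>\<sigma>. dual_sgn \<tau> \<sigma> * c \<sigma> * ksgn k (\<tau> - \<sigma>) (e (insert k (\<tau> - \<sigma>))))"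
    by (rule sum.Sigma[symmetric]) auto
  also have "\<dots> = (\<Sum>\<sigma>\<in>Pow \<tau>. dual_sgn \<tau> \<sigma> * c \<sigma> * bd e (\<tau> - \<sigma>))"
  proof (intro sum.cong refl)
    fix \<sigma> assume "\<sigma> \<in> Pow \<tau>"
    then have "bd e (\<tau> - \<sigma>) = (\<Sum>k\<in>\<sigma>. ksgn k (\<tau> - \<sigma>) (e (insert k (\<tau> - \<sigma>))))"
    proof -
      assume \<sigma>: "\<sigma> \<in> Pow \<tau>"
      have "e (insert k (\<tau> - \<sigma>)) = 0" if "k \<notin> \<tau>" for k using e that by blast
      then show ?thesis unfolding kd_def using \<sigma> by (intro sum.mono_neutral_right) auto
    qed
    then show "(\<Sum>k\<in>\<sigma>. dual_sgn \<tau> \<sigma> * c \<sigma> * ksgn k (\<tau> - \<sigma>) (e (insert k (\<tau> - \<sigma>)))) =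
        dual_sgn \<tau> \<sigma> * c \<sigma> * bd e (\<tau> - \<sigma>)"
      by (simp add: sum_distrib_left)
  qed
  finally show ?thesis .
qed

lemma sum_fun_apply: "(\<Sum>x\<in>A. f x) y = (\<Sum>x\<in>A. f x y)"
  by (induction A rule: infinite_finite_induct) auto

text \<open>Dualizing over a field is exact: a functional that vanishes on the kernel of f factors
  through f. A right inverse of f on its image, extended linearly, turns the factor into a
  functional on the whole space, hence into a vector \<psi>.\<close>

lemma functional_factors:
  fixes f :: "('x::finite \<Rightarrow> 'k::field) \<Rightarrow> ('x \<Rightarrow> 'k)" and g :: "('x \<Rightarrow> 'k) \<Rightarrow> 'k"
  assumes f: "\<And>a b. f (\<lambda>x. a x + b x) = (\<lambda>x. f a x + f b x)" "\<And>r a. f (\<lambda>x. r * a x) = (\<lambda>x. r * f a x)"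
    and g: "\<And>a b. g (\<lambda>x. a x + b x) = g a + g b" "\<And>r a. g (\<lambda>x. r * a x) = r * g a"
    and ker: "\<And>a. f a = (\<lambda>_. 0) \<Longrightarrow> g a = 0"
  obtains \<psi> where "\<And>a. g a = (\<Sum>x\<in>UNIV. \<psi> x * f a x)"
proof -
  interpret V: vector_space "\<lambda>r (a :: 'x \<Rightarrow> 'k) x. r * a x"
    by unfold_locales (auto simp: algebra_simps)
  interpret K: vector_space "(*) :: 'k \<Rightarrow> 'k \<Rightarrow> 'k"
    by unfold_locales (auto simp: algebra_simps)
  interpret VV: vector_space_pair "\<lambda>r (a :: 'x \<Rightarrow> 'k) x. r * a x" "\<lambda>r (a :: 'x \<Rightarrow> 'k) x. r * a x" ..
  interpret VK: vector_space_pair "\<lambda>r (a :: 'x \<Rightarrow> 'k) x. r * a x" "(*) :: 'k \<Rightarrow> 'k \<Rightarrow> 'k" ..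
  have lf: "Vector_Spaces.linear (\<lambda>r a x. r * a x) (\<lambda>r a x. r * a x) f"
    using f by unfold_locales (auto simp: plus_fun_def)
  have lg: "Vector_Spaces.linear (\<lambda>r a x. r * a x) (*) g"
    using g by unfold_locales (auto simp: plus_fun_def)
  obtain r where r: "Vector_Spaces.linear (\<lambda>r a x. r * a x) (\<lambda>r a x. r * a x) r"
    "\<And>v. v \<in> f ` UNIV \<Longrightarrow> f (r v) = v"
    using VV.linear_exists_right_inverse_on[OF lf V.subspace_UNIV] by blast
  have gr: "g a = g (r (f a))" for a
  proof -
    have "f (\<lambda>x. a x + (- 1) * r (f a) x) = (\<lambda>_. 0)"
      unfolding f(1) f(2) using r(2)[of "f a"] by auto
    from ker[OF this] show ?thesis unfolding g(1) g(2) by simp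
  qed
  have lgr: "Vector_Spaces.linear (\<lambda>r a x. r * a x) (*) (g \<circ> r)"
    using r(1) lg by (rule Vector_Spaces.linear_compose)
  interpret L: Vector_Spaces.linear "\<lambda>r (a :: 'x \<Rightarrow> 'k) x. r * a x" "(*)" "g \<circ> r" by (rule lgr)
  define \<delta> where "\<delta> = (\<lambda>x y :: 'x. if x = y then 1 else (0 :: 'k))"
  have *: "(g \<circ> r) a = (\<Sum>x\<in>UNIV. (g \<circ> r) (\<delta> x) * a x)" for a
  proof -
    have "a = (\<Sum>x\<in>UNIV. (\<lambda>y. a x * \<delta> x y))"
    proof
      fix y
      have "a x * \<delta> x y = (if x = y then a x else 0)" for x by (simp add: \<delta>_def)
      then show "a y = (\<Sum>x\<in>UNIV. (\<lambda>y. a x * \<delta> x y)) y" unfolding sum_fun_apply by simp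
    qed
    then have "(g \<circ> r) a = (g \<circ> r) (\<Sum>x\<in>UNIV. (\<lambda>y. a x * \<delta> x y))" by (rule arg_cong)
    also have "\<dots> = (\<Sum>x\<in>UNIV. a x * (g \<circ> r) (\<delta> x))"
      unfolding L.sum L.scale ..
    finally show ?thesis by (simp add: mult.commute)
  qed
  show ?thesis
  proof (rule that)
    fix a
    have "g a = (g \<circ> r) (f a)" using gr[of a] by simp
    also note *
    finally show "g a = (\<Sum>x\<in>UNIV. (g \<circ> r) (\<delta> x) * f a x)" .
  qed
qed

text \<open>A cycle c of \<Y> is a functional on chains of \<X> that vanishes on cycles, since these
  are boundaries and the two boundaries are adjoint. So it factors through the boundary of \<X>, and
  the factor, read as a chain of \<Y>, fills c.\<close>

theorem cexact_dual:
  fixes \<X> \<Y> :: "'n::{finite, linorder} set set"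
  assumes sub: "\<X> \<subseteq> Pow \<tau>" "\<Y> \<subseteq> Pow \<tau>"
    and dual: "\<And>\<sigma>. \<sigma> \<subseteq> \<tau> \<Longrightarrow> \<sigma> \<in> \<X> \<longleftrightarrow> \<tau> - \<sigma> \<in> \<Y>"
    and n: "i + i' = card \<tau>" and ex: "cexact TYPE('k::field) \<X> i"
  shows "cexact TYPE('k) \<Y> i'"
  unfolding cexact_def
proof (intro allI impI)
  fix c :: "'n set \<Rightarrow> 'k" assume c: "c \<in> cchain \<Y> i'" "cbd \<Y> c = (\<lambda>_. 0)"
  \<comment> \<open>A linear projection of all functions onto the chains of index i, so that
    \<open>functional_factors\<close> applies to the full function space.\<close>
  define pr where "pr = (\<lambda>(e :: 'n set \<Rightarrow> 'k) \<sigma>. if \<sigma> \<in> \<X> \<and> card \<sigma> = i then e \<sigma> else 0)"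
  have pr: "pr e \<in> cchain \<X> i" for e by (simp add: pr_def cchain_iff)
  define pair where "pair = (\<lambda>c (e :: 'n set \<Rightarrow> 'k). \<Sum>\<rho>\<in>Pow \<tau>. dual_sgn \<tau> \<rho> * c \<rho> * e (\<tau> - \<rho>))"
  have sup: "u \<sigma> = 0" if "u \<in> cchain \<X> m \<or> u \<in> cchain \<Y> m" "\<not> \<sigma> \<subseteq> \<tau>" for u :: "'n set \<Rightarrow> 'k" and m \<sigma>
    using that sub cchain_off[of u _ m \<sigma>] by blast
  have dual': "\<tau> - \<sigma> \<in> \<X> \<longleftrightarrow> \<sigma> \<in> \<Y>" if "\<sigma> \<subseteq> \<tau>" for \<sigma>
    using dual[of "\<tau> - \<sigma>"] that by (simp add: double_diff)
  have adj: "pair (cbd \<Y> u) e = pair u (cbd \<X> e)" if "u \<in> cchain \<Y> m" "e \<in> cchain \<X> m'" for u e m m'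
  proof -
    have "pair (cbd \<Y> u) e = pair (bd u) e"
      unfolding pair_def
    proof (intro sum.cong refl)
      fix \<rho> assume "\<rho> \<in> Pow \<tau>"
      then show "dual_sgn \<tau> \<rho> * cbd \<Y> u \<rho> * e (\<tau> - \<rho>) = dual_sgn \<tau> \<rho> * bd u \<rho> * e (\<tau> - \<rho>)"
        using cchainD[OF that(2), of "\<tau> - \<rho>"] dual'[of \<rho>] by (auto simp: cbd_def)
    qed
    also have "\<dots> = pair u (bd e)"
      unfolding pair_def using sup that by (intro bd_adjoint) auto
    also have "\<dots> = pair u (cbd \<X> e)"
      unfolding pair_def
    proof (intro sum.cong refl)
      fix \<rho> assume "\<rho> \<in> Pow \<tau>"
      then show "dual_sgn \<tau> \<rho> * u \<rho> * bd e (\<tau> - \<rho>) = dual_sgn \<tau> \<rho> * u \<rho> * cbd \<X> e (\<tau> - \<rho>)"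
        using cchainD[OF that(1), of \<rho>] dual'[of \<rho>] by (auto simp: cbd_def)
    qed
    finally show ?thesis .
  qed
  have bd_lin: "bd (\<lambda>x. r * a x) = (\<lambda>x. r * bd a x)" for r and a :: "'n set \<Rightarrow> 'k"
    by (simp add: kd_def ksgn_eq_power sum_distrib_left mult_ac)
  have cbd_add: "cbd \<X> (\<lambda>x. a x + b x) = (\<lambda>x. cbd \<X> a x + cbd \<X> b x)"
    and cbd_mul: "cbd \<X> (\<lambda>x. r * a x) = (\<lambda>x. r * cbd \<X> a x)" for r and a b :: "'n set \<Rightarrow> 'k"
    by (auto simp: cbd_def cb.kd_add bd_lin)
  have pr_add: "pr (\<lambda>x. a x + b x) = (\<lambda>x. pr a x + pr b x)"
    and pr_mul: "pr (\<lambda>x. r * a x) = (\<lambda>x. r * pr a x)" for r a b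
    by (auto simp: pr_def)
  have pair_add: "pair c (\<lambda>x. a x + b x) = pair c a + pair c b"
    and pair_mul: "pair c (\<lambda>x. r * a x) = r * pair c a" for r a b
    by (simp_all add: pair_def algebra_simps sum.distrib sum_distrib_left)
  have ker: "pair c (pr e) = 0" if z: "cbd \<X> (pr e) = (\<lambda>_. 0)" for e
  proof -
    obtain e' where "e' \<in> cchain \<X> (Suc i)" "cbd \<X> e' = pr e"
      using ex[unfolded cexact_def, rule_format, OF pr z] by (elim bexE)
    then have "pair c (pr e) = pair (cbd \<Y> c) e'" using adj[OF c(1), of e' "Suc i"] by simp
    then show ?thesis unfolding c(2) by (simp add: pair_def)
  qed
  obtain \<psi> where \<psi>: "\<And>e. pair c (pr e) = (\<Sum>x\<in>UNIV. \<psi> x * cbd \<X> (pr e) x)"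
  proof (rule functional_factors[of "\<lambda>e. cbd \<X> (pr e)" "\<lambda>e. pair c (pr e)"])
    fix a b :: "'n set \<Rightarrow> 'k" and r
    show "cbd \<X> (pr (\<lambda>x. a x + b x)) = (\<lambda>x. cbd \<X> (pr a) x + cbd \<X> (pr b) x)"
      unfolding pr_add by (rule cbd_add)
    show "cbd \<X> (pr (\<lambda>x. r * a x)) = (\<lambda>x. r * cbd \<X> (pr a) x)"
      unfolding pr_mul by (rule cbd_mul)
    show "pair c (pr (\<lambda>x. a x + b x)) = pair c (pr a) + pair c (pr b)"
      unfolding pr_add by (rule pair_add)
    show "pair c (pr (\<lambda>x. r * a x)) = r * pair c (pr a)"
      unfolding pr_mul by (rule pair_mul)
  qed (use ker that in blast)+
  define c' where "c' = (\<lambda>\<rho>. if \<rho> \<in> \<Y> \<and> card \<rho> = Suc i' then dual_sgn \<tau> \<rho> * \<psi> (\<tau> - \<rho>) else 0)"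
  have c': "c' \<in> cchain \<Y> (Suc i')" by (auto simp: c'_def cchain_iff)
  have card_compl: "card (\<tau> - \<sigma>) + card \<sigma> = card \<tau>" if "\<sigma> \<subseteq> \<tau>" for \<sigma>
    using that by (metis card_Diff_subset card_mono finite le_add_diff_inverse2)
  have key: "pair c (pr e) = pair c' (cbd \<X> (pr e))" for e
  proof -
    have "pair c (pr e) = (\<Sum>x\<in>Pow \<tau>. \<psi> x * cbd \<X> (pr e) x)"
      unfolding \<psi> using sub by (intro sum.mono_neutral_right) (auto simp: cbd_def)
    also have "\<dots> = (\<Sum>\<rho>\<in>Pow \<tau>. \<psi> (\<tau> - \<rho>) * cbd \<X> (pr e) (\<tau> - \<rho>))"
      by (rule sum.reindex_bij_witness[of _ "\<lambda>\<rho>. \<tau> - \<rho>" "\<lambda>\<rho>. \<tau> - \<rho>"]) (auto simp: double_diff)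
    also have "\<dots> = pair c' (cbd \<X> (pr e))"
      unfolding pair_def
    proof (intro sum.cong refl)
      fix \<rho> assume \<rho>: "\<rho> \<in> Pow \<tau>"
      show "\<psi> (\<tau> - \<rho>) * cbd \<X> (pr e) (\<tau> - \<rho>) = dual_sgn \<tau> \<rho> * c' \<rho> * cbd \<X> (pr e) (\<tau> - \<rho>)"
      proof (cases "cbd \<X> (pr e) (\<tau> - \<rho>) = 0")
        case False
        then have nz: "\<tau> - \<rho> \<in> \<X>" "bd (pr e) (\<tau> - \<rho>) \<noteq> 0" by (auto simp: cbd_def split: if_splits)
        from bd_nonzero[OF pr nz(2)] have "Suc (card (\<tau> - \<rho>)) = i"
          by (metis card_insert_disjoint finite)
        with card_compl[of \<rho>] \<rho> n have "card \<rho> = Suc i'" by simp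
        moreover have "\<rho> \<in> \<Y>" using nz(1) dual' \<rho> by simp
        ultimately have "dual_sgn \<tau> \<rho> * c' \<rho> = (dual_sgn \<tau> \<rho> * dual_sgn \<tau> \<rho>) * \<psi> (\<tau> - \<rho>)"
          by (simp add: c'_def)
        then show ?thesis by simp
      qed simp
    qed
    finally show ?thesis .
  qed
  have "c \<sigma> = cbd \<Y> c' \<sigma>" for \<sigma>
  proof (cases "\<sigma> \<in> \<Y> \<and> card \<sigma> = i'")
    case False
    then show ?thesis
      using cchainD[OF c(1), of \<sigma>] cchainD[OF cbd_mem[OF c'], of \<sigma>] by metis
  next
    case True
    with sub have \<sigma>: "\<sigma> \<subseteq> \<tau>" by auto
    \<comment> \<open>Pairing with the indicator of the complement of \<sigma> reads off the
      coefficient at \<sigma>, up to sign.\<close>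
    define e where "e = (\<lambda>\<rho>. if \<rho> = \<tau> - \<sigma> then 1 else (0 :: 'k))"
    have "\<tau> - \<sigma> \<in> \<X>" "card (\<tau> - \<sigma>) = i"
      using True \<sigma> dual' n card_compl[of \<sigma>] by auto
    then have [simp]: "pr e = e" by (auto simp: pr_def e_def)
    have pe: "pair u e = dual_sgn \<tau> \<sigma> * u \<sigma>" for u
    proof -
      have "\<tau> - \<rho> = \<tau> - \<sigma> \<longleftrightarrow> \<rho> = \<sigma>" if "\<rho> \<in> Pow \<tau>" for \<rho> using that \<sigma> by auto
      then have "pair u e = (\<Sum>\<rho>\<in>Pow \<tau>. if \<rho> = \<sigma> then dual_sgn \<tau> \<rho> * u \<rho> else 0)"
        unfolding pair_def by (intro sum.cong refl) (simp add: e_def)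
      then show ?thesis using \<sigma> by simp
    qed
    have "pair c e = pair (cbd \<Y> c') e"
      using key[of e] adj[OF c' pr[of e]] by simp
    then have "dual_sgn \<tau> \<sigma> * (dual_sgn \<tau> \<sigma> * c \<sigma>) = dual_sgn \<tau> \<sigma> * (dual_sgn \<tau> \<sigma> * cbd \<Y> c' \<sigma>)"
      by (simp add: pe)
    then show ?thesis unfolding mult.assoc[symmetric] by simp
  qed
  then show "\<exists>e\<in>cchain \<Y> (Suc i'). cbd \<Y> e = c" using c' by (intro bexI[of _ c']) auto
qed

text \<open>The full simplex is exact, so the relative homology of the simplex modulo \<X> at
  \<open>Suc i\<close> is the homology of \<X> at i.\<close>

lemma cexact_complement:
  fixes \<X> :: "'n::{finite, linorder} set set"
  assumes \<X>: "downset \<X>" "\<X> \<subseteq> Pow \<tau>" and \<tau>: "\<tau> \<noteq> {}"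
  shows "cexact TYPE('k::field) \<X> i \<longleftrightarrow> cexact TYPE('k) (Pow \<tau> - \<X>) (Suc i)"
proof -
  let ?Q = "Pow \<tau> - \<X>"
  have dP: "downset (Pow \<tau>)" by (auto simp: downset_def)
  have full: "\<exists>e\<in>cchain (Pow \<tau>) (Suc m). bd e = c" if "c \<in> cchain (Pow \<tau>) m" "bd c = (\<lambda>_. 0)" for c :: "'n set \<Rightarrow> 'k" and m
    using cexact_Pow[OF \<tau>, of m] that unfolding cexact_downset_iff[OF dP] by blast
  define rs where "rs = (\<lambda>\<Y> (y :: 'n set \<Rightarrow> 'k) \<sigma>. if \<sigma> \<in> \<Y> then y \<sigma> else 0)"
  have rs: "rs \<Y> y \<in> cchain \<Y> m" if "y \<in> cchain (Pow \<tau>) m" for \<Y> y m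
    using cchainD[OF that] by (intro cchainI) (auto simp: rs_def split: if_splits)
  have rs_split: "y \<sigma> = rs ?Q y \<sigma> + rs \<X> y \<sigma>" if "y \<in> cchain (Pow \<tau>) m" for y m \<sigma>
    using cchain_off[OF that, of \<sigma>] by (auto simp: rs_def)
  have bd_split: "bd (rs ?Q y) \<sigma> = bd y \<sigma> - bd (rs \<X> y) \<sigma>" if "y \<in> cchain (Pow \<tau>) m" for y m \<sigma>
  proof -
    have "y = (\<lambda>\<sigma>. rs ?Q y \<sigma> + rs \<X> y \<sigma>)" by (rule ext) (rule rs_split[OF that])
    from trans[OF arg_cong[OF this, of bd] cb.kd_add]
    show ?thesis by (simp add: eq_diff_eq fun_eq_iff)
  qed
  have up: "c \<in> cchain (Pow \<tau>) m" if "c \<in> cchain \<X> m \<or> c \<in> cchain ?Q m" for c :: "'n set \<Rightarrow> 'k" and m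
    using that \<X>(2) by (auto intro: cchain_mono)
  have zQ: "bd c \<sigma> = 0" if "c \<in> cchain \<X> (Suc m)" "\<sigma> \<notin> \<X>" for c :: "'n set \<Rightarrow> 'k" and m \<sigma>
    using bd_mem[OF \<X>(1) that(1)] that(2) by (rule cchain_off)
  show ?thesis
  proof
    assume L: "cexact TYPE('k) \<X> i"
    show "cexact TYPE('k) ?Q (Suc i)"
      unfolding cexact_def
    proof (intro allI impI)
      fix q :: "'n set \<Rightarrow> 'k" assume q: "q \<in> cchain ?Q (Suc i)" "cbd ?Q q = (\<lambda>_. 0)"
      have q': "q \<in> cchain (Pow \<tau>) (Suc i)" using up q(1) by blast
      have "bd q \<in> cchain \<X> i"
      proof (rule cchainI)
        fix \<sigma> assume nz: "bd q \<sigma> \<noteq> 0"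
        from cchainD[OF bd_mem[OF dP q'] nz] have "\<sigma> \<subseteq> \<tau>" "card \<sigma> = i" by simp_all
        with nz fun_cong[OF q(2), of \<sigma>] show "\<sigma> \<in> \<X> \<and> card \<sigma> = i"
          by (simp add: cbd_def split: if_splits)
      qed
      then obtain x where x: "x \<in> cchain \<X> (Suc i)" "bd x = bd q"
        using L cb.kd_kd unfolding cexact_downset_iff[OF \<X>(1)] by blast
      obtain y where y: "y \<in> cchain (Pow \<tau>) (Suc (Suc i))" "bd y = (\<lambda>\<sigma>. q \<sigma> - x \<sigma>)"
        using full[OF cchain_diff[OF q' up[OF disjI1[OF x(1)]]]] by (auto simp: cb.kd_diff x(2))
      have "cbd ?Q (rs ?Q y) \<sigma> = q \<sigma>" for \<sigma>
      proof (cases "\<sigma> \<in> ?Q")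
        case True
        have "bd (rs ?Q y) \<sigma> = bd y \<sigma> - bd (rs \<X> y) \<sigma>"
          by (rule bd_split[OF y(1)])
        also have "\<dots> = q \<sigma>"
          using True zQ[OF rs[OF y(1)], of \<sigma>] cchain_off[OF x(1), of \<sigma>] by (simp add: y(2))
        finally show ?thesis using True by (simp add: cbd_def)
      next
        case False
        then show ?thesis by (simp only: cbd_def if_not_P[OF False] if_False cchain_off[OF q(1) False])
      qed
      then show "\<exists>e\<in>cchain ?Q (Suc (Suc i)). cbd ?Q e = q"
        using rs[OF y(1)] by blast
    qed
  next
    assume L: "cexact TYPE('k) ?Q (Suc i)"
    show "cexact TYPE('k) \<X> i"
      unfolding cexact_downset_iff[OF \<X>(1)]
    proof (intro allI impI)
      fix x :: "'n set \<Rightarrow> 'k" assume x: "x \<in> cchain \<X> i" "bd x = (\<lambda>_. 0)"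
      obtain y where y: "y \<in> cchain (Pow \<tau>) (Suc i)" "bd y = x"
        using full[OF up[OF disjI1[OF x(1)]] x(2)] by blast
      have spl: "bd (rs ?Q y) \<sigma> = bd y \<sigma> - bd (rs \<X> y) \<sigma>" for \<sigma>
        by (rule bd_split[OF y(1)])
      have "cbd ?Q (rs ?Q y) \<sigma> = 0" for \<sigma>
        using spl[of \<sigma>] zQ[OF rs[OF y(1)], of \<sigma>] cchain_off[OF x(1), of \<sigma>] by (auto simp: cbd_def y(2))
      then obtain z where z: "z \<in> cchain ?Q (Suc (Suc i))" "cbd ?Q z = rs ?Q y"
        using L rs[OF y(1)] unfolding cexact_def by blast
      let ?y = "\<lambda>\<sigma>. y \<sigma> - bd z \<sigma>"
      have y': "?y \<in> cchain (Pow \<tau>) (Suc i)"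
        using y(1) bd_mem[OF dP up[OF disjI2[OF z(1)]]] by (rule cchain_diff)
      have "?y \<sigma> = 0" if "\<sigma> \<notin> \<X>" for \<sigma>
      proof (cases "\<sigma> \<in> ?Q")
        case True
        then show ?thesis using fun_cong[OF z(2), of \<sigma>] by (simp add: cbd_def rs_def)
      next
        case False
        then show ?thesis using cchain_off[OF y', of \<sigma>] that by auto
      qed
      then have "?y \<in> cchain \<X> (Suc i)" using cchainD[OF y'] by (intro cchainI) blast
      moreover have "bd ?y = x" by (simp add: cb.kd_diff cb.kd_kd y(2))
      ultimately show "\<exists>e\<in>cchain \<X> (Suc i). bd e = x" by blast
    qed
  qed
qed

text \<open>The sets whose complement in \<tau> is a nonface form the Alexander dual of the induced
  subcomplex on \<tau>. Duality turns index i into \<open>card \<tau> - Suc i\<close>, which is at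
  least r iff \<open>i + r < card \<tau>\<close>; then links replace induced subcomplexes.\<close>

theorem nonfaces_exact_iff_links_exact:
  fixes \<Delta> :: "'n::{finite, linorder} set set"
  assumes \<Delta>: "downset \<Delta>" and r: "r \<ge> 1"
  shows "(\<forall>\<tau> i. i + r < card \<tau> \<longrightarrow> cexact TYPE('k::field) {\<sigma>. \<sigma> \<subseteq> \<tau> \<and> \<tau> - \<sigma> \<notin> \<Delta>} i) \<longleftrightarrow>
    (\<forall>F. \<forall>i\<ge>r. cexact TYPE('k) (lk \<Delta> F (- F)) i)"
proof -
  have iff: "cexact TYPE('k) {\<sigma>. \<sigma> \<subseteq> \<tau> \<and> \<tau> - \<sigma> \<notin> \<Delta>} i \<longleftrightarrow> cexact TYPE('k) (lk \<Delta> {} \<tau>) (card \<tau> - Suc i)"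
    if "i < card \<tau>" for \<tau> i
  proof -
    let ?X = "{\<sigma>. \<sigma> \<subseteq> \<tau> \<and> \<tau> - \<sigma> \<notin> \<Delta>}"
    have "\<tau> \<noteq> {}" using that by auto
    moreover have "downset ?X"
      unfolding downset_def
    proof (intro ballI allI impI)
      fix \<sigma> \<rho> assume "\<sigma> \<in> ?X" "\<rho> \<subseteq> \<sigma>"
      moreover from this have "\<tau> - \<sigma> \<subseteq> \<tau> - \<rho>" by auto
      ultimately show "\<rho> \<in> ?X" using \<Delta>(1) unfolding downset_def by blast
    qed
    ultimately have "cexact TYPE('k) ?X i \<longleftrightarrow> cexact TYPE('k) (Pow \<tau> - ?X) (Suc i)"
      by (intro cexact_complement) auto
    also have "\<dots> \<longleftrightarrow> cexact TYPE('k) (lk \<Delta> {} \<tau>) (card \<tau> - Suc i)"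
    proof
      show "cexact TYPE('k) (lk \<Delta> {} \<tau>) (card \<tau> - Suc i)" if "cexact TYPE('k) (Pow \<tau> - ?X) (Suc i)"
        by (rule cexact_dual[OF _ _ _ _ that]) (use \<open>i < card \<tau>\<close> in \<open>auto simp: lk_def\<close>)
      show "cexact TYPE('k) (Pow \<tau> - ?X) (Suc i)" if "cexact TYPE('k) (lk \<Delta> {} \<tau>) (card \<tau> - Suc i)"
        by (rule cexact_dual[OF _ _ _ _ that]) (use \<open>i < card \<tau>\<close> in \<open>auto simp: lk_def double_diff\<close>)
    qed
    finally show ?thesis .
  qed
  have "(\<forall>\<tau> i. i + r < card \<tau> \<longrightarrow> cexact TYPE('k) {\<sigma>. \<sigma> \<subseteq> \<tau> \<and> \<tau> - \<sigma> \<notin> \<Delta>} i) \<longleftrightarrow>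
    (\<forall>\<tau>. \<forall>i\<ge>r. cexact TYPE('k) (lk \<Delta> {} \<tau>) i)" (is "?L \<longleftrightarrow> ?R")
  proof
    assume L: ?L
    show ?R
    proof (intro allI impI)
      fix \<tau> :: "'n set" and i assume i: "r \<le> i"
      show "cexact TYPE('k) (lk \<Delta> {} \<tau>) i"
      proof (cases "i < card \<tau>")
        case True
        with i L iff[of "card \<tau> - Suc i" \<tau>] show ?thesis by simp
      next
        case False
        \<comment> \<open>From index card \<tau> on, a chain can only sit on \<tau> itself. A
          nonempty face \<tau> makes the complex a simplex, and an empty \<tau> is excluded by r
          \<ge> 1.\<close>
        show ?thesis
        proof (cases "\<tau> \<in> \<Delta> \<and> \<tau> \<noteq> {}")
          case True
          then have "lk \<Delta> {} \<tau> = Pow \<tau>" using \<Delta>(1) by (auto simp: lk_def downset_def)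
          with True cexact_Pow show ?thesis by metis
        next
          case nf: False
          have "c \<sigma> = 0" if "c \<in> cchain (lk \<Delta> {} \<tau>) i" for \<sigma> and c :: "'n set \<Rightarrow> 'k"
          proof (rule ccontr)
            assume "c \<sigma> \<noteq> 0"
            with cchainD[OF that this] have \<sigma>: "\<sigma> \<subseteq> \<tau>" "\<sigma> \<in> \<Delta>" "card \<sigma> = i" by (auto simp: lk_def)
            with False have "\<sigma> = \<tau>" using card_mono[of \<tau> \<sigma>] by (intro card_subset_eq) auto
            with nf \<sigma> i r show False by auto
          qed
          then show ?thesis
            unfolding cexact_def using cchain_zero by (intro allI impI bexI[of _ "\<lambda>_. 0"]) (auto simp: cbd_def)
        qed
      qed
    qed
  qed (use iff in auto)
  with links_exact_iff_restrictions_exact[OF \<Delta>(1)] show ?thesis by blast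
qed

section \<open>Monomials\<close>

abbreviation "lookup \<equiv> Poly_Mapping.lookup"
abbreviation "keys \<equiv> Poly_Mapping.keys"
abbreviation "single \<equiv> Poly_Mapping.single"

lemma poly_expand: "p = (\<Sum>m\<in>keys p. single m (lookup p m))"
proof (rule poly_mapping_eqI)
  fix k
  have "lookup (\<Sum>m\<in>keys p. single m (lookup p m)) k = (\<Sum>m\<in>keys p. if m = k then lookup p m else 0)"
    by (simp add: lookup_sum lookup_single when_def)
  then show "lookup p k = lookup (\<Sum>m\<in>keys p. single m (lookup p m)) k"
    by (simp add: in_keys_iff)
qed

lemma poly_induct_single [case_names zero single add]:
  fixes p :: "'a \<Rightarrow>\<^sub>0 'b::comm_monoid_add"
  assumes "P 0" "\<And>m c. P (single m c)" "\<And>p q. P p \<Longrightarrow> P q \<Longrightarrow> P (p + q)"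
  shows "P p"
proof -
  have "P (\<Sum>m\<in>A. single m (lookup p m))" if "finite A" for A
    using that by (induction A rule: finite_induct) (auto intro: assms)
  then have "P (\<Sum>m\<in>keys p. single m (lookup p m))" by simp
  then show ?thesis by (simp only: poly_expand[symmetric])
qed

lemma Var_times_single: "Var k * single m c = single (m + single k 1) (c :: 'k::comm_ring_1)"
  by (simp add: Var_def mult_single add.commute)

lemma mon_diff_add: "lookup m k \<noteq> 0 \<Longrightarrow> m - single k 1 + single k 1 = (m :: 'n \<Rightarrow>\<^sub>0 nat)"
  by (rule poly_mapping_eqI) (auto simp: lookup_add lookup_minus lookup_single when_def)

lemma mon_add_diff: "m + single k 1 - single k 1 = (m :: 'n \<Rightarrow>\<^sub>0 nat)"
  by (rule poly_mapping_eqI) (simp add: lookup_add lookup_minus)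

lemma lookup_Var_times:
  "lookup (Var k * p) m = (if k \<in> keys m then lookup p (m - single k 1) else (0 :: 'k::comm_ring_1))"
proof (induction p rule: poly_induct_single)
  case (single m' c)
  have "m' + single k 1 = m \<longleftrightarrow> k \<in> keys m \<and> m' = m - single k 1"
    using mon_diff_add[of m k] mon_add_diff[of m' k] by (auto simp: in_keys_iff lookup_add)
  then show ?case unfolding Var_times_single by (auto simp: lookup_single when_def)
qed (auto simp: lookup_add algebra_simps)

lemma lookup_Const_times: "lookup (Const c * p) m = c * lookup p m"
proof (induction p rule: poly_induct_single)
  case (single m' d)
  then show ?case by (simp add: Const_def mult_single lookup_single when_def)
qed (auto simp: lookup_add algebra_simps)

definition ind :: "'n::finite set \<Rightarrow> 'n \<Rightarrow>\<^sub>0 nat" where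
  "ind \<sigma> = (\<Sum>k\<in>\<sigma>. single k 1)"

lemma lookup_ind: "lookup (ind \<sigma>) k = (if k \<in> \<sigma> then 1 else 0)"
  by (simp add: ind_def lookup_sum lookup_single when_def)

lemma keys_ind [simp]: "keys (ind \<sigma>) = \<sigma>"
  by (auto simp: in_keys_iff lookup_ind split: if_splits)

lemma mon_degree_UNIV: "mon_degree (m :: 'n::finite \<Rightarrow>\<^sub>0 nat) = (\<Sum>i\<in>UNIV. lookup m i)"
  unfolding mon_degree_def by (rule sum.mono_neutral_left) (auto simp: in_keys_iff)

lemma mon_degree_add: "mon_degree (a + b :: 'n::finite \<Rightarrow>\<^sub>0 nat) = mon_degree a + mon_degree b"
  by (simp add: mon_degree_UNIV lookup_add sum.distrib)

lemma mon_degree_ind: "mon_degree (ind \<sigma>) = card \<sigma>"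
  by (simp add: mon_degree_UNIV lookup_ind flip: sum.inter_restrict[of UNIV "\<lambda>_. 1" \<sigma>, simplified])

lemma mon_degree_single: "mon_degree (single k c :: 'n::finite \<Rightarrow>\<^sub>0 nat) = c"
  by (simp add: mon_degree_UNIV lookup_single when_def)

lemma ind_diff_add: "\<sigma> \<subseteq> keys b \<Longrightarrow> b - ind \<sigma> + ind \<sigma> = b"
  by (rule poly_mapping_eqI) (auto simp: lookup_add lookup_minus lookup_ind in_keys_iff subset_iff Suc_leI)

lemma ind_add_diff: "m + ind \<sigma> - ind \<sigma> = m"
  by (rule poly_mapping_eqI) (simp add: lookup_add lookup_minus)

lemma keys_add_mon: "keys (a + b :: 'n \<Rightarrow>\<^sub>0 nat) = keys a \<union> keys b"
  by (auto simp: in_keys_iff lookup_add)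

lemma ind_diff_insert: "k \<notin> \<rho> \<Longrightarrow> b - ind \<rho> - single k 1 = b - ind (insert k \<rho>)"
  by (rule poly_mapping_eqI) (auto simp: lookup_minus lookup_ind lookup_single when_def)

lemma keys_diff_mon: "keys (b - a :: 'n \<Rightarrow>\<^sub>0 nat) \<subseteq> keys b"
  by (auto simp: in_keys_iff lookup_minus)

section \<open>Koszul homology of spans of monomials\<close>

text \<open>
  For an upset \<open>\<U>\<close> of sets, \<open>mons (\<U> \<inter> \<D>)\<close> with the operators \<open>ymul \<D>\<close> is a squarefree monomial
  ideal if \<open>\<D> = UNIV\<close>, and the quotient of one by its multiples of \<open>x\<^sub>1 \<cdots> x\<^sub>\<ell>\<close> if \<open>\<D>\<close> consists of
  the proper subsets.
\<close>

definition mons :: "'n::finite set set \<Rightarrow> bool \<Rightarrow> int \<Rightarrow> ('n, 'k::comm_ring_1) mpoly set" where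
  "mons \<S> g j = {p. \<forall>m\<in>keys p. keys m \<in> \<S> \<and> (g \<longrightarrow> int (mon_degree m) = j)}"

definition trunc :: "'n set set \<Rightarrow> ('n, 'k::comm_ring_1) mpoly \<Rightarrow> ('n, 'k) mpoly" where
  "trunc \<D> p = (\<Sum>m | m \<in> keys p \<and> keys m \<in> \<D>. single m (lookup p m))"

text \<open>Multiplication in the quotient by the monomials with support outside \<D>, carried out
  on the span of the remaining monomials.\<close>

definition ymul :: "'n set set \<Rightarrow> 'n \<Rightarrow> ('n, 'k::comm_ring_1) mpoly \<Rightarrow> ('n, 'k) mpoly" where
  "ymul \<D> k p = trunc \<D> (Var k * p)"

definition upset :: "'n set set \<Rightarrow> bool" where
  "upset \<U> \<longleftrightarrow> (\<forall>A\<in>\<U>. \<forall>B. A \<subseteq> B \<longrightarrow> B \<in> \<U>)"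

lemma lookup_trunc: "lookup (trunc \<D> p) m = (if keys m \<in> \<D> then lookup p m else 0)"
proof -
  have "lookup (trunc \<D> p) m = (\<Sum>m' | m' \<in> keys p \<and> keys m' \<in> \<D>. if m' = m then lookup p m' else 0)"
    by (simp add: trunc_def lookup_sum lookup_single when_def)
  then show ?thesis by (simp add: in_keys_iff)
qed

lemma lookup_ymul:
  "lookup (ymul \<D> k p) m = (if keys m \<in> \<D> \<and> k \<in> keys m then lookup p (m - single k 1) else 0)"
  by (simp add: ymul_def lookup_trunc lookup_Var_times)

lemma ymul_UNIV: "ymul UNIV k p = Var k * p"
  by (rule poly_mapping_eqI) (simp add: ymul_def lookup_trunc)

lemma trunc_add: "trunc \<D> (p + q) = trunc \<D> p + trunc \<D> q"
  by (rule poly_mapping_eqI) (simp add: lookup_trunc lookup_add)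

lemma mons_memD: "p \<in> mons \<S> g j \<Longrightarrow> lookup p m \<noteq> 0 \<Longrightarrow> keys m \<in> \<S> \<and> (g \<longrightarrow> int (mon_degree m) = j)"
  unfolding mons_def by (simp add: in_keys_iff)

lemma mons_memI: "(\<And>m. lookup p m \<noteq> 0 \<Longrightarrow> keys m \<in> \<S> \<and> (g \<longrightarrow> int (mon_degree m) = j)) \<Longrightarrow> p \<in> mons \<S> g j"
  unfolding mons_def by (simp add: in_keys_iff)

lemma mons_UNIV_homog: "mons UNIV True j = homog j"
  by (simp add: mons_def homog_def)

lemma mons_UNIV_False: "mons UNIV False j = UNIV"
  by (simp add: mons_def)

text \<open>A monomial with support in \<D> has all its divisors there, so truncating after each
  factor amounts to truncating the product once.\<close>

lemma koszul_ops_ymul: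
  assumes "downset \<D>"
  shows "koszul_ops (ymul \<D> :: 'n::{finite, linorder} \<Rightarrow> ('n, 'k::comm_ring_1) mpoly \<Rightarrow> _)"
proof unfold_locales
  fix k l :: 'n and a b :: "('n, 'k) mpoly"
  show "ymul \<D> k (a + b) = ymul \<D> k a + ymul \<D> k b"
    by (simp add: ymul_def distrib_left trunc_add)
  have "keys (m - single k 1) \<in> \<D>" if "keys m \<in> \<D>" for m :: "'n \<Rightarrow>\<^sub>0 nat" and k
    using assms that keys_diff_mon unfolding downset_def by blast
  then have "ymul \<D> k (ymul \<D> l a) = trunc \<D> (Var k * (Var l * a))" for k l
    by (intro poly_mapping_eqI) (simp add: lookup_ymul lookup_trunc lookup_Var_times)
  then show "ymul \<D> k (ymul \<D> l a) = ymul \<D> l (ymul \<D> k a)"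
    by (simp add: mult.left_commute)
qed

lemma koszul_fam_mons:
  assumes "downset \<D>" "upset \<U>"
  shows "koszul_fam (ymul \<D>) (mons (\<U> \<inter> \<D>) g :: int \<Rightarrow> ('n::{finite, linorder}, 'k::comm_ring_1) mpoly set)"
proof -
  interpret koszul_ops "ymul \<D> :: 'n \<Rightarrow> ('n, 'k) mpoly \<Rightarrow> _" by (rule koszul_ops_ymul[OF assms(1)])
  show ?thesis
  proof unfold_locales
    fix a b :: "('n, 'k) mpoly" and j k
    show "0 \<in> mons (\<U> \<inter> \<D>) g j" by (simp add: mons_def)
    show "a + b \<in> mons (\<U> \<inter> \<D>) g j" if "a \<in> mons (\<U> \<inter> \<D>) g j" "b \<in> mons (\<U> \<inter> \<D>) g j"
      using that keys_add[of a b] unfolding mons_def by blast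
    show "- a \<in> mons (\<U> \<inter> \<D>) g j" if "a \<in> mons (\<U> \<inter> \<D>) g j"
      using that by (simp add: mons_def in_keys_iff)
    show "ymul \<D> k a \<in> mons (\<U> \<inter> \<D>) g (j + 1)" if a: "a \<in> mons (\<U> \<inter> \<D>) g j"
    proof (rule mons_memI)
      fix m assume "lookup (ymul \<D> k a) m \<noteq> 0"
      then have m: "keys m \<in> \<D>" "k \<in> keys m" "lookup a (m - single k 1) \<noteq> 0"
        by (auto simp: lookup_ymul split: if_splits)
      have e: "m - single k 1 + single k 1 = m" using m(2) by (intro mon_diff_add) (simp add: in_keys_iff)
      have "mon_degree m = mon_degree (m - single k 1) + 1"
        by (subst e[symmetric]) (simp only: mon_degree_add mon_degree_single)
      moreover have "keys m \<in> \<U>"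
        using mons_memD[OF a m(3)] assms(2) keys_diff_mon[of m "single k 1"] unfolding upset_def by blast
      ultimately show "keys m \<in> \<U> \<inter> \<D> \<and> (g \<longrightarrow> int (mon_degree m) = j + 1)"
        using m(1) mons_memD[OF a m(3)] by simp
    qed
  qed
qed

text \<open>The part of multidegree b, where \<sigma> itself has multidegree
  \<open>ind \<sigma>\<close>. The guard is there because subtraction of exponents stops at
  zero.\<close>

definition slice :: "('n::{finite, linorder} set \<Rightarrow> ('n, 'k::field) mpoly) \<Rightarrow> ('n \<Rightarrow>\<^sub>0 nat) \<Rightarrow> 'n set \<Rightarrow> 'k" where
  "slice \<kappa> b \<sigma> = (if \<sigma> \<subseteq> keys b then lookup (\<kappa> \<sigma>) (b - ind \<sigma>) else 0)"

definition slice_fam :: "'n::finite set set \<Rightarrow> ('n \<Rightarrow>\<^sub>0 nat) \<Rightarrow> 'n set set" where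
  "slice_fam \<S> b = {\<sigma>. \<sigma> \<subseteq> keys b \<and> keys (b - ind \<sigma>) \<in> \<S>}"

lemma slice_add_ind: "slice \<kappa> (m + ind \<sigma>) \<sigma> = lookup (\<kappa> \<sigma>) m"
  by (auto simp: slice_def ind_add_diff keys_add_mon)

text \<open>The Koszul differential preserves multidegrees and is the simplicial boundary in each of
  them, because multiplication by a variable moves a coefficient without changing it.\<close>

lemma lookup_kd_ymul:
  fixes \<kappa> :: "'n::{finite, linorder} set \<Rightarrow> ('n, 'k::field) mpoly"
  shows "lookup (kd (ymul \<D>) \<kappa> \<rho>) m = (if keys m \<in> \<D> then bd (slice \<kappa> (m + ind \<rho>)) \<rho> else 0)"
proof -
  have ks: "lookup (ksgn k \<rho> p) m = ksgn k \<rho> (lookup p m)" for k and p :: "('n, 'k) mpoly"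
    by (simp add: ksgn_def)
  have "lookup (kd (ymul \<D>) \<kappa> \<rho>) m = (\<Sum>k\<in>-\<rho>. ksgn k \<rho> (lookup (ymul \<D> k (\<kappa> (insert k \<rho>))) m))"
    by (simp add: kd_def lookup_sum ks)
  also have "\<dots> = (\<Sum>k\<in>-\<rho>. if keys m \<in> \<D> then ksgn k \<rho> (slice \<kappa> (m + ind \<rho>) (insert k \<rho>)) else 0)"
  proof (intro sum.cong refl)
    fix k assume "k \<in> - \<rho>"
    then have k: "k \<notin> \<rho>" by simp
    have "m + ind \<rho> - ind (insert k \<rho>) = m - single k 1"
      by (simp only: ind_diff_insert[OF k, symmetric] ind_add_diff)
    then show "ksgn k \<rho> (lookup (ymul \<D> k (\<kappa> (insert k \<rho>))) m) =
        (if keys m \<in> \<D> then ksgn k \<rho> (slice \<kappa> (m + ind \<rho>) (insert k \<rho>)) else 0)"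
      using k by (auto simp: lookup_ymul slice_def keys_add_mon)
  qed
  also have "\<dots> = (if keys m \<in> \<D> then bd (slice \<kappa> (m + ind \<rho>)) \<rho> else 0)"
    by (simp add: kd_def)
  finally show ?thesis .
qed

text \<open>Adding k to \<rho> can only shrink the support of the remaining monomial. So no boundary
  reaches a place outside the upset, and the cut-off in \<open>cbd\<close> is the effect of \<D>
  alone.\<close>

lemma bd_outside_upset:
  assumes "upset \<U>" "c \<in> cchain (slice_fam (\<U> \<inter> \<D>) b) i" "keys (b - ind \<rho>) \<notin> \<U>"
  shows "bd c \<rho> = 0"
proof (rule ccontr)
  assume "bd c \<rho> \<noteq> 0"
  from bd_nonzero[OF assms(2) this] obtain k where
    "k \<notin> \<rho>" "insert k \<rho> \<in> slice_fam (\<U> \<inter> \<D>) b" "card (insert k \<rho>) = i" .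
  then have "keys (b - ind (insert k \<rho>)) \<in> \<U>" "keys (b - ind (insert k \<rho>)) \<subseteq> keys (b - ind \<rho>)"
    using ind_diff_insert[of k \<rho> b] keys_diff_mon[of "b - ind \<rho>" "single k 1"] by (auto simp: slice_fam_def)
  with assms(1,3) show False unfolding upset_def by blast
qed

lemma slice_mem:
  assumes "\<kappa> \<in> kcomp (mons \<S> g) i j"
  shows "slice \<kappa> b \<in> cchain (slice_fam \<S> b) i"
proof (rule cchainI)
  fix \<sigma> assume "slice \<kappa> b \<sigma> \<noteq> 0"
  then have s: "\<sigma> \<subseteq> keys b" "lookup (\<kappa> \<sigma>) (b - ind \<sigma>) \<noteq> 0" by (auto simp: slice_def split: if_splits)
  then have "\<kappa> \<sigma> \<noteq> 0" by auto
  then have c: "card \<sigma> = i" using kcomp_zero_off[OF assms, of \<sigma>] by auto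
  from mons_memD[OF kcomp_mem[OF assms c] s(2)] s(1) c
  show "\<sigma> \<in> slice_fam \<S> b \<and> card \<sigma> = i" by (simp add: slice_fam_def)
qed

lemma slice_degree:
  assumes "\<kappa> \<in> kcomp (mons \<S> True) i j" "slice \<kappa> b \<sigma> \<noteq> 0"
  shows "int (mon_degree b) = j"
proof -
  from assms(2) have s: "\<sigma> \<subseteq> keys b" "lookup (\<kappa> \<sigma>) (b - ind \<sigma>) \<noteq> 0" by (auto simp: slice_def split: if_splits)
  have c: "card \<sigma> = i" using cchainD[OF slice_mem[OF assms(1)] assms(2)] by simp
  have "mon_degree b = mon_degree (b - ind \<sigma>) + card \<sigma>"
    by (subst ind_diff_add[OF s(1), symmetric]) (simp only: mon_degree_add mon_degree_ind)
  with mons_memD[OF kcomp_mem[OF assms(1) c] s(2)] c show ?thesis by simp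
qed

text \<open>The slices are filled one multidegree at a time and the fillings are put
  together.\<close>

lemma kexact_ymul_if:
  fixes \<U> \<D> :: "'n::{finite, linorder} set set"
  assumes fams: "downset \<D>" "upset \<U>"
    and ex: "\<And>b. (g \<longrightarrow> int (mon_degree b) = j) \<Longrightarrow> cexact TYPE('k::field) (slice_fam (\<U> \<inter> \<D>) b) i"
  shows "kexact (ymul \<D>) (mons (\<U> \<inter> \<D>) g :: int \<Rightarrow> ('n, 'k) mpoly set) i j"
  unfolding kexact_def
proof (intro ballI impI)
  let ?\<S> = "\<U> \<inter> \<D>"
  fix \<kappa> :: "'n set \<Rightarrow> ('n, 'k) mpoly"
  assume \<kappa>: "\<kappa> \<in> kcomp (mons ?\<S> g) i j" and cyc: "kd (ymul \<D>) \<kappa> = (\<lambda>_. 0)"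
  \<comment> \<open>A zero slice gets the zero filling, which makes the later sum over multidegrees
    finite.\<close>
  have "\<exists>e. e \<in> cchain (slice_fam ?\<S> b) (Suc i) \<and> cbd (slice_fam ?\<S> b) e = slice \<kappa> b \<and>
      (slice \<kappa> b = (\<lambda>_. 0) \<longrightarrow> e = (\<lambda>_. 0))" for b
  proof (cases "slice \<kappa> b = (\<lambda>_. 0)")
    case True
    then show ?thesis by (intro exI[of _ "\<lambda>_. 0"]) (simp add: cchain_zero cbd_def fun_eq_iff)
  next
    case False
    then obtain \<sigma> where "slice \<kappa> b \<sigma> \<noteq> 0" by auto
    then have "g \<longrightarrow> int (mon_degree b) = j" using \<kappa> slice_degree[of \<kappa> ?\<S> i j b \<sigma>] by (cases g) auto
    note ex' = ex[OF this, unfolded cexact_def, rule_format, OF slice_mem[OF \<kappa>]]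
    have "cbd (slice_fam ?\<S> b) (slice \<kappa> b) \<rho> = 0" for \<rho>
    proof (cases "\<rho> \<in> slice_fam ?\<S> b")
      case True
      then have \<rho>: "\<rho> \<subseteq> keys b" "keys (b - ind \<rho>) \<in> \<D>" by (auto simp: slice_fam_def)
      have "0 = lookup (kd (ymul \<D>) \<kappa> \<rho>) (b - ind \<rho>)" by (simp add: cyc)
      also have "\<dots> = bd (slice \<kappa> b) \<rho>" by (simp only: lookup_kd_ymul \<rho>(2) if_True ind_diff_add[OF \<rho>(1)])
      finally show ?thesis by (simp add: cbd_def)
    qed (simp add: cbd_def)
    then obtain e where "e \<in> cchain (slice_fam ?\<S> b) (Suc i)" "cbd (slice_fam ?\<S> b) e = slice \<kappa> b"
      using ex' by blast
    with False show ?thesis by blast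
  qed
  then obtain e where e: "\<And>b. e b \<in> cchain (slice_fam ?\<S> b) (Suc i)"
    "\<And>b. cbd (slice_fam ?\<S> b) (e b) = slice \<kappa> b" "\<And>b. slice \<kappa> b = (\<lambda>_. 0) \<Longrightarrow> e b = (\<lambda>_. 0)"
    by metis
  define Bs where "Bs = (\<Union>\<sigma>. (\<lambda>m. m + ind \<sigma>) ` keys (\<kappa> \<sigma>))"
  have fin: "finite Bs" by (simp add: Bs_def)
  have eBs: "e b = (\<lambda>_. 0)" if "b \<notin> Bs" for b
  proof (rule e(3), rule ext)
    fix \<sigma>
    show "slice \<kappa> b \<sigma> = 0"
    proof (rule ccontr)
      assume "slice \<kappa> b \<sigma> \<noteq> 0"
      then have s: "\<sigma> \<subseteq> keys b" "b - ind \<sigma> \<in> keys (\<kappa> \<sigma>)" by (auto simp: slice_def in_keys_iff split: if_splits)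
      from imageI[OF s(2), of "\<lambda>m. m + ind \<sigma>"] ind_diff_add[OF s(1)] that show False
        by (auto simp: Bs_def)
    qed
  qed
  define \<eta> where "\<eta> = (\<lambda>\<sigma>. \<Sum>b | b \<in> Bs \<and> \<sigma> \<subseteq> keys b. single (b - ind \<sigma>) (e b \<sigma>))"
  have l\<eta>: "lookup (\<eta> \<sigma>) m = e (m + ind \<sigma>) \<sigma>" for \<sigma> m
  proof -
    have "b - ind \<sigma> = m \<longleftrightarrow> b = m + ind \<sigma>" if "\<sigma> \<subseteq> keys b" for b
      using ind_diff_add[OF that] ind_add_diff[of m \<sigma>] by auto
    then have "lookup (\<eta> \<sigma>) m = (\<Sum>b | b \<in> Bs \<and> \<sigma> \<subseteq> keys b. if b = m + ind \<sigma> then e b \<sigma> else 0)"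
      unfolding \<eta>_def lookup_sum by (intro sum.cong) (auto simp: lookup_single when_def)
    also have "\<dots> = e (m + ind \<sigma>) \<sigma>"
      using fin eBs[of "m + ind \<sigma>"] by (auto simp: keys_add_mon)
    finally show ?thesis .
  qed
  have sl\<eta>: "slice \<eta> b = e b" for b
  proof
    fix \<sigma>
    show "slice \<eta> b \<sigma> = e b \<sigma>"
    proof (cases "\<sigma> \<subseteq> keys b")
      case True
      then show ?thesis by (simp add: slice_def l\<eta> ind_diff_add)
    next
      case False
      then have "\<sigma> \<notin> slice_fam ?\<S> b" by (simp add: slice_fam_def)
      then show ?thesis using False cchain_off[OF e(1)[of b]] by (simp add: slice_def)
    qed
  qed
  have "\<eta> \<in> kcomp (mons ?\<S> g) (Suc i) j"
    unfolding kcomp_def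
  proof (intro CollectI allI)
    fix \<sigma> :: "'n set"
    have nz: "keys m \<in> ?\<S> \<and> (g \<longrightarrow> int (mon_degree m) = j - int (Suc i)) \<and> card \<sigma> = Suc i" if "lookup (\<eta> \<sigma>) m \<noteq> 0" for m
    proof -
      have ne: "e (m + ind \<sigma>) \<sigma> \<noteq> 0" using that by (simp add: l\<eta>)
      from cchainD[OF e(1) ne] have "\<sigma> \<in> slice_fam ?\<S> (m + ind \<sigma>)" "card \<sigma> = Suc i" by simp_all
      moreover have "int (mon_degree m) = j - int (Suc i)" if g: g
      proof -
        from ne e(3)[of "m + ind \<sigma>"] have "slice \<kappa> (m + ind \<sigma>) \<noteq> (\<lambda>_. 0)" by auto
        then obtain \<rho> where "slice \<kappa> (m + ind \<sigma>) \<rho> \<noteq> 0" by auto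
        with \<kappa> g have "int (mon_degree (m + ind \<sigma>)) = j" by (intro slice_degree) auto
        then show ?thesis using \<open>card \<sigma> = Suc i\<close> by (simp add: mon_degree_add mon_degree_ind)
      qed
      ultimately show ?thesis by (simp add: slice_fam_def ind_add_diff)
    qed
    show "if card \<sigma> = Suc i then \<eta> \<sigma> \<in> mons ?\<S> g (j - int (Suc i)) else \<eta> \<sigma> = 0"
    proof (cases "card \<sigma> = Suc i")
      case True
      have "\<eta> \<sigma> \<in> mons ?\<S> g (j - int (Suc i))"
        by (rule mons_memI) (use nz in blast)
      then show ?thesis using True by simp
    next
      case False
      have "\<eta> \<sigma> = 0" using nz False by (intro poly_mapping_eqI) force
      then show ?thesis using False by simp
    qed
  qed
  moreover have "kd (ymul \<D>) \<eta> = \<kappa>"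
  proof (rule ext, rule poly_mapping_eqI)
    fix \<rho> :: "'n set" and m
    let ?b = "m + ind \<rho>"
    have "lookup (kd (ymul \<D>) \<eta> \<rho>) m = (if keys m \<in> \<D> then bd (e ?b) \<rho> else 0)"
      by (simp add: lookup_kd_ymul sl\<eta>)
    also have "\<dots> = cbd (slice_fam ?\<S> ?b) (e ?b) \<rho>"
      using bd_outside_upset[OF fams(2) e(1), of ?b \<rho>]
      by (auto simp: cbd_def slice_fam_def ind_add_diff keys_add_mon)
    also have "\<dots> = lookup (\<kappa> \<rho>) m" by (simp add: e(2) slice_add_ind)
    finally show "lookup (kd (ymul \<D>) \<eta> \<rho>) m = lookup (\<kappa> \<rho>) m" .
  qed
  ultimately show "\<exists>\<eta>\<in>kcomp (mons ?\<S> g) (Suc i) j. kd (ymul \<D>) \<eta> = \<kappa>" by blast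
qed

lemma slice_fam_ind: "slice_fam \<S> (ind \<tau>) = {\<sigma>. \<sigma> \<subseteq> \<tau> \<and> \<tau> - \<sigma> \<in> \<S>}"
proof -
  have "keys (ind \<tau> - ind \<sigma>) = \<tau> - \<sigma>" for \<sigma>
    by (auto simp: in_keys_iff lookup_minus lookup_ind split: if_splits)
  then show ?thesis by (simp add: slice_fam_def)
qed

text \<open>A chain on subsets of \<tau> is a Koszul chain concentrated in the squarefree
  multidegree \<open>ind \<tau>\<close>, and the slice there of a Koszul filling fills it.\<close>

lemma kexact_ymul_only_if:
  fixes \<U> \<D> :: "'n::{finite, linorder} set set"
  assumes fams: "downset \<D>" "upset \<U>"
    and ex: "kexact (ymul \<D>) (mons (\<U> \<inter> \<D>) g :: int \<Rightarrow> ('n, 'k::field) mpoly set) i j"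
    and j: "g \<longrightarrow> int (card \<tau>) = j"
  shows "cexact TYPE('k) {\<sigma>. \<sigma> \<subseteq> \<tau> \<and> \<tau> - \<sigma> \<in> \<U> \<inter> \<D>} i"
  unfolding cexact_def slice_fam_ind[symmetric]
proof (intro allI impI)
  let ?\<S> = "\<U> \<inter> \<D>" let ?X = "slice_fam ?\<S> (ind \<tau>)"
  fix c :: "'n set \<Rightarrow> 'k" assume c: "c \<in> cchain ?X i" "cbd ?X c = (\<lambda>_. 0)"
  define \<kappa> where "\<kappa> = (\<lambda>\<sigma>. single (ind \<tau> - ind \<sigma>) (c \<sigma>) :: ('n, 'k) mpoly)"
  have sub: "\<sigma> \<subseteq> \<tau>" "\<tau> - \<sigma> \<in> ?\<S>" "card \<sigma> = i" if "c \<sigma> \<noteq> 0" for \<sigma>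
    using cchainD[OF c(1) that] by (auto simp: slice_fam_ind)
  have dk: "ind \<tau> - ind \<sigma> + ind \<sigma> = ind \<tau>" if "\<sigma> \<subseteq> \<tau>" for \<sigma>
    using that by (intro ind_diff_add) simp
  have sl: "slice \<kappa> b = (if b = ind \<tau> then c else (\<lambda>_. 0))" for b
  proof
    fix \<sigma>
    show "slice \<kappa> b \<sigma> = (if b = ind \<tau> then c else (\<lambda>_. 0)) \<sigma>"
    proof (cases "c \<sigma> = 0")
      case True
      then show ?thesis by (simp add: slice_def \<kappa>_def)
    next
      case False
      note s = sub[OF False]
      have "\<sigma> \<subseteq> keys b \<and> ind \<tau> - ind \<sigma> = b - ind \<sigma> \<longleftrightarrow> b = ind \<tau>"
        using ind_diff_add[of \<sigma> b] dk[OF s(1)] s(1) by auto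
      then show ?thesis by (auto simp: slice_def \<kappa>_def lookup_single when_def)
    qed
  qed
  have "\<kappa> \<in> kcomp (mons ?\<S> g) i j"
    unfolding kcomp_def
  proof (intro CollectI allI)
    fix \<sigma> :: "'n set"
    show "if card \<sigma> = i then \<kappa> \<sigma> \<in> mons ?\<S> g (j - int i) else \<kappa> \<sigma> = 0"
    proof (cases "c \<sigma> = 0")
      case True
      then show ?thesis by (simp add: \<kappa>_def mons_def)
    next
      case False
      note s = sub[OF False]
      have "card \<tau> = mon_degree (ind \<tau> - ind \<sigma>) + card \<sigma>"
        using arg_cong[OF dk[OF s(1)], of mon_degree] by (simp only: mon_degree_add mon_degree_ind)
      moreover have "keys (ind \<tau> - ind \<sigma>) = \<tau> - \<sigma>"
        by (auto simp: in_keys_iff lookup_minus lookup_ind split: if_splits)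
      ultimately show ?thesis using s j False by (auto simp: \<kappa>_def mons_def)
    qed
  qed
  moreover have "kd (ymul \<D>) \<kappa> = (\<lambda>_. 0)"
  proof (rule ext, rule poly_mapping_eqI)
    fix \<rho> :: "'n set" and m
    show "lookup (kd (ymul \<D>) \<kappa> \<rho>) m = lookup 0 m"
    proof (cases "m + ind \<rho> = ind \<tau>")
      case True
      have "cbd ?X c \<rho> = 0" by (simp add: c(2))
      moreover have "ind \<tau> - ind \<rho> = m" by (simp only: True[symmetric] ind_add_diff)
      moreover have "\<rho> \<subseteq> \<tau>" using arg_cong[OF True, of keys] by (auto simp: keys_add_mon)
      ultimately show ?thesis
        using bd_outside_upset[OF fams(2) c(1), of \<rho>]
        by (auto simp: lookup_kd_ymul sl True cbd_def slice_fam_def split: if_splits)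
    next
      case False
      then show ?thesis by (simp only: lookup_kd_ymul sl if_False cb.kd_zero) simp
    qed
  qed
  ultimately obtain \<eta> where \<eta>: "\<eta> \<in> kcomp (mons ?\<S> g) (Suc i) j" "kd (ymul \<D>) \<eta> = \<kappa>"
    by (rule kexactD[OF ex])
  have "cbd ?X (slice \<eta> (ind \<tau>)) \<rho> = c \<rho>" for \<rho>
  proof (cases "\<rho> \<in> ?X")
    case True
    then have \<rho>: "\<rho> \<subseteq> \<tau>" "keys (ind \<tau> - ind \<rho>) \<in> \<D>" by (auto simp: slice_fam_def)
    have "bd (slice \<eta> (ind \<tau>)) \<rho> = lookup (kd (ymul \<D>) \<eta> \<rho>) (ind \<tau> - ind \<rho>)"
      by (simp only: lookup_kd_ymul \<rho>(2) dk[OF \<rho>(1)] if_True)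
    also have "\<dots> = c \<rho>" by (simp add: \<eta>(2) \<kappa>_def)
    finally show ?thesis using True by (simp add: cbd_def)
  next
    case False
    then show ?thesis by (simp add: cbd_def cchain_off[OF c(1)])
  qed
  then show "\<exists>e\<in>cchain ?X (Suc i). cbd ?X e = c"
    using slice_mem[OF \<eta>(1)] by blast
qed

text \<open>In a multidegree that is not squarefree the complex is a cone.\<close>

lemma cexact_slice_not_squarefree:
  assumes "lookup b k \<ge> 2"
  shows "cexact TYPE('k::field) (slice_fam \<S> (b :: 'n::{finite, linorder} \<Rightarrow>\<^sub>0 nat)) i"
proof (rule cexact_cone[of k])
  fix \<sigma>
  have "keys (b - ind (insert k \<sigma>)) = keys (b - ind \<sigma>)"
    using assms by (auto simp: in_keys_iff lookup_minus lookup_ind split: if_splits)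
  then show "insert k \<sigma> \<in> slice_fam \<S> b \<longleftrightarrow> \<sigma> \<in> slice_fam \<S> b"
    using assms by (auto simp: slice_fam_def in_keys_iff)
qed

text \<open>Only squarefree multidegrees carry homology, one for each \<tau>; with g set, the
  internal degree selects the \<tau> of cardinality j. For squarefree monomial ideals this is the
  description of Betti numbers by upper Koszul complexes.\<close>

theorem kexact_ymul_iff:
  fixes \<U> \<D> :: "'n::{finite, linorder} set set"
  assumes fams: "downset \<D>" "upset \<U>"
  shows "kexact (ymul \<D>) (mons (\<U> \<inter> \<D>) g :: int \<Rightarrow> ('n, 'k::field) mpoly set) i j \<longleftrightarrow>
    (\<forall>\<tau>. (g \<longrightarrow> int (card \<tau>) = j) \<longrightarrow> cexact TYPE('k) {\<sigma>. \<sigma> \<subseteq> \<tau> \<and> \<tau> - \<sigma> \<in> \<U> \<inter> \<D>} i)"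
    (is "?L \<longleftrightarrow> ?R")
proof
  assume ?L
  then show ?R using kexact_ymul_only_if[OF fams] by blast
next
  assume R: ?R
  show ?L
  proof (rule kexact_ymul_if[OF fams])
    fix b :: "'n \<Rightarrow>\<^sub>0 nat" assume b: "g \<longrightarrow> int (mon_degree b) = j"
    show "cexact TYPE('k) (slice_fam (\<U> \<inter> \<D>) b) i"
    proof (cases "\<exists>k. lookup b k \<ge> 2")
      case True
      then show ?thesis using cexact_slice_not_squarefree by blast
    next
      case False
      have "b = ind (keys b)"
      proof (rule poly_mapping_eqI)
        fix k
        have "lookup b k < 2" using False by (meson not_le)
        then show "lookup b k = lookup (ind (keys b)) k" by (auto simp: lookup_ind in_keys_iff)
      qed
      then obtain \<tau> where \<tau>: "b = ind \<tau>" by blast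
      with R b show ?thesis by (simp add: slice_fam_ind mon_degree_ind)
    qed
  qed
qed

text \<open>In squarefree multidegrees the family is a full simplex, which is exact unless \<tau> is
  empty, and the empty simplex lives at index 0.\<close>

lemma kexact_polynomials:
  assumes "i > 0"
  shows "kexact (\<lambda>k p. Var k * p) (mons UNIV g :: int \<Rightarrow> ('n::{finite, linorder}, 'k::field) mpoly set) i j"
proof -
  have "cexact TYPE('k) (Pow \<tau>) i" for \<tau> :: "'n set"
  proof (cases "\<tau> = {}")
    case True
    have "c = (\<lambda>_. 0)" if "c \<in> cchain (Pow \<tau>) i" for c :: "'n set \<Rightarrow> 'k"
    proof
      fix \<sigma>
      show "c \<sigma> = 0" using cchainD[OF that, of \<sigma>] assms True by (cases "c \<sigma> = 0") auto
    qed
    then show ?thesis unfolding cexact_def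
      using cchain_zero by (intro allI impI bexI[of _ "\<lambda>_. 0"]) (auto simp: cbd_def)
  qed (rule cexact_Pow)
  moreover have "downset (UNIV :: 'n set set)" "upset (UNIV :: 'n set set)"
    by (auto simp: downset_def upset_def)
  ultimately have "kexact (ymul UNIV) (mons (UNIV \<inter> UNIV) g :: int \<Rightarrow> ('n, 'k) mpoly set) i j"
    unfolding kexact_ymul_iff[OF \<open>downset _\<close> \<open>upset _\<close>] by (simp add: Pow_def)
  moreover have "ymul UNIV = (\<lambda>k (p :: ('n, 'k) mpoly). Var k * p)" by (intro ext ymul_UNIV)
  ultimately show ?thesis by simp
qed

section \<open>Graded modules\<close>

lemma Const_add: "Const (a + b) = Const a + Const b"
  by (simp add: Const_def single_add)

lemma Const_mult: "Const (a * b) = Const a * Const b"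
  by (simp add: Const_def mult_single)

lemma Const_one [simp]: "Const 1 = 1"
  by (simp add: Const_def)

lemma Const_zero [simp]: "Const 0 = 0"
  by (simp add: Const_def)

lemma single_eq_Const_times: "single m c = Const c * single m 1"
  by (simp add: Const_def mult_single)

text \<open>The grading is given by projections on M, since M is only a subset of an ungraded type.
  Stability of the components is asked for constants and variables; \<open>gr_scale\<close> extends
  it to homogeneous polynomials.\<close>

locale gmod = module s
  for s :: "('n::{finite, linorder}, 'k::field) mpoly \<Rightarrow> 'a::ab_group_add \<Rightarrow> 'a" +
  fixes M :: "'a set" and gr :: "int \<Rightarrow> 'a set" and pr :: "int \<Rightarrow> 'a \<Rightarrow> 'a"
  assumes M_subspace: "subspace M"
    and gr_sub: "gr j \<subseteq> M"
    and gr_zero: "0 \<in> gr j"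
    and gr_add: "a \<in> gr j \<Longrightarrow> b \<in> gr j \<Longrightarrow> a + b \<in> gr j"
    and gr_Const: "a \<in> gr j \<Longrightarrow> s (Const c) a \<in> gr j"
    and gr_Var: "a \<in> gr j \<Longrightarrow> s (Var k) a \<in> gr (j + 1)"
    and pr_mem: "a \<in> M \<Longrightarrow> pr j a \<in> gr j"
    and pr_add: "a \<in> M \<Longrightarrow> b \<in> M \<Longrightarrow> pr j (a + b) = pr j a + pr j b"
    and pr_gr: "a \<in> gr i \<Longrightarrow> pr j a = (if i = j then a else 0)"
    and pr_finite: "a \<in> M \<Longrightarrow> finite {j. pr j a \<noteq> 0}"
    and pr_sum: "a \<in> M \<Longrightarrow> (\<Sum>j | pr j a \<noteq> 0. pr j a) = a"
begin

lemma gr_uminus: "a \<in> gr j \<Longrightarrow> - a \<in> gr j"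
  using gr_Const[of a j "- 1"] by (simp add: Const_def single_uminus)

lemma kspace: "vector_space (\<lambda>c. s (Const c))"
  by unfold_locales (simp_all add: Const_add Const_mult scale_right_distrib scale_left_distrib)

sublocale kv: vector_space "\<lambda>c. s (Const c)"
  by (rule kspace)

lemma koszul_ops_Var: "koszul_ops (\<lambda>k. s (Var k))"
  by unfold_locales (simp_all add: scale_right_distrib mult.commute)

sublocale G: koszul_fam "\<lambda>k. s (Var k)" gr
  by (intro koszul_fam.intro koszul_ops_Var, unfold_locales)
    (auto simp: gr_zero gr_add gr_uminus gr_Var)

lemma gr_scale: "p \<in> homog i \<Longrightarrow> a \<in> gr j \<Longrightarrow> s p a \<in> gr (i + j)"
proof -
  assume p: "p \<in> homog i" and a: "a \<in> gr j"
  have sing: "s (single m 1) a \<in> gr (int (mon_degree m) + j)" for m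
  proof (induction "mon_degree m" arbitrary: m)
    case 0
    then have "m = 0"
      by (intro poly_mapping_eqI) (simp add: mon_degree_UNIV)
    then show ?case using a by (simp add: mon_degree_UNIV)
  next
    case (Suc d)
    have "\<exists>k. lookup m k \<noteq> 0"
    proof (rule ccontr)
      assume "\<nexists>k. lookup m k \<noteq> 0"
      then have "mon_degree m = 0" by (simp add: mon_degree_UNIV)
      with Suc.hyps(2) show False by simp
    qed
    then obtain k where k: "lookup m k \<noteq> 0" by blast
    let ?m = "m - single k 1"
    note e = mon_diff_add[OF k]
    have d: "mon_degree m = mon_degree ?m + 1"
      using arg_cong[OF e, of mon_degree] by (simp only: mon_degree_add mon_degree_single)
    have "s (single m 1) a = s (Var k) (s (single ?m 1) a)"
      by (simp only: scale_scale Var_times_single e)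
    also have "\<dots> \<in> gr (int (mon_degree ?m) + j + 1)"
      using d Suc.hyps(2) by (intro gr_Var Suc.hyps(1)) simp
    finally show ?case using d by (simp add: algebra_simps)
  qed
  have "s (\<Sum>m\<in>keys p. single m (lookup p m)) a = (\<Sum>m\<in>keys p. s (Const (lookup p m)) (s (single m 1) a))"
    by (simp add: scale_sum_left scale_scale single_eq_Const_times[symmetric])
  also have "\<dots> \<in> gr (i + j)"
  proof (intro G.fam_sum gr_Const)
    fix m assume "m \<in> keys p"
    with p have "int (mon_degree m) = i" by (simp add: homog_def)
    then show "s (single m 1) a \<in> gr (i + j)" using sing[of m] by simp
  qed
  finally show ?thesis by (simp only: poly_expand[symmetric])
qed

lemma pr_zero [simp]: "pr j 0 = 0"
  using pr_gr[OF gr_zero[of j], of j] by simp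

lemma pr_M: "a \<in> M \<Longrightarrow> pr j a \<in> M"
  using pr_mem gr_sub by blast

lemma pr_sum_fun: "(\<And>x. x \<in> A \<Longrightarrow> f x \<in> M) \<Longrightarrow> pr j (\<Sum>x\<in>A. f x) = (\<Sum>x\<in>A. pr j (f x))"
proof (induction A rule: infinite_finite_induct)
  case (insert x A)
  then have "(\<Sum>x\<in>A. f x) \<in> M" by (intro subspace_sum[OF M_subspace]) auto
  with insert show ?case by (simp add: pr_add)
qed auto

lemma pr_uminus: "a \<in> M \<Longrightarrow> pr j (- a) = - pr j a"
  using pr_add[of a "- a" j] subspace_neg[OF M_subspace, of a] by (simp add: eq_neg_iff_add_eq_0 add.commute)

lemma pr_linear:
  assumes h: "\<And>x y. h (x + y) = h x + h y" and hM: "\<And>x. x \<in> M \<Longrightarrow> h x \<in> M"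
    and hg: "\<And>x i. x \<in> gr i \<Longrightarrow> h x \<in> gr (i + d)" and a: "a \<in> M"
  shows "pr (j + d) (h a) = h (pr j a)"
proof -
  have h0: "h 0 = 0" using h[of 0 0] by simp
  have hs: "h (\<Sum>x\<in>A. f x) = (\<Sum>x\<in>A. h (f x))" for A and f :: "int \<Rightarrow> 'a"
    by (induction A rule: infinite_finite_induct) (auto simp: h h0)
  let ?A = "{i. pr i a \<noteq> 0}"
  have "pr (j + d) (h a) = pr (j + d) (h (\<Sum>i\<in>?A. pr i a))" by (simp only: pr_sum[OF a])
  also have "\<dots> = (\<Sum>i\<in>?A. pr (j + d) (h (pr i a)))"
    unfolding hs by (intro pr_sum_fun hM pr_M a)
  also have "\<dots> = (\<Sum>i\<in>?A. if i = j then h (pr i a) else 0)"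
    by (intro sum.cong refl) (simp add: pr_gr[OF hg[OF pr_mem[OF a]]])
  also have "\<dots> = h (pr j a)"
    using pr_finite[OF a] by (simp add: h0)
  finally show ?thesis .
qed

lemma pr_Var: "a \<in> M \<Longrightarrow> pr j (s (Var k) a) = s (Var k) (pr (j - 1) a)"
  using pr_linear[of "s (Var k)" 1 a "j - 1"] gr_Var subspace_scale[OF M_subspace]
  by (simp add: scale_right_distrib)

text \<open>The degree j part of the product of M with the homogeneous maximal ideal.\<close>

definition dec :: "int \<Rightarrow> 'a set" where
  "dec j = {\<Sum>k\<in>UNIV. s (Var k) (w k) | w. \<forall>k. w k \<in> gr (j - 1)}"

lemma kexact_0_iff_dec: "kexact (\<lambda>k. s (Var k)) gr 0 j \<longleftrightarrow> gr j \<subseteq> dec j"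
  unfolding G.kexact_0_iff dec_def by blast

lemma dec_sub_gr: "dec j \<subseteq> gr j"
  unfolding dec_def using gr_Var[of _ "j - 1"] by (auto intro!: G.fam_sum)

lemma dec_ksubspace: "kv.subspace (dec j)"
  unfolding kv.subspace_def
proof (intro conjI ballI allI)
  show "0 \<in> dec j" unfolding dec_def using gr_zero by (intro CollectI exI[of _ "\<lambda>_. 0"]) simp
next
  fix x y assume "x \<in> dec j" "y \<in> dec j"
  then obtain w w' where w: "\<And>k. w k \<in> gr (j - 1)" "\<And>k. w' k \<in> gr (j - 1)"
    "x = (\<Sum>k\<in>UNIV. s (Var k) (w k))" "y = (\<Sum>k\<in>UNIV. s (Var k) (w' k))"
    unfolding dec_def by blast
  then show "x + y \<in> dec j" unfolding dec_def
    by (intro CollectI exI[of _ "\<lambda>k. w k + w' k"]) (auto simp: scale_right_distrib sum.distrib gr_add)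
next
  fix c x assume "x \<in> dec j"
  then obtain w where w: "\<And>k. w k \<in> gr (j - 1)" "x = (\<Sum>k\<in>UNIV. s (Var k) (w k))"
    unfolding dec_def by blast
  then show "s (Const c) x \<in> dec j" unfolding dec_def
    by (intro CollectI exI[of _ "\<lambda>k. s (Const c) (w k)"])
      (auto simp: scale_sum_right scale_scale mult.commute gr_Const)
qed

end

lemma (in vector_space) independent_mod_span:
  assumes ind: "independent (C \<union> D)" and disj: "C \<inter> D = {}" and fin: "finite C"
    and sum: "(\<Sum>x\<in>C. scale (u x) x) \<in> span D" and x: "x \<in> C"
  shows "u x = 0"
proof -
  obtain t r where t: "finite t" "t \<subseteq> D" "(\<Sum>x\<in>C. scale (u x) x) = (\<Sum>a\<in>t. scale (r a) a)"
    using sum unfolding span_explicit by auto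
  define v where "v = (\<lambda>y. if y \<in> C then u y else - r y)"
  have d: "C \<inter> t = {}" using disj t(2) by auto
  have "(\<Sum>y\<in>C \<union> t. scale (v y) y) = (\<Sum>y\<in>C. scale (v y) y) + (\<Sum>y\<in>t. scale (v y) y)"
    by (rule sum.union_disjoint[OF fin t(1) d])
  also have "(\<Sum>y\<in>C. scale (v y) y) = (\<Sum>y\<in>C. scale (u y) y)" by (simp add: v_def)
  also have "(\<Sum>y\<in>t. scale (v y) y) = - (\<Sum>a\<in>t. scale (r a) a)"
    unfolding sum_negf[symmetric] using d by (intro sum.cong) (auto simp: v_def)
  finally have "(\<Sum>y\<in>C \<union> t. scale (v y) y) = 0" by (simp add: t(3))
  moreover have "C \<union> t \<subseteq> C \<union> D" using t(2) by auto
  ultimately have "v x = 0"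
    using independentD[OF ind _ \<open>C \<union> t \<subseteq> C \<union> D\<close>, of v x] fin t(1) x by auto
  then show ?thesis using x by (simp add: v_def)
qed

text \<open>C is a basis of V modulo U. Applied to \<open>gr j\<close> and \<open>dec j\<close> it
  yields the minimal generators of degree j.\<close>

lemma (in vector_space) extend_basis_within:
  assumes "subspace U" "U \<subseteq> V" "finite B" "V \<subseteq> span B"
  obtains C D where "finite C" "C \<inter> D = {}" "independent (C \<union> D)" "span D = U" "C \<subseteq> V" "V \<subseteq> span (C \<union> D)"
proof -
  obtain D where D: "D \<subseteq> U" "independent D" "U \<subseteq> span D"
    using maximal_independent_subset by blast
  obtain E where E: "D \<subseteq> E" "E \<subseteq> V" "independent E" "V \<subseteq> span E"
    using maximal_independent_subset_extend[of D V] D assms(2) by (metis subset_trans)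
  have "finite E" using independent_span_bound[OF assms(3) E(3)] E(2) assms(4) by blast
  moreover have "span D = U" using D assms(1) span_minimal[of D U] by blast
  moreover have "(E - D) \<union> D = E" using E(1) by blast
  ultimately show ?thesis using that[of "E - D" D] E by auto
qed

section \<open>Graded free modules\<close>

interpretation fsc: module "fscale :: 'r::comm_ring_1 \<Rightarrow> ('x \<Rightarrow>\<^sub>0 'r) \<Rightarrow> _"
  by (rule module_fscale)

lemma koszul_ops_times_Var: "koszul_ops (\<lambda>k (p :: ('n::{finite, linorder}, 'k::comm_ring_1) mpoly). Var k * p)"
  by unfold_locales (auto simp: distrib_left mult.left_commute)

text \<open>Coordinates are filled separately; those where the cycle vanishes receive zero, so the
  filling has finite support.\<close>

lemma kexact_pointwise:
  fixes g :: "'x \<Rightarrow> int \<Rightarrow> ('n::{finite, linorder}, 'k::field) mpoly set"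
  assumes ex: "\<And>x. kexact (\<lambda>k p. Var k * p) (g x) i j" and z: "\<And>x j. 0 \<in> g x j"
  shows "kexact (\<lambda>k. fscale (Var k)) (\<lambda>j. {z. \<forall>x. lookup z x \<in> g x j}) i j"
    (is "kexact _ ?gr i j")
  unfolding kexact_def
proof (intro ballI impI)
  fix \<kappa> :: "'n set \<Rightarrow> ('x \<Rightarrow>\<^sub>0 ('n, 'k) mpoly)"
  assume \<kappa>: "\<kappa> \<in> kcomp ?gr i j" "kd (\<lambda>k. fscale (Var k)) \<kappa> = (\<lambda>_. 0)"
  have kl: "kd (\<lambda>k p. Var k * p) (\<lambda>\<sigma>. lookup (\<mu> \<sigma>) x) \<rho> = lookup (kd (\<lambda>k. fscale (Var k)) \<mu> \<rho>) x"
    for \<mu> :: "'n set \<Rightarrow> ('x \<Rightarrow>\<^sub>0 ('n, 'k) mpoly)" and x \<rho>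
  proof -
    have "lookup (ksgn k \<rho> u) x = ksgn k \<rho> (lookup u x)" for k and u :: "'x \<Rightarrow>\<^sub>0 ('n, 'k) mpoly"
      by (simp add: ksgn_def)
    then show ?thesis by (simp add: kd_def lookup_sum lookup_fscale)
  qed
  interpret V: koszul_ops "\<lambda>k (p :: ('n, 'k) mpoly). Var k * p" by (rule koszul_ops_times_Var)
  have "\<exists>e. e \<in> kcomp (g x) (Suc i) j \<and> kd (\<lambda>k p. Var k * p) e = (\<lambda>\<sigma>. lookup (\<kappa> \<sigma>) x) \<and>
      ((\<forall>\<sigma>. lookup (\<kappa> \<sigma>) x = 0) \<longrightarrow> e = (\<lambda>_. 0))" for x
  proof (cases "\<forall>\<sigma>. lookup (\<kappa> \<sigma>) x = 0")
    case True
    then show ?thesis using z by (intro exI[of _ "\<lambda>_. 0"]) (simp add: kcomp_def)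
  next
    case False
    have m: "(\<lambda>\<sigma>. lookup (\<kappa> \<sigma>) x) \<in> kcomp (g x) i j"
      unfolding kcomp_def
    proof (intro CollectI allI)
      fix \<sigma> :: "'n set"
      show "if card \<sigma> = i then lookup (\<kappa> \<sigma>) x \<in> g x (j - int i) else lookup (\<kappa> \<sigma>) x = 0"
        using kcomp_mem[OF \<kappa>(1), of \<sigma>] kcomp_zero_off[OF \<kappa>(1), of \<sigma>] by auto
    qed
    have "kd (\<lambda>k p. Var k * p) (\<lambda>\<sigma>. lookup (\<kappa> \<sigma>) x) = (\<lambda>_. 0)"
      by (rule ext) (simp add: kl \<kappa>(2))
    from kexactD[OF ex m this] False show ?thesis by blast
  qed
  then obtain e where e: "\<And>x. e x \<in> kcomp (g x) (Suc i) j"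
    "\<And>x. kd (\<lambda>k p. Var k * p) (e x) = (\<lambda>\<sigma>. lookup (\<kappa> \<sigma>) x)"
    "\<And>x. (\<forall>\<sigma>. lookup (\<kappa> \<sigma>) x = 0) \<Longrightarrow> e x = (\<lambda>_. 0)"
    by metis
  define A where "A = (\<Union>\<sigma>. keys (\<kappa> \<sigma>))"
  have A: "finite A" "\<And>x. x \<notin> A \<Longrightarrow> e x = (\<lambda>_. 0)"
    using e(3) by (auto simp: A_def in_keys_iff)
  define \<eta> where "\<eta> = (\<lambda>\<sigma>. \<Sum>x\<in>A. single x (e x \<sigma>))"
  have l: "lookup (\<eta> \<sigma>) x = e x \<sigma>" for \<sigma> x
    using A by (auto simp: \<eta>_def lookup_sum lookup_single when_def)
  have "\<eta> \<in> kcomp ?gr (Suc i) j"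
    unfolding kcomp_def
  proof (intro CollectI allI)
    fix \<sigma> :: "'n set"
    show "if card \<sigma> = Suc i then \<eta> \<sigma> \<in> ?gr (j - int (Suc i)) else \<eta> \<sigma> = 0"
      using kcomp_mem[OF e(1), of \<sigma>] kcomp_zero_off[OF e(1), of \<sigma>]
      by (auto simp: l intro: poly_mapping_eqI)
  qed
  moreover have "kd (\<lambda>k. fscale (Var k)) \<eta> = \<kappa>"
  proof (rule ext, rule poly_mapping_eqI)
    fix \<rho> :: "'n set" and x
    have "lookup (kd (\<lambda>k. fscale (Var k)) \<eta> \<rho>) x = kd (\<lambda>k p. Var k * p) (e x) \<rho>"
      by (simp only: kl[symmetric] l)
    also have "\<dots> = lookup (\<kappa> \<rho>) x" by (simp only: e(2))
    finally show "lookup (kd (\<lambda>k. fscale (Var k)) \<eta> \<rho>) x = lookup (\<kappa> \<rho>) x" .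
  qed
  ultimately show "\<exists>\<eta>\<in>kcomp ?gr (Suc i) j. kd (\<lambda>k. fscale (Var k)) \<eta> = \<kappa>" by blast
qed

definition hpart :: "int \<Rightarrow> ('n, 'k::comm_ring_1) mpoly \<Rightarrow> ('n, 'k) mpoly" where
  "hpart d p = (\<Sum>m | m \<in> keys p \<and> int (mon_degree m) = d. single m (lookup p m))"

lemma lookup_hpart: "lookup (hpart d p) m = (if int (mon_degree m) = d then lookup p m else 0)"
proof -
  have "lookup (hpart d p) m = (\<Sum>m' | m' \<in> keys p \<and> int (mon_degree m') = d. if m' = m then lookup p m' else 0)"
    by (simp add: hpart_def lookup_sum lookup_single when_def)
  then show ?thesis by (simp add: in_keys_iff)
qed

lemma hpart_add: "hpart d (p + q) = hpart d p + hpart d q"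
  by (rule poly_mapping_eqI) (simp add: lookup_hpart lookup_add)

lemma hpart_homog: "hpart d p \<in> homog d"
  by (auto simp: homog_def in_keys_iff lookup_hpart split: if_splits)

lemma hpart_of_homog: "p \<in> homog e \<Longrightarrow> hpart d p = (if e = d then p else 0)"
  by (rule poly_mapping_eqI) (auto simp: lookup_hpart homog_def in_keys_iff)

lemma homog_zero [simp]: "0 \<in> homog d"
  by (simp add: homog_def)

lemma homog_add: "p \<in> homog d \<Longrightarrow> q \<in> homog d \<Longrightarrow> p + q \<in> homog d"
  unfolding homog_def using keys_add[of p q] by blast

lemma homog_Const_times: "p \<in> homog d \<Longrightarrow> Const c * p \<in> homog d"
  by (auto simp: homog_def in_keys_iff lookup_Const_times)

lemma homog_Var_times: "p \<in> homog d \<Longrightarrow> Var k * p \<in> homog (d + 1)"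
  for p :: "('n::{finite, linorder}, 'k::field) mpoly"
proof -
  assume p: "p \<in> homog d"
  interpret koszul_fam "ymul UNIV :: 'n \<Rightarrow> ('n, 'k) mpoly \<Rightarrow> _" "mons (UNIV \<inter> UNIV) True"
    by (rule koszul_fam_mons) (auto simp: downset_def upset_def)
  show ?thesis using fam_op[of p d k] p by (simp add: mons_UNIV_homog ymul_UNIV)
qed

definition gpr :: "int list \<Rightarrow> int \<Rightarrow> (nat \<Rightarrow>\<^sub>0 ('n, 'k::comm_ring_1) mpoly) \<Rightarrow> (nat \<Rightarrow>\<^sub>0 ('n, 'k) mpoly)" where
  "gpr a j x = (\<Sum>k<length a. single k (hpart (j - a ! k) (lookup x k)))"

lemma lookup_gpr: "lookup (gpr a j x) k = (if k < length a then hpart (j - a ! k) (lookup x k) else 0)"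
  by (simp add: gpr_def lookup_sum lookup_single when_def)

lemma gfree_iff: "x \<in> gfree a \<longleftrightarrow> (\<forall>k\<ge>length a. lookup x k = 0)"
  unfolding gfree_def by (auto simp: in_keys_iff) (metis not_le)

lemma gfree_comp_iff: "x \<in> gfree_comp a j \<longleftrightarrow> (\<forall>k. lookup x k \<in> (if k < length a then homog (j - a ! k) else {0}))"
  unfolding gfree_comp_def gfree_iff by (auto simp: not_less)

lemma gfree_subspace: "fsc.subspace (gfree a)"
  by (simp add: fsc.subspace_def gfree_iff lookup_add lookup_fscale)

lemma gmod_gfree:
  "gmod fscale (gfree a) (gfree_comp a) (gpr a :: _ \<Rightarrow> (nat \<Rightarrow>\<^sub>0 ('n::{finite, linorder}, 'k::field) mpoly) \<Rightarrow> _)"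
proof unfold_locales
  fix x y :: "nat \<Rightarrow>\<^sub>0 ('n, 'k) mpoly" and i j :: int and c :: 'k and k :: 'n
  show "fsc.subspace (gfree a)" by (rule gfree_subspace)
  show "gfree_comp a j \<subseteq> (gfree a :: (nat \<Rightarrow>\<^sub>0 ('n, 'k) mpoly) set)" by (auto simp: gfree_comp_def)
  show "0 \<in> gfree_comp a j" by (simp add: gfree_comp_iff)
  show "x + y \<in> gfree_comp a j" if "x \<in> gfree_comp a j" "y \<in> gfree_comp a j"
    unfolding gfree_comp_iff
  proof
    fix k show "lookup (x + y) k \<in> (if k < length a then homog (j - a ! k) else {0})"
      using that[unfolded gfree_comp_iff, THEN spec, of k] by (auto simp: lookup_add homog_add)
  qed
  show "fscale (Const c) x \<in> gfree_comp a j" if "x \<in> gfree_comp a j"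
    unfolding gfree_comp_iff
  proof
    fix k show "lookup (fscale (Const c) x) k \<in> (if k < length a then homog (j - a ! k) else {0})"
      using that[unfolded gfree_comp_iff, THEN spec, of k] by (auto simp: lookup_fscale homog_Const_times)
  qed
  show "fscale (Var k) x \<in> gfree_comp a (j + 1)" if "x \<in> gfree_comp a j"
    unfolding gfree_comp_iff
  proof
    fix l
    have e: "j + 1 - a ! l = j - a ! l + 1" by simp
    show "lookup (fscale (Var k) x) l \<in> (if l < length a then homog (j + 1 - a ! l) else {0})"
      using that[unfolded gfree_comp_iff, THEN spec, of l] unfolding e by (auto simp: lookup_fscale homog_Var_times)
  qed
  show "gpr a j x \<in> gfree_comp a j" by (simp add: gfree_comp_iff lookup_gpr hpart_homog)
  show "gpr a j (x + y) = gpr a j x + gpr a j y"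
    by (rule poly_mapping_eqI) (simp add: lookup_gpr lookup_add hpart_add)
  show "gpr a j x = (if i = j then x else 0)" if "x \<in> gfree_comp a i"
  proof (rule poly_mapping_eqI)
    fix k show "lookup (gpr a j x) k = lookup (if i = j then x else 0) k"
      using that[unfolded gfree_comp_iff, THEN spec, of k] by (auto simp: lookup_gpr hpart_of_homog)
  qed
  define D where "D = (\<Union>k<length a. (\<lambda>m. int (mon_degree m) + a ! k) ` keys (lookup x k))"
  have DI: "int (mon_degree m) + a ! k \<in> D" if "k < length a" "lookup (lookup x k) m \<noteq> 0" for k m
    using that unfolding D_def by (intro UN_I[of k] imageI) (auto simp: in_keys_iff)
  have D: "gpr a j x = 0" if "j \<notin> D" for j
  proof (intro poly_mapping_eqI)
    fix k m
    have "int (mon_degree m) \<noteq> j - a ! k" if "k < length a" "lookup (lookup x k) m \<noteq> 0" for m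
      using DI[OF that] \<open>j \<notin> D\<close> by auto
    then show "lookup (lookup (gpr a j x) k) m = lookup (lookup 0 k) m"
      by (auto simp: lookup_gpr lookup_hpart)
  qed
  have fD: "finite D" by (simp add: D_def)
  show fin: "finite {j. gpr a j x \<noteq> 0}"
    by (rule finite_subset[OF _ fD]) (use D in auto)
  assume x: "x \<in> gfree a"
  have "(\<Sum>j | gpr a j x \<noteq> 0. gpr a j x) = (\<Sum>j\<in>D. gpr a j x)"
    using fD D by (intro sum.mono_neutral_left) auto
  also have "\<dots> = x"
  proof (intro poly_mapping_eqI)
    fix k m
    show "lookup (lookup (\<Sum>j\<in>D. gpr a j x) k) m = lookup (lookup x k) m"
    proof (cases "k < length a \<and> lookup (lookup x k) m \<noteq> 0")
      case True
      have "lookup (lookup (\<Sum>j\<in>D. gpr a j x) k) m =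
          (\<Sum>j\<in>D. if j = int (mon_degree m) + a ! k then lookup (lookup x k) m else 0)"
        unfolding lookup_sum using True by (intro sum.cong) (auto simp: lookup_gpr lookup_hpart)
      also have "(\<Sum>j\<in>D. if j = int (mon_degree m) + a ! k then lookup (lookup x k) m else 0) = lookup (lookup x k) m"
        using fD DI True by simp
      finally show ?thesis .
    next
      case False
      then have "lookup (lookup x k) m = 0" using x[unfolded gfree_iff, rule_format, of k] by (cases "k < length a") auto
      then show ?thesis by (auto simp: lookup_sum lookup_gpr lookup_hpart intro!: sum.neutral)
    qed
  qed
  finally show "(\<Sum>j | gpr a j x \<noteq> 0. gpr a j x) = x" .
qed

lemma kexact_gfree_comp:
  assumes "i > 0"
  shows "kexact (\<lambda>k. fscale (Var k)) (gfree_comp a :: int \<Rightarrow> (nat \<Rightarrow>\<^sub>0 ('n::{finite, linorder}, 'k::field) mpoly) set) i j"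
proof -
  let ?g = "\<lambda>k j. if k < length a then homog (j - a ! k) else {0 :: ('n, 'k) mpoly}"
  have kc: "kcomp (?g k) n d = kcomp homog n (d - a ! k)" if "k < length a" for k n d
    using that by (auto simp: kcomp_def algebra_simps)
  have "kexact (\<lambda>k p. Var k * p) (?g k) i j" for k
  proof (cases "k < length a")
    case True
    have "kexact (\<lambda>k p. Var k * p) (homog :: int \<Rightarrow> ('n, 'k) mpoly set) i (j - a ! k)"
      using kexact_polynomials[OF assms, of True] by (simp add: mons_UNIV_homog[abs_def])
    then show ?thesis unfolding kexact_def kc[OF True] .
  next
    case False
    then have "\<kappa> = (\<lambda>_. 0)" if "\<kappa> \<in> kcomp (?g k) i j" for \<kappa> :: "'n set \<Rightarrow> ('n, 'k) mpoly"
      using that by (auto simp: kcomp_def fun_eq_iff split: if_splits)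
    moreover have "(\<lambda>_. 0) \<in> kcomp (?g k) (Suc i) j" by (auto simp: kcomp_def)
    ultimately show ?thesis unfolding kexact_def by (auto simp: kd_def intro!: bexI[of _ "\<lambda>_. 0"])
  qed
  then have "kexact (\<lambda>k. fscale (Var k)) (\<lambda>j. {z. \<forall>k. lookup z k \<in> ?g k j}) i j"
    by (rule kexact_pointwise) simp
  moreover have "(\<lambda>j. {z. \<forall>k. lookup z k \<in> ?g k j}) = gfree_comp a"
    by (intro ext set_eqI) (simp only: mem_Collect_eq gfree_comp_iff)
  ultimately show ?thesis by simp
qed

lemma kexact_free_module:
  assumes "i > 0"
  shows "kexact (\<lambda>k. fscale (Var k)) (\<lambda>_. UNIV :: ('x \<Rightarrow>\<^sub>0 ('n::{finite, linorder}, 'k::field) mpoly) set) i j"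
  using kexact_pointwise[of "\<lambda>_ :: 'x. mons UNIV False :: int \<Rightarrow> ('n, 'k) mpoly set" i j]
    kexact_polynomials[OF assms, of False j]
  by (simp add: mons_UNIV_False[abs_def])

text \<open>Each nonconstant monomial is divided by its least variable and by no other, which makes
  the decomposition in \<open>vdiv_decompose\<close> canonical.\<close>

definition vdiv :: "'n::{finite, linorder} \<Rightarrow> ('n, 'k::comm_ring_1) mpoly \<Rightarrow> ('n, 'k) mpoly" where
  "vdiv k p = (\<Sum>m | m \<in> keys p \<and> m \<noteq> 0 \<and> Min (keys m) = k. single (m - single k 1) (lookup p m))"

lemma vdiv_decompose: "p = Const (lookup p 0) + (\<Sum>k\<in>UNIV. Var k * vdiv k p)"
proof -
  have "(\<Sum>k\<in>UNIV. Var k * vdiv k p) = (\<Sum>k\<in>UNIV. \<Sum>m | m \<in> {m\<in>keys p. m \<noteq> 0} \<and> Min (keys m) = k. single m (lookup p m))"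
  proof (intro sum.cong refl)
    fix k :: 'a
    have "Var k * single (m - single k 1) (lookup p m) = single m (lookup p m)"
      if "m \<in> keys p" "m \<noteq> 0" "Min (keys m) = k" for m
    proof -
      have "keys m \<noteq> {}" using that(2) by simp
      then have "k \<in> keys m" using Min_in[of "keys m"] that(3) by simp
      then have "lookup m k \<noteq> 0" by (simp add: in_keys_iff)
      then show ?thesis by (simp only: Var_times_single mon_diff_add[OF \<open>lookup m k \<noteq> 0\<close>])
    qed
    then show "Var k * vdiv k p = (\<Sum>m | m \<in> {m\<in>keys p. m \<noteq> 0} \<and> Min (keys m) = k. single m (lookup p m))"
      unfolding vdiv_def sum_distrib_left by (intro sum.cong) auto
  qed
  also have "\<dots> = (\<Sum>m | m \<in> keys p \<and> m \<noteq> 0. single m (lookup p m))"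
    by (rule sum.group) auto
  also have "Const (lookup p 0) + \<dots> = (\<Sum>m\<in>keys p. single m (lookup p m))"
  proof (cases "0 \<in> keys p")
    case True
    then have "keys p = insert 0 {m \<in> keys p. m \<noteq> 0}" by auto
    then have "(\<Sum>m\<in>keys p. single m (lookup p m)) = (\<Sum>m\<in>insert 0 {m \<in> keys p. m \<noteq> 0}. single m (lookup p m))"
      by (rule arg_cong)
    then show ?thesis by (simp add: Const_def)
  next
    case False
    then have "keys p = {m \<in> keys p. m \<noteq> 0}" by auto
    with False show ?thesis by (simp add: Const_def in_keys_iff)
  qed
  finally show ?thesis by (simp only: poly_expand[symmetric])
qed

lemma vdiv_homog:
  fixes p :: "('n::{finite, linorder}, 'k::comm_ring_1) mpoly"
  assumes "p \<in> homog d"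
  shows "vdiv k p \<in> homog (d - 1)"
  unfolding vdiv_def
proof -
  have z: "sum f A \<in> homog (d - 1)" if "\<And>m. m \<in> A \<Longrightarrow> f m \<in> homog (d - 1)" for f :: "_ \<Rightarrow> ('n, 'k) mpoly" and A :: "('n \<Rightarrow>\<^sub>0 nat) set"
    using that by (induction A rule: infinite_finite_induct) (auto intro: homog_add)
  show "(\<Sum>m | m \<in> keys p \<and> m \<noteq> 0 \<and> Min (keys m) = k. single (m - single k 1) (lookup p m)) \<in> homog (d - 1)"
  proof (rule z)
    fix m assume m: "m \<in> {m. m \<in> keys p \<and> m \<noteq> 0 \<and> Min (keys m) = k}"
    then have "keys m \<noteq> {}" by simp
    then have "k \<in> keys m" using Min_in[OF finite_keys, of m] m by auto
    then have "m - single k 1 + single k 1 = m" by (intro mon_diff_add) (simp add: in_keys_iff)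
    from arg_cong[OF this, of mon_degree]
    have "mon_degree m = mon_degree (m - single k 1) + 1" by (simp only: mon_degree_add mon_degree_single)
    moreover have "int (mon_degree m) = d" using m assms by (simp add: homog_def)
    ultimately show "single (m - single k 1) (lookup p m) \<in> homog (d - 1)"
      by (simp add: homog_def)
  qed
qed

text \<open>The maximal ideal times a free module is cut out by the vanishing of the constant terms;
  the division by \<open>vdiv\<close> respects the grading.\<close>

lemma gfree_comp_dec_iff:
  fixes x :: "nat \<Rightarrow>\<^sub>0 ('n::{finite, linorder}, 'k::field) mpoly"
  assumes x: "x \<in> gfree_comp a j"
  shows "(\<exists>w. (\<forall>k. w k \<in> gfree_comp a (j - 1)) \<and> x = (\<Sum>k\<in>UNIV. fscale (Var k) (w k))) \<longleftrightarrow>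
    (\<forall>l. lookup (lookup x l) 0 = 0)"
proof
  assume "\<exists>w. (\<forall>k. w k \<in> gfree_comp a (j - 1)) \<and> x = (\<Sum>k\<in>UNIV. fscale (Var k) (w k))"
  then obtain w where w: "x = (\<Sum>k\<in>UNIV. fscale (Var k) (w k))" by blast
  have "lookup (lookup x l) 0 = (\<Sum>k\<in>UNIV. lookup (Var k * lookup (w k) l) 0)" for l
    by (simp add: w lookup_sum lookup_fscale)
  then show "\<forall>l. lookup (lookup x l) 0 = 0" by (simp add: lookup_Var_times)
next
  assume z: "\<forall>l. lookup (lookup x l) 0 = 0"
  define w where "w = (\<lambda>k. \<Sum>l<length a. single l (vdiv k (lookup x l)))"
  have lw: "lookup (w k) l = (if l < length a then vdiv k (lookup x l) else 0)" for k l
    by (simp add: w_def lookup_sum lookup_single when_def)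
  have "w k \<in> gfree_comp a (j - 1)" for k
    unfolding gfree_comp_iff
  proof
    fix l
    have e: "j - 1 - a ! l = j - a ! l - 1" by simp
    show "lookup (w k) l \<in> (if l < length a then homog (j - 1 - a ! l) else {0})"
      using x[unfolded gfree_comp_iff, THEN spec, of l] unfolding e by (auto simp: lw vdiv_homog)
  qed
  moreover have "x = (\<Sum>k\<in>UNIV. fscale (Var k) (w k))"
  proof (rule poly_mapping_eqI)
    fix l
    show "lookup x l = lookup (\<Sum>k\<in>UNIV. fscale (Var k) (w k)) l"
    proof (cases "l < length a")
      case True
      have "lookup x l = Const (lookup (lookup x l) 0) + (\<Sum>k\<in>UNIV. Var k * vdiv k (lookup x l))"
        by (rule vdiv_decompose)
      then show ?thesis using True z by (simp add: lookup_sum lookup_fscale lw)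
    next
      case False
      then show ?thesis using x[unfolded gfree_comp_iff, THEN spec, of l] by (simp add: lookup_sum lookup_fscale lw)
    qed
  qed
  ultimately show "\<exists>w. (\<forall>k. w k \<in> gfree_comp a (j - 1)) \<and> x = (\<Sum>k\<in>UNIV. fscale (Var k) (w k))" by blast
qed

lemma lookup_le_mon_degree: "lookup m i \<le> mon_degree (m :: 'n::finite \<Rightarrow>\<^sub>0 nat)"
  unfolding mon_degree_UNIV by (rule member_le_sum) auto

lemma finite_mon_degree: "finite {m :: 'n::finite \<Rightarrow>\<^sub>0 nat. mon_degree m = d}"
proof -
  have fin: "finite {f :: 'n \<Rightarrow> nat. \<forall>i. f i \<in> {..d}}"
    using finite_set_of_finite_funs[of "UNIV :: 'n set" "{..d}" 0] by simp
  have sub: "lookup ` {m :: 'n \<Rightarrow>\<^sub>0 nat. mon_degree m = d} \<subseteq> {f. \<forall>i. f i \<in> {..d}}"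
  proof (intro image_subsetI CollectI allI)
    fix m :: "'n \<Rightarrow>\<^sub>0 nat" and i assume "m \<in> {m. mon_degree m = d}"
    then show "lookup m i \<in> {..d}" using lookup_le_mon_degree[of m i] by simp
  qed
  have inj: "inj_on lookup {m :: 'n \<Rightarrow>\<^sub>0 nat. mon_degree m = d}"
    by (rule inj_onI) (rule poly_mapping_eq_iff[THEN iffD2])
  show ?thesis by (rule finite_imageD[OF finite_subset[OF sub fin] inj])
qed

text \<open>Syzygies inherit this finiteness, so minimal generators of each degree are finite in
  number.\<close>

lemma gfree_comp_finite_dim:
  "\<exists>B. finite B \<and> (gfree_comp a j :: (nat \<Rightarrow>\<^sub>0 ('n::{finite, linorder}, 'k::field) mpoly) set) \<subseteq> module.span (\<lambda>c. fscale (Const c)) B"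
proof -
  interpret gmod fscale "gfree a" "gfree_comp a" "gpr a :: _ \<Rightarrow> (nat \<Rightarrow>\<^sub>0 ('n, 'k) mpoly) \<Rightarrow> _"
    by (rule gmod_gfree)
  define B where "B = (\<Union>l<length a. (\<lambda>m. single l (single m (1 :: 'k))) ` {m :: 'n \<Rightarrow>\<^sub>0 nat. mon_degree m = nat (j - a ! l)})"
  have "finite B" by (simp add: B_def finite_mon_degree)
  moreover have "x \<in> kv.span B" if x: "x \<in> gfree_comp a j" for x
  proof -
    have "single l (lookup x l) \<in> kv.span B" if l: "l < length a" for l
    proof -
      have "single l (lookup x l) = (\<Sum>m\<in>keys (lookup x l). fscale (Const (lookup (lookup x l) m)) (single l (single m 1)))"
      proof (rule poly_mapping_eqI)
        fix k
        show "lookup (single l (lookup x l)) k = lookup (\<Sum>m\<in>keys (lookup x l). fscale (Const (lookup (lookup x l) m)) (single l (single m 1))) k"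
          by (cases "k = l") (simp_all add: lookup_sum lookup_fscale lookup_single single_eq_Const_times[symmetric] poly_expand[symmetric])
      qed
      also have "\<dots> \<in> kv.span B"
      proof (intro kv.span_sum kv.span_scale kv.span_base)
        fix m assume "m \<in> keys (lookup x l)"
        then have "int (mon_degree m) = j - a ! l"
          using x[unfolded gfree_comp_iff, THEN spec, of l] l by (simp add: homog_def)
        then show "single l (single m 1) \<in> B" using l unfolding B_def by force
      qed
      finally show ?thesis .
    qed
    then have "(\<Sum>l<length a. single l (lookup x l)) \<in> kv.span B" by (intro kv.span_sum) simp
    also have "(\<Sum>l<length a. single l (lookup x l)) = x"
    proof (rule poly_mapping_eqI)
      fix k
      show "lookup (\<Sum>l<length a. single l (lookup x l)) k = lookup x k"
        using x[unfolded gfree_comp_iff, THEN spec, of k] by (auto simp: lookup_sum lookup_single when_def)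
    qed
    finally show ?thesis .
  qed
  ultimately show ?thesis by blast
qed

section \<open>Minimal graded free resolutions\<close>

locale gepi = F: gmod t F gF pF + M: gmod s M gM pM
  for t :: "('n::{finite, linorder}, 'k::field) mpoly \<Rightarrow> 'b::ab_group_add \<Rightarrow> 'b" and F gF pF
    and s :: "('n, 'k) mpoly \<Rightarrow> 'a::ab_group_add \<Rightarrow> 'a" and M gM pM +
  fixes h :: "'b \<Rightarrow> 'a"
  assumes hom: "module_hom_on t s F M h"
    and surj: "h ` F = M"
    and graded: "h ` gF j \<subseteq> gM j"
begin

lemma h_add: "x \<in> F \<Longrightarrow> y \<in> F \<Longrightarrow> h (x + y) = h x + h y"
  using hom by (simp add: module_hom_on_def)

lemma h_scale: "x \<in> F \<Longrightarrow> h (t r x) = s r (h x)"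
  using hom by (simp add: module_hom_on_def)

lemma h_zero: "h 0 = 0"
  using h_add[of 0 0] F.subspace_0[OF F.M_subspace] by simp

lemma h_sum: "(\<And>x. x \<in> A \<Longrightarrow> f x \<in> F) \<Longrightarrow> h (\<Sum>x\<in>A. f x) = (\<Sum>x\<in>A. h (f x))"
proof (induction A rule: infinite_finite_induct)
  case (insert x A)
  then have "(\<Sum>x\<in>A. f x) \<in> F" by (intro F.subspace_sum[OF F.M_subspace]) auto
  with insert show ?case by (simp add: h_add)
qed (auto simp: h_zero)

lemma h_pr:
  assumes x: "x \<in> F"
  shows "h (pF j x) = pM j (h x)"
proof -
  let ?A = "{i. pF i x \<noteq> 0}"
  have g: "h (pF i x) \<in> gM i" for i using graded F.pr_mem[OF x] by blast
  have "pM j (h x) = pM j (h (\<Sum>i\<in>?A. pF i x))" by (simp only: F.pr_sum[OF x])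
  also have "\<dots> = pM j (\<Sum>i\<in>?A. h (pF i x))"
    by (simp only: h_sum[OF F.pr_M[OF x]])
  also have "\<dots> = (\<Sum>i\<in>?A. pM j (h (pF i x)))"
    using g M.gr_sub by (intro M.pr_sum_fun) blast
  also have "\<dots> = (\<Sum>i\<in>?A. if i = j then h (pF i x) else 0)"
    by (intro sum.cong refl) (simp add: M.pr_gr[OF g])
  also have "\<dots> = h (pF j x)"
    using F.pr_finite[OF x] by (simp add: h_zero)
  finally show ?thesis ..
qed

lemma graded_surj: "h ` gF j = gM j"
proof
  show "gM j \<subseteq> h ` gF j"
  proof
    fix y assume y: "y \<in> gM j"
    then obtain x where x: "x \<in> F" "y = h x" using M.gr_sub surj by blast
    have "y = pM j y" using M.pr_gr[OF y] by simp
    also have "\<dots> = h (pF j x)" by (simp only: x(2) h_pr[OF x(1)])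
    finally show "y \<in> h ` gF j" using F.pr_mem[OF x(1)] by blast
  qed
qed (rule graded)

sublocale K: koszul_epi "\<lambda>k. t (Var k)" gF "\<lambda>k. s (Var k)" gM h
proof
  fix a b j k
  show "h (a + b) = h a + h b" if "a \<in> gF j" "b \<in> gF j"
    using that F.gr_sub h_add by blast
  show "h (t (Var k) a) = s (Var k) (h a)" if "a \<in> gF j"
    using that F.gr_sub h_scale by blast
  show "h ` gF j = gM j" by (rule graded_surj)
qed

lemma gmod_ker: "gmod t {x \<in> F. h x = 0} K.gK pF"
proof (unfold_locales)
  fix x y :: 'b and i j :: int and c :: 'k and k :: 'n
  let ?Z = "{x \<in> F. h x = 0}"
  show "F.subspace ?Z"
    unfolding F.subspace_def
    by (auto simp: F.subspace_0 F.subspace_add F.subspace_scale F.M_subspace h_zero h_add h_scale)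
  show "K.gK j \<subseteq> ?Z" using F.gr_sub by (auto simp: K.gK_def)
  show "0 \<in> K.gK j" by (simp add: K.gK_def F.gr_zero h_zero)
  show "x + y \<in> K.gK j" if "x \<in> K.gK j" "y \<in> K.gK j"
    using that K.h_add[of x j y] by (simp add: K.gK_def F.gr_add)
  show "t (Const c) x \<in> K.gK j" if "x \<in> K.gK j"
    using that F.gr_sub[of j] h_scale[of x "Const c"] by (auto simp: K.gK_def F.gr_Const)
  show "t (Var k) x \<in> K.gK (j + 1)" if "x \<in> K.gK j"
    using that K.h_op[of x j k] by (simp add: K.gK_def F.gr_Var)
  show "pF j x = (if i = j then x else 0)" if "x \<in> K.gK i"
    using that F.pr_gr by (simp add: K.gK_def)
  assume x: "x \<in> ?Z"
  show "pF j x \<in> K.gK j" using x F.pr_mem by (simp add: K.gK_def h_pr)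
  show "pF j (x + y) = pF j x + pF j y" if "y \<in> ?Z" using x that F.pr_add by simp
  show "finite {j. pF j x \<noteq> 0}" using x F.pr_finite by simp
  show "(\<Sum>j | pF j x \<noteq> 0. pF j x) = x" using x F.pr_sum by simp
qed

end

text \<open>Graded Nakayama: representatives of bases of \<open>gr j\<close> modulo
  \<open>dec j\<close> generate M by induction on the degree, and degrees above N contribute none. A
  relation with a nonzero constant coefficient would contradict independence modulo
  \<open>dec j\<close>, so the kernel has no constant terms.\<close>

theorem (in gmod) minimal_cover:
  assumes fd: "\<And>j. \<exists>B. finite B \<and> gr j \<subseteq> kv.span B"
    and low: "\<And>j. j < 0 \<Longrightarrow> gr j = {0}"
    and high: "\<And>j. j > N \<Longrightarrow> kexact (\<lambda>k. s (Var k)) gr 0 j"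
  shows "\<exists>a \<epsilon>. (\<forall>d\<in>set a. 0 \<le> d \<and> \<not> kexact (\<lambda>k. s (Var k)) gr 0 d) \<and>
    gepi fscale (gfree a) (gfree_comp a) (gpr a) s M gr pr \<epsilon> \<and>
    (\<forall>x\<in>gfree a. \<epsilon> x = 0 \<longrightarrow> (\<forall>k. lookup (lookup x k) 0 = 0))"
proof -
  have "\<exists>C D. finite C \<and> C \<inter> D = {} \<and> kv.independent (C \<union> D) \<and> kv.span D = dec j \<and>
      C \<subseteq> gr j \<and> gr j \<subseteq> kv.span (C \<union> D)" for j
  proof -
    obtain B where "finite B" "gr j \<subseteq> kv.span B" using fd by blast
    from kv.extend_basis_within[OF dec_ksubspace dec_sub_gr this] show ?thesis by metis
  qed
  then obtain C D where CD: "\<And>j. finite (C j)" "\<And>j. C j \<inter> D j = {}" "\<And>j. kv.independent (C j \<union> D j)"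
    "\<And>j. kv.span (D j) = dec j" "\<And>j. C j \<subseteq> gr j" "\<And>j. gr j \<subseteq> kv.span (C j \<union> D j)"
    by metis
  have "finite (SIGMA j:{0..N}. C j)" using CD(1) by simp
  then obtain L where L: "set L = (SIGMA j:{0..N}. C j)" "distinct L"
    using finite_distinct_list by blast
  define a where "a = map fst L"
  define b where "b = (\<lambda>i. snd (L ! i))"
  have len: "length a = length L" by (simp add: a_def)
  have Li: "0 \<le> a ! i \<and> a ! i \<le> N \<and> b i \<in> C (a ! i)" if "i < length a" for i
  proof -
    have "L ! i \<in> set L" using that len by simp
    then show ?thesis using that len by (auto simp: L(1) a_def b_def)
  qed
  have bg: "b i \<in> gr (a ! i)" if "i < length a" for i using Li[OF that] CD(5) by blast
  have bM: "b i \<in> M" if "i < length a" for i using bg[OF that] gr_sub by blast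
  have Lex: "\<exists>i<length a. a ! i = j \<and> b i = y" if "0 \<le> j" "j \<le> N" "y \<in> C j" for j y
  proof -
    have "(j, y) \<in> set L" using that by (simp add: L(1))
    then obtain i where "i < length L" "L ! i = (j, y)" by (auto simp: in_set_conv_nth)
    then show ?thesis by (intro exI[of _ i]) (simp add: a_def b_def)
  qed
  define \<epsilon> where "\<epsilon> = (\<lambda>x. \<Sum>i<length a. s (lookup x i) (b i))"
  have \<epsilon>_add: "\<epsilon> (x + y) = \<epsilon> x + \<epsilon> y" for x y
    by (simp add: \<epsilon>_def lookup_add scale_left_distrib sum.distrib)
  have \<epsilon>_scale: "\<epsilon> (fscale r x) = s r (\<epsilon> x)" for r x
    by (simp add: \<epsilon>_def lookup_fscale scale_sum_right)
  have \<epsilon>_M: "\<epsilon> x \<in> M" for x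
    unfolding \<epsilon>_def using bM by (intro subspace_sum[OF M_subspace] subspace_scale[OF M_subspace]) simp
  have \<epsilon>_gr: "\<epsilon> x \<in> gr j" if "x \<in> gfree_comp a j" for x j
    unfolding \<epsilon>_def
  proof (rule G.fam_sum)
    fix i assume "i \<in> {..<length a}"
    then have i: "i < length a" by simp
    then have "lookup x i \<in> homog (j - a ! i)" using that[unfolded gfree_comp_iff, THEN spec, of i] by simp
    from gr_scale[OF this bg[OF i]] show "s (lookup x i) (b i) \<in> gr j" by simp
  qed
  define R where "R = \<epsilon> ` gfree a"
  have R_add: "x + y \<in> R" if "x \<in> R" "y \<in> R" for x y
    using that fsc.subspace_add[OF gfree_subspace[of a]] unfolding R_def by (auto simp: \<epsilon>_add[symmetric] intro!: imageI)
  have R_scale: "s r x \<in> R" if "x \<in> R" for r x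
    using that fsc.subspace_scale[OF gfree_subspace[of a]] unfolding R_def by (auto simp: \<epsilon>_scale[symmetric] intro!: imageI)
  have R_zero: "0 \<in> R"
    unfolding R_def using fsc.subspace_0[OF gfree_subspace[of a]] by (intro image_eqI[of _ _ 0]) (simp_all add: \<epsilon>_def)
  have R_sum: "(\<Sum>x\<in>A. f x) \<in> R" if "\<And>x. x \<in> A \<Longrightarrow> f x \<in> R" for A and f :: "'x \<Rightarrow> 'a"
    using that
  proof (induction A rule: infinite_finite_induct)
    case (insert x A)
    then show ?case using R_add[of "f x" "sum f A"] by simp
  qed (simp_all only: sum.infinite sum.empty R_zero not_False_eq_True)
  have R_kv: "kv.subspace R" unfolding kv.subspace_def using R_zero R_add R_scale by blast
  have CR: "C j \<subseteq> R" if j: "0 \<le> j" "j \<le> N" for j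
  proof
    fix y assume y: "y \<in> C j"
    obtain i where i: "i < length a" "b i = y" using Lex[OF j y] by blast
    have "\<epsilon> (single i 1) = (\<Sum>l<length a. if l = i then b l else 0)"
      unfolding \<epsilon>_def by (intro sum.cong refl) (simp add: lookup_single when_def)
    then have "\<epsilon> (single i 1) = y" using i by simp
    moreover have "single i 1 \<in> gfree a" using i by (simp add: gfree_def)
    ultimately show "y \<in> R" unfolding R_def by blast
  qed
  \<comment> \<open>The induction starts in degree -1, where the component is zero.\<close>
  have grR: "gr (int n - 1) \<subseteq> R" for n
  proof (induction n)
    case 0
    show ?case using low[of "int 0 - 1"] R_zero by simp
  next
    case (Suc n)
    have decR: "dec (int n) \<subseteq> R"
      unfolding dec_def using Suc by (auto intro!: R_sum R_scale)
    have "gr (int n) \<subseteq> R"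
    proof (cases "int n > N")
      case True
      then show ?thesis using high[OF True] decR unfolding kexact_0_iff_dec by blast
    next
      case False
      then have "C (int n) \<subseteq> R" by (intro CR) auto
      moreover have "D (int n) \<subseteq> R" using CD(4)[of "int n"] kv.span_superset decR by blast
      ultimately have "kv.span (C (int n) \<union> D (int n)) \<subseteq> R" by (intro kv.span_minimal R_kv) simp
      then show ?thesis using CD(6) by blast
    qed
    then show ?case by simp
  qed
  have grR': "gr j \<subseteq> R" for j
    using grR[of "nat (j + 1)"] low[of j] R_zero by (cases "j < 0") auto
  have "R = M"
  proof
    show "M \<subseteq> R"
    proof
      fix x assume x: "x \<in> M"
      have "(\<Sum>j | pr j x \<noteq> 0. pr j x) \<in> R" using grR' pr_mem[OF x] by (intro R_sum) blast
      then show "x \<in> R" by (simp only: pr_sum[OF x])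
    qed
  qed (use \<epsilon>_M in \<open>auto simp: R_def\<close>)
  interpret FF: gmod fscale "gfree a" "gfree_comp a" "gpr a :: _ \<Rightarrow> (nat \<Rightarrow>\<^sub>0 ('n, 'k) mpoly) \<Rightarrow> _"
    by (rule gmod_gfree)
  have epi: "gepi fscale (gfree a) (gfree_comp a) (gpr a) s M gr pr \<epsilon>"
  proof unfold_locales
    show "module_hom_on fscale s (gfree a) M \<epsilon>"
      unfolding module_hom_on_def using \<epsilon>_M \<epsilon>_add \<epsilon>_scale by auto
    show "\<epsilon> ` gfree a = M" using \<open>R = M\<close> by (simp add: R_def)
    show "\<epsilon> ` gfree_comp a j \<subseteq> gr j" for j using \<epsilon>_gr by blast
  qed
  have minimal: "lookup (lookup x i0) 0 = 0" if x: "x \<in> gfree a" "\<epsilon> x = 0" for x i0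
  proof (cases "i0 < length a")
    case False
    then show ?thesis using x(1) by (simp add: gfree_iff)
  next
    case True
    define j where "j = a ! i0"
    define c where "c = (\<lambda>i. lookup (lookup x i) 0)"
    define I where "I = {i\<in>{..<length a}. a ! i = j}"
    have injb: "inj_on b I"
    proof (rule inj_onI)
      fix i i' assume i: "i \<in> I" "i' \<in> I" "b i = b i'"
      then have "L ! i = L ! i'" using len by (auto simp: I_def a_def b_def prod_eq_iff)
      then show "i = i'" using i L(2) len by (simp add: I_def nth_eq_iff_index_eq)
    qed
    have bI: "b ` I = C j"
    proof
      show "b ` I \<subseteq> C j" using Li by (auto simp: I_def)
      have "0 \<le> j" "j \<le> N" using Li[OF True] by (simp_all add: j_def)
      then show "C j \<subseteq> b ` I" using Lex[of j] by (fastforce simp: I_def)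
    qed
    \<comment> \<open>The degree j part of the relation is a combination of the generators of degree
      j with constant coefficients, plus a decomposable element built from w.\<close>
    define w where "w = (\<lambda>k. \<Sum>i<length a. pr (j - 1) (s (vdiv k (lookup x i)) (b i)))"
    have "pr j (s (lookup x i) (b i)) =
        (if a ! i = j then s (Const (c i)) (b i) else 0) + (\<Sum>k\<in>UNIV. s (Var k) (pr (j - 1) (s (vdiv k (lookup x i)) (b i))))"
      if i: "i < length a" for i
    proof -
      note bi = bM[OF i] and sM = subspace_scale[OF M_subspace]
      have "s (lookup x i) (b i) = s (Const (c i) + (\<Sum>k\<in>UNIV. Var k * vdiv k (lookup x i))) (b i)"
        unfolding c_def by (simp only: vdiv_decompose[symmetric])
      also have "\<dots> = s (Const (c i)) (b i) + (\<Sum>k\<in>UNIV. s (Var k) (s (vdiv k (lookup x i)) (b i)))"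
        by (simp add: scale_left_distrib scale_sum_left scale_scale)
      finally have e: "s (lookup x i) (b i) = s (Const (c i)) (b i) + (\<Sum>k\<in>UNIV. s (Var k) (s (vdiv k (lookup x i)) (b i)))" .
      have "pr j (s (lookup x i) (b i)) = pr j (s (Const (c i)) (b i)) + pr j (\<Sum>k\<in>UNIV. s (Var k) (s (vdiv k (lookup x i)) (b i)))"
        unfolding e by (intro pr_add sM bi subspace_sum[OF M_subspace])
      also have "pr j (s (Const (c i)) (b i)) = (if a ! i = j then s (Const (c i)) (b i) else 0)"
        by (rule pr_gr[OF gr_Const[OF bg[OF i]]])
      also have "pr j (\<Sum>k\<in>UNIV. s (Var k) (s (vdiv k (lookup x i)) (b i))) = (\<Sum>k\<in>UNIV. pr j (s (Var k) (s (vdiv k (lookup x i)) (b i))))"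
        by (intro pr_sum_fun sM bi)
      also have "\<dots> = (\<Sum>k\<in>UNIV. s (Var k) (pr (j - 1) (s (vdiv k (lookup x i)) (b i))))"
        by (intro sum.cong refl pr_Var sM bi)
      finally show ?thesis .
    qed
    then have "pr j (\<epsilon> x) = (\<Sum>i<length a. (if a ! i = j then s (Const (c i)) (b i) else 0) +
        (\<Sum>k\<in>UNIV. s (Var k) (pr (j - 1) (s (vdiv k (lookup x i)) (b i)))))"
      unfolding \<epsilon>_def using bM subspace_scale[OF M_subspace] by (subst pr_sum_fun) auto
    also have "\<dots> = (\<Sum>i\<in>I. s (Const (c i)) (b i)) + (\<Sum>k\<in>UNIV. s (Var k) (w k))"
    proof -
      have "(\<Sum>i<length a. \<Sum>k\<in>UNIV. s (Var k) (pr (j - 1) (s (vdiv k (lookup x i)) (b i)))) = (\<Sum>k\<in>UNIV. s (Var k) (w k))"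
        unfolding w_def scale_sum_right by (rule sum.swap)
      moreover have "(\<Sum>i<length a. if a ! i = j then s (Const (c i)) (b i) else 0) = (\<Sum>i\<in>I. s (Const (c i)) (b i))"
        unfolding I_def by (simp only: sum.inter_filter finite_lessThan)
      ultimately show ?thesis by (simp add: sum.distrib)
    qed
    finally have "(\<Sum>i\<in>I. s (Const (c i)) (b i)) = - (\<Sum>k\<in>UNIV. s (Var k) (w k))"
      by (simp add: x(2) eq_neg_iff_add_eq_0)
    moreover have "w k \<in> gr (j - 1)" for k
      unfolding w_def using bM subspace_scale[OF M_subspace] by (intro G.fam_sum pr_mem) auto
    then have "(\<Sum>k\<in>UNIV. s (Var k) (w k)) \<in> dec j" unfolding dec_def by blast
    ultimately have "(\<Sum>i\<in>I. s (Const (c i)) (b i)) \<in> kv.span (D j)"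
      unfolding CD(4) using kv.subspace_neg[OF dec_ksubspace] by simp
    moreover have "(\<Sum>y\<in>C j. s (Const (c (inv_into I b y))) y) = (\<Sum>i\<in>I. s (Const (c i)) (b i))"
      unfolding bI[symmetric] by (subst sum.reindex[OF injb]) (simp add: injb)
    ultimately have "(\<Sum>y\<in>C j. s (Const (c (inv_into I b y))) y) \<in> kv.span (D j)" by simp
    moreover have i0: "i0 \<in> I" using True by (simp add: I_def j_def)
    then have "b i0 \<in> C j" using bI by blast
    ultimately have "c (inv_into I b (b i0)) = 0"
      using kv.independent_mod_span[OF CD(3)[of j] CD(2)[of j] CD(1)[of j],
          of "\<lambda>y. c (inv_into I b y)" "b i0"] by blast
    then show ?thesis using injb i0 by (simp add: c_def)
  qed
  have "\<not> kexact (\<lambda>k. s (Var k)) gr 0 d \<and> 0 \<le> d" if "d \<in> set a" for d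
  proof -
    from that obtain i where i: "i < length a" "a ! i = d" by (auto simp: in_set_conv_nth)
    have "\<not> gr d \<subseteq> dec d"
    proof
      assume "gr d \<subseteq> dec d"
      then have bi: "b i \<in> kv.span (D d)" using bg[OF i(1)] i(2) CD(4) by auto
      have bC: "b i \<in> C d" using Li[OF i(1)] i(2) by simp
      have "(\<Sum>y\<in>C d. s (Const (if y = b i then 1 else 0)) y) = (\<Sum>y\<in>C d. if y = b i then y else 0)"
        by (intro sum.cong) auto
      also have "\<dots> = b i" using bC CD(1) by simp
      finally show False
        using kv.independent_mod_span[OF CD(3)[of d] CD(2) CD(1), of "\<lambda>y. if y = b i then 1 else 0" "b i"] bi bC by simp
    qed
    then show ?thesis using Li[OF i(1)] i(2) by (simp add: kexact_0_iff_dec)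
  qed
  with epi minimal show ?thesis by (intro exI[of _ a] exI[of _ \<epsilon>]) blast
qed

text \<open>Dimension shifting along a minimal cover. At position 0 the free module has homology;
  minimality puts every kernel element into the maximal ideal times the free module, hence makes it
  a boundary there.\<close>

lemma kexact_syzygy:
  fixes s :: "('n::{finite, linorder}, 'k::field) mpoly \<Rightarrow> 'a::ab_group_add \<Rightarrow> 'a"
  assumes "gepi fscale (gfree a) (gfree_comp a) (gpr a) s M gr pr \<epsilon>"
    and min: "\<forall>x\<in>gfree a. \<epsilon> x = 0 \<longrightarrow> (\<forall>k. lookup (lookup x k) 0 = 0)"
    and ex: "kexact (\<lambda>k. s (Var k)) gr (Suc i) j"
  shows "kexact (\<lambda>k. fscale (Var k)) (\<lambda>j. {x \<in> gfree_comp a j. \<epsilon> x = 0}) i j"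
proof -
  interpret gepi fscale "gfree a" "gfree_comp a" "gpr a" s M gr pr \<epsilon> by fact
  have gK: "(\<lambda>j. {x \<in> gfree_comp a j. \<epsilon> x = 0}) = K.gK" by (simp add: K.gK_def[abs_def])
  show ?thesis
  proof (cases "i = 0")
    case False
    then show ?thesis unfolding gK
      using ex K.kexact_Suc_iff[OF kexact_gfree_comp kexact_gfree_comp] by simp
  next
    case True
    show ?thesis
      unfolding gK kexact_def True
    proof (intro ballI impI)
      fix \<kappa> :: "'n set \<Rightarrow> (nat \<Rightarrow>\<^sub>0 ('n, 'k) mpoly)"
      assume \<kappa>: "\<kappa> \<in> kcomp K.gK 0 j"
      then have \<kappa>F: "\<kappa> \<in> kcomp (gfree_comp a) 0 j" by (simp add: K.kcomp_gK_iff)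
      have "\<kappa> {} \<in> gfree_comp a j" "\<epsilon> (\<kappa> {}) = 0"
        using kcomp_mem[OF \<kappa>, of "{}"] by (auto simp: K.gK_def)
      then have "\<exists>\<eta>\<in>kcomp (gfree_comp a) (Suc 0) j. kd (\<lambda>k. fscale (Var k)) \<eta> = \<kappa>"
        unfolding F.G.boundary_0_iff[OF \<kappa>F] gfree_comp_dec_iff[OF \<open>\<kappa> {} \<in> _\<close>]
        using min F.gr_sub by blast
      then show "\<exists>\<eta>\<in>kcomp K.gK (Suc 0) j. kd (\<lambda>k. fscale (Var k)) \<eta> = \<kappa>"
        using ex \<kappa> unfolding True K.kexact_Suc_iff_boundary[OF kexact_gfree_comp[OF zero_less_Suc]] by blast
    qed
  qed
qed

lemma gfree_comp_negative:
  assumes "\<forall>d\<in>set a. 0 \<le> d" "j < 0"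
  shows "gfree_comp a j = {0}"
proof -
  have "x = 0" if "x \<in> gfree_comp a j" for x
  proof (intro poly_mapping_eqI)
    fix k m
    show "lookup (lookup x k) m = lookup (lookup 0 k) m"
    proof (cases "k < length a")
      case True
      then have "lookup x k \<in> homog (j - a ! k)" "0 \<le> a ! k"
        using that[unfolded gfree_comp_iff, THEN spec, of k] assms(1) by simp_all
      then have "m \<notin> keys (lookup x k)" using assms(2) unfolding homog_def by force
      then show ?thesis by (simp add: in_keys_iff)
    next
      case False
      then show ?thesis using that[unfolded gfree_comp_iff, THEN spec, of k] by simp
    qed
  qed
  then show ?thesis by (auto simp: gfree_comp_iff)
qed

text \<open>A graded submodule of a free module with the induced grading. Nonnegative generator
  degrees make its components of negative degree zero.\<close>

definition syz :: "int list \<Rightarrow> (nat \<Rightarrow>\<^sub>0 ('n::{finite, linorder}, 'k::field) mpoly) set \<Rightarrow> bool" where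
  "syz a Z \<longleftrightarrow> gmod fscale Z (\<lambda>j. Z \<inter> gfree_comp a j) (gpr a) \<and> Z \<subseteq> gfree a \<and> (\<forall>d\<in>set a. 0 \<le> d)"

lemma syz_ker:
  assumes "gepi fscale (gfree a) (gfree_comp a) (gpr a) s M gr pr \<epsilon>" "\<forall>d\<in>set a. 0 \<le> d"
  shows "syz a {x \<in> gfree a. \<epsilon> x = 0}"
    and "(\<lambda>j. {x \<in> gfree a. \<epsilon> x = 0} \<inter> gfree_comp a j) = (\<lambda>j. {x \<in> gfree_comp a j. \<epsilon> x = 0})"
proof -
  interpret gepi fscale "gfree a" "gfree_comp a" "gpr a" s M gr pr \<epsilon> by fact
  show e: "(\<lambda>j. {x \<in> gfree a. \<epsilon> x = 0} \<inter> gfree_comp a j) = (\<lambda>j. {x \<in> gfree_comp a j. \<epsilon> x = 0})"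
    using F.gr_sub by (intro ext) blast
  show "syz a {x \<in> gfree a. \<epsilon> x = 0}"
    using gmod_ker assms(2) unfolding syz_def e K.gK_def[abs_def] by blast
qed

lemma syz_step:
  fixes Z :: "(nat \<Rightarrow>\<^sub>0 ('n::{finite, linorder}, 'k::field) mpoly) set"
  assumes Z: "syz a Z" and high: "\<And>j. j > N \<Longrightarrow> kexact (\<lambda>k. fscale (Var k)) (\<lambda>j. Z \<inter> gfree_comp a j) 0 j"
  shows "\<exists>a' d. (\<forall>e\<in>set a'. 0 \<le> e \<and> \<not> kexact (\<lambda>k. fscale (Var k)) (\<lambda>j. Z \<inter> gfree_comp a j) 0 e) \<and>
    gepi fscale (gfree a') (gfree_comp a') (gpr a') fscale Z (\<lambda>j. Z \<inter> gfree_comp a j) (gpr a) d \<and>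
    (\<forall>x\<in>gfree a'. d x = 0 \<longrightarrow> (\<forall>k. lookup (lookup x k) 0 = 0))"
proof -
  interpret gmod fscale Z "\<lambda>j. Z \<inter> gfree_comp a j" "gpr a" using Z by (simp add: syz_def)
  show ?thesis
  proof (rule minimal_cover)
    show "kexact (\<lambda>k. fscale (Var k)) (\<lambda>j. Z \<inter> gfree_comp a j) 0 j" if "j > N" for j
      by (rule high[OF that])
    show "\<exists>B. finite B \<and> Z \<inter> gfree_comp a j \<subseteq> kv.span B" for j
      using gfree_comp_finite_dim[of a j, where 'n='n and 'k='k] by blast
    have nn: "\<forall>d\<in>set a. 0 \<le> d" using Z unfolding syz_def by (elim conjE)
    show "Z \<inter> gfree_comp a j = {0}" if "j < 0" for j
      using gr_zero[of j] unfolding gfree_comp_negative[OF nn that] by simp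
  qed
qed

text \<open>Iterated minimal covers. Exactness passes from M to the n-th kernel with a shift by n +
  1, so one bound N serves all steps, and where the Koszul homology of M vanishes the corresponding
  term has no generators.\<close>

theorem (in gmod) graded_free_resolution_exists:
  assumes fd: "\<And>j. \<exists>B. finite B \<and> gr j \<subseteq> kv.span B"
    and low: "\<And>j. j < 0 \<Longrightarrow> gr j = {0}"
    and high: "\<And>i j. j > N \<Longrightarrow> kexact (\<lambda>k. s (Var k)) gr i j"
  shows "\<exists>a d \<epsilon>. graded_free_resolution s M gr a d \<epsilon> \<and>
    (\<forall>n. (\<forall>i>n. \<forall>j. kexact (\<lambda>k. s (Var k)) gr i j) \<longrightarrow> (\<forall>i>n. a i = []))"
proof -
  let ?ker = "\<lambda>a (d :: (nat \<Rightarrow>\<^sub>0 ('n, 'k) mpoly) \<Rightarrow> (nat \<Rightarrow>\<^sub>0 ('n, 'k) mpoly)). {x \<in> gfree a. d x = 0}"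
  let ?X = "\<lambda>k. fscale (Var k) :: (nat \<Rightarrow>\<^sub>0 ('n, 'k) mpoly) \<Rightarrow> _"
  obtain a0 \<epsilon> where a0: "\<forall>d\<in>set a0. 0 \<le> d" "gepi fscale (gfree a0) (gfree_comp a0) (gpr a0) s M gr pr \<epsilon>"
      "\<forall>x\<in>gfree a0. \<epsilon> x = 0 \<longrightarrow> (\<forall>k. lookup (lookup x k) 0 = 0)"
    using minimal_cover[of N, OF fd low high[where i = 0]] by blast
  define Z0 where "Z0 = {x \<in> gfree a0. \<epsilon> x = 0}"
  \<comment> \<open>The state consists of the current free module, the kernel in it and the last
    differential. The clause for n = 0 pins the start, so that the sequence can be joined to
    \<epsilon>.\<close>
  define P where "P = (\<lambda>n (a, Z, _ :: (nat \<Rightarrow>\<^sub>0 ('n, 'k) mpoly) \<Rightarrow> (nat \<Rightarrow>\<^sub>0 ('n, 'k) mpoly)). syz a Z \<and> (n = 0 \<longrightarrow> a = a0 \<and> Z = Z0) \<and>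
    (\<forall>i j. kexact (\<lambda>k. s (Var k)) gr (Suc (i + n)) j \<longrightarrow> kexact ?X (\<lambda>j. Z \<inter> gfree_comp a j) i j))"
  define Q where "Q = (\<lambda>(_ :: nat) (a, Z, _ :: (nat \<Rightarrow>\<^sub>0 ('n, 'k) mpoly) \<Rightarrow> (nat \<Rightarrow>\<^sub>0 ('n, 'k) mpoly))
    (a', Z', d' :: (nat \<Rightarrow>\<^sub>0 ('n, 'k) mpoly) \<Rightarrow> (nat \<Rightarrow>\<^sub>0 ('n, 'k) mpoly)). Z' = ?ker a' d' \<and>
    (\<forall>e\<in>set a'. \<not> kexact ?X (\<lambda>j. Z \<inter> gfree_comp a j) 0 e) \<and>
    gepi fscale (gfree a') (gfree_comp a') (gpr a') fscale Z (\<lambda>j. Z \<inter> gfree_comp a j) (gpr a) d')"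
  have P0: "P 0 (a0, Z0, id)"
    unfolding P_def Z0_def using syz_ker[OF a0(2,1)] kexact_syzygy[OF a0(2,3)] by simp
  have step: "\<exists>S'. P (Suc n) S' \<and> Q n S S'" if S: "P n S" for n S
  proof -
    obtain a Z d where S_eq: "S = (a, Z, d)" by (cases S)
    have PS: "syz a Z" "\<And>i j. kexact (\<lambda>k. s (Var k)) gr (Suc (i + n)) j \<Longrightarrow> kexact ?X (\<lambda>j. Z \<inter> gfree_comp a j) i j"
      using S by (auto simp: P_def S_eq)
    obtain a' d' where d': "\<forall>e\<in>set a'. 0 \<le> e \<and> \<not> kexact ?X (\<lambda>j. Z \<inter> gfree_comp a j) 0 e"
      "gepi fscale (gfree a') (gfree_comp a') (gpr a') fscale Z (\<lambda>j. Z \<inter> gfree_comp a j) (gpr a) d'"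
      "\<forall>x\<in>gfree a'. d' x = 0 \<longrightarrow> (\<forall>k. lookup (lookup x k) 0 = 0)"
      using syz_step[of a Z N, OF PS(1) PS(2)[OF high]] by blast
    have nn: "\<forall>e\<in>set a'. 0 \<le> e" using d'(1) by blast
    note sk = syz_ker[OF d'(2) nn]
    have "kexact ?X (\<lambda>j. ?ker a' d' \<inter> gfree_comp a' j) i j" if "kexact (\<lambda>k. s (Var k)) gr (Suc (i + Suc n)) j" for i j
      unfolding sk(2) using that by (intro kexact_syzygy[OF d'(2,3)] PS(2)) simp
    then have "P (Suc n) (a', ?ker a' d', d')" unfolding P_def using sk(1) by simp
    moreover have "Q n S (a', ?ker a' d', d')" unfolding Q_def S_eq using d'(1,2) by simp
    ultimately show ?thesis by blast
  qed
  obtain S where S: "\<And>n. P n (S n)" "\<And>n. Q n (S n) (S (Suc n))"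
    using dependent_nat_choice[of P Q] P0 step by blast
  define a where "a = (\<lambda>n. fst (S n))"
  define Z where "Z = (\<lambda>n. fst (snd (S n)))"
  define d where "d = (\<lambda>n. snd (snd (S (Suc n))))"
  have PZ: "syz (a n) (Z n)" "\<And>i j. kexact (\<lambda>k. s (Var k)) gr (Suc (i + n)) j \<Longrightarrow> kexact ?X (\<lambda>j. Z n \<inter> gfree_comp (a n) j) i j" for n
    using S(1)[of n] by (simp_all add: P_def a_def Z_def split_beta)
  have start: "a 0 = a0" "Z 0 = Z0"
    using S(1)[of 0] by (simp_all add: P_def a_def Z_def split_beta)
  have QZ: "Z (Suc n) = ?ker (a (Suc n)) (d n)" "\<forall>e\<in>set (a (Suc n)). \<not> kexact ?X (\<lambda>j. Z n \<inter> gfree_comp (a n) j) 0 e"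
      "gepi fscale (gfree (a (Suc n))) (gfree_comp (a (Suc n))) (gpr (a (Suc n))) fscale (Z n) (\<lambda>j. Z n \<inter> gfree_comp (a n) j) (gpr (a n)) (d n)" for n
    using S(2)[of n] by (simp_all add: Q_def a_def Z_def d_def split_beta)
  have dn: "module_hom_on fscale fscale (gfree (a (Suc n))) (gfree (a n)) (d n)" "d n ` gfree (a (Suc n)) = Z n"
    "d n ` gfree_comp (a (Suc n)) j \<subseteq> gfree_comp (a n) j" for n j
  proof -
    interpret gepi fscale "gfree (a (Suc n))" "gfree_comp (a (Suc n))" "gpr (a (Suc n))" fscale "Z n" "\<lambda>j. Z n \<inter> gfree_comp (a n) j" "gpr (a n)" "d n"
      by (rule QZ(3))
    show "d n ` gfree (a (Suc n)) = Z n" by (rule surj)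
    show "module_hom_on fscale fscale (gfree (a (Suc n))) (gfree (a n)) (d n)"
      using hom PZ(1)[of n] unfolding module_hom_on_def syz_def by blast
    show "d n ` gfree_comp (a (Suc n)) j \<subseteq> gfree_comp (a n) j" using graded by blast
  qed
  interpret E: gepi fscale "gfree a0" "gfree_comp a0" "gpr a0" s M gr pr \<epsilon> by (rule a0(2))
  have "graded_free_resolution s M gr a d \<epsilon>"
    unfolding graded_free_resolution_def resolution_def
  proof (intro conjI allI)
    show "module_hom_on fscale s (gfree (a 0)) M \<epsilon>" unfolding start by (rule E.hom)
    show "\<epsilon> ` gfree (a 0) = M" unfolding start by (rule E.surj)
    show "{x \<in> gfree (a 0). \<epsilon> x = 0} = d 0 ` gfree (a 1)"
      using dn(2)[of 0] start Z0_def by simp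
    show "\<epsilon> ` gfree_comp (a 0) j \<subseteq> gr j" for j unfolding start by (rule E.graded)
    show "{x \<in> gfree (a (Suc i)). d i x = 0} = d (Suc i) ` gfree (a (Suc (Suc i)))" for i
      using dn(2)[of "Suc i"] QZ(1)[of i] by simp
  qed (rule dn)+
  moreover have "a i = []" if n: "\<forall>i>n. \<forall>j. kexact (\<lambda>k. s (Var k)) gr i j" and i: "i > n" for n i
  proof -
    obtain m where m: "i = Suc m" using i by (cases i) auto
    have "kexact ?X (\<lambda>j. Z m \<inter> gfree_comp (a m) j) 0 j" for j
      using n i m by (intro PZ(2)) simp
    then have "set (a i) = {}" using QZ(2)[of m] m by auto
    then show ?thesis by simp
  qed
  ultimately show ?thesis by blast
qed

section \<open>Betti numbers and Koszul homology\<close>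

text \<open>The coordinates of x modulo the maximal ideal, that is, of x \<otimes> 1 in the tensor
  product with K.\<close>

abbreviation consts0 :: "(nat \<Rightarrow>\<^sub>0 ('n, 'k::comm_ring_1) mpoly) \<Rightarrow> nat \<Rightarrow> 'k" where
  "consts0 x \<equiv> \<lambda>l. lookup (lookup x l) 0"

lemma resolutionD:
  assumes "resolution s t M P d \<epsilon>"
  shows "module_hom_on t s (P 0) M \<epsilon>" "module_hom_on t t (P (Suc i)) (P i) (d i)" "\<epsilon> ` P 0 = M"
    "{x \<in> P 0. \<epsilon> x = 0} = d 0 ` P 1" "{x \<in> P (Suc i). d i x = 0} = d (Suc i) ` P (Suc (Suc i))"
proof -
  note r = assms[unfolded resolution_def]
  show "module_hom_on t s (P 0) M \<epsilon>" by (rule r[THEN conjunct1])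
  show "module_hom_on t t (P (Suc i)) (P i) (d i)" by (rule r[THEN conjunct2, THEN conjunct1, THEN spec])
  show "\<epsilon> ` P 0 = M" by (rule r[THEN conjunct2, THEN conjunct2, THEN conjunct1])
  show "{x \<in> P 0. \<epsilon> x = 0} = d 0 ` P 1"
    by (rule r[THEN conjunct2, THEN conjunct2, THEN conjunct2, THEN conjunct1])
  show "{x \<in> P (Suc i). d i x = 0} = d (Suc i) ` P (Suc (Suc i))"
    by (rule r[THEN conjunct2, THEN conjunct2, THEN conjunct2, THEN conjunct2, THEN spec])
qed

lemma graded_free_resolutionD:
  assumes "graded_free_resolution s M gr a d \<epsilon>"
  shows "resolution s fscale M (\<lambda>i. gfree (a i)) d \<epsilon>" "\<epsilon> ` gfree_comp (a 0) j \<subseteq> gr j"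
    "d i ` gfree_comp (a (Suc i)) j \<subseteq> gfree_comp (a i) j"
proof -
  note r = assms[unfolded graded_free_resolution_def]
  show "resolution s fscale M (\<lambda>i. gfree (a i)) d \<epsilon>" by (rule r[THEN conjunct1])
  show "\<epsilon> ` gfree_comp (a 0) j \<subseteq> gr j" by (rule r[THEN conjunct2, THEN conjunct1, THEN spec])
  show "d i ` gfree_comp (a (Suc i)) j \<subseteq> gfree_comp (a i) j"
    by (rule r[THEN conjunct2, THEN conjunct2, THEN spec, THEN spec])
qed

lemma (in gepi) gK_eq: "K.gK = (\<lambda>j. {x \<in> F. h x = 0} \<inter> gF j)"
  unfolding K.gK_def using F.gr_sub by (intro ext) blast

lemma gmod_syzygies:
  assumes "gepi fscale (gfree a) (gfree_comp a) (gpr a) s M gr pr h"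
  shows "gmod fscale {x \<in> gfree a. h x = 0} (\<lambda>j. {x \<in> gfree a. h x = 0} \<inter> gfree_comp a j) (gpr a)"
proof -
  interpret gepi fscale "gfree a" "gfree_comp a" "gpr a" s M gr pr h by fact
  show ?thesis using gmod_ker unfolding gK_eq .
qed

text \<open>
  For an exact sequence \<open>F\<^sub>b \<rightarrow> F\<^sub>a \<rightarrow> M \<rightarrow> 0\<close> with \<open>F\<^sub>a\<close>, \<open>F\<^sub>b\<close> free, decomposability of elements of
  \<open>M\<close> is lifted to \<open>F\<^sub>a\<close>.
\<close>

lemma decomposable_iff_lift:
  fixes s :: "('n::{finite, linorder}, 'k::field) mpoly \<Rightarrow> 'a::ab_group_add \<Rightarrow> 'a"
  assumes h: "gepi fscale (gfree a) (gfree_comp a) (gpr a) s M gr pr h"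
    and g: "gepi fscale (gfree b) (gfree_comp b) (gpr b) fscale {x \<in> gfree a. h x = 0}
      (\<lambda>j. {x \<in> gfree a. h x = 0} \<inter> gfree_comp a j) (gpr a) g"
  shows "(\<forall>z\<in>gr j. P z \<longrightarrow> (\<exists>w. (\<forall>k. w k \<in> gr (j - 1)) \<and> z = (\<Sum>k\<in>UNIV. s (Var k) (w k)))) \<longleftrightarrow>
    (\<forall>x\<in>gfree_comp a j. P (h x) \<longrightarrow> (\<exists>x'\<in>gfree_comp b j. consts0 x = consts0 (g x')))"
proof -
  interpret h: gepi fscale "gfree a" "gfree_comp a" "gpr a" s M gr pr h by (rule h)
  interpret g: gepi fscale "gfree b" "gfree_comp b" "gpr b" fscale "{x \<in> gfree a. h x = 0}"
    "\<lambda>j. {x \<in> gfree a. h x = 0} \<inter> gfree_comp a j" "gpr a" g by (rule g)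
  have hX: "h (\<Sum>k\<in>UNIV. fscale (Var k) (u k)) = (\<Sum>k\<in>UNIV. s (Var k) (h (u k)))"
    if "\<And>k. u k \<in> gfree_comp a d" for u :: "'n \<Rightarrow> (nat \<Rightarrow>\<^sub>0 ('n, 'k) mpoly)" and d
  proof -
    have uF: "u k \<in> gfree a" for k using that h.F.gr_sub by blast
    have "h (\<Sum>k\<in>UNIV. fscale (Var k) (u k)) = (\<Sum>k\<in>UNIV. h (fscale (Var k) (u k)))"
      using uF by (intro h.h_sum fsc.subspace_scale[OF gfree_subspace])
    then show ?thesis using uF by (simp add: h.h_scale)
  qed
  have c0: "consts0 (x - y) = (\<lambda>_. 0) \<longleftrightarrow> consts0 x = consts0 y" for x y :: "nat \<Rightarrow>\<^sub>0 ('n, 'k) mpoly"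
    by (auto simp: lookup_minus fun_eq_iff)
  have XF: "(\<Sum>k\<in>UNIV. fscale (Var k) (u k)) \<in> gfree_comp a j" if "\<And>k. u k \<in> gfree_comp a (j - 1)" for u :: "'n \<Rightarrow> (nat \<Rightarrow>\<^sub>0 ('n, 'k) mpoly)"
    using h.F.gr_Var[OF that] by (intro h.F.G.fam_sum) simp
  show ?thesis
  proof
    assume L: "\<forall>z\<in>gr j. P z \<longrightarrow> (\<exists>w. (\<forall>k. w k \<in> gr (j - 1)) \<and> z = (\<Sum>k\<in>UNIV. s (Var k) (w k)))"
    show "\<forall>x\<in>gfree_comp a j. P (h x) \<longrightarrow> (\<exists>x'\<in>gfree_comp b j. consts0 x = consts0 (g x'))"
    proof (intro ballI impI)
      fix x assume x: "x \<in> gfree_comp a j" "P (h x)"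
      have "h x \<in> gr j" using h.graded x(1) by blast
      from L[rule_format, OF this x(2)]
      obtain w where w': "(\<forall>k. w k \<in> gr (j - 1)) \<and> h x = (\<Sum>k\<in>UNIV. s (Var k) (w k))"
        by (rule exE)
      note w = conjunct1[OF w', rule_format] conjunct2[OF w']
      have "\<exists>u. u \<in> gfree_comp a (j - 1) \<and> h u = w k" for k
      proof -
        have "w k \<in> h ` gfree_comp a (j - 1)" unfolding h.graded_surj by (rule w(1))
        then show ?thesis by (elim imageE) (metis)
      qed
      then obtain u where u: "\<And>k. u k \<in> gfree_comp a (j - 1)" "\<And>k. h (u k) = w k" by metis
      \<comment> \<open>Subtracting from x a decomposable lift of h x gives a kernel element, hence
        an element of the image of g, with the same constants as x.\<close>
      let ?u = "\<Sum>k\<in>UNIV. fscale (Var k) (u k)"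
      have uF: "?u \<in> gfree_comp a j" by (rule XF) (rule u(1))
      have hu: "h ?u = (\<Sum>k\<in>UNIV. s (Var k) (h (u k)))" by (rule hX) (rule u(1))
      have "h (x - ?u) = h x - h ?u" using x(1) uF by (rule h.K.h_diff)
      also have "\<dots> = 0" unfolding hu by (simp add: w(2) u(2))
      finally have "x - ?u \<in> {x \<in> gfree a. h x = 0} \<inter> gfree_comp a j"
        using h.F.G.fam_diff[OF x(1) uF] subsetD[OF h.F.gr_sub] by simp
      then have "x - ?u \<in> g ` gfree_comp b j" unfolding g.graded_surj .
      then obtain x' where x': "x - ?u = g x'" "x' \<in> gfree_comp b j" by (rule imageE)
      have "\<forall>l. consts0 ?u l = 0"
        unfolding gfree_comp_dec_iff[OF uF, symmetric] using u(1) by (intro exI[of _ u]) simp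
      then have "consts0 x = consts0 (g x')" by (simp add: x'(1)[symmetric] lookup_minus)
      with x'(2) show "\<exists>x'\<in>gfree_comp b j. consts0 x = consts0 (g x')" by blast
    qed
  next
    assume R: "\<forall>x\<in>gfree_comp a j. P (h x) \<longrightarrow> (\<exists>x'\<in>gfree_comp b j. consts0 x = consts0 (g x'))"
    show "\<forall>z\<in>gr j. P z \<longrightarrow> (\<exists>w. (\<forall>k. w k \<in> gr (j - 1)) \<and> z = (\<Sum>k\<in>UNIV. s (Var k) (w k)))"
    proof (intro ballI impI)
      fix z assume z: "z \<in> gr j" "P z"
      have "z \<in> h ` gfree_comp a j" unfolding h.graded_surj by (rule z(1))
      then obtain x where x: "x \<in> gfree_comp a j" "h x = z" by blast
      have "P (h x)" using z(2) x(2) by simp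
      from R[rule_format, OF x(1) this] obtain x' where x': "x' \<in> gfree_comp b j" "consts0 x = consts0 (g x')"
        by (rule bexE)
      have gx': "g x' \<in> gfree_comp a j" "h (g x') = 0" using g.graded x'(1) by blast+
      note y = h.F.G.fam_diff[OF x(1) gx'(1)]
      have "\<forall>l. consts0 (x - g x') l = 0" using fun_cong[OF x'(2)] by (simp add: lookup_minus)
      then obtain u where u': "(\<forall>k. u k \<in> gfree_comp a (j - 1)) \<and> x - g x' = (\<Sum>k\<in>UNIV. fscale (Var k) (u k))"
        unfolding gfree_comp_dec_iff[OF y, symmetric] by (rule exE)
      note u = conjunct1[OF u', rule_format] conjunct2[OF u']
      have "z = h (x - g x')" using h.K.h_diff[OF x(1) gx'(1)] by (simp add: x(2) gx'(2))
      also have "\<dots> = (\<Sum>k\<in>UNIV. s (Var k) (h (u k)))" unfolding u(2) by (rule hX) (rule u(1))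
      finally show "\<exists>w. (\<forall>k. w k \<in> gr (j - 1)) \<and> z = (\<Sum>k\<in>UNIV. s (Var k) (w k))"
        using subsetD[OF h.graded imageI[OF u(1)]] by (intro exI[of _ "\<lambda>k. h (u k)"]) simp
    qed
  qed
qed

text \<open>Vanishing of the degree j part of the homology of F \<otimes> K at position i, with F
  \<otimes> K described by constants of coordinates.\<close>

definition tor_zero ::
  "(nat \<Rightarrow> int list) \<Rightarrow> (nat \<Rightarrow> (nat \<Rightarrow>\<^sub>0 ('n, 'k::comm_ring_1) mpoly) \<Rightarrow> (nat \<Rightarrow>\<^sub>0 ('n, 'k) mpoly)) \<Rightarrow> nat \<Rightarrow> int \<Rightarrow> bool" where
  "tor_zero a d i j \<longleftrightarrow> (\<forall>x\<in>gfree_comp (a i) j.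
     (case i of 0 \<Rightarrow> True | Suc i' \<Rightarrow> consts0 (d i' x) = (\<lambda>_. 0)) \<longrightarrow>
     (\<exists>x'\<in>gfree_comp (a (Suc i)) j. consts0 x = consts0 (d i x')))"

context gmod
begin

text \<open>Tor may be computed by resolving either factor: the Koszul complex resolves K, the given
  resolution M. A positive position is shifted along the kernels Z down to 1, and decomposability is
  then lifted to constants. The resolution may be far from minimal.\<close>

theorem kexact_iff_tor_zero:
  assumes res: "graded_free_resolution s M gr a d \<epsilon>"
  shows "kexact (\<lambda>k. s (Var k)) gr i j \<longleftrightarrow> tor_zero a d i j"
proof -
  let ?X = "\<lambda>k. fscale (Var k) :: (nat \<Rightarrow>\<^sub>0 ('n, 'k) mpoly) \<Rightarrow> _"
  note gres = graded_free_resolutionD[OF res]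
  note r1 = resolutionD(1,3,4)[OF gres(1)] and r2 = resolutionD(2)[OF gres(1)]
    and r3 = resolutionD(5)[OF gres(1)] and r4 = gres(2) and r5 = gres(3)
  have G: "gmod fscale (gfree a) (gfree_comp a) (gpr a :: _ \<Rightarrow> (nat \<Rightarrow>\<^sub>0 ('n, 'k) mpoly) \<Rightarrow> _)" for a
    by (rule gmod_gfree)
  have e: "gepi fscale (gfree (a 0)) (gfree_comp (a 0)) (gpr (a 0)) s M gr pr \<epsilon>"
    by (intro gepi.intro G gmod_axioms gepi_axioms.intro r1 r4)
  define Z where "Z = (\<lambda>i. case i of 0 \<Rightarrow> {x \<in> gfree (a 0). \<epsilon> x = 0} | Suc i' \<Rightarrow> {x \<in> gfree (a (Suc i')). d i' x = 0})"
  define gZ where "gZ = (\<lambda>i j. Z i \<inter> gfree_comp (a i) j)"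
  have Zd: "Z i = d i ` gfree (a (Suc i))" for i
    using r1(3) r3 by (cases i) (simp_all add: Z_def)
  have dg: "gepi fscale (gfree (a (Suc i))) (gfree_comp (a (Suc i))) (gpr (a (Suc i))) fscale (Z i) (gZ i) (gpr (a i)) (d i)"
    if "gmod fscale (Z i) (gZ i) (gpr (a i))" for i
  proof (intro gepi.intro G that gepi_axioms.intro)
    show "module_hom_on fscale fscale (gfree (a (Suc i))) (Z i) (d i)"
      using r2[of i] unfolding module_hom_on_def Zd by simp
    show "d i ` gfree (a (Suc i)) = Z i" by (simp add: Zd)
    show "d i ` gfree_comp (a (Suc i)) j \<subseteq> gZ i j" for j
    proof -
      have "d i ` gfree_comp (a (Suc i)) j \<subseteq> Z i" unfolding Zd by (intro image_mono) (auto simp: gfree_comp_def)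
      then show ?thesis using r5[of i j] unfolding gZ_def by (rule Int_greatest)
    qed
  qed
  have gm: "gmod fscale (Z i) (gZ i) (gpr (a i))" for i
  proof (induction i)
    case 0
    show ?case using gmod_syzygies[OF e] by (simp add: Z_def gZ_def)
  next
    case (Suc i)
    show ?case using gmod_syzygies[OF dg[OF Suc]] by (simp add: Z_def gZ_def)
  qed
  note dg = dg[OF gm]
  \<comment> \<open>The shift ends at position 1 of a kernel, because free modules are exact only at
    positive positions.\<close>
  have shift: "kexact (\<lambda>k. s (Var k)) gr (Suc (Suc n) + m) j \<longleftrightarrow> kexact ?X (gZ m) (Suc n) j" for n m
  proof (induction m arbitrary: n)
    case 0
    interpret e: gepi fscale "gfree (a 0)" "gfree_comp (a 0)" "gpr (a 0)" s M gr pr \<epsilon> by (rule e)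
    have "e.K.gK = gZ 0" unfolding e.gK_eq by (simp add: gZ_def Z_def)
    then show ?case using e.K.kexact_Suc_iff[where i = "Suc n" and j = j, OF kexact_gfree_comp kexact_gfree_comp] by simp
  next
    case (Suc m)
    interpret dm: gepi fscale "gfree (a (Suc m))" "gfree_comp (a (Suc m))" "gpr (a (Suc m))" fscale "Z m" "gZ m" "gpr (a m)" "d m"
      by (rule dg)
    have "dm.K.gK = gZ (Suc m)" unfolding dm.gK_eq by (simp add: gZ_def Z_def)
    then have "kexact ?X (gZ m) (Suc (Suc n)) j \<longleftrightarrow> kexact ?X (gZ (Suc m)) (Suc n) j"
      using dm.K.kexact_Suc_iff[where i = "Suc n" and j = j, OF kexact_gfree_comp kexact_gfree_comp] by simp
    with Suc.IH[of "Suc n"] show ?case by simp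
  qed
  \<comment> \<open>At position 1 the criterion becomes: a kernel element with zero constants, that
    is, one bounding in the free module, is decomposable within the kernel.\<close>
  have one: "kexact (\<lambda>k. s' (Var k)) gr' (Suc 0) j \<longleftrightarrow>
      (\<forall>z\<in>{x \<in> gfree b. h x = 0} \<inter> gfree_comp b j. consts0 z = (\<lambda>_. 0) \<longrightarrow>
        (\<exists>w. (\<forall>k. w k \<in> {x \<in> gfree b. h x = 0} \<inter> gfree_comp b (j - 1)) \<and> z = (\<Sum>k\<in>UNIV. fscale (Var k) (w k))))"
    if h: "gepi fscale (gfree b) (gfree_comp b) (gpr b) s' M' gr' pr' h"
    for s' :: "('n, 'k) mpoly \<Rightarrow> 'c::ab_group_add \<Rightarrow> 'c" and M' gr' pr' b h
  proof -
    interpret h: gepi fscale "gfree b" "gfree_comp b" "gpr b" s' M' gr' pr' h by (rule h)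
    let ?gK = "\<lambda>j. {x \<in> gfree b. h x = 0} \<inter> gfree_comp b j"
    have gK: "h.K.gK = ?gK" by (rule h.gK_eq)
    interpret Zf: koszul_fam ?X ?gK using h.K.koszul_fam_gK unfolding gK .
    let ?\<kappa> = "\<lambda>(z :: nat \<Rightarrow>\<^sub>0 ('n, 'k) mpoly) (\<sigma> :: 'n set). if \<sigma> = {} then z else 0"
    have kz: "?\<kappa> z \<in> kcomp ?gK 0 j \<longleftrightarrow> z \<in> ?gK j" for z by (auto simp: kcomp_def)
    have all: "(\<forall>\<kappa>\<in>kcomp ?gK 0 j. Q \<kappa>) \<longleftrightarrow> (\<forall>z\<in>?gK j. Q (?\<kappa> z))" for Q
    proof
      assume A: "\<forall>z\<in>?gK j. Q (?\<kappa> z)"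
      show "\<forall>\<kappa>\<in>kcomp ?gK 0 j. Q \<kappa>"
      proof
        fix \<kappa> :: "'n set \<Rightarrow> (nat \<Rightarrow>\<^sub>0 ('n, 'k) mpoly)"
        assume \<kappa>: "\<kappa> \<in> kcomp ?gK 0 j"
        have e: "?\<kappa> (\<kappa> {}) = \<kappa>" using kcomp_zero_off[OF \<kappa>] by (intro ext) auto
        have "\<kappa> {} \<in> ?gK j" using kcomp_mem[OF \<kappa>, of "{}"] by simp
        from bspec[OF A this] show "Q \<kappa>" unfolding e .
      qed
    qed (use kz in blast)
    have "kexact (\<lambda>k. s' (Var k)) gr' (Suc 0) j \<longleftrightarrow> (\<forall>z\<in>?gK j.
        (\<exists>\<eta>\<in>kcomp (gfree_comp b) (Suc 0) j. kd ?X \<eta> = ?\<kappa> z) \<longrightarrow> (\<exists>\<eta>\<in>kcomp ?gK (Suc 0) j. kd ?X \<eta> = ?\<kappa> z))"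
      unfolding h.K.kexact_Suc_iff_boundary[OF kexact_gfree_comp[OF zero_less_Suc]] gK all ..
    also have "\<dots> \<longleftrightarrow> (\<forall>z\<in>?gK j. consts0 z = (\<lambda>_. 0) \<longrightarrow>
        (\<exists>w. (\<forall>k. w k \<in> ?gK (j - 1)) \<and> z = (\<Sum>k\<in>UNIV. fscale (Var k) (w k))))"
    proof (intro ball_cong refl)
      fix z assume z: "z \<in> ?gK j"
      then have zF: "z \<in> gfree_comp b j" by blast
      have \<kappa>F: "?\<kappa> z \<in> kcomp (gfree_comp b) 0 j" using zF by (auto simp: kcomp_def)
      have "(\<exists>\<eta>\<in>kcomp (gfree_comp b) (Suc 0) j. kd ?X \<eta> = ?\<kappa> z) \<longleftrightarrow> consts0 z = (\<lambda>_. 0)"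
        unfolding h.F.G.boundary_0_iff[OF \<kappa>F] if_P[OF refl] gfree_comp_dec_iff[OF zF] by (auto simp: fun_eq_iff)
      moreover have "(\<exists>\<eta>\<in>kcomp ?gK (Suc 0) j. kd ?X \<eta> = ?\<kappa> z) \<longleftrightarrow>
          (\<exists>w. (\<forall>k. w k \<in> ?gK (j - 1)) \<and> z = (\<Sum>k\<in>UNIV. fscale (Var k) (w k)))"
        unfolding Zf.boundary_0_iff[OF kz[THEN iffD2, OF z]] if_P[OF refl] ..
      ultimately show "((\<exists>\<eta>\<in>kcomp (gfree_comp b) (Suc 0) j. kd ?X \<eta> = ?\<kappa> z) \<longrightarrow> (\<exists>\<eta>\<in>kcomp ?gK (Suc 0) j. kd ?X \<eta> = ?\<kappa> z)) =
          (consts0 z = (\<lambda>_. 0) \<longrightarrow> (\<exists>w. (\<forall>k. w k \<in> ?gK (j - 1)) \<and> z = (\<Sum>k\<in>UNIV. fscale (Var k) (w k))))"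
        by simp
    qed
    finally show ?thesis .
  qed
  have gZ': "{x \<in> gfree (a 0). \<epsilon> x = 0} = Z 0" "{x \<in> gfree (a (Suc i)). d i x = 0} = Z (Suc i)" for i
    by (simp_all add: Z_def)
  have B: "kexact (\<lambda>k. s (Var k)) gr (Suc i) j \<longleftrightarrow> (\<forall>z\<in>gZ i j. consts0 z = (\<lambda>_. 0) \<longrightarrow>
        (\<exists>w. (\<forall>k. w k \<in> gZ i (j - 1)) \<and> z = (\<Sum>k\<in>UNIV. fscale (Var k) (w k))))" for i
  proof (cases i)
    case 0
    then show ?thesis using one[OF e] by (simp add: gZ' gZ_def)
  next
    case (Suc m)
    then show ?thesis using shift[of 0 m] one[OF dg[of m]] by (simp add: gZ' gZ_def)
  qed
  show ?thesis
  proof (cases i)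
    case 0
    have d0: "gepi fscale (gfree (a (Suc 0))) (gfree_comp (a (Suc 0))) (gpr (a (Suc 0))) fscale {x \<in> gfree (a 0). \<epsilon> x = 0}
      (\<lambda>j. {x \<in> gfree (a 0). \<epsilon> x = 0} \<inter> gfree_comp (a 0) j) (gpr (a 0)) (d 0)"
      using dg[of 0] unfolding gZ' gZ_def .
    show ?thesis
      unfolding 0 G.kexact_0_iff tor_zero_def
      using decomposable_iff_lift[OF e d0, of j "\<lambda>_. True"] by simp
  next
    case (Suc m)
    have dS: "gepi fscale (gfree (a (Suc (Suc m)))) (gfree_comp (a (Suc (Suc m)))) (gpr (a (Suc (Suc m)))) fscale {x \<in> gfree (a (Suc m)). d m x = 0}
      (\<lambda>j. {x \<in> gfree (a (Suc m)). d m x = 0} \<inter> gfree_comp (a (Suc m)) j) (gpr (a (Suc m))) (d (Suc m))"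
      using dg[of "Suc m"] unfolding gZ' gZ_def .
    show ?thesis
      unfolding Suc B tor_zero_def
      using decomposable_iff_lift[OF dg[of m] dS, of j "\<lambda>z. consts0 z = (\<lambda>_. 0)"] by simp
  qed
qed

end

section \<open>Tensor products with the residue field\<close>

lemma lookup_mult_0: "lookup (p * q) 0 = lookup p 0 * lookup q (0 :: 'n \<Rightarrow>\<^sub>0 nat)"
  for p q :: "('n, 'k::comm_ring_1) mpoly"
proof (induction p rule: poly_induct_single)
  case (single m c)
  show ?case
  proof (induction q rule: poly_induct_single)
    case (single m' c')
    have "m + m' = 0 \<longleftrightarrow> m = 0 \<and> m' = 0"
      by (auto simp: poly_mapping_eq_iff fun_eq_iff lookup_add)
    then show ?case by (auto simp: mult_single lookup_single when_def)
  qed (auto simp: lookup_add algebra_simps)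
qed (auto simp: lookup_add algebra_simps)

lemma lookup_Const_0: "lookup (Const c) 0 = c"
  by (simp add: Const_def)

text \<open>The map to F \<otimes> K in coordinates: x \<otimes> c goes to c times the constants of
  x, extended to formal sums.\<close>

definition ev0 :: "((nat \<Rightarrow>\<^sub>0 ('n, 'k::field) mpoly) \<times> 'k \<Rightarrow>\<^sub>0 ('n, 'k) mpoly) \<Rightarrow> nat \<Rightarrow> 'k" where
  "ev0 z l = (\<Sum>p\<in>keys z. lookup (lookup z p) 0 * (snd p * consts0 (fst p) l))"

definition supp_in :: "int list \<Rightarrow> ((nat \<Rightarrow>\<^sub>0 ('n, 'k::field) mpoly) \<times> 'k \<Rightarrow>\<^sub>0 ('n, 'k) mpoly) set" where
  "supp_in a = {z. keys z \<subseteq> gfree a \<times> UNIV}"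

lemma ev0_superset:
  assumes "finite A" "keys z \<subseteq> A"
  shows "ev0 z l = (\<Sum>p\<in>A. lookup (lookup z p) 0 * (snd p * consts0 (fst p) l))"
  unfolding ev0_def using assms by (intro sum.mono_neutral_left) (auto simp: in_keys_iff)

lemma ev0_add: "ev0 (z + w) l = ev0 z l + ev0 w l"
proof -
  let ?A = "keys z \<union> keys w"
  have "ev0 (z + w) l = (\<Sum>p\<in>?A. lookup (lookup (z + w) p) 0 * (snd p * consts0 (fst p) l))"
    using keys_add[of z w] by (intro ev0_superset) auto
  also have "\<dots> = ev0 z l + ev0 w l"
    by (simp add: ev0_superset[of ?A] lookup_add distrib_right sum.distrib)
  finally show ?thesis .
qed

lemma ev0_scale: "ev0 (fscale r z) l = lookup r 0 * ev0 z l"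
  for z :: "((nat \<Rightarrow>\<^sub>0 ('n, 'k::field) mpoly) \<times> 'k \<Rightarrow>\<^sub>0 ('n, 'k) mpoly)"
proof -
  have "keys (fscale r z) \<subseteq> keys z" by (auto simp: in_keys_iff lookup_fscale)
  then have "ev0 (fscale r z) l = (\<Sum>p\<in>keys z. lookup (lookup (fscale r z) p) 0 * (snd p * consts0 (fst p) l))"
    by (intro ev0_superset) auto
  then show ?thesis by (simp add: ev0_def lookup_fscale lookup_mult_0 sum_distrib_left mult.assoc)
qed

lemma ev0_zero [simp]: "ev0 0 l = 0"
  by (simp add: ev0_def)

lemma ev0_uminus: "ev0 (- z) l = - ev0 z l"
  using ev0_add[of z "- z" l] by (simp add: eq_neg_iff_add_eq_0 add.commute)

lemma ev0_diff: "ev0 (z - w) l = ev0 z l - ev0 w l"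
  using ev0_add[of z "- w" l] by (simp add: ev0_uminus)

lemma ev0_sum: "ev0 (\<Sum>x\<in>A. f x) l = (\<Sum>x\<in>A. ev0 (f x) l)"
  by (induction A rule: infinite_finite_induct) (auto simp: ev0_add)

lemma ev0_tensor: "ev0 (tensor x c) l = c * consts0 x l"
  by (simp add: ev0_def tensor_def)

lemma ev0_kscale: "ev0 (kscale c z) l = c * ev0 z l"
  for z :: "((nat \<Rightarrow>\<^sub>0 ('n, 'k::field) mpoly) \<times> 'k \<Rightarrow>\<^sub>0 ('n, 'k) mpoly)"
  by (simp add: kscale_def ev0_scale lookup_Const_0)

lemma supp_in_subspace: "fsc.subspace (supp_in a)"
  unfolding fsc.subspace_def supp_in_def
proof (intro conjI ballI allI)
  fix x y :: "(nat \<Rightarrow>\<^sub>0 ('n, 'k::field) mpoly) \<times> 'k \<Rightarrow>\<^sub>0 ('n, 'k) mpoly" and c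
  show "0 \<in> {z. keys z \<subseteq> gfree a \<times> UNIV}" by simp
  show "x + y \<in> {z. keys z \<subseteq> gfree a \<times> UNIV}" if "x \<in> {z. keys z \<subseteq> gfree a \<times> UNIV}" "y \<in> {z. keys z \<subseteq> gfree a \<times> UNIV}"
    using that keys_add[of x y] by blast
  show "fscale c x \<in> {z. keys z \<subseteq> gfree a \<times> UNIV}" if "x \<in> {z. keys z \<subseteq> gfree a \<times> UNIV}"
  proof -
    have "keys (fscale c x) \<subseteq> keys x" by (auto simp: in_keys_iff lookup_fscale)
    with that show ?thesis by blast
  qed
qed

lemma tensor_supp_in: "x \<in> gfree a \<Longrightarrow> tensor x c \<in> supp_in a"
  by (simp add: supp_in_def tensor_def)

abbreviation gens :: "int list \<Rightarrow> (nat \<Rightarrow> 'k) \<Rightarrow> ((nat \<Rightarrow>\<^sub>0 ('n, 'k::field) mpoly) \<times> 'k \<Rightarrow>\<^sub>0 ('n, 'k) mpoly)" where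
  "gens a v \<equiv> \<Sum>l<length a. kscale (v l) (tensor (single l 1) 1)"

lemma basis_gfree: "l < length a \<Longrightarrow> single l 1 \<in> gfree a"
  by (simp add: gfree_def)

lemma gens_supp_in: "gens a v \<in> supp_in a"
  unfolding kscale_def
  by (intro fsc.subspace_sum[OF supp_in_subspace] fsc.subspace_scale[OF supp_in_subspace] tensor_supp_in basis_gfree) simp

lemma ev0_gens: "ev0 (gens a v :: ((nat \<Rightarrow>\<^sub>0 ('n, 'k::field) mpoly) \<times> 'k \<Rightarrow>\<^sub>0 ('n, 'k) mpoly)) l = (if l < length a then v l else 0)"
proof -
  have "ev0 (gens a v :: ((nat \<Rightarrow>\<^sub>0 ('n, 'k) mpoly) \<times> 'k \<Rightarrow>\<^sub>0 ('n, 'k) mpoly)) l = (\<Sum>i<length a. if i = l then v i else 0)"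
    unfolding ev0_sum by (intro sum.cong) (auto simp: ev0_kscale ev0_tensor lookup_single when_def)
  then show ?thesis by simp
qed

lemma gfree_expand: "x \<in> gfree a \<Longrightarrow> x = (\<Sum>l<length a. fscale (lookup x l) (single l 1))"
proof (rule poly_mapping_eqI)
  fix k assume x: "x \<in> gfree a"
  have "lookup (\<Sum>l<length a. fscale (lookup x l) (single l 1)) k = (\<Sum>l<length a. if l = k then lookup x l else 0)"
    unfolding lookup_sum by (intro sum.cong) (auto simp: lookup_fscale lookup_single when_def)
  then show "lookup x k = lookup (\<Sum>l<length a. fscale (lookup x l) (single l 1)) k"
    using x by (simp add: gfree_iff)
qed

text \<open>The bilinear relations have zero coordinates, and modulo them a formal sum supported on
  F \<times> K equals the combination \<open>gens\<close> of basis tensors with the same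
  coordinates. So the relations are the kernel of \<open>ev0\<close>.\<close>

lemma tensK_rel_iff:
  fixes z :: "(nat \<Rightarrow>\<^sub>0 ('n, 'k::field) mpoly) \<times> 'k \<Rightarrow>\<^sub>0 ('n, 'k) mpoly"
  shows "z \<in> tensK_rel a \<longleftrightarrow> z \<in> supp_in a \<and> ev0 z = (\<lambda>_. 0)"
    and "z \<in> supp_in a \<Longrightarrow> z - gens a (ev0 z) \<in> tensK_rel a"
proof -
  let ?R = "tensK_rel a :: ((nat \<Rightarrow>\<^sub>0 ('n, 'k) mpoly) \<times> 'k \<Rightarrow>\<^sub>0 ('n, 'k) mpoly) set"
  let ?N = "{z \<in> supp_in a. ev0 z = (\<lambda>_. 0)} :: ((nat \<Rightarrow>\<^sub>0 ('n, 'k) mpoly) \<times> 'k \<Rightarrow>\<^sub>0 ('n, 'k) mpoly) set"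
  note sN = supp_in_subspace
  have N: "fsc.subspace ?N"
    unfolding fsc.subspace_def
    by (auto simp: fsc.subspace_0[OF sN] fsc.subspace_add[OF sN] fsc.subspace_scale[OF sN] ev0_add ev0_scale fun_eq_iff)
  note F = fsc.subspace_add[OF gfree_subspace[of a]] fsc.subspace_scale[OF gfree_subspace[of a]]
  note mem = fsc.subspace_diff[OF sN] fsc.subspace_scale[OF sN] tensor_supp_in F
  note ev = ev0_add ev0_diff ev0_tensor ev0_scale lookup_add lookup_fscale lookup_mult_0 res_scale_def
  have n1: "tensor (x + x') y - tensor x y - tensor x' y \<in> ?N" if "x \<in> gfree a" "x' \<in> gfree a"
    for x x' :: "nat \<Rightarrow>\<^sub>0 ('n, 'k) mpoly" and y
    using that by (intro CollectI conjI mem ext) (simp_all add: ev algebra_simps)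
  have n2: "tensor x (y + y') - tensor x y - tensor x y' \<in> ?N" if "x \<in> gfree a"
    for x :: "nat \<Rightarrow>\<^sub>0 ('n, 'k) mpoly" and y y'
    using that by (intro CollectI conjI mem ext) (simp_all add: ev algebra_simps)
  have n3: "tensor (fscale r x) y - fscale r (tensor x y) \<in> ?N" if "x \<in> gfree a"
    for x :: "nat \<Rightarrow>\<^sub>0 ('n, 'k) mpoly" and y r
    using that by (intro CollectI conjI mem ext) (simp_all add: ev algebra_simps)
  have n4: "tensor x (res_scale r y) - fscale r (tensor x y) \<in> ?N" if "x \<in> gfree a"
    for x :: "nat \<Rightarrow>\<^sub>0 ('n, 'k) mpoly" and y r
    using that by (intro CollectI conjI mem ext) (simp_all add: ev algebra_simps)
  have sub: "?R \<subseteq> ?N"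
    unfolding tensK_rel_def tensor_rel_def
    by (rule fsc.span_minimal[OF _ N], intro Un_least) (use n1 n2 n3 n4 in blast)+
  have R: "fsc.subspace ?R" unfolding tensK_rel_def tensor_rel_def by (rule fsc.subspace_span)
  have g1: "tensor (x + x') c - tensor x c - tensor x' c \<in> ?R" if "x \<in> gfree a" "x' \<in> gfree a" for x x' :: "nat \<Rightarrow>\<^sub>0 ('n, 'k) mpoly" and c
    unfolding tensK_rel_def tensor_rel_def using that by (intro fsc.span_base) blast
  have g3: "tensor (fscale r x) c - fscale r (tensor x c) \<in> ?R" if "x \<in> gfree a" for x :: "nat \<Rightarrow>\<^sub>0 ('n, 'k) mpoly" and r c
    unfolding tensK_rel_def tensor_rel_def using that by (intro fsc.span_base) blast
  have g4: "tensor x (lookup r 0 * c) - fscale r (tensor x c) \<in> ?R" if "x \<in> gfree a" for x :: "nat \<Rightarrow>\<^sub>0 ('n, 'k) mpoly" and r c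
    unfolding tensK_rel_def tensor_rel_def res_scale_def[symmetric] using that by (intro fsc.span_base) blast
  note tr = fsc.subspace_add[OF R]
  have trans: "u - w \<in> ?R" if "u - v \<in> ?R" "v - w \<in> ?R" for u v w
    using tr[OF that] by simp
  have sym: "v - u \<in> ?R" if "u - v \<in> ?R" for u v
    using fsc.subspace_neg[OF R that] by simp
  have tsum: "tensor (\<Sum>l\<in>A. f l) c - (\<Sum>l\<in>A. tensor (f l) c) \<in> ?R"
    if "finite A" "\<And>l. l \<in> A \<Longrightarrow> f l \<in> gfree a" for A :: "nat set" and f :: "nat \<Rightarrow> (nat \<Rightarrow>\<^sub>0 ('n, 'k) mpoly)" and c
    using that
  proof (induction A rule: finite_induct)
    case empty
    have "tensor (0 + 0) c - tensor 0 c - tensor 0 c \<in> ?R"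
      by (rule g1) (simp_all add: gfree_iff)
    then have "- tensor 0 c \<in> ?R" by simp
    then show ?case using fsc.subspace_neg[OF R] by fastforce
  next
    case (insert x A)
    have "(\<Sum>l\<in>A. f l) \<in> gfree a" using insert by (intro fsc.subspace_sum[OF gfree_subspace]) auto
    then have "tensor (f x + (\<Sum>l\<in>A. f l)) c - tensor (f x) c - tensor (\<Sum>l\<in>A. f l) c \<in> ?R"
      using insert by (intro g1) auto
    moreover have "tensor (\<Sum>l\<in>A. f l) c - (\<Sum>l\<in>A. tensor (f l) c) \<in> ?R" using insert by auto
    ultimately have "(tensor (f x + (\<Sum>l\<in>A. f l)) c - tensor (f x) c - tensor (\<Sum>l\<in>A. f l) c) +
        (tensor (\<Sum>l\<in>A. f l) c - (\<Sum>l\<in>A. tensor (f l) c)) \<in> ?R" by (rule tr)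
    with insert(1,2) show ?case by (simp add: algebra_simps)
  qed
  have elem: "fscale r (tensor x c) - gens a (\<lambda>l. lookup r 0 * c * consts0 x l) \<in> ?R"
    if x: "x \<in> gfree a" for x :: "nat \<Rightarrow>\<^sub>0 ('n, 'k) mpoly" and r c
  proof -
    let ?c = "lookup r 0 * c"
    have "fscale r (tensor x c) - tensor x ?c \<in> ?R" by (rule sym[OF g4[OF x]])
    moreover have "tensor x ?c - (\<Sum>l<length a. tensor (fscale (lookup x l) (single l 1)) ?c) \<in> ?R"
      by (subst gfree_expand[OF x])
        (rule tsum, auto intro: fsc.subspace_scale[OF gfree_subspace] basis_gfree)
    moreover have "(\<Sum>l<length a. tensor (fscale (lookup x l) (single l 1)) ?c) - gens a (\<lambda>l. ?c * consts0 x l) \<in> ?R"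
      unfolding sum_subtractf[symmetric]
    proof (rule fsc.subspace_sum[OF R])
      fix l assume "l \<in> {..<length a}"
      then have e: "single l 1 \<in> gfree a" by (simp add: basis_gfree)
      have "tensor (fscale (lookup x l) (single l 1)) ?c - fscale (lookup x l) (tensor (single l 1) ?c) \<in> ?R"
        by (rule g3[OF e])
      moreover have "fscale (lookup x l) (tensor (single l 1) ?c) - tensor (single l 1) (consts0 x l * ?c) \<in> ?R"
        by (rule sym[OF g4[OF e]])
      moreover have "tensor (single l 1) (lookup (Const (?c * consts0 x l) :: ('n, 'k) mpoly) 0 * 1) -
          fscale (Const (?c * consts0 x l)) (tensor (single l 1) 1) \<in> ?R"
        by (rule g4[OF e])
      then have "tensor (single l 1) (consts0 x l * ?c) - kscale (?c * consts0 x l) (tensor (single l 1) 1) \<in> ?R"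
        by (simp add: lookup_Const_0 kscale_def mult.commute)
      ultimately show "tensor (fscale (lookup x l) (single l 1)) ?c - kscale (?c * consts0 x l) (tensor (single l 1) 1) \<in> ?R"
        by (rule trans[OF _ trans])
    qed
    ultimately show ?thesis by (rule trans[OF _ trans])
  qed
  have expand: "z - gens a (ev0 z) \<in> ?R" if z: "z \<in> supp_in a"
    for z :: "(nat \<Rightarrow>\<^sub>0 ('n, 'k) mpoly) \<times> 'k \<Rightarrow>\<^sub>0 ('n, 'k) mpoly"
  proof -
    have zs: "z = (\<Sum>p\<in>keys z. fscale (lookup z p) (tensor (fst p) (snd p)))"
    proof (rule poly_mapping_eqI)
      fix q
      have "lookup (\<Sum>p\<in>keys z. fscale (lookup z p) (tensor (fst p) (snd p))) q = (\<Sum>p\<in>keys z. if p = q then lookup z p else 0)"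
        unfolding lookup_sum by (intro sum.cong) (auto simp: lookup_fscale tensor_def lookup_single when_def)
      then show "lookup z q = lookup (\<Sum>p\<in>keys z. fscale (lookup z p) (tensor (fst p) (snd p))) q"
        by (simp add: in_keys_iff)
    qed
    have gz: "(gens a (ev0 z) :: (nat \<Rightarrow>\<^sub>0 ('n, 'k) mpoly) \<times> 'k \<Rightarrow>\<^sub>0 ('n, 'k) mpoly) = (\<Sum>p\<in>keys z. gens a (\<lambda>l. lookup (lookup z p) 0 * snd p * consts0 (fst p) l))"
    proof -
      have ks: "kscale (\<Sum>p\<in>A. f p) u = (\<Sum>p\<in>A. kscale (f p) u)" for A and f :: "(nat \<Rightarrow>\<^sub>0 ('n, 'k) mpoly) \<times> 'k \<Rightarrow> 'k" and u :: "(nat \<Rightarrow>\<^sub>0 ('n, 'k) mpoly) \<times> 'k \<Rightarrow>\<^sub>0 ('n, 'k) mpoly"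
        by (induction A rule: infinite_finite_induct) (auto simp: kscale_def Const_add fsc.scale_left_distrib)
      show ?thesis unfolding ev0_def ks by (subst sum.swap) (simp add: mult.assoc)
    qed
    have "(\<Sum>p\<in>keys z. fscale (lookup z p) (tensor (fst p) (snd p))) - gens a (ev0 z) \<in> ?R"
      unfolding gz sum_subtractf[symmetric]
      using z by (intro fsc.subspace_sum[OF R] elem) (auto simp: supp_in_def)
    then show ?thesis by (simp only: zs[symmetric])
  qed
  show "z \<in> supp_in a \<Longrightarrow> z - gens a (ev0 z) \<in> tensK_rel a" by (rule expand)
  show "z \<in> tensK_rel a \<longleftrightarrow> z \<in> supp_in a \<and> ev0 z = (\<lambda>_. 0)"
  proof
    assume "z \<in> supp_in a \<and> ev0 z = (\<lambda>_. 0)"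
    then show "z \<in> tensK_rel a" using expand[of z] by (simp add: kscale_def)
  qed (use sub in blast)
qed

text \<open>An infinite C would have cardinality 0, so every admissible C must be shown to be finite
  even though B may have infinite dimension. A finite U that spans Z together with B bounds C by
  exchange.\<close>

lemma (in vector_space) quot_dim_nonzero_iff:
  assumes B: "subspace B" and Z: "subspace Z" "B \<subseteq> Z" and U: "finite U" "Z \<subseteq> span (U \<union> B)"
  shows "quot_dim scale Z B \<noteq> 0 \<longleftrightarrow> Z \<noteq> B"
proof -
  define P where "P = (\<lambda>C. \<exists>C'. C \<inter> C' = {} \<and> \<not> dependent (C \<union> C') \<and> span C' = B \<and> span (C \<union> C') = Z)"
  obtain C' where C': "C' \<subseteq> B" "independent C'" "B \<subseteq> span C'"
    using maximal_independent_subset by blast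
  obtain E where E: "C' \<subseteq> E" "E \<subseteq> Z" "independent E" "Z \<subseteq> span E"
    using maximal_independent_subset_extend[of C' Z] C' Z(2) by (metis subset_trans)
  have "span C' = B" using C' B span_minimal[of C' B] by blast
  moreover have "span E = Z" using E Z(1) span_minimal[of E Z] by blast
  moreover have "(E - C') \<union> C' = E" using E(1) by blast
  ultimately have "P (E - C')"
    unfolding P_def using E(3) by (intro exI[of _ C']) auto
  then have "P (SOME C. P C)" by (rule someI)
  then obtain C C' where C: "quot_dim scale Z B = card C" "C \<inter> C' = {}" "independent (C \<union> C')"
    "span C' = B" "span (C \<union> C') = Z"
    unfolding quot_dim_def P_def by blast
  \<comment> \<open>Each element of C1 involves finitely many elements of C'. Collected in D, these
    give an independent set C1 \<union> D inside the span of U \<union> D.\<close>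
  have card_le: "card C1 \<le> card U" if C1: "finite C1" "C1 \<subseteq> C" for C1
  proof -
    have "\<exists>t. finite t \<and> t \<subseteq> C' \<and> x \<in> span (U \<union> t)" if "x \<in> C1" for x
    proof -
      have "span (U \<union> B) \<subseteq> span (U \<union> C')"
        using C(4) span_mono[of C' "U \<union> C'"] span_superset[of "U \<union> C'"] by (intro span_minimal subspace_span) auto
      moreover have "x \<in> Z" using that C1(2) C(5) span_superset by blast
      ultimately have "x \<in> span (U \<union> C')" using U(2) by blast
      then obtain t r where t: "finite t" "t \<subseteq> U \<union> C'" "x = (\<Sum>a\<in>t. scale (r a) a)"
        unfolding span_explicit by auto
      have "x \<in> span t" unfolding t(3) by (intro span_sum span_scale span_base)
      then have "x \<in> span (U \<union> (t \<inter> C'))" using t(2) span_mono[of t "U \<union> (t \<inter> C')"] by blast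
      then show ?thesis using t(1) by (intro exI[of _ "t \<inter> C'"]) auto
    qed
    then obtain t where t: "\<And>x. x \<in> C1 \<Longrightarrow> finite (t x) \<and> t x \<subseteq> C' \<and> x \<in> span (U \<union> t x)" by metis
    define D where "D = (\<Union>x\<in>C1. t x)"
    have D: "finite D" "D \<subseteq> C'" using t C1(1) by (auto simp: D_def)
    have sub: "C1 \<union> D \<subseteq> span (U \<union> D)"
    proof
      fix x assume "x \<in> C1 \<union> D"
      then consider "x \<in> C1" | "x \<in> D" by blast
      then show "x \<in> span (U \<union> D)"
      proof cases
        case 1
        then have "t x \<subseteq> D" by (auto simp: D_def)
        then have "span (U \<union> t x) \<subseteq> span (U \<union> D)" by (intro span_mono) auto
        then show ?thesis using t[OF 1] by blast
      qed (auto intro: span_base)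
    qed
    have "independent (C1 \<union> D)" using C(3) C1(2) D(2) by (elim independent_mono) auto
    then have "card (C1 \<union> D) \<le> card (U \<union> D)"
      using independent_span_bound[of "U \<union> D" "C1 \<union> D"] U(1) D(1) sub by auto
    moreover have "card (C1 \<union> D) = card C1 + card D"
      using C1 D C(2) by (intro card_Un_disjoint) auto
    moreover have "card (U \<union> D) \<le> card U + card D" by (rule card_Un_le)
    ultimately show ?thesis by simp
  qed
  have "finite C"
  proof (rule ccontr)
    assume "infinite C"
    then obtain C1 where "C1 \<subseteq> C" "finite C1" "card C1 = Suc (card U)" by (meson infinite_arbitrarily_large)
    then show False using card_le[of C1] by simp
  qed
  moreover have "C = {} \<longleftrightarrow> Z = B"
  proof
    assume "C = {}"
    then show "Z = B" using C(4,5) by simp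
  next
    assume ZB: "Z = B"
    show "C = {}"
    proof (rule ccontr)
      assume "C \<noteq> {}"
      then obtain x where x: "x \<in> C" by blast
      have "x \<in> span C'" using x C(4,5) ZB span_superset[of "C \<union> C'"] by auto
      also have "span C' \<subseteq> span ((C \<union> C') - {x})" using x C(2) by (intro span_mono) auto
      finally show False using C(3) x unfolding dependent_def by blast
    qed
  qed
  ultimately show ?thesis unfolding C(1) by simp
qed

section \<open>Tor of a graded free resolution in coordinates\<close>

lemma vector_space_kscale: "vector_space (kscale :: 'k::field \<Rightarrow> ('x \<Rightarrow>\<^sub>0 ('n, 'k) mpoly) \<Rightarrow> _)"
  by unfold_locales
    (simp_all add: kscale_def Const_add Const_mult fsc.scale_right_distrib fsc.scale_left_distrib)

interpretation ks: vector_space "kscale :: 'k::field \<Rightarrow> ('x \<Rightarrow>\<^sub>0 ('n, 'k) mpoly) \<Rightarrow> _"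
  by (rule vector_space_kscale)

text \<open>The element of the free module with constant coordinates v, a section of
  \<open>consts0\<close>.\<close>

definition rep :: "int list \<Rightarrow> (nat \<Rightarrow> 'k) \<Rightarrow> (nat \<Rightarrow>\<^sub>0 ('n, 'k::field) mpoly)" where
  "rep a v = (\<Sum>l<length a. fscale (Const (v l)) (single l 1))"

text \<open>The preimage of the degree j part of F \<otimes> K, which is spanned by the basis
  elements of degree j.\<close>

definition tsup :: "int list \<Rightarrow> int \<Rightarrow> ((nat \<Rightarrow>\<^sub>0 ('n, 'k::field) mpoly) \<times> 'k \<Rightarrow>\<^sub>0 ('n, 'k) mpoly) set" where
  "tsup a j = {z \<in> supp_in a. \<forall>l. ev0 z l \<noteq> 0 \<longrightarrow> l < length a \<and> a ! l = j}"

lemma tsup_iff: "z \<in> tsup a j \<longleftrightarrow> z \<in> supp_in a \<and> (\<forall>l. \<not> (l < length a \<and> a ! l = j) \<longrightarrow> ev0 z l = 0)"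
  unfolding tsup_def by blast

lemma tsup_subspace: "ks.subspace (tsup a j)"
  unfolding ks.subspace_def
proof (intro conjI ballI allI)
  fix x y :: "(nat \<Rightarrow>\<^sub>0 ('n, 'k::field) mpoly) \<times> 'k \<Rightarrow>\<^sub>0 ('n, 'k) mpoly" and c
  show "0 \<in> tsup a j" by (simp add: tsup_iff fsc.subspace_0[OF supp_in_subspace])
  show "x + y \<in> tsup a j" if "x \<in> tsup a j" "y \<in> tsup a j"
    using that by (simp add: tsup_iff fsc.subspace_add[OF supp_in_subspace] ev0_add)
  show "kscale c x \<in> tsup a j" if "x \<in> tsup a j"
    using that unfolding kscale_def by (simp add: tsup_iff fsc.subspace_scale[OF supp_in_subspace] ev0_scale)
qed

lemma lookup_rep: "lookup (rep a v) l = (if l < length a then Const (v l) else 0)"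
proof -
  have "lookup (rep a v) l = (\<Sum>i<length a. if i = l then Const (v i) else 0)"
    unfolding rep_def lookup_sum by (intro sum.cong) (auto simp: lookup_fscale lookup_single when_def)
  then show ?thesis by simp
qed

lemma consts_rep: "consts0 (rep a v :: nat \<Rightarrow>\<^sub>0 ('n, 'k::field) mpoly) l = (if l < length a then v l else 0)"
  by (simp add: lookup_rep lookup_Const_0)

lemma rep_gfree: "rep a v \<in> gfree a"
  by (simp add: gfree_iff lookup_rep)

lemma rep_gfree_comp:
  assumes "\<And>l. v l \<noteq> 0 \<Longrightarrow> l < length a \<and> a ! l = j"
  shows "rep a v \<in> gfree_comp a j"
  unfolding gfree_comp_iff
proof
  fix l
  show "lookup (rep a v) l \<in> (if l < length a then homog (j - a ! l) else {0})"
  proof (cases "v l = 0")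
    case False
    with assms[OF this] show ?thesis by (simp add: lookup_rep Const_def homog_def mon_degree_def)
  qed (simp add: lookup_rep)
qed

lemma consts_gfree_comp:
  assumes "x \<in> gfree_comp a j" "consts0 x l \<noteq> 0"
  shows "l < length a \<and> a ! l = j"
proof -
  have m: "lookup x l \<in> (if l < length a then homog (j - a ! l) else {0})" using assms(1) by (simp add: gfree_comp_iff)
  have l: "l < length a" using m assms(2) by (cases "l < length a") auto
  have "0 \<in> keys (lookup x l)" using assms(2) by (simp add: in_keys_iff)
  with m l have "int (mon_degree (0 :: 'a \<Rightarrow>\<^sub>0 nat)) = j - a ! l" unfolding homog_def by auto
  with l show ?thesis by (simp add: mon_degree_def)
qed

lemma tensK_comp_plus_rel:
  "{z + w |z w. z \<in> tensK_comp a j \<and> w \<in> tensK_rel a} =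
    (tsup a j :: ((nat \<Rightarrow>\<^sub>0 ('n, 'k::field) mpoly) \<times> 'k \<Rightarrow>\<^sub>0 ('n, 'k) mpoly) set)"
    (is "?L = ?T")
proof
  have T: "ks.subspace ?T"
    by (rule tsup_subspace)
  have "tensK_comp a j \<subseteq> ?T"
    unfolding tensK_comp_def
  proof (rule ks.span_minimal[OF _ T])
    show "{tensor x c |x c. x \<in> gfree_comp a j} \<subseteq> ?T"
    proof (rule subsetI, elim CollectE exE conjE)
      fix z :: "(nat \<Rightarrow>\<^sub>0 ('n, 'k) mpoly) \<times> 'k \<Rightarrow>\<^sub>0 ('n, 'k) mpoly" and c and x :: "nat \<Rightarrow>\<^sub>0 ('n, 'k) mpoly"
      assume x: "x \<in> gfree_comp a j" and z: "z = tensor x c"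
      have "x \<in> gfree a" using x by (simp add: gfree_comp_def)
      then show "z \<in> ?T"
        using consts_gfree_comp[OF x] unfolding z tsup_def by (simp add: ev0_tensor tensor_supp_in)
    qed
  qed
  moreover have "tensK_rel a \<subseteq> ?T"
    by (auto simp: tsup_def tensK_rel_iff(1))
  ultimately show "?L \<subseteq> ?T" using ks.subspace_add[OF T] by blast
  show "?T \<subseteq> ?L"
  proof
    fix z assume z: "z \<in> ?T"
    have "gens a (ev0 z) \<in> tensK_comp a j"
      unfolding tensK_comp_def
    proof (rule ks.span_sum)
      fix l assume l: "l \<in> {..<length a}"
      show "kscale (ev0 z l) (tensor (single l 1) 1) \<in> ks.span {tensor x c |x c. x \<in> gfree_comp a j}"
      proof (cases "ev0 z l = 0")
        case False
        then have "a ! l = j" using z by (simp add: tsup_def)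
        then have "single l 1 \<in> gfree_comp a j"
          using l by (auto simp: gfree_comp_iff lookup_single when_def homog_def mon_degree_def)
        then show ?thesis by (intro ks.span_scale ks.span_base) blast
      qed (simp add: ks.span_zero)
    qed
    moreover have "z - gens a (ev0 z) \<in> tensK_rel a"
      using z by (intro tensK_rel_iff(2)) (simp add: tsup_def)
    moreover have "z = gens a (ev0 z) + (z - gens a (ev0 z))" by simp
    ultimately show "z \<in> ?L" by blast
  qed
qed

text \<open>Modulo the maximal ideal a homomorphism of free modules is a matrix over K acting on
  constants.\<close>

lemma consts_hom:
  fixes d :: "(nat \<Rightarrow>\<^sub>0 ('n, 'k::field) mpoly) \<Rightarrow> (nat \<Rightarrow>\<^sub>0 ('n, 'k) mpoly)"
  assumes d: "module_hom_on fscale fscale (gfree a) N d" and x: "x \<in> gfree a"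
  shows "consts0 (d x) l = (\<Sum>i<length a. consts0 x i * consts0 (d (single i 1)) l)"
proof -
  have dadd: "d (x + y) = d x + d y" if "x \<in> gfree a" "y \<in> gfree a" for x y
    using d that by (simp add: module_hom_on_def)
  have dsc: "d (fscale r x) = fscale r (d x)" if "x \<in> gfree a" for x r
    using d that by (simp add: module_hom_on_def)
  have d0: "d 0 = 0" using dadd[of 0 0] fsc.subspace_0[OF gfree_subspace[of a]] by simp
  have e: "fscale r (single i 1) \<in> gfree a" if "i < length a" for r :: "('n, 'k) mpoly" and i
    using that by (intro fsc.subspace_scale[OF gfree_subspace] basis_gfree)
  have ds: "d (\<Sum>i\<in>A. fscale (lookup x i) (single i 1)) = (\<Sum>i\<in>A. fscale (lookup x i) (d (single i 1)))"
    if "A \<subseteq> {..<length a}" for A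
    using finite_subset[OF that finite_lessThan] that
  proof (induction A rule: finite_induct)
    case (insert i A)
    have "(\<Sum>i\<in>A. fscale (lookup x i) (single i 1)) \<in> gfree a"
      using insert.prems e by (intro fsc.subspace_sum[OF gfree_subspace]) auto
    with insert show ?case by (simp add: dadd dsc e basis_gfree)
  qed (simp add: d0)
  have "consts0 (d x) l = consts0 (d (\<Sum>i<length a. fscale (lookup x i) (single i 1))) l"
    using gfree_expand[OF x] by simp
  also have "\<dots> = (\<Sum>i<length a. consts0 x i * consts0 (d (single i 1)) l)"
    by (simp only: ds[OF subset_refl] lookup_sum lookup_fscale lookup_mult_0)
  finally show ?thesis .
qed

lemma tensor_map_props:
  fixes d :: "(nat \<Rightarrow>\<^sub>0 ('n, 'k::field) mpoly) \<Rightarrow> (nat \<Rightarrow>\<^sub>0 ('n, 'k) mpoly)"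
  assumes d: "module_hom_on fscale fscale (gfree a) (gfree b) d" and z: "z \<in> supp_in a"
  shows "tensor_map d z \<in> supp_in b" and "ev0 (tensor_map d z) = consts0 (d (rep a (ev0 z)))"
proof -
  have p: "fst p \<in> gfree a" if "p \<in> keys z" for p using z that by (auto simp: supp_in_def)
  have dp: "d (fst p) \<in> gfree b" if "p \<in> keys z" for p
    using d p[OF that] unfolding module_hom_on_def by blast
  show "tensor_map d z \<in> supp_in b"
    unfolding tensor_map_def using dp
    by (intro fsc.subspace_sum[OF supp_in_subspace] fsc.subspace_scale[OF supp_in_subspace] tensor_supp_in)
  show "ev0 (tensor_map d z) = consts0 (d (rep a (ev0 z)))"
  proof
    fix l
    let ?D = "\<lambda>i. consts0 (d (single i 1)) l"
    have "ev0 (tensor_map d z) l = (\<Sum>p\<in>keys z. lookup (lookup z p) 0 * (snd p * consts0 (d (fst p)) l))"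
      by (simp add: tensor_map_def ev0_sum ev0_scale ev0_tensor)
    also have "\<dots> = (\<Sum>p\<in>keys z. \<Sum>i<length a. lookup (lookup z p) 0 * (snd p * consts0 (fst p) i) * ?D i)"
      by (intro sum.cong refl) (simp add: consts_hom[OF d p] sum_distrib_left mult.assoc)
    also have "\<dots> = (\<Sum>i<length a. \<Sum>p\<in>keys z. lookup (lookup z p) 0 * (snd p * consts0 (fst p) i) * ?D i)"
      by (rule sum.swap)
    also have "\<dots> = (\<Sum>i<length a. ev0 z i * ?D i)"
      by (simp add: ev0_def sum_distrib_right)
    also have "\<dots> = consts0 (d (rep a (ev0 z))) l"
      unfolding consts_hom[OF d rep_gfree] by (intro sum.cong refl) (simp add: lookup_rep lookup_Const_0)
    finally show "ev0 (tensor_map d z) l = consts0 (d (rep a (ev0 z))) l" .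
  qed
qed

text \<open>Cycles and boundaries are both described by coordinates, where the differential becomes
  its matrix of constants. Both contain the tensor relations, and finitely many basis tensors span
  the cycles modulo the boundaries, so \<open>quot_dim_nonzero_iff\<close> applies.\<close>

lemma betti_resolution_nonzero_iff:
  fixes s :: "('n::{finite, linorder}, 'k::field) mpoly \<Rightarrow> 'a::ab_group_add \<Rightarrow> 'a"
  assumes res: "graded_free_resolution s M gr a d \<epsilon>"
  shows "quot_dim kscale (tor_cycles a d i j) (tor_boundaries a d i j) \<noteq> 0 \<longleftrightarrow> \<not> tor_zero a d i j"
proof -
  note gres = graded_free_resolutionD[OF res]
  note hom = resolutionD(2)[OF gres(1)]
  have dgr: "d i x \<in> gfree_comp (a i) j" if "x \<in> gfree_comp (a (Suc i)) j" for i x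
    using subsetD[OF gres(3) imageI[OF that]] .
  have dd: "d i' (d (Suc i') x) = 0" if "x \<in> gfree (a (Suc (Suc i')))" for i' x
  proof -
    have "d (Suc i') x \<in> {x \<in> gfree (a (Suc i')). d i' x = 0}"
      unfolding resolutionD(5)[OF gres(1)] using that by (rule imageI)
    then show ?thesis by simp
  qed
  have gc: "gfree_comp b j \<subseteq> (gfree b :: (nat \<Rightarrow>\<^sub>0 ('n, 'k) mpoly) set)" for b by (auto simp: gfree_comp_def)
  let ?T = "tsup (a i) j :: ((nat \<Rightarrow>\<^sub>0 ('n, 'k) mpoly) \<times> 'k \<Rightarrow>\<^sub>0 ('n, 'k) mpoly) set"
  let ?cond = "\<lambda>x. case i of 0 \<Rightarrow> True | Suc i' \<Rightarrow> consts0 (d i' x) = (\<lambda>_. 0)"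
  let ?Z = "tor_cycles a d i j" and ?B = "tor_boundaries a d i j"
  have consts_eq: "consts0 (d i' x) = consts0 (d i' y)"
    if "x \<in> gfree (a (Suc i'))" "y \<in> gfree (a (Suc i'))" "consts0 x = consts0 y" for i' x y
    using fun_cong[OF that(3)] by (intro ext) (simp add: consts_hom[OF hom that(1)] consts_hom[OF hom that(2)])
  have Z: "?Z = {z \<in> ?T. ?cond (rep (a i) (ev0 z))}"
  proof -
    have "(tensor_map (d i') z \<in> tensK_rel (a i')) = (consts0 (d i' (rep (a i) (ev0 z))) = (\<lambda>_. 0))"
      if "i = Suc i'" "z \<in> ?T" for i' z
    proof -
      have z: "z \<in> supp_in (a (Suc i'))" using that by (simp add: tsup_def)
      show ?thesis unfolding tensK_rel_iff(1) using tensor_map_props[OF hom z] that(1) by simp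
    qed
    then show ?thesis
      unfolding tor_cycles_def tensK_comp_plus_rel by (cases i) auto
  qed
  have B: "?B = {y \<in> supp_in (a i). \<exists>v\<in>gfree_comp (a (Suc i)) j. ev0 y = consts0 (d i v)}" (is "_ = ?B'")
  proof
    show "?B \<subseteq> ?B'"
    proof
      fix y assume "y \<in> ?B"
      then obtain z w where y: "y = tensor_map (d i) z + w" "z \<in> tensK_comp (a (Suc i)) j" "w \<in> tensK_rel (a i)"
        unfolding tor_boundaries_def by blast
      have "z = z + 0" "0 \<in> tensK_rel (a (Suc i))" by (simp_all add: tensK_rel_iff(1) fsc.subspace_0[OF supp_in_subspace] fun_eq_iff)
      then have zT: "z \<in> tsup (a (Suc i)) j" unfolding tensK_comp_plus_rel[symmetric] using y(2) by blast
      then have zs: "z \<in> supp_in (a (Suc i))" by (simp add: tsup_def)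
      note tm = tensor_map_props[OF hom zs]
      have w: "w \<in> supp_in (a i)" "ev0 w = (\<lambda>_. 0)" using y(3) by (simp_all add: tensK_rel_iff(1))
      have "y \<in> supp_in (a i)" unfolding y(1) by (rule fsc.subspace_add[OF supp_in_subspace tm(1) w(1)])
      moreover have "ev0 y = consts0 (d i (rep (a (Suc i)) (ev0 z)))"
        unfolding tm(2)[symmetric] by (rule ext) (simp add: y(1) ev0_add w(2))
      moreover have "rep (a (Suc i)) (ev0 z) \<in> gfree_comp (a (Suc i)) j"
        using zT by (intro rep_gfree_comp) (simp add: tsup_def)
      ultimately show "y \<in> ?B'" by blast
    qed
    show "?B' \<subseteq> ?B"
    proof
      fix y assume "y \<in> ?B'"
      then obtain v where y: "y \<in> supp_in (a i)" "v \<in> gfree_comp (a (Suc i)) j" "ev0 y = consts0 (d i v)" by blast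
      let ?g = "gens (a (Suc i)) (consts0 v) :: (nat \<Rightarrow>\<^sub>0 ('n, 'k) mpoly) \<times> 'k \<Rightarrow>\<^sub>0 ('n, 'k) mpoly"
      have vT: "?g \<in> tsup (a (Suc i)) j"
        using consts_gfree_comp[OF y(2)] by (auto simp: tsup_def gens_supp_in ev0_gens split: if_splits)
      then obtain z w where zw: "?g = z + w" "z \<in> tensK_comp (a (Suc i)) j" "w \<in> tensK_rel (a (Suc i))"
        unfolding tensK_comp_plus_rel[symmetric] by blast
      have w: "w \<in> supp_in (a (Suc i))" "ev0 w = (\<lambda>_. 0)" using zw(3) by (simp_all add: tensK_rel_iff(1))
      have z_eq: "z = ?g - w" using zw(1) by simp
      have zs: "z \<in> supp_in (a (Suc i))"
        unfolding z_eq by (rule fsc.subspace_diff[OF supp_in_subspace gens_supp_in w(1)])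
      have vF: "v \<in> gfree (a (Suc i))" using y(2) gc by blast
      have ez: "ev0 z l = consts0 v l" for l
        using vF[unfolded gfree_iff, rule_format, of l] by (auto simp: z_eq ev0_diff w(2) ev0_gens not_less)
      note tm = tensor_map_props[OF hom zs]
      have "consts0 (d i (rep (a (Suc i)) (ev0 z))) = consts0 (d i v)"
        using vF[unfolded gfree_iff] by (intro consts_eq rep_gfree vF) (auto simp: consts_rep ez fun_eq_iff not_less)
      then have "y - tensor_map (d i) z \<in> tensK_rel (a i)"
        unfolding tensK_rel_iff(1) using fsc.subspace_diff[OF supp_in_subspace y(1) tm(1)]
        by (simp add: fun_eq_iff ev0_diff tm(2) y(3))
      moreover have "y = tensor_map (d i) z + (y - tensor_map (d i) z)" by simp
      ultimately show "y \<in> ?B" unfolding tor_boundaries_def using zw(2) by blast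
    qed
  qed
  have BZ: "?B \<subseteq> ?Z"
  proof
    fix y assume "y \<in> ?B"
    then obtain v where y: "y \<in> supp_in (a i)" "v \<in> gfree_comp (a (Suc i)) j" "ev0 y = consts0 (d i v)"
      unfolding B by blast
    have yT: "y \<in> ?T" using consts_gfree_comp[OF dgr[OF y(2)]] y(1,3) by (simp add: tsup_def)
    have "consts0 (d i' (rep (a i) (ev0 y))) = (\<lambda>_. 0)" if i: "i = Suc i'" for i'
    proof -
      have v: "v \<in> gfree (a (Suc (Suc i')))" using y(2) gc i by blast
      have dv: "d (Suc i') v \<in> gfree (a (Suc i'))" using dgr[OF y(2)] gc i by blast
      have "consts0 (d i' (rep (a (Suc i')) (ev0 y))) = consts0 (d i' (d (Suc i') v))"
        using dv[unfolded gfree_iff] y(3) i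
        by (intro consts_eq rep_gfree dv) (auto simp: consts_rep fun_eq_iff not_less)
      then show ?thesis using dd[OF v] i by simp
    qed
    then show "y \<in> ?Z" unfolding Z using yT by (cases i) auto
  qed
  have ZB: "?Z \<subseteq> ?B \<longleftrightarrow> tor_zero a d i j"
  proof
    assume L: "?Z \<subseteq> ?B"
    show "tor_zero a d i j"
      unfolding tor_zero_def
    proof (intro ballI impI)
      fix x assume x: "x \<in> gfree_comp (a i) j" "?cond x"
      have xF: "x \<in> gfree (a i)" using x(1) gc by blast
      let ?z = "gens (a i) (consts0 x) :: (nat \<Rightarrow>\<^sub>0 ('n, 'k) mpoly) \<times> 'k \<Rightarrow>\<^sub>0 ('n, 'k) mpoly"
      have ez: "ev0 ?z = consts0 x"
        using xF[unfolded gfree_iff] by (auto simp: ev0_gens fun_eq_iff not_less)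
      have cz: "consts0 (rep (a i) (ev0 ?z)) = consts0 x"
        using xF[unfolded gfree_iff] unfolding ez by (intro ext) (auto simp: consts_rep not_less)
      have "?z \<in> ?T"
        unfolding tsup_iff ez using consts_gfree_comp[OF x(1)] by (intro conjI gens_supp_in allI impI) metis
      moreover have "?cond (rep (a i) (ev0 ?z))"
      proof (cases i)
        case (Suc i')
        have "consts0 (d i' (rep (a (Suc i')) (ev0 ?z))) = consts0 (d i' x)"
          using xF cz Suc by (intro consts_eq rep_gfree) simp_all
        then show ?thesis using x(2) Suc by simp
      qed simp
      ultimately have "?z \<in> ?B" using L Z by blast
      then have "\<exists>v\<in>gfree_comp (a (Suc i)) j. ev0 ?z = consts0 (d i v)"
        unfolding B mem_Collect_eq by (rule conjunct2)
      then show "\<exists>x'\<in>gfree_comp (a (Suc i)) j. consts0 x = consts0 (d i x')"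
        unfolding ez .
    qed
  next
    assume R: "tor_zero a d i j"
    show "?Z \<subseteq> ?B"
    proof
      fix z assume "z \<in> ?Z"
      then have z: "z \<in> ?T" "?cond (rep (a i) (ev0 z))" unfolding Z by blast+
      let ?r = "rep (a i) (ev0 z) :: nat \<Rightarrow>\<^sub>0 ('n, 'k) mpoly"
      have "?r \<in> gfree_comp (a i) j"
        using z(1) by (intro rep_gfree_comp) (simp add: tsup_def)
      from R[unfolded tor_zero_def, rule_format, OF this z(2)]
      obtain x' where x': "x' \<in> gfree_comp (a (Suc i)) j" "consts0 ?r = consts0 (d i x')"
        by (elim bexE) (rule that)
      have e: "consts0 ?r = ev0 z"
        using z(1) unfolding tsup_iff by (intro ext) (simp add: consts_rep)
      have "z \<in> supp_in (a i)" using z(1) by (simp add: tsup_iff)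
      then show "z \<in> ?B" unfolding B using x' unfolding e by blast
    qed
  qed
  have kT: "ks.subspace ?T"
    by (rule tsup_subspace)
  have add_rep: "rep b (ev0 (x + y)) = rep b (ev0 x) + rep b (ev0 y)" for b and x y :: "(nat \<Rightarrow>\<^sub>0 ('n, 'k) mpoly) \<times> 'k \<Rightarrow>\<^sub>0 ('n, 'k) mpoly"
    by (rule poly_mapping_eqI) (simp add: lookup_rep lookup_add ev0_add Const_add)
  have mul_rep: "rep b (ev0 (kscale c x)) = fscale (Const c) (rep b (ev0 x))" for b c and x :: "(nat \<Rightarrow>\<^sub>0 ('n, 'k) mpoly) \<times> 'k \<Rightarrow>\<^sub>0 ('n, 'k) mpoly"
    by (rule poly_mapping_eqI) (simp add: lookup_rep lookup_fscale ev0_kscale Const_mult)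
  have zero_rep: "rep b (ev0 (0 :: (nat \<Rightarrow>\<^sub>0 ('n, 'k) mpoly) \<times> 'k \<Rightarrow>\<^sub>0 ('n, 'k) mpoly)) = 0" for b
    by (rule poly_mapping_eqI) (simp add: lookup_rep)
  have dl: "d i' (x + y) = d i' x + d i' y" "d i' (fscale r x) = fscale r (d i' x)"
    if "x \<in> gfree (a (Suc i'))" "y \<in> gfree (a (Suc i'))" for i' x y r
    using hom[of i'] that by (simp_all add: module_hom_on_def)
  have d0: "d i' 0 = 0" for i'
  proof -
    have z: "0 \<in> gfree (a (Suc i'))" by (rule fsc.subspace_0[OF gfree_subspace])
    have "d i' 0 + 0 = d i' 0 + d i' 0" using dl(1)[OF z z] by (simp only: add_0_right)
    then show ?thesis by (simp only: add_left_cancel)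
  qed
  have kZ: "ks.subspace ?Z"
    unfolding ks.subspace_def Z
  proof (intro conjI ballI allI)
    show "0 \<in> {z \<in> ?T. ?cond (rep (a i) (ev0 z))}"
      using ks.subspace_0[OF kT] by (cases i) (simp_all add: zero_rep d0)
  next
    fix x y assume "x \<in> {z \<in> ?T. ?cond (rep (a i) (ev0 z))}" "y \<in> {z \<in> ?T. ?cond (rep (a i) (ev0 z))}"
    then show "x + y \<in> {z \<in> ?T. ?cond (rep (a i) (ev0 z))}"
      using ks.subspace_add[OF kT, of x y]
      by (cases i) (auto simp: add_rep dl rep_gfree lookup_add fun_eq_iff)
  next
    fix c x assume "x \<in> {z \<in> ?T. ?cond (rep (a i) (ev0 z))}"
    then show "kscale c x \<in> {z \<in> ?T. ?cond (rep (a i) (ev0 z))}"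
      using ks.subspace_scale[OF kT, of x c]
      by (cases i) (auto simp: mul_rep dl[OF rep_gfree rep_gfree] lookup_fscale lookup_mult_0 fun_eq_iff)
  qed
  have Bi: "y \<in> ?B \<longleftrightarrow> y \<in> supp_in (a i) \<and> (\<exists>v\<in>gfree_comp (a (Suc i)) j. ev0 y = consts0 (d i v))" for y
    unfolding B by (rule mem_Collect_eq)
  interpret Fi: gmod fscale "gfree (a (Suc i))" "gfree_comp (a (Suc i))" "gpr (a (Suc i)) :: _ \<Rightarrow> (nat \<Rightarrow>\<^sub>0 ('n, 'k) mpoly) \<Rightarrow> _"
    by (rule gmod_gfree)
  have kB: "ks.subspace ?B"
    unfolding ks.subspace_def
  proof (intro conjI ballI allI)
    show "0 \<in> ?B"
      unfolding Bi
    proof (intro conjI bexI[of _ 0])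
      show "0 \<in> supp_in (a i)" by (rule fsc.subspace_0[OF supp_in_subspace])
      show "ev0 (0 :: (nat \<Rightarrow>\<^sub>0 ('n, 'k) mpoly) \<times> 'k \<Rightarrow>\<^sub>0 ('n, 'k) mpoly) = consts0 (d i 0)" by (auto simp: d0)
      show "0 \<in> gfree_comp (a (Suc i)) j" by (simp add: gfree_comp_iff)
    qed
  next
    fix x y assume "x \<in> ?B" "y \<in> ?B"
    note xy = this[unfolded Bi]
    from conjunct2[OF xy(1)] obtain v where v: "v \<in> gfree_comp (a (Suc i)) j" "ev0 x = consts0 (d i v)" by (elim bexE)
    from conjunct2[OF xy(2)] obtain u where u: "u \<in> gfree_comp (a (Suc i)) j" "ev0 y = consts0 (d i u)" by (elim bexE)
    have vu: "v \<in> gfree (a (Suc i))" "u \<in> gfree (a (Suc i))" using v(1) u(1) gc by blast+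
    show "x + y \<in> ?B"
      unfolding Bi
    proof (intro conjI bexI[of _ "v + u"])
      show "x + y \<in> supp_in (a i)"
        by (rule fsc.subspace_add[OF supp_in_subspace conjunct1[OF xy(1)] conjunct1[OF xy(2)]])
      show "ev0 (x + y) = consts0 (d i (v + u))"
        by (intro ext) (simp add: dl(1)[OF vu] ev0_add v(2) u(2) lookup_add)
      show "v + u \<in> gfree_comp (a (Suc i)) j" by (rule Fi.gr_add[OF v(1) u(1)])
    qed
  next
    fix c x assume "x \<in> ?B"
    note x = this[unfolded Bi]
    from conjunct2[OF x] obtain v where v: "v \<in> gfree_comp (a (Suc i)) j" "ev0 x = consts0 (d i v)" by (elim bexE)
    have vF: "v \<in> gfree (a (Suc i))" using v(1) gc by blast
    show "kscale c x \<in> ?B"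
      unfolding Bi
    proof (intro conjI bexI[of _ "fscale (Const c) v"])
      show "kscale c x \<in> supp_in (a i)"
        unfolding kscale_def by (rule fsc.subspace_scale[OF supp_in_subspace conjunct1[OF x]])
      show "ev0 (kscale c x) = consts0 (d i (fscale (Const c) v))"
        by (intro ext) (simp add: dl(2)[OF vF vF] ev0_kscale v(2) lookup_fscale lookup_mult_0 lookup_Const_0)
      show "fscale (Const c) v \<in> gfree_comp (a (Suc i)) j" by (rule Fi.gr_Const[OF v(1)])
    qed
  qed
  let ?U = "(\<lambda>l. tensor (single l 1) 1) ` {..<length (a i)} :: ((nat \<Rightarrow>\<^sub>0 ('n, 'k) mpoly) \<times> 'k \<Rightarrow>\<^sub>0 ('n, 'k) mpoly) set"
  have "?Z \<subseteq> ks.span (?U \<union> ?B)"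
  proof
    fix z assume "z \<in> ?Z"
    then have zs: "z \<in> supp_in (a i)" unfolding Z by (simp add: tsup_def)
    have "gens (a i) (ev0 z) \<in> ks.span (?U \<union> ?B)"
      by (intro ks.span_sum ks.span_scale ks.span_base) blast
    moreover have "z - gens (a i) (ev0 z) \<in> ?B"
    proof -
      have "z - gens (a i) (ev0 z) \<in> tensK_rel (a i)" by (rule tensK_rel_iff(2)[OF zs])
      then have "z - gens (a i) (ev0 z) \<in> supp_in (a i)" "ev0 (z - gens (a i) (ev0 z)) = (\<lambda>_. 0)"
        by (simp_all add: tensK_rel_iff(1))
      moreover have "0 \<in> gfree_comp (a (Suc i)) j" by (simp add: gfree_comp_iff)
      moreover have "consts0 (d i 0) = (\<lambda>_. 0)" by (simp add: d0)
      ultimately show ?thesis unfolding Bi by (intro conjI bexI[of _ 0]) simp_all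
    qed
    then have "z - gens (a i) (ev0 z) \<in> ks.span (?U \<union> ?B)" by (intro ks.span_base) blast
    ultimately have "gens (a i) (ev0 z) + (z - gens (a i) (ev0 z)) \<in> ks.span (?U \<union> ?B)" by (rule ks.span_add)
    then show "z \<in> ks.span (?U \<union> ?B)" by simp
  qed
  then have "quot_dim kscale ?Z ?B \<noteq> 0 \<longleftrightarrow> ?Z \<noteq> ?B"
    by (intro ks.quot_dim_nonzero_iff kB kZ BZ) auto
  then show ?thesis using ZB BZ by blast
qed

text \<open>The resolution inside \<open>betti\<close> is an arbitrary choice. The hypothesis
  ensures that the choice is a resolution, and Koszul homology makes the answer depend on M
  alone.\<close>

theorem (in gmod) betti_nonzero_iff:
  assumes "graded_free_resolution s M gr a d \<epsilon>"
  shows "betti s M gr i j \<noteq> 0 \<longleftrightarrow> \<not> kexact (\<lambda>k. s (Var k)) gr i j"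
proof -
  define P where "P = (\<lambda>(a, d, \<epsilon>). graded_free_resolution s M gr a d \<epsilon>)"
  obtain a' d' \<epsilon>' where e: "(SOME x. P x) = (a', d', \<epsilon>')" by (cases "SOME x. P x")
  have "P (SOME x. P x)" by (rule someI[of P "(a, d, \<epsilon>)"]) (simp add: P_def assms)
  then have r: "graded_free_resolution s M gr a' d' \<epsilon>'" unfolding e by (simp add: P_def)
  have "betti s M gr i j = quot_dim kscale (tor_cycles a' d' i j) (tor_boundaries a' d' i j)"
    unfolding betti_def P_def[symmetric] e by simp
  then show ?thesis
    using betti_resolution_nonzero_iff[OF r, of i j] kexact_iff_tor_zero[OF r, of i j] by simp
qed

section \<open>Projective dimension\<close>

lemma module_hom_onD:
  assumes "module_hom_on s t M N f"
  shows "x \<in> M \<Longrightarrow> f x \<in> N" "x \<in> M \<Longrightarrow> y \<in> M \<Longrightarrow> f (x + y) = f x + f y" "x \<in> M \<Longrightarrow> f (s r x) = t r (f x)"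
  using assms unfolding module_hom_on_def by blast+

lemma module_hom_on_kd:
  fixes s :: "('n::{finite, linorder}, 'k::field) mpoly \<Rightarrow> 'a::ab_group_add \<Rightarrow> 'a"
  assumes s: "module s" and M: "module.subspace s M" and f: "module_hom_on s t M N f" and \<kappa>: "\<And>\<sigma>. \<kappa> \<sigma> \<in> M"
  shows "kd (\<lambda>k. t (Var k)) (\<lambda>\<sigma>. f (\<kappa> \<sigma>)) = (\<lambda>\<sigma>. f (kd (\<lambda>k. s (Var k)) \<kappa> \<sigma>))"
proof
  interpret s: module s by fact
  note hom = module_hom_onD[OF f]
  have f0: "f 0 = 0" using hom(2)[of 0 0] s.subspace_0[OF M] by simp
  have fneg: "f (- x) = - f x" if "x \<in> M" for x
    using hom(2)[OF that s.subspace_neg[OF M that]] f0 by (simp add: eq_neg_iff_add_eq_0 add.commute)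
  have fsum: "f (\<Sum>x\<in>A. g x) = (\<Sum>x\<in>A. f (g x))" if "\<And>x. x \<in> A \<Longrightarrow> g x \<in> M" for g and A :: "'n set"
    using finite[of A] that
  proof (induction A rule: finite_induct)
    case (insert x A)
    have "sum g A \<in> M" using insert.prems by (intro s.subspace_sum[OF M]) simp
    then show ?case using insert hom(2) by simp
  qed (simp add: f0)
  fix \<rho>
  have "f (ksgn k \<rho> (s (Var k) (\<kappa> (insert k \<rho>)))) = ksgn k \<rho> (t (Var k) (f (\<kappa> (insert k \<rho>))))" for k
    using fneg[OF s.subspace_scale[OF M \<kappa>]] hom(3)[OF \<kappa>] by (simp add: ksgn_def)
  moreover have "f (\<Sum>k\<in>- \<rho>. ksgn k \<rho> (s (Var k) (\<kappa> (insert k \<rho>)))) = (\<Sum>k\<in>- \<rho>. f (ksgn k \<rho> (s (Var k) (\<kappa> (insert k \<rho>)))))"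
    by (intro fsum) (simp add: ksgn_def s.subspace_neg[OF M] s.subspace_scale[OF M] \<kappa>)
  ultimately show "kd (\<lambda>k. t (Var k)) (\<lambda>\<sigma>. f (\<kappa> \<sigma>)) \<rho> = f (kd (\<lambda>k. s (Var k)) \<kappa> \<rho>)"
    unfolding kd_def by simp
qed

lemma koszul_fam_submodule:
  fixes s :: "('n::{finite, linorder}, 'k::field) mpoly \<Rightarrow> 'a::ab_group_add \<Rightarrow> 'a"
  assumes s: "module s" and M: "module.subspace s M"
  shows "koszul_fam (\<lambda>k. s (Var k)) (\<lambda>_. M)"
proof -
  interpret s: module s by fact
  show ?thesis
    by unfold_locales
      (simp_all add: s.scale_right_distrib mult.commute M s.subspace_0 s.subspace_add s.subspace_neg s.subspace_scale)
qed

text \<open>A projective module is a retract of a free one, and a filling found in the free module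
  retracts. The family is constant because projective resolutions carry no grading.\<close>

lemma kexact_projective:
  fixes s :: "('n::{finite, linorder}, 'k::field) mpoly \<Rightarrow> 'a::ab_group_add \<Rightarrow> 'a"
  assumes s: "module s" and P: "projective s P" and i: "i > 0"
  shows "kexact (\<lambda>k. s (Var k)) (\<lambda>_. P) i j"
  unfolding kexact_def
proof (intro ballI impI)
  fix \<kappa> :: "'n set \<Rightarrow> 'a"
  assume \<kappa>: "\<kappa> \<in> kcomp (\<lambda>_. P) i j" "kd (\<lambda>k. s (Var k)) \<kappa> = (\<lambda>_. 0)"
  interpret s: module s by fact
  have sub: "s.subspace P" using P by (simp add: projective_def)
  obtain \<iota> :: "'a \<Rightarrow> ('a \<Rightarrow>\<^sub>0 ('n, 'k) mpoly)" and \<pi>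
    where \<iota>: "module_hom_on s fscale P UNIV \<iota>" and \<pi>: "module_hom_on fscale s UNIV P \<pi>"
      and ret: "\<And>x. x \<in> P \<Longrightarrow> \<pi> (\<iota> x) = x"
  proof -
    from P have "\<exists>(i :: 'a \<Rightarrow> ('a \<Rightarrow>\<^sub>0 ('n, 'k) mpoly)) \<pi>.
        module_hom_on s fscale P UNIV i \<and> module_hom_on fscale s UNIV P \<pi> \<and> (\<forall>x\<in>P. \<pi> (i x) = x)"
      unfolding projective_def by (rule conjunct2)
    then show thesis using that by blast
  qed
  have \<kappa>P: "\<kappa> \<sigma> \<in> P" for \<sigma>
    using \<kappa>(1) s.subspace_0[OF sub] by (cases "card \<sigma> = i") (auto simp: kcomp_def split: if_splits)
  have \<iota>0: "\<iota> 0 = 0" using module_hom_onD(2)[OF \<iota>, of 0 0] s.subspace_0[OF sub] by simp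
  have \<pi>0: "\<pi> 0 = 0" using module_hom_onD(2)[OF \<pi>, of 0 0] by simp
  have "(\<lambda>\<sigma>. \<iota> (\<kappa> \<sigma>)) \<in> kcomp (\<lambda>_. UNIV) i j"
    using kcomp_zero_off[OF \<kappa>(1)] \<iota>0 by (simp add: kcomp_def)
  moreover have "kd (\<lambda>k. fscale (Var k)) (\<lambda>\<sigma>. \<iota> (\<kappa> \<sigma>)) = (\<lambda>_. 0)"
    using module_hom_on_kd[OF s sub \<iota>, of \<kappa>] \<kappa>P \<kappa>(2) \<iota>0 by simp
  ultimately obtain \<eta> where \<eta>: "\<eta> \<in> kcomp (\<lambda>_. UNIV) (Suc i) j" "kd (\<lambda>k. fscale (Var k)) \<eta> = (\<lambda>\<sigma>. \<iota> (\<kappa> \<sigma>))"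
    by (rule kexactD[OF kexact_free_module[OF i]])
  have "kd (\<lambda>k. s (Var k)) (\<lambda>\<sigma>. \<pi> (\<eta> \<sigma>)) = (\<lambda>\<sigma>. \<pi> (kd (\<lambda>k. fscale (Var k)) \<eta> \<sigma>))"
    by (rule module_hom_on_kd[OF module_fscale _ \<pi>]) simp_all
  also have "\<dots> = \<kappa>" by (simp add: \<eta>(2) ret \<kappa>P)
  finally have "kd (\<lambda>k. s (Var k)) (\<lambda>\<sigma>. \<pi> (\<eta> \<sigma>)) = \<kappa>" .
  moreover have "(\<lambda>\<sigma>. \<pi> (\<eta> \<sigma>)) \<in> kcomp (\<lambda>_. P) (Suc i) j"
    using kcomp_zero_off[OF \<eta>(1)] \<pi>0 module_hom_onD(1)[OF \<pi>] by (simp add: kcomp_def)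
  ultimately show "\<exists>\<eta>\<in>kcomp (\<lambda>_. P) (Suc i) j. kd (\<lambda>k. s (Var k)) \<eta> = \<kappa>" by blast
qed

lemma kexact_Suc_cokernel:
  fixes s :: "('n::{finite, linorder}, 'k::field) mpoly \<Rightarrow> 'a::ab_group_add \<Rightarrow> 'a"
    and t :: "('n, 'k) mpoly \<Rightarrow> 'b::ab_group_add \<Rightarrow> 'b"
  assumes st: "module s" "module t" and P: "projective t P" and M: "module.subspace s M"
    and h: "module_hom_on t s P M h" "h ` P = M" and i: "i > 0"
  shows "kexact (\<lambda>k. s (Var k)) (\<lambda>_. M) (Suc i) j \<longleftrightarrow> kexact (\<lambda>k. t (Var k)) (\<lambda>_. {x \<in> P. h x = 0}) i j"
proof -
  have sub: "module.subspace t P" using P by (simp add: projective_def)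
  interpret F: koszul_fam "\<lambda>k. t (Var k)" "\<lambda>_. P" by (rule koszul_fam_submodule[OF st(2) sub])
  interpret N: koszul_fam "\<lambda>k. s (Var k)" "\<lambda>_. M" by (rule koszul_fam_submodule[OF st(1) M])
  interpret koszul_epi "\<lambda>k. t (Var k)" "\<lambda>_. P" "\<lambda>k. s (Var k)" "\<lambda>_. M" h
    by unfold_locales (use module_hom_onD(2,3)[OF h(1)] h(2) in auto)
  have "gK = (\<lambda>_. {x \<in> P. h x = 0})" by (intro ext) (simp add: gK_def)
  then show ?thesis
    using kexact_Suc_iff[of i j] kexact_projective[OF st(2) P, of _ j] i by simp
qed

lemma kexact_Suc_isomorphic_projective:
  fixes s :: "('n::{finite, linorder}, 'k::field) mpoly \<Rightarrow> 'a::ab_group_add \<Rightarrow> 'a"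
    and t :: "('n, 'k) mpoly \<Rightarrow> 'b::ab_group_add \<Rightarrow> 'b"
  assumes st: "module s" "module t" and P: "projective t P" and M: "module.subspace s M"
    and h: "module_hom_on t s P M h" "h ` P = M" "{x \<in> P. h x = 0} = {0}"
  shows "kexact (\<lambda>k. s (Var k)) (\<lambda>_. M) (Suc i) j"
proof -
  have sub: "module.subspace t P" using P by (simp add: projective_def)
  interpret F: koszul_fam "\<lambda>k. t (Var k)" "\<lambda>_. P" by (rule koszul_fam_submodule[OF st(2) sub])
  interpret N: koszul_fam "\<lambda>k. s (Var k)" "\<lambda>_. M" by (rule koszul_fam_submodule[OF st(1) M])
  interpret koszul_epi "\<lambda>k. t (Var k)" "\<lambda>_. P" "\<lambda>k. s (Var k)" "\<lambda>_. M" h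
    by unfold_locales (use module_hom_onD(2,3)[OF h(1)] h(2) in auto)
  have "kexact (\<lambda>k. s (Var k)) (\<lambda>_. M) (Suc i) j \<longleftrightarrow> kexact (\<lambda>k. t (Var k)) (\<lambda>_. P) (Suc i) j"
    by (rule kexact_iso) (use h(3) in blast)
  then show ?thesis using kexact_projective[OF st(2) P, of "Suc i" j] by simp
qed

text \<open>Dimension shifting along the kernels ends at a module isomorphic to a projective one.
  This is the lower bound for the projective dimension.\<close>

lemma kexact_beyond_resolution:
  fixes s :: "('n::{finite, linorder}, 'k::field) mpoly \<Rightarrow> 'a::ab_group_add \<Rightarrow> 'a"
  assumes s: "module s" and M: "module.subspace s M"
    and res: "resolution s fscale M P d \<epsilon>" and proj: "\<And>i. projective fscale (P i)"
    and zero: "\<And>i. i > n \<Longrightarrow> P i = {0}" and m: "m > n"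
  shows "kexact (\<lambda>k. s (Var k)) (\<lambda>_. M) m j"
proof -
  note r = resolutionD[OF res]
  define Z where "Z = (\<lambda>i. d i ` P (Suc i))"
  have Zker: "{x \<in> P (Suc i). d i x = 0} = Z (Suc i)" for i by (simp only: Z_def r(5))
  have Zker0: "{x \<in> P 0. \<epsilon> x = 0} = Z 0" by (simp add: Z_def r(4))
  have sub: "fsc.subspace (P i)" for i using proj[of i] by (simp add: projective_def)
  have d0: "d i 0 = 0" for i
    using module_hom_onD(2)[OF r(2)[of i], of 0 0] fsc.subspace_0[OF sub[of "Suc i"]] by simp
  have subZ: "fsc.subspace (Z i)" for i
    unfolding fsc.subspace_def
  proof (intro conjI ballI allI)
    show "0 \<in> Z i" unfolding Z_def by (rule image_eqI[of _ _ 0]) (simp_all add: d0 fsc.subspace_0[OF sub])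
  next
    fix x y assume "x \<in> Z i" "y \<in> Z i"
    then obtain u v where uv: "u \<in> P (Suc i)" "v \<in> P (Suc i)" "x = d i u" "y = d i v" unfolding Z_def by blast
    show "x + y \<in> Z i"
      unfolding Z_def uv(3,4) module_hom_onD(2)[OF r(2) uv(1,2), symmetric]
      by (intro imageI fsc.subspace_add[OF sub] uv)
  next
    fix c x assume "x \<in> Z i"
    then obtain u where u: "u \<in> P (Suc i)" "x = d i u" unfolding Z_def by blast
    show "fscale c x \<in> Z i"
      unfolding Z_def u(2) module_hom_onD(3)[OF r(2) u(1), symmetric]
      by (intro imageI fsc.subspace_scale[OF sub] u)
  qed
  have Z0: "Z i = {0}" if "i \<ge> n" for i
    unfolding Z_def using zero[of "Suc i"] that by (simp add: d0)
  have hom: "module_hom_on fscale fscale (P (Suc i)) (Z i) (d i)" for i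
    using module_hom_onD(2,3)[OF r(2)[of i]] unfolding module_hom_on_def Z_def by blast
  have Zex: "kexact (\<lambda>k. fscale (Var k)) (\<lambda>_. Z i) (Suc l) j" if "i + Suc l \<ge> n" for i l
    using that
  proof (induction l arbitrary: i)
    case 0
    then have "{x \<in> P (Suc i). d i x = 0} = {0}" unfolding Zker by (intro Z0) simp
    then show ?case
      by (rule kexact_Suc_isomorphic_projective[OF module_fscale module_fscale proj subZ hom Z_def[THEN fun_cong, symmetric]])
  next
    case (Suc l)
    show ?case
      unfolding kexact_Suc_cokernel[OF module_fscale module_fscale proj subZ hom Z_def[THEN fun_cong, symmetric] zero_less_Suc] Zker
      using Suc by simp
  qed
  show ?thesis
  proof (cases "m = 1")
    case True
    then have "{x \<in> P 0. \<epsilon> x = 0} = {0}" unfolding Zker0 using m by (intro Z0) simp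
    then show ?thesis
      unfolding True One_nat_def
      by (rule kexact_Suc_isomorphic_projective[OF s module_fscale proj M r(1,3)])
  next
    case False
    then obtain l where l: "m = Suc (Suc l)" using m by (metis One_nat_def less_nat_zero_code not0_implies_Suc)
    show ?thesis
      unfolding l kexact_Suc_cokernel[OF s module_fscale proj M r(1,3) zero_less_Suc] Zker0
      by (rule Zex) (use m l in simp)
  qed
qed

text \<open>In the definition of projectivity the free module has the underlying type as its basis,
  so the l-th basis element is sent to the generator named by that very element.\<close>

lemma projective_gfree:
  "projective fscale (gfree a :: (nat \<Rightarrow>\<^sub>0 ('n::{finite, linorder}, 'k::field) mpoly) set)"
proof -
  let ?e = "\<lambda>l. single l 1 :: nat \<Rightarrow>\<^sub>0 ('n, 'k) mpoly"
  define \<iota> where "\<iota> = (\<lambda>x :: nat \<Rightarrow>\<^sub>0 ('n, 'k) mpoly. \<Sum>l<length a. single (?e l) (lookup x l))"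
  define \<pi> where "\<pi> = (\<lambda>z :: (nat \<Rightarrow>\<^sub>0 ('n, 'k) mpoly) \<Rightarrow>\<^sub>0 ('n, 'k) mpoly. \<Sum>l<length a. single l (lookup z (?e l)))"
  have inj: "?e l = ?e l' \<longleftrightarrow> l = l'" for l l'
    by (metis lookup_single_eq lookup_single_not_eq one_neq_zero)
  have l\<pi>: "lookup (\<pi> z) l = (if l < length a then lookup z (?e l) else 0)" for z l
    by (simp add: \<pi>_def lookup_sum lookup_single when_def)
  have l\<iota>: "lookup (\<iota> x) (?e l) = (if l < length a then lookup x l else 0)" for x l
    by (simp add: \<iota>_def lookup_sum lookup_single when_def inj)
  have "module_hom_on fscale fscale (gfree a) UNIV \<iota>"
    unfolding module_hom_on_def
    by (auto simp: \<iota>_def single_add lookup_add sum.distrib intro!: poly_mapping_eqI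
      simp: lookup_fscale lookup_sum lookup_single when_def sum_distrib_left if_distrib cong: if_cong)
  moreover have "module_hom_on fscale fscale UNIV (gfree a) \<pi>"
    unfolding module_hom_on_def
    by (auto simp: gfree_iff l\<pi> lookup_add lookup_fscale intro!: poly_mapping_eqI)
  moreover have "\<pi> (\<iota> x) = x" if "x \<in> gfree a" for x
    using that[unfolded gfree_iff] by (intro poly_mapping_eqI) (simp add: l\<pi> l\<iota>)
  ultimately show ?thesis unfolding projective_def using gfree_subspace by blast
qed

text \<open>Projecting a filling to the degree prescribed by j leaves a filling, since the operators
  raise degrees by one.\<close>

lemma (in gmod) kexact_graded_if_total:
  assumes ex: "kexact (\<lambda>k. s (Var k)) (\<lambda>_. M) i j"
  shows "kexact (\<lambda>k. s (Var k)) gr i j"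
  unfolding kexact_def
proof (intro ballI impI)
  fix \<kappa> assume \<kappa>: "\<kappa> \<in> kcomp gr i j" "kd (\<lambda>k. s (Var k)) \<kappa> = (\<lambda>_. 0)"
  have "\<kappa> \<in> kcomp (\<lambda>_. M) i j"
    using kcomp_mem[OF \<kappa>(1)] kcomp_zero_off[OF \<kappa>(1)] gr_sub by (auto simp: kcomp_def)
  with ex \<kappa>(2) obtain \<eta> where \<eta>: "\<eta> \<in> kcomp (\<lambda>_. M) (Suc i) j" "kd (\<lambda>k. s (Var k)) \<eta> = \<kappa>"
    by (auto elim: kexactD)
  have \<eta>M: "\<eta> \<sigma> \<in> M" for \<sigma>
    using \<eta>(1) subspace_0[OF M_subspace] by (cases "card \<sigma> = Suc i") (auto simp: kcomp_def split: if_splits)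
  let ?e = "j - int (Suc i)"
  have pv: "pr (?e + 1) (s (Var k) (\<eta> \<sigma>)) = s (Var k) (pr ?e (\<eta> \<sigma>))" for k \<sigma>
    using pr_Var[OF \<eta>M, of "?e + 1" k \<sigma>] by (simp only: add_diff_cancel_right')
  have pk: "pr (?e + 1) (ksgn k \<rho> (s (Var k) (\<eta> \<sigma>))) = ksgn k \<rho> (s (Var k) (pr ?e (\<eta> \<sigma>)))" for k \<rho> \<sigma>
    by (cases "even (card {l\<in>\<rho>. l < k})")
      (simp_all only: ksgn_def pv pr_uminus[OF subspace_scale[OF M_subspace \<eta>M]] if_True if_False)
  have "(\<lambda>\<sigma>. pr ?e (\<eta> \<sigma>)) \<in> kcomp gr (Suc i) j"
    using kcomp_zero_off[OF \<eta>(1)] pr_mem[OF \<eta>M] by (simp add: kcomp_def)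
  moreover have "kd (\<lambda>k. s (Var k)) (\<lambda>\<sigma>. pr ?e (\<eta> \<sigma>)) = \<kappa>"
  proof
    fix \<rho> :: "'n set"
    have "kd (\<lambda>k. s (Var k)) (\<lambda>\<sigma>. pr ?e (\<eta> \<sigma>)) \<rho> = (\<Sum>k\<in>- \<rho>. pr (?e + 1) (ksgn k \<rho> (s (Var k) (\<eta> (insert k \<rho>)))))"
      unfolding kd_def pk ..
    also have "\<dots> = pr (?e + 1) (\<kappa> \<rho>)"
      unfolding \<eta>(2)[symmetric] kd_def
      by (intro pr_sum_fun[symmetric]) (simp add: ksgn_def subspace_neg[OF M_subspace] subspace_scale[OF M_subspace] \<eta>M)
    also have "\<dots> = \<kappa> \<rho>"
      using \<kappa>(1) pr_gr[of "\<kappa> \<rho>" "j - int i" "j - int i"] kcomp_zero_off[OF \<kappa>(1), of \<rho>] kcomp_mem[OF \<kappa>(1), of \<rho>]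
      by (cases "card \<rho> = i") simp_all
    finally show "kd (\<lambda>k. s (Var k)) (\<lambda>\<sigma>. pr ?e (\<eta> \<sigma>)) \<rho> = \<kappa> \<rho>" .
  qed
  ultimately show "\<exists>\<eta>\<in>kcomp gr (Suc i) j. kd (\<lambda>k. s (Var k)) \<eta> = \<kappa>" by blast
qed

lemma Inf_enat_eqI:
  assumes "Q n" "\<And>m. Q m \<Longrightarrow> n \<le> m"
  shows "Inf {enat m | m. Q m} = enat n"
  using assms by (intro antisym Inf_lower Inf_greatest) auto

text \<open>The upper bound is a graded free resolution without generators beyond n. The lower bound
  concerns projective resolutions without grading and therefore goes through the ungraded Koszul
  complex; for n = 0 it is trivial.\<close>

theorem (in gmod) proj_dim_eq:
  assumes fd: "\<And>j. \<exists>B. finite B \<and> gr j \<subseteq> kv.span B"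
    and low: "\<And>j. j < 0 \<Longrightarrow> gr j = {0}"
    and high: "\<And>i j. j > N \<Longrightarrow> kexact (\<lambda>k. s (Var k)) gr i j"
    and above: "\<And>i j. i > n \<Longrightarrow> kexact (\<lambda>k. s (Var k)) gr i j"
    and at: "n = 0 \<or> (\<exists>j. \<not> kexact (\<lambda>k. s (Var k)) gr n j)"
  shows "proj_dim s M = enat n"
proof -
  let ?Q = "\<lambda>n. \<exists>(P :: nat \<Rightarrow> (nat \<Rightarrow>\<^sub>0 ('n, 'k) mpoly) set) d \<epsilon>.
    resolution s fscale M P d \<epsilon> \<and> (\<forall>i. projective fscale (P i)) \<and> (\<forall>i>n. P i = {0})"
  have "\<exists>a d \<epsilon>. graded_free_resolution s M gr a d \<epsilon> \<and>
    (\<forall>n. (\<forall>i>n. \<forall>j. kexact (\<lambda>k. s (Var k)) gr i j) \<longrightarrow> (\<forall>i>n. a i = []))"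
    by (rule graded_free_resolution_exists[OF fd low high])
  then obtain a d \<epsilon> where a0: "graded_free_resolution s M gr a d \<epsilon> \<and>
    (\<forall>n. (\<forall>i>n. \<forall>j. kexact (\<lambda>k. s (Var k)) gr i j) \<longrightarrow> (\<forall>i>n. a i = []))"
    by (elim exE)
  note a = conjunct1[OF a0] conjunct2[OF a0, THEN spec, of n]
  have "gfree (a i) = ({0} :: (nat \<Rightarrow>\<^sub>0 ('n, 'k) mpoly) set)" if "i > n" for i
    using a(2) above that by (auto simp: gfree_def)
  then have "?Q n"
    using graded_free_resolutionD(1)[OF a(1)] projective_gfree[where 'n='n and 'k='k]
    by (intro exI[of _ "\<lambda>i. gfree (a i)"] exI[of _ d] exI[of _ \<epsilon>]) simp
  moreover have "n \<le> m" if Q: "?Q m" for m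
  proof (rule ccontr)
    assume m: "\<not> n \<le> m"
    obtain P :: "nat \<Rightarrow> (nat \<Rightarrow>\<^sub>0 ('n, 'k) mpoly) set" and d \<epsilon> where P: "resolution s fscale M P d \<epsilon>"
      "\<forall>i. projective fscale (P i)" "\<forall>i>m. P i = {0}"
      using Q by (elim exE conjE)
    have "kexact (\<lambda>k. s (Var k)) gr n j" for j
      by (rule kexact_graded_if_total, rule kexact_beyond_resolution[OF module_axioms M_subspace P(1)])
        (use P(2,3) m in auto)
    then show False using at m by auto
  qed
  ultimately show ?thesis
    unfolding proj_dim_def by (rule Inf_enat_eqI)
qed

section \<open>Substitution into polynomials\<close>

lemma mpoly_induct [case_names Const Var add mult]:
  fixes p :: "('n::{finite, linorder}, 'k::comm_ring_1) mpoly"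
  assumes "\<And>c. P (Const c)" "\<And>i. P (Var i)" "\<And>p q. P p \<Longrightarrow> P q \<Longrightarrow> P (p + q)" "\<And>p q. P p \<Longrightarrow> P q \<Longrightarrow> P (p * q)"
  shows "P p"
proof (induction p rule: poly_induct_single)
  case zero
  show ?case using assms(1)[of 0] by simp
next
  case (single m c)
  show ?case
  proof (induction "mon_degree m" arbitrary: m)
    case 0
    then have "m = 0" by (intro poly_mapping_eqI) (simp add: mon_degree_UNIV)
    then show ?case using assms(1)[of c] by (simp add: Const_def)
  next
    case (Suc d)
    have "\<exists>k. lookup m k \<noteq> 0"
    proof (rule ccontr)
      assume "\<nexists>k. lookup m k \<noteq> 0"
      then show False using Suc.hyps(2) by (simp add: mon_degree_UNIV)
    qed
    then obtain k where k: "lookup m k \<noteq> 0" by blast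
    have "mon_degree m = mon_degree (m - single k 1) + 1"
      by (subst mon_diff_add[OF k, symmetric]) (simp only: mon_degree_add mon_degree_single)
    then have "P (single (m - single k 1) c)" using Suc by simp
    from assms(4)[OF assms(2)[of k] this] show ?case
      unfolding Var_times_single mon_diff_add[OF k] .
  qed
qed (rule assms(3))

text \<open>Evaluation along a coefficient homomorphism c, so that the target may be another ring: c
  is \<open>Const\<close> for substitutions of polynomials and gives constant polynomials in t for
  \<open>unev\<close>.\<close>

definition psub :: "('k::comm_ring_1 \<Rightarrow> 'r::comm_ring_1) \<Rightarrow> ('n::finite \<Rightarrow> 'r) \<Rightarrow> ('n, 'k) mpoly \<Rightarrow> 'r" where
  "psub c x p = (\<Sum>m\<in>keys p. c (lookup p m) * (\<Prod>i\<in>UNIV. x i ^ lookup m i))"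

locale coeff_hom =
  fixes c :: "'k::comm_ring_1 \<Rightarrow> 'r::comm_ring_1"
  assumes coeff_add: "c (a + b) = c a + c b" and coeff_mult: "c (a * b) = c a * c b" and coeff_one: "c 1 = 1"
begin

lemma coeff_zero: "c 0 = 0"
  using coeff_add[of 0 0] by simp

lemma psub_superset:
  assumes "finite A" "keys p \<subseteq> A"
  shows "psub c x p = (\<Sum>m\<in>A. c (lookup p m) * (\<Prod>i\<in>UNIV. x i ^ lookup m i))"
  unfolding psub_def using assms by (intro sum.mono_neutral_left) (auto simp: in_keys_iff coeff_zero)

lemma psub_zero [simp]: "psub c x 0 = 0"
  by (simp add: psub_def)

lemma psub_add: "psub c x (p + q) = psub c x p + psub c x q"
proof -
  have f: "finite (keys p \<union> keys q)" by simp
  show ?thesis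
    unfolding psub_superset[OF f keys_add] psub_superset[OF f Un_upper1] psub_superset[OF f Un_upper2]
    by (simp add: lookup_add coeff_add distrib_right sum.distrib)
qed

lemma psub_single: "psub c x (single m a) = c a * (\<Prod>i\<in>UNIV. x i ^ lookup m i)"
proof -
  have f: "finite {m}" and k: "keys (single m a) \<subseteq> {m}" by simp_all
  show ?thesis unfolding psub_superset[OF f k] by simp
qed

lemma psub_mult: "psub c x (p * q) = psub c x p * psub c x q"
proof (induction p rule: poly_induct_single)
  case (single m a)
  show ?case
  proof (induction q rule: poly_induct_single)
    case (single m' b)
    show ?case by (simp add: mult_single psub_single lookup_add power_add prod.distrib coeff_mult mult_ac)
  qed (simp_all add: distrib_left psub_add)
qed (simp_all add: distrib_right psub_add)

lemma psub_Const [simp]: "psub c x (Const a) = c a"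
  by (simp add: Const_def psub_single)

lemma psub_Var [simp]: "psub c x (Var k) = x k"
proof -
  have "(\<Prod>i\<in>UNIV. x i ^ lookup (single k (1::nat)) i) = (\<Prod>i\<in>UNIV. if i = k then x i else 1)"
    by (intro prod.cong refl) (simp add: lookup_single when_def)
  then show ?thesis by (simp add: Var_def psub_single coeff_one)
qed

lemma psub_one [simp]: "psub c x 1 = 1"
  using psub_Const[of x 1] by (simp add: coeff_one)

lemma psub_uminus: "psub c x (- p) = - psub c x p"
  using psub_add[of x p "- p"] by (simp add: eq_neg_iff_add_eq_0 add.commute)

lemma psub_diff: "psub c x (p - q) = psub c x p - psub c x q"
  using psub_add[of x p "- q"] by (simp add: psub_uminus)

lemma psub_prod: "psub c x (\<Prod>a\<in>A. f a) = (\<Prod>a\<in>A. psub c x (f a))"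
  by (induction A rule: infinite_finite_induct) (simp_all add: psub_mult)

lemma psub_cong_mod:
  fixes p :: "('n::{finite, linorder}, 'k) mpoly"
  assumes "\<And>i. D dvd x i - y i"
  shows "D dvd psub c x p - psub c y p"
proof (induction p rule: mpoly_induct)
  case (add p q)
  have "psub c x (p + q) - psub c y (p + q) = (psub c x p - psub c y p) + (psub c x q - psub c y q)"
    by (simp add: psub_add)
  then show ?case using add by (simp only: dvd_add)
next
  case (mult p q)
  have "psub c x (p * q) - psub c y (p * q) =
      (psub c x p - psub c y p) * psub c x q + psub c y p * (psub c x q - psub c y q)"
    by (simp add: psub_mult algebra_simps)
  then show ?case using mult by (simp only: dvd_add dvd_mult dvd_mult2)
qed (use assms in simp_all)

end

interpretation C: coeff_hom "Const :: 'k::comm_ring_1 \<Rightarrow> ('n::{finite, linorder}, 'k) mpoly"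
  by unfold_locales (simp_all add: Const_add Const_mult)

interpretation P: coeff_hom "\<lambda>a. [:Const a:] :: ('n::{finite, linorder}, 'k::comm_ring_1) mpoly poly"
  by unfold_locales (simp_all add: Const_add Const_mult one_pCons)

lemma psub_Var_id: "psub Const Var p = (p :: ('n::{finite, linorder}, 'k::comm_ring_1) mpoly)"
  by (induction p rule: mpoly_induct) (simp_all add: C.psub_add C.psub_mult)

definition kill :: "'n set \<Rightarrow> ('n::{finite, linorder}, 'k::comm_ring_1) mpoly \<Rightarrow> ('n, 'k) mpoly" where
  "kill A = psub Const (\<lambda>i. if i \<in> A then 0 else Var i)"

lemma kill_simps [simp]:
  "kill A (p * q) = kill A p * kill A q" "kill A (p + q) = kill A p + kill A q" "kill A (- p) = - kill A p"
  "kill A (Var i) = (if i \<in> A then 0 else Var i)" "kill A (Const c) = Const c"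
  "kill A (prod f B) = (\<Prod>b\<in>B. kill A (f b))" "kill A 0 = 0" "kill A 1 = 1"
  by (simp_all add: kill_def C.psub_mult C.psub_add C.psub_uminus C.psub_prod)

lemma kill_single: "kill A (single m a) = (if keys m \<inter> A = {} then single m a else 0)"
proof (cases "keys m \<inter> A = {}")
  case True
  have z: "lookup m i = 0" if "i \<in> A" for i
  proof -
    have "i \<notin> keys m" using True that by blast
    then show ?thesis by (simp add: in_keys_iff)
  qed
  have "(if i \<in> A then 0 else Var i) ^ lookup m i = (Var i ^ lookup m i :: ('a, 'b) mpoly)" for i
    using z[of i] by (cases "i \<in> A") simp_all
  then have "kill A (single m a) = psub Const Var (single m a)"
    unfolding kill_def C.psub_single by (simp only:)
  also have "\<dots> = single m a" by (rule psub_Var_id)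
  finally show ?thesis using True by simp
next
  case False
  then obtain i where i: "i \<in> keys m" "i \<in> A" by blast
  then have "lookup m i > 0" by (simp add: in_keys_iff)
  then have "(if i \<in> A then 0 else Var i) ^ lookup m i = (0 :: ('a, 'b) mpoly)"
    using i(2) by (simp only: zero_power if_True)
  then have "(\<Prod>i\<in>UNIV. (if i \<in> A then 0 else Var i) ^ lookup m i) = (0 :: ('a, 'b) mpoly)"
    by (intro prod_zero finite bexI[of _ i] UNIV_I)
  then show ?thesis using False unfolding kill_def C.psub_single by simp
qed

lemma lookup_kill: "lookup (kill A p) m = (if keys m \<inter> A = {} then lookup p m else 0)"
proof (induction p rule: poly_induct_single)
  case (single m' a)
  show ?case by (auto simp: kill_single lookup_single when_def)
qed (simp_all add: lookup_add)

section \<open>Linear forms \<open>x\<^sub>u - x\<^sub>v\<close>\<close>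

lemma Var_eq_iff: "Var u = (Var v :: ('n, 'k::comm_ring_1) mpoly) \<longleftrightarrow> u = v"
proof
  assume "Var u = (Var v :: ('n, 'k) mpoly)"
  then have "lookup (Var u :: ('n, 'k) mpoly) (single u 1) = lookup (Var v :: ('n, 'k) mpoly) (single u 1)" by simp
  then have "single v (1::nat) = single u 1" by (auto simp: Var_def lookup_single when_def split: if_splits)
  then have "lookup (single v (1::nat)) u = 1" by simp
  then show "u = v" by (auto simp: lookup_single when_def split: if_splits)
qed simp

definition glue :: "'n \<Rightarrow> 'n \<Rightarrow> ('n::{finite, linorder}, 'k::comm_ring_1) mpoly \<Rightarrow> ('n, 'k) mpoly" where
  "glue u v = psub Const (\<lambda>i. if i = u then Var v else Var i)"

lemma glue_simps [simp]:
  "glue u v (p * q) = glue u v p * glue u v q" "glue u v (p + q) = glue u v p + glue u v q"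
  "glue u v (p - q) = glue u v p - glue u v q" "glue u v (Var i) = (if i = u then Var v else Var i)"
  "glue u v (Const c) = Const c" "glue u v (prod f A) = (\<Prod>a\<in>A. glue u v (f a))" "glue u v 0 = 0"
  by (simp_all add: glue_def C.psub_mult C.psub_add C.psub_diff C.psub_prod)

text \<open>The remainder theorem: substituting x_v for x_u changes a polynomial by a multiple of
  x_u - x_v.\<close>

lemma diff_Var_dvd_iff: "Var u - Var v dvd p \<longleftrightarrow> glue u v p = 0"
  for p :: "('n::{finite, linorder}, 'k::comm_ring_1) mpoly"
proof
  assume "glue u v p = 0"
  moreover have "Var u - Var v dvd psub Const Var p - glue u v p"
    unfolding glue_def by (rule C.psub_cong_mod) simp
  ultimately show "Var u - Var v dvd p" by (simp add: psub_Var_id)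
qed (auto elim!: dvdE)

lemma diff_Var_dvd_diff_Var:
  assumes "Var u - Var v dvd (Var a - Var b :: ('n::{finite, linorder}, 'k::field) mpoly)" "a \<noteq> b"
  shows "{a, b} = {u, v}"
  using assms unfolding diff_Var_dvd_iff by (auto simp: Var_eq_iff split: if_splits)

text \<open>\<open>glue u v\<close> is a homomorphism into a domain, and its kernel consists of the
  multiples of x_u - x_v.\<close>

lemma prime_elem_diff_Var:
  assumes "u \<noteq> v"
  shows "prime_elem (Var u - Var v :: ('n::{finite, linorder}, 'k::field) mpoly)"
proof (rule prime_elemI)
  show "Var u - Var v \<noteq> (0 :: ('n, 'k) mpoly)" using assms by (simp add: Var_eq_iff)
  show "\<not> Var u - Var v dvd (1 :: ('n, 'k) mpoly)"
    unfolding diff_Var_dvd_iff by (simp add: glue_def)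
  show "Var u - Var v dvd a \<or> Var u - Var v dvd b" if "Var u - Var v dvd a * b" for a b :: "('n, 'k) mpoly"
    using that unfolding diff_Var_dvd_iff by simp
qed

lemma prime_elem_dvd_prodD:
  fixes D :: "'b \<Rightarrow> 'a::idom"
  assumes "prime_elem q" "q dvd (\<Prod>a\<in>A. D a)"
  shows "\<exists>a\<in>A. q dvd D a"
  using assms(2) prime_elem_not_unit[OF assms(1)]
  by (induction A rule: infinite_finite_induct) (auto simp: prime_elem_dvd_mult_iff[OF assms(1)])

lemma prod_primes_dvd:
  fixes D :: "'b \<Rightarrow> 'a::idom"
  assumes "finite A" "\<And>a. a \<in> A \<Longrightarrow> prime_elem (D a)" "\<And>a b. a \<in> A \<Longrightarrow> b \<in> A \<Longrightarrow> a \<noteq> b \<Longrightarrow> \<not> D a dvd D b"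
    and "\<And>a. a \<in> A \<Longrightarrow> D a dvd p"
  shows "(\<Prod>a\<in>A. D a) dvd p"
  using assms
proof (induction A rule: finite_induct)
  case (insert a A)
  then have "(\<Prod>b\<in>A. D b) dvd p" by simp
  then obtain q where q: "p = (\<Prod>b\<in>A. D b) * q" by (elim dvdE)
  have pa: "prime_elem (D a)" using insert.prems by simp
  have "\<not> D a dvd (\<Prod>b\<in>A. D b)"
    using prime_elem_dvd_prodD[OF pa, of D A] insert.hyps insert.prems(2) by blast
  moreover have "D a dvd (\<Prod>b\<in>A. D b) * q" using insert.prems(3)[of a] q by simp
  ultimately have "D a dvd q" by (simp add: prime_elem_dvd_mult_iff[OF pa])
  then have "D a * (\<Prod>b\<in>A. D b) dvd q * (\<Prod>b\<in>A. D b)" by (intro mult_dvd_mono dvd_refl)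
  then show ?case using insert.hyps by (simp add: q mult.commute)
qed simp

section \<open>Interpolation\<close>

text \<open>The variables of the coefficients stand for y_j = x_u - x_j. As y_u becomes 0, a
  monomial containing all the y_j vanishes for every u.\<close>

definition ysub :: "'n \<Rightarrow> ('n::{finite, linorder}, 'k::comm_ring_1) mpoly \<Rightarrow> ('n, 'k) mpoly" where
  "ysub u = psub Const (\<lambda>j. Var u - Var j)"

text \<open>
  The polynomial variable is \<open>t\<close> and the variables of the coefficients are \<open>y\<^sub>j\<close>; \<open>ev u\<close> substitutes
  \<open>t = x\<^sub>u\<close> and \<open>y\<^sub>j = x\<^sub>u - x\<^sub>j\<close>, and \<open>unev A\<close> sets \<open>x\<^sub>j = t\<close> for \<open>j \<in> A\<close> and \<open>x\<^sub>j = t - y\<^sub>j\<close> otherwise.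
\<close>

definition ev :: "'n \<Rightarrow> ('n::{finite, linorder}, 'k::comm_ring_1) mpoly poly \<Rightarrow> ('n, 'k) mpoly" where
  "ev u f = poly (map_poly (ysub u) f) (Var u)"

definition unev :: "'n set \<Rightarrow> ('n::{finite, linorder}, 'k::comm_ring_1) mpoly \<Rightarrow> ('n, 'k) mpoly poly" where
  "unev A = psub (\<lambda>a. [:Const a:]) (\<lambda>j. if j \<in> A then [:0, 1:] else [:- Var j, 1:])"

lemma ysub_simps [simp]:
  "ysub u (p * q) = ysub u p * ysub u q" "ysub u (p + q) = ysub u p + ysub u q"
  "ysub u (p - q) = ysub u p - ysub u q" "ysub u (Var i) = Var u - Var i"
  "ysub u (Const c) = Const c" "ysub u (prod f A) = (\<Prod>a\<in>A. ysub u (f a))" "ysub u 0 = 0" "ysub u 1 = 1"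
  "ysub u (- p) = - ysub u p"
  by (simp_all add: ysub_def C.psub_mult C.psub_add C.psub_diff C.psub_prod C.psub_uminus)

lemma unev_simps [simp]:
  "unev A (p * q) = unev A p * unev A q" "unev A (p + q) = unev A p + unev A q"
  "unev A (p - q) = unev A p - unev A q" "unev A (Var i) = (if i \<in> A then [:0, 1:] else [:- Var i, 1:])"
  "unev A (Const c) = [:Const c:]" "unev A 0 = 0"
  by (simp_all add: unev_def P.psub_mult P.psub_add P.psub_diff)

lemma ev_pCons [simp]: "ev u (pCons a f) = ysub u a + Var u * ev u f"
  by (simp add: ev_def map_poly_pCons)

lemma ev_zero [simp]: "ev u 0 = 0"
  by (simp add: ev_def)

lemma ev_add [simp]: "ev u (f + g) = ev u f + ev u g"
proof (induction f arbitrary: g)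
  case (pCons a f g)
  obtain b g' where g: "g = pCons b g'" by (cases g) blast
  show ?case by (simp add: g pCons distrib_left)
qed simp

lemma ev_smult [simp]: "ev u (smult p f) = ysub u p * ev u f"
  by (induction f) (simp_all add: algebra_simps)

lemma ev_mult [simp]: "ev u (f * g) = ev u f * ev u g"
  by (induction f) (simp_all add: distrib_left distrib_right mult.left_commute mult.assoc)

lemma ev_uminus [simp]: "ev u (- f) = - ev u f"
  using ev_add[of u f "- f"] by (simp add: eq_neg_iff_add_eq_0 add.commute del: ev_add)

lemma ev_diff [simp]: "ev u (f - g) = ev u f - ev u g"
  using ev_add[of u f "- g"] by (simp del: ev_add)

lemma ev_unev: "ev u (unev {u} p) = p"
  by (induction p rule: mpoly_induct) auto

lemma unev_ysub: "u \<in> A \<Longrightarrow> unev A (ysub u p) = [:kill A p:]"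
  by (induction p rule: mpoly_induct) simp_all

text \<open>From its value at u the polynomial is recovered with y_j set to zero for j in A. For A =
  {u} only monomials containing y_u are lost; for A = {u, v} the monomials avoiding both u and v
  remain.\<close>

lemma unev_ev:
  assumes "u \<in> A"
  shows "unev A (ev u f) = map_poly (kill A) f"
proof (induction f)
  case (pCons a f)
  then show ?case using assms by (simp add: unev_ysub map_poly_pCons)
qed simp

lemma map_poly_kill_mult: "map_poly (kill A) (f * g) = map_poly (kill A) f * map_poly (kill A) g"
proof (rule poly_eqI)
  fix n
  have "kill A (sum h B) = (\<Sum>b\<in>B. kill A (h b))" for h :: "nat \<Rightarrow> ('a, 'b) mpoly" and B
    by (induction B rule: infinite_finite_induct) simp_all
  then show "coeff (map_poly (kill A) (f * g)) n = coeff (map_poly (kill A) f * map_poly (kill A) g) n"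
    by (simp add: coeff_map_poly coeff_mult)
qed

lemma map_poly_kill_unev: "map_poly (kill A) (unev A p) = unev A p"
proof (induction p rule: mpoly_induct)
  case (add p q)
  then show ?case by (simp add: poly_eq_iff coeff_map_poly)
next
  case (mult p q)
  then show ?case by (simp add: map_poly_kill_mult)
qed (simp_all add: map_poly_pCons)

lemma coeff_unev:
  assumes "lookup (coeff (unev A p) n) m \<noteq> 0"
  shows "keys m \<inter> A = {}"
proof -
  have "coeff (unev A p) n = coeff (map_poly (kill A) (unev A p)) n"
    by (simp only: map_poly_kill_unev)
  also have "\<dots> = kill A (coeff (unev A p) n)"
    by (simp add: coeff_map_poly)
  finally have "lookup (coeff (unev A p) n) m = lookup (kill A (coeff (unev A p) n)) m" by (rule arg_cong)
  then show ?thesis using assms unfolding lookup_kill by (simp split: if_splits)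
qed

lemma ev_cong: "Var u - Var v dvd ev u f - ev v f"
proof (induction f)
  case (pCons a f)
  have "Var u - Var v dvd ysub u a - ysub v a"
    unfolding ysub_def by (rule C.psub_cong_mod) simp
  moreover have "ev u (pCons a f) - ev v (pCons a f) =
      (ysub u a - ysub v a) + ((Var u - Var v) * ev u f + Var v * (ev u f - ev v f))"
    by (simp add: algebra_simps)
  ultimately show ?case using pCons.IH by (simp only: dvd_add dvd_mult dvd_triv_left)
qed simp

text \<open>Newton interpolation: a new node v is served by a correction that is a multiple of the
  product of the y_a over the old nodes and so vanishes at each of them. At v this product becomes
  that of the x_v - x_a, distinct primes which all divide the defect.\<close>

lemma interpolation:
  fixes g :: "'n::{finite, linorder} \<Rightarrow> ('n, 'k::field) mpoly"
  assumes g: "\<And>u v. u \<noteq> v \<Longrightarrow> Var u - Var v dvd g u - g v"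
  obtains f where "\<And>u. ev u f = g u" "\<And>n m. lookup (coeff f n) m \<noteq> 0 \<Longrightarrow> keys m \<noteq> UNIV"
proof -
  have "\<exists>f. (\<forall>u\<in>A. ev u f = g u) \<and> (\<forall>n m. lookup (coeff f n) m \<noteq> 0 \<longrightarrow> \<not> A \<subseteq> keys m)" if "finite A" for A
    using that
  proof (induction A rule: finite_induct)
    case empty
    then show ?case by (intro exI[of _ 0]) simp
  next
    case (insert v A)
    then obtain f where f: "\<And>u. u \<in> A \<Longrightarrow> ev u f = g u"
      "\<And>n m. lookup (coeff f n) m \<noteq> 0 \<Longrightarrow> \<not> A \<subseteq> keys m" by blast
    have nv: "v \<noteq> u" if "u \<in> A" for u using that insert.hyps by blast
    have "(\<Prod>a\<in>A. Var v - Var a) dvd g v - ev v f"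
    proof (rule prod_primes_dvd[OF insert.hyps(1)])
      show "prime_elem (Var v - Var a :: ('n, 'k) mpoly)" if "a \<in> A" for a
        by (rule prime_elem_diff_Var[OF nv[OF that]])
      show "\<not> Var v - Var a dvd (Var v - Var b :: ('n, 'k) mpoly)" if "a \<in> A" "b \<in> A" "a \<noteq> b" for a b
        using diff_Var_dvd_diff_Var[of v a v b] nv[OF that(1)] nv[OF that(2)] that(3) by (auto simp: doubleton_eq_iff)
      show "Var v - Var a dvd g v - ev v f" if "a \<in> A" for a
      proof -
        have "g v - ev v f = (g v - g a) - (ev v f - ev a f)" using f(1)[OF that] by simp
        then show ?thesis using g[OF nv[OF that]] ev_cong[of v a f] by (simp only: dvd_diff)
      qed
    qed
    then obtain q where q: "g v - ev v f = (\<Prod>a\<in>A. Var v - Var a) * q" by (elim dvdE)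
    \<comment> \<open>\<open>unev {v}\<close> expresses q without y_v, so no monomial of the
      correction contains all variables of the enlarged set of nodes.\<close>
    let ?f = "f + smult (\<Prod>a\<in>A. Var a) (unev {v} q)"
    have "ev u ?f = g u" if "u \<in> insert v A" for u
    proof (cases "u = v")
      case True
      then show ?thesis using q by (simp add: ev_unev algebra_simps)
    next
      case False
      then have u: "u \<in> A" using that by simp
      then have "(\<Prod>a\<in>A. Var u - Var a) = (0 :: ('n, 'k) mpoly)"
        by (intro prod_zero insert.hyps(1) bexI[of _ u] u right_minus_eq[THEN iffD2] refl)
      then show ?thesis using f(1)[OF u] by simp
    qed
    moreover have "\<not> insert v A \<subseteq> keys m" if m: "lookup (coeff ?f n) m \<noteq> 0" for n m
    proof (cases "lookup (coeff f n) m = 0")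
      case False
      then show ?thesis using f(2) by blast
    next
      case True
      have vm: "v \<notin> keys m" if "lookup ((\<Prod>a\<in>A. Var a) * coeff (unev {v} q) n) m \<noteq> 0"
      proof -
        have "kill {v} (coeff (unev {v} q) n) = coeff (unev {v} q) n"
          using coeff_unev[of "{v}" q n] by (intro poly_mapping_eqI) (auto simp: lookup_kill)
        moreover have "(\<Prod>a\<in>A. kill {v} (Var a)) = (\<Prod>a\<in>A. Var a :: ('n, 'k) mpoly)"
          using nv by (intro prod.cong) auto
        ultimately have "kill {v} ((\<Prod>a\<in>A. Var a) * coeff (unev {v} q) n) = (\<Prod>a\<in>A. Var a) * coeff (unev {v} q) n"
          by (simp only: kill_simps)
        then have "lookup (kill {v} ((\<Prod>a\<in>A. Var a) * coeff (unev {v} q) n)) m \<noteq> 0" using that by (simp only: not_False_eq_True)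
        then show ?thesis unfolding lookup_kill by (simp split: if_splits)
      qed
      then show ?thesis using m True by (simp add: lookup_add)
    qed
    ultimately show ?case by blast
  qed
  from this[OF finite[of UNIV]] obtain f where f: "\<forall>u\<in>UNIV. ev u f = g u"
    "\<forall>n m. lookup (coeff f n) m \<noteq> 0 \<longrightarrow> \<not> UNIV \<subseteq> keys m" by (elim exE conjE)
  show ?thesis
  proof (rule that[of f])
    show "ev u f = g u" for u using f(1) by blast
    show "keys m \<noteq> UNIV" if "lookup (coeff f n) m \<noteq> 0" for n m using f(2) that by blast
  qed
qed

section \<open>Logarithmic forms of graphic arrangements\<close>

text \<open>The coordinates of the chosen normal vector are found by inserting points of the
  hyperplane: the unit vectors away from u and v, and the vector of ones.\<close>

lemma normal_vec_diff:
  fixes u v :: "'n::finite"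
  assumes "u \<noteq> v"
  obtains l :: "'k::field" where "l \<noteq> 0"
    "normal_vec {x :: 'k ^ 'n. x $ u = x $ v} = (\<chi> i. if i = u then l else if i = v then - l else 0)"
proof -
  let ?H = "{x :: 'k ^ 'n. x $ u = x $ v}"
  let ?P = "\<lambda>c :: 'k ^ 'n. c \<noteq> 0 \<and> ?H = {x. (\<Sum>i\<in>UNIV. c $ i * x $ i) = 0}"
  let ?c = "\<chi> i. if i = u then 1 else if i = v then - 1 else (0 :: 'k)"
  have sum: "(\<Sum>i\<in>UNIV. ?c $ i * x $ i) = x $ u - x $ v" for x :: "'k ^ 'n"
  proof -
    have "(\<Sum>i\<in>UNIV. ?c $ i * x $ i) = (\<Sum>i\<in>UNIV. (if i = u then x $ u else 0) - (if i = v then x $ v else 0))"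
      using assms by (intro sum.cong refl) simp
    then show ?thesis by (simp add: sum_subtractf)
  qed
  have "?c \<noteq> 0"
  proof
    assume "?c = 0"
    then have "?c $ u = 0" by (simp only: zero_index)
    then show False by simp
  qed
  then have "?P ?c" unfolding sum by simp
  then have P: "?P (normal_vec ?H)" unfolding normal_vec_def by (rule someI)
  define c where "c = normal_vec ?H"
  have c: "c \<noteq> 0" "?H = {x. (\<Sum>i\<in>UNIV. c $ i * x $ i) = 0}"
    using conjunct1[OF P] conjunct2[OF P] unfolding c_def by this+
  have z: "(\<Sum>i\<in>UNIV. c $ i * x $ i) = 0" if "x $ u = x $ v" for x
    using c(2) that by blast
  have ci: "c $ i = 0" if "i \<noteq> u" "i \<noteq> v" for i
  proof -
    have "(\<Sum>j\<in>UNIV. c $ j * (\<chi> j. if j = i then 1 else 0) $ j) = 0"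
      by (rule z) (use that in simp)
    then show ?thesis by (simp add: if_distrib cong: if_cong)
  qed
  have cv: "c $ v = - (c $ u)"
  proof -
    have "(\<Sum>j\<in>UNIV. c $ j * (\<chi> j. 1) $ j) = 0"
      by (rule z) simp
    then have "(\<Sum>j\<in>UNIV. c $ j) = 0" by simp
    also have "(\<Sum>j\<in>UNIV. c $ j) = (\<Sum>j\<in>{u, v}. c $ j)"
      using ci by (intro sum.mono_neutral_right) auto
    finally show ?thesis using assms by (simp add: eq_neg_iff_add_eq_0 add.commute)
  qed
  have "c = (\<chi> i. if i = u then c $ u else if i = v then - (c $ u) else 0)"
    using ci cv by (simp add: vec_eq_iff)
  moreover have "c $ u \<noteq> 0"
  proof
    assume "c $ u = 0"
    then have "c $ i = 0" for i using ci[of i] cv by (cases "i = u"; cases "i = v") simp_all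
    then show False using c(1) by (simp add: vec_eq_iff)
  qed
  ultimately show ?thesis using that[of "c $ u"] unfolding c_def by blast
qed

lemma def_form_diff:
  fixes u v :: "'n::{finite, linorder}"
  assumes "u \<noteq> v"
  obtains l :: "'k::field" where "l \<noteq> 0"
    "def_form {x :: 'k ^ 'n::_. x $ u = x $ v} = Const l * (Var u - Var v)"
    "d_def_form {x :: 'k ^ 'n::_. x $ u = x $ v} = (\<chi> i. if i = u then Const l else if i = v then - Const l else 0)"
proof -
  obtain l :: 'k where l: "l \<noteq> 0"
    "normal_vec {x :: 'k ^ 'n::_. x $ u = x $ v} = (\<chi> i. if i = u then l else if i = v then - l else 0)"
    by (rule normal_vec_diff[OF assms])
  have cu: "Const (- l) = (- Const l :: ('n, 'k) mpoly)"
    by (simp add: Const_def single_uminus)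
  have "def_form {x :: 'k ^ 'n::_. x $ u = x $ v} =
      (\<Sum>i\<in>UNIV. (if i = u then Const l * Var u else 0) - (if i = v then Const l * Var v else 0))"
    unfolding def_form_def l(2) using assms by (intro sum.cong refl) (simp add: cu)
  then have "def_form {x :: 'k ^ 'n::_. x $ u = x $ v} = Const l * (Var u - Var v)"
    by (simp add: sum_subtractf right_diff_distrib)
  moreover have "d_def_form {x :: 'k ^ 'n::_. x $ u = x $ v} =
      (\<chi> i. if i = u then Const l else if i = v then - Const l else 0)"
    unfolding d_def_form_def l(2) by (simp add: vec_eq_iff cu)
  ultimately show ?thesis using that l(1) by blast
qed

lemma Const_inverse: "l \<noteq> 0 \<Longrightarrow> Const l * Const (inverse l) = (1 :: ('n, 'k::field) mpoly)"
  by (simp add: Const_mult[symmetric])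

lemma Const_nonzero: "l \<noteq> 0 \<Longrightarrow> Const l \<noteq> (0 :: ('n, 'k::field) mpoly)"
  using Const_inverse[of l, where 'n='n] by auto

lemma Const_times_dvd_iff: "l \<noteq> 0 \<Longrightarrow> Const l * p dvd q \<longleftrightarrow> p dvd q"
  for p q :: "('n::{finite, linorder}, 'k::field) mpoly"
proof
  assume l: "l \<noteq> 0" and "p dvd q"
  then obtain r where "q = p * r" by (elim dvdE)
  then have "q = (Const l * p) * (Const (inverse l) * r)"
    using Const_inverse[OF l, where 'n='n] by (simp add: mult_ac)
  then show "Const l * p dvd q" by (rule dvdI)
qed (rule dvd_mult_right)

lemma dvd_Const_times_iff: "l \<noteq> 0 \<Longrightarrow> p dvd Const l * q \<longleftrightarrow> p dvd q"
  for p q :: "('n::{finite, linorder}, 'k::field) mpoly"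
proof
  assume l: "l \<noteq> 0" and d: "p dvd Const l * q"
  from d have "p dvd Const (inverse l) * (Const l * q)" by (rule dvd_mult)
  also have "Const (inverse l) * (Const l * q) = q"
    using l by (simp add: mult.assoc[symmetric] Const_mult[symmetric])
  finally show "p dvd q" .
qed simp

text \<open>Cancelling D, the entrywise quotients inherit antisymmetry and the zero diagonal, the
  latter being a condition of its own in characteristic two.\<close>

lemma two_forms_multiple_iff:
  fixes W :: "'r::idom ^ 'n ^ 'n::finite"
  assumes W: "\<And>i. W $ i $ i = 0" "\<And>i j. W $ j $ i = - (W $ i $ j)" and D: "D \<noteq> 0"
  shows "(\<exists>\<tau>\<in>two_forms. W = (\<chi> i j. D * \<tau> $ i $ j)) \<longleftrightarrow> (\<forall>i j. D dvd W $ i $ j)"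
proof
  assume L: "\<forall>i j. D dvd W $ i $ j"
  define T where "T = (\<lambda>i j. SOME t. W $ i $ j = D * t)"
  have T: "W $ i $ j = D * T i j" for i j
    unfolding T_def by (rule someI_ex) (rule L[THEN spec, THEN spec, of i j, unfolded dvd_def])
  have "T i i = 0" for i
    using W(1)[of i] D unfolding T by simp
  moreover have "T j i = - T i j" for i j
  proof -
    have "D * T j i = D * - T i j" using W(2)[where i = i and j = j] unfolding T by (simp only: mult_minus_right)
    then show ?thesis using D by (simp only: mult_cancel_left) simp
  qed
  ultimately have "(\<chi> i j. T i j) \<in> two_forms"
    unfolding two_forms_def mem_Collect_eq vec_lambda_beta by (intro conjI allI)
  then show "\<exists>\<tau>\<in>two_forms. W = (\<chi> i j. D * \<tau> $ i $ j)"
    by (rule bexI[rotated]) (simp add: vec_eq_iff T)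
qed (auto simp: vec_eq_iff)

text \<open>Up to a unit, \<eta> is wedged with dx_u - dx_v. The entries are, up to sign, the
  coefficients away from u and v, the sum of the other two, and zero.\<close>

lemma wedge_condition_iff:
  fixes \<eta> :: "('n::{finite, linorder}, 'k::field) mpoly ^ 'n::_"
  assumes "u \<noteq> v"
  shows "(\<exists>\<tau>\<in>two_forms. wedge \<eta> (d_def_form {x :: 'k ^ 'n::_. x $ u = x $ v}) =
      (\<chi> i j. def_form {x :: 'k ^ 'n::_. x $ u = x $ v} * \<tau> $ i $ j)) \<longleftrightarrow>
    (\<forall>i. i \<noteq> u \<and> i \<noteq> v \<longrightarrow> Var u - Var v dvd \<eta> $ i) \<and> Var u - Var v dvd \<eta> $ u + \<eta> $ v"
proof -
  obtain l :: 'k where l: "l \<noteq> 0"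
    and f: "def_form {x :: 'k ^ 'n::_. x $ u = x $ v} = Const l * (Var u - Var v)"
    and c: "d_def_form {x :: 'k ^ 'n::_. x $ u = x $ v} = (\<chi> i. if i = u then Const l else if i = v then - Const l else 0)"
    by (rule def_form_diff[OF assms])
  let ?D = "Var u - Var v :: ('n, 'k) mpoly"
  let ?c = "\<lambda>i. if i = u then 1 else if i = v then - 1 else (0 :: ('n, 'k) mpoly)"
  let ?W = "wedge \<eta> (d_def_form {x :: 'k ^ 'n::_. x $ u = x $ v})"
  have W: "?W $ i $ j = Const l * (\<eta> $ i * ?c j - \<eta> $ j * ?c i)" for i j
    by (simp add: wedge_def c algebra_simps)
  have "def_form {x :: 'k ^ 'n::_. x $ u = x $ v} \<noteq> (0 :: ('n, 'k) mpoly)"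
    using assms Const_nonzero[OF l, where 'n='n] unfolding f by (simp add: Var_eq_iff)
  then have "(\<exists>\<tau>\<in>two_forms. ?W = (\<chi> i j. def_form {x :: 'k ^ 'n::_. x $ u = x $ v} * \<tau> $ i $ j)) \<longleftrightarrow>
      (\<forall>i j. def_form {x :: 'k ^ 'n::_. x $ u = x $ v} dvd ?W $ i $ j)"
    by (intro two_forms_multiple_iff) (simp_all add: wedge_def)
  also have "\<dots> \<longleftrightarrow> (\<forall>i j. ?D dvd \<eta> $ i * ?c j - \<eta> $ j * ?c i)"
    unfolding f W Const_times_dvd_iff[OF l] dvd_Const_times_iff[OF l] ..
  also have "\<dots> \<longleftrightarrow> (\<forall>i. i \<noteq> u \<and> i \<noteq> v \<longrightarrow> ?D dvd \<eta> $ i) \<and> ?D dvd \<eta> $ u + \<eta> $ v" (is "?L \<longleftrightarrow> ?R")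
  proof
    assume L: ?L
    have "?D dvd \<eta> $ i" if "i \<noteq> u" "i \<noteq> v" for i
      using L[THEN spec, THEN spec, of i u] that by simp
    moreover have "?D dvd \<eta> $ u + \<eta> $ v"
      using L[THEN spec, THEN spec, of v u] assms by (simp add: add.commute)
    ultimately show ?R by blast
  next
    assume R: ?R
    have m: "?D dvd - \<eta> $ u - \<eta> $ v" "?D dvd \<eta> $ v + \<eta> $ u"
      using R dvd_minus_iff[of ?D "\<eta> $ u + \<eta> $ v"] by (simp_all add: algebra_simps)
    show ?L
    proof (intro allI)
      fix i j
      show "?D dvd \<eta> $ i * ?c j - \<eta> $ j * ?c i"
        using R m assms by (cases "i = u"; cases "i = v"; cases "j = u"; cases "j = v") simp_all
    qed
  qed
  finally show ?thesis .
qed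

lemma finite_graphic_arrangement: "finite (graphic_arrangement E :: ('k::field ^ 'n::finite) set set)"
proof -
  have "graphic_arrangement E \<subseteq> (\<lambda>(u, v). {x :: 'k ^ 'n::_. x $ u = x $ v}) ` UNIV"
    by (auto simp: graphic_arrangement_def)
  then show ?thesis by (rule finite_subset) simp
qed

lemma simple_graphD: "simple_graph E \<Longrightarrow> {u, v} \<in> E \<Longrightarrow> u \<noteq> v"
  by (auto simp: simple_graph_def complete_graph_def)

section \<open>Divisibility by factors of the defining polynomial\<close>

context
  fixes E :: "'n::{finite, linorder} set set"
  assumes simple: "simple_graph E"
begin

lemma arrangementE:
  assumes "H \<in> (graphic_arrangement E :: ('k::field ^ 'n::_) set set)"
  obtains u v and l :: "'k::field" where "{u, v} \<in> E" "u \<noteq> v" "H = {x. x $ u = x $ v}" "l \<noteq> 0" "def_form H = Const l * (Var u - Var v)"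
proof -
  obtain u v where uv: "{u, v} \<in> E" "H = {x. x $ u = x $ v}"
    using assms by (auto simp: graphic_arrangement_def)
  have ne: "u \<noteq> v" by (rule simple_graphD[OF simple uv(1)])
  obtain l :: 'k where l: "l \<noteq> 0" "def_form H = Const l * (Var u - Var v)"
    unfolding uv(2) by (rule def_form_diff[OF ne])
  show ?thesis by (rule that[OF uv(1) ne uv(2) l])
qed

lemma diff_Var_dvd_def_form:
  fixes H :: "('k::field ^ 'n::_) set"
  assumes H: "H \<in> graphic_arrangement E" and D: "Var u - Var v dvd def_form H"
  shows "{u, v} \<in> E" "H = {x. x $ u = x $ v}"
proof -
  obtain a b and l :: 'k where ab: "{a, b} \<in> E" "a \<noteq> b" "H = {x. x $ a = x $ b}" "l \<noteq> 0" "def_form H = Const l * (Var a - Var b)"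
    by (rule arrangementE[OF H])
  have "{a, b} = {u, v}"
    using diff_Var_dvd_diff_Var[of u v a b, where 'k='k] D ab(2) unfolding ab(5) dvd_Const_times_iff[OF ab(4)] by simp
  then show "{u, v} \<in> E" "H = {x. x $ u = x $ v}" using ab(1,3) by (auto simp: doubleton_eq_iff insert_commute)
qed

lemma prime_elem_def_form:
  fixes H :: "('k::field ^ 'n::_) set"
  assumes "H \<in> graphic_arrangement E"
  shows "prime_elem (def_form H)"
proof -
  obtain a b and l :: 'k where ab: "{a, b} \<in> E" "a \<noteq> b" "H = {x. x $ a = x $ b}" "l \<noteq> 0" "def_form H = Const l * (Var a - Var b)"
    by (rule arrangementE[OF assms])
  show ?thesis
    using prime_elem_diff_Var[OF ab(2), where 'k='k] Const_nonzero[OF ab(4), where 'n='n]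
    unfolding ab(5) prime_elem_def by (simp add: Const_times_dvd_iff[OF ab(4)])
qed

lemma prime_elem_nonzero: "prime_elem (p :: 'a::comm_semiring_1) \<Longrightarrow> p \<noteq> 0"
  by (simp add: prime_elem_def)

lemma arr_poly_nonzero: "arr_poly (graphic_arrangement E :: ('k::field ^ 'n::_) set set) \<noteq> 0"
  unfolding arr_poly_def prod_zero_iff[OF finite_graphic_arrangement]
  using prime_elem_def_form prime_elem_nonzero by blast

lemma diff_Var_dvd_arr_poly:
  assumes "u \<noteq> v" "Var u - Var v dvd arr_poly (graphic_arrangement E :: ('k::field ^ 'n::_) set set)"
  shows "{u, v} \<in> E"
  using prime_elem_dvd_prodD[OF prime_elem_diff_Var[OF assms(1)] assms(2)[unfolded arr_poly_def]] diff_Var_dvd_def_form(1) by blast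

text \<open>The arrangement is a set, so x_u - x_v occurs in the product exactly once, up to a
  unit.\<close>

lemma arr_poly_factor:
  assumes uv: "{u, v} \<in> E"
  obtains Q' where "arr_poly (graphic_arrangement E :: ('k::field ^ 'n::_) set set) = (Var u - Var v) * Q'"
    "\<not> Var u - Var v dvd Q'"
proof -
  let ?A = "graphic_arrangement E :: ('k ^ 'n::_) set set" and ?H = "{x :: 'k ^ 'n::_. x $ u = x $ v}"
  have ne: "u \<noteq> v" by (rule simple_graphD[OF simple uv])
  obtain l :: 'k where l: "l \<noteq> 0" "def_form ?H = Const l * (Var u - Var v)"
    by (rule def_form_diff[OF ne])
  have H: "?H \<in> ?A" using uv by (auto simp: graphic_arrangement_def)
  let ?Q' = "Const l * (\<Prod>H\<in>?A - {?H}. def_form H)"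
  have "arr_poly ?A = def_form ?H * (\<Prod>H\<in>?A - {?H}. def_form H)"
    unfolding arr_poly_def by (rule prod.remove[OF finite_graphic_arrangement H])
  then have "arr_poly ?A = (Var u - Var v) * ?Q'" unfolding l(2) by (simp only: mult_ac)
  moreover have "\<not> Var u - Var v dvd ?Q'"
  proof
    assume "Var u - Var v dvd ?Q'"
    then have "Var u - Var v dvd (\<Prod>H\<in>?A - {?H}. def_form H)"
      unfolding dvd_Const_times_iff[OF l(1)] .
    from prime_elem_dvd_prodD[OF prime_elem_diff_Var[OF ne] this]
    show False using diff_Var_dvd_def_form(2) by blast
  qed
  ultimately show ?thesis by (rule that)
qed

lemma arr_poly_dvd:
  assumes "\<And>u v. {u, v} \<in> E \<Longrightarrow> Var u - Var v dvd p"
  shows "arr_poly (graphic_arrangement E :: ('k::field ^ 'n::_) set set) dvd p"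
  unfolding arr_poly_def
proof (rule prod_primes_dvd[OF finite_graphic_arrangement prime_elem_def_form])
  fix H K :: "('k ^ 'n::_) set" assume H: "H \<in> graphic_arrangement E" and K: "K \<in> graphic_arrangement E" "H \<noteq> K"
  obtain a b and l :: 'k where ab: "{a, b} \<in> E" "a \<noteq> b" "H = {x. x $ a = x $ b}" "l \<noteq> 0" "def_form H = Const l * (Var a - Var b)"
    by (rule arrangementE[OF H])
  show "\<not> def_form H dvd (def_form K :: ('n, 'k) mpoly)"
    unfolding ab(5) Const_times_dvd_iff[OF ab(4)] using diff_Var_dvd_def_form(2)[OF K(1)] ab(3) K(2) by blast
next
  fix H :: "('k ^ 'n::_) set" assume H: "H \<in> graphic_arrangement E"
  obtain a b and l :: 'k where ab: "{a, b} \<in> E" "a \<noteq> b" "H = {x. x $ a = x $ b}" "l \<noteq> 0" "def_form H = Const l * (Var a - Var b)"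
    by (rule arrangementE[OF H])
  show "def_form H dvd p" unfolding ab(5) Const_times_dvd_iff[OF ab(4)] by (rule assms[OF ab(1)])
qed

end

text \<open>The denominator for the i-th coefficient: besides the factors for edges at i it has one
  for each non-neighbour, which turns a missing edge into a divisibility condition on the
  numerator.\<close>

definition vand :: "'n::{finite, linorder} \<Rightarrow> ('n, 'k::field) mpoly" where
  "vand i = (\<Prod>j\<in>- {i}. Var i - Var j)"

lemma vand_dvd:
  assumes "\<And>j. j \<noteq> i \<Longrightarrow> Var i - Var j dvd p"
  shows "vand i dvd (p :: ('n::{finite, linorder}, 'k::field) mpoly)"
  unfolding vand_def
proof (rule prod_primes_dvd)
  fix a b assume ab: "a \<in> - {i}" "b \<in> - {i}" "a \<noteq> b"
  show "\<not> Var i - Var a dvd (Var i - Var b :: ('n, 'k) mpoly)"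
    using diff_Var_dvd_diff_Var[of i a i b, where 'k='k] ab by (auto simp: doubleton_eq_iff)
qed (use assms in \<open>auto intro: prime_elem_diff_Var\<close>)

lemma diff_Var_dvd_vand: "i \<noteq> j \<Longrightarrow> Var i - Var j dvd vand i"
  unfolding vand_def by (rule dvd_prodI) auto

lemma vand_nonzero: "vand i \<noteq> (0 :: ('n::{finite, linorder}, 'k::field) mpoly)"
  by (auto simp: vand_def Var_eq_iff)

lemma diff_Var_not_dvd_prod:
  assumes "u \<noteq> v" "\<And>j. j \<in> A \<Longrightarrow> i \<noteq> j \<and> {i, j} \<noteq> {u, v}"
  shows "\<not> Var u - Var v dvd (\<Prod>j\<in>A. Var i - Var j :: ('n::{finite, linorder}, 'k::field) mpoly)"
proof
  assume "Var u - Var v dvd (\<Prod>j\<in>A. Var i - Var j :: ('n, 'k) mpoly)"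
  from prime_elem_dvd_prodD[OF prime_elem_diff_Var[OF assms(1)] this]
  obtain j where "j \<in> A" "Var u - Var v dvd (Var i - Var j :: ('n, 'k) mpoly)" by blast
  with diff_Var_dvd_diff_Var[of u v i j, where 'k='k] assms(2)[of j] show False by blast
qed

text \<open>Meant for D = x_u - x_v at an edge: D * q is the defining polynomial, while D * a and -
  (D * b) are \<open>vand u\<close> and \<open>vand v\<close>. The opposite sign of the second turns
  the sum of two coefficients into a difference of numerators.\<close>

lemma dvd_diff_iff_dvd_add:
  fixes D :: "'a::idom"
  assumes D: "prime_elem D" "\<not> D dvd q" "\<not> D dvd a" "D dvd a - b"
    and e: "x * (D * a) = D * q * g" "y * - (D * b) = D * q * h"
  shows "D dvd g - h \<longleftrightarrow> D dvd x + y"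
proof -
  have nz: "D \<noteq> 0" using D(1) by auto
  have "D * (x * a) = D * (q * g)"
    using e(1) by (simp only: mult.left_commute[of D x a] mult.assoc)
  moreover have "D * - (y * b) = D * (q * h)"
    using e(2) by (simp only: mult_minus_right mult.left_commute[of D y b] mult.assoc)
  ultimately have xy: "x * a = q * g" "- (y * b) = q * h"
    using nz by (simp_all only: mult_cancel_left simp_thms)
  have "q * (g - h) = x * a + y * b" unfolding right_diff_distrib xy[symmetric] by simp
  also have "\<dots> = (x + y) * a - y * (a - b)" by (simp add: algebra_simps)
  finally have eq: "q * (g - h) = (x + y) * a - y * (a - b)" .
  have "D dvd g - h \<longleftrightarrow> D dvd q * (g - h)"
    unfolding prime_elem_dvd_mult_iff[OF D(1)] using D(2) by blast
  also have "\<dots> \<longleftrightarrow> D dvd (x + y) * a"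
    unfolding eq by (rule dvd_diff_left_iff) (rule dvd_mult[OF D(4)])
  also have "\<dots> \<longleftrightarrow> D dvd x + y"
    unfolding prime_elem_dvd_mult_iff[OF D(1)] using D(3) by blast
  finally show ?thesis .
qed

text \<open>With Q the defining polynomial and \<eta> = Q \<omega>, the numerators satisfy \<eta>_i
  * \<open>vand i\<close> = Q * g_i, and divisibility is tested one prime x_u - x_v at a time. An
  edge at i divides Q and \<open>vand i\<close> once each; an edge away from i divides Q only, hence
  \<eta>_i; a missing edge at i divides \<open>vand i\<close> only, hence g_i.\<close>

theorem log_forms_iff:
  fixes E :: "'n::{finite, linorder} set set" and \<omega> :: "('n, 'k::field) mpoly fract ^ 'n::_"
  assumes simple: "simple_graph E"
  shows "\<omega> \<in> log_forms (graphic_arrangement E) \<longleftrightarrow>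
    (\<exists>g. (\<forall>i. to_fract (vand i) * \<omega> $ i = to_fract (g i)) \<and>
      (\<forall>i j. i \<noteq> j \<longrightarrow> Var i - Var j dvd g i - g j) \<and>
      (\<forall>i j. i \<noteq> j \<and> {i, j} \<notin> E \<longrightarrow> Var i - Var j dvd g i))"
proof -
  let ?A = "graphic_arrangement E :: ('k ^ 'n::_) set set"
  let ?Q = "arr_poly ?A"
  let ?w = "\<lambda>\<eta> :: ('n, 'k) mpoly ^ 'n::_. \<forall>u v. {u, v} \<in> E \<longrightarrow>
    (\<forall>i. i \<noteq> u \<and> i \<noteq> v \<longrightarrow> Var u - Var v dvd \<eta> $ i) \<and> Var u - Var v dvd \<eta> $ u + \<eta> $ v"
  have Qnz: "to_fract ?Q \<noteq> 0" using arr_poly_nonzero[OF simple, where 'k='k] by simp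
  have vnz: "to_fract (vand i) \<noteq> (0 :: ('n, 'k) mpoly fract)" for i using vand_nonzero by simp
  have w: "(\<forall>H\<in>?A. \<exists>\<tau>\<in>two_forms. wedge \<eta> (d_def_form H) = (\<chi> i j. def_form H * \<tau> $ i $ j)) \<longleftrightarrow> ?w \<eta>" for \<eta>
  proof -
    have b: "(\<forall>H\<in>?A. P H) \<longleftrightarrow> (\<forall>u v. {u, v} \<in> E \<longrightarrow> P {x. x $ u = x $ v})" for P
      unfolding graphic_arrangement_def by blast
    show ?thesis
      unfolding b by (intro all_cong1 imp_cong refl wedge_condition_iff simple_graphD[OF simple])
  qed
  have edge: "Var u - Var v dvd g u - g v \<longleftrightarrow> Var u - Var v dvd \<eta> $ u + \<eta> $ v"
    if uv: "{u, v} \<in> E" and e: "\<And>i. \<eta> $ i * vand i = ?Q * g i" for u v g and \<eta> :: "('n, 'k) mpoly ^ 'n::_"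
  proof -
    let ?D = "Var u - Var v :: ('n, 'k) mpoly"
    have ne: "u \<noteq> v" by (rule simple_graphD[OF simple uv])
    obtain Q' where Q': "?Q = ?D * Q'" "\<not> ?D dvd Q'" by (rule arr_poly_factor[OF simple uv])
    let ?a = "\<Prod>j\<in>- {u, v}. Var u - Var j :: ('n, 'k) mpoly" and ?b = "\<Prod>j\<in>- {u, v}. Var v - Var j :: ('n, 'k) mpoly"
    have s: "- {u} - {v} = - {u, v}" "- {v} - {u} = - {u, v}" by auto
    have va: "vand u = ?D * ?a"
      unfolding vand_def using ne by (subst prod.remove[of _ v]) (simp_all add: s)
    have "vand v = (Var v - Var u) * ?b"
      unfolding vand_def using ne by (subst prod.remove[of _ u]) (simp_all add: s)
    then have vb: "vand v = - (?D * ?b)" by (simp add: algebra_simps)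
    have na: "\<not> ?D dvd ?a" by (rule diff_Var_not_dvd_prod[OF ne]) (auto simp: doubleton_eq_iff)
    \<comment> \<open>Modulo x_u - x_v the remaining factors of \<open>vand u\<close> and
      \<open>vand v\<close> have the same product.\<close>
    have "(\<Prod>j\<in>- {u, v}. Var v - glue u v (Var j)) = (?b :: ('n, 'k) mpoly)"
      by (intro prod.cong refl) simp
    moreover have "(\<Prod>j\<in>- {u, v}. glue u v (Var v) - glue u v (Var j)) = (?b :: ('n, 'k) mpoly)"
      using ne by (intro prod.cong refl) simp
    ultimately have ab: "?D dvd ?a - ?b"
      unfolding diff_Var_dvd_iff by (simp del: glue_simps(4) add: glue_simps(4)[of u v u] )
    show ?thesis
      by (rule dvd_diff_iff_dvd_add[OF prime_elem_diff_Var[OF ne] Q'(2) na ab])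
        (use e[of u] e[of v] in \<open>simp_all only: va vb Q'(1)\<close>)
  qed
  show ?thesis
  proof
    assume "\<omega> \<in> log_forms ?A"
    then obtain \<eta> where \<eta>: "form_scale ?Q \<omega> = (\<chi> i. to_fract (\<eta> $ i))" "?w \<eta>"
      unfolding log_forms_def w by blast
    have Q\<omega>: "to_fract ?Q * \<omega> $ i = to_fract (\<eta> $ i)" for i
      using \<eta>(1) by (simp add: form_scale_def vec_eq_iff)
    have "?Q dvd \<eta> $ i * vand i" for i
    proof (rule arr_poly_dvd[OF simple])
      fix u v assume uv: "{u, v} \<in> E"
      have ne: "u \<noteq> v" by (rule simple_graphD[OF simple uv])
      have D: "Var u - Var v = - (Var v - Var u :: ('n, 'k) mpoly)" by simp
      consider "i = u" | "i = v" | "i \<noteq> u" "i \<noteq> v" by blast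
      then show "Var u - Var v dvd \<eta> $ i * vand i"
      proof cases
        case 1
        show ?thesis unfolding 1 by (intro dvd_mult diff_Var_dvd_vand ne)
      next
        case 2
        show ?thesis unfolding D minus_dvd_iff 2 by (intro dvd_mult diff_Var_dvd_vand ne[symmetric])
      next
        case 3
        then have "Var u - Var v dvd \<eta> $ i" using \<eta>(2) uv by blast
        then show ?thesis by (rule dvd_mult2)
      qed
    qed
    then have "\<forall>i. \<exists>h. \<eta> $ i * vand i = ?Q * h" unfolding dvd_def by (rule allI)
    from choice[OF this] obtain g where "\<forall>i. \<eta> $ i * vand i = ?Q * g i" by (rule exE)
    then have g: "\<eta> $ i * vand i = ?Q * g i" for i by (rule spec)
    have "to_fract (vand i) * \<omega> $ i = to_fract (g i)" for i
    proof -
      have "to_fract ?Q * (to_fract (vand i) * \<omega> $ i) = to_fract (vand i) * to_fract (\<eta> $ i)"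
        using Q\<omega>[of i] by (simp only: mult.left_commute)
      also have "\<dots> = to_fract ?Q * to_fract (g i)"
        using g[of i] by (simp only: to_fract_mult[symmetric] mult.commute)
      finally show ?thesis using Qnz by (simp only: mult_cancel_left simp_thms)
    qed
    moreover have non: "Var i - Var j dvd g i" if "i \<noteq> j" "{i, j} \<notin> E" for i j
    proof -
      have "Var i - Var j dvd ?Q * g i"
        using diff_Var_dvd_vand[OF that(1)] unfolding g[symmetric] by (rule dvd_mult)
      then show ?thesis
        using diff_Var_dvd_arr_poly[OF simple that(1)] that(2)
        by (simp only: prime_elem_dvd_mult_iff[OF prime_elem_diff_Var[OF that(1)]]) blast
    qed
    moreover have "Var i - Var j dvd g i - g j" if "i \<noteq> j" for i j
    proof (cases "{i, j} \<in> E")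
      case True
      then show ?thesis unfolding edge[OF True g] using \<eta>(2) by blast
    next
      case False
      have D: "Var i - Var j = - (Var j - Var i :: ('n, 'k) mpoly)" by simp
      have "Var i - Var j dvd g j" unfolding D minus_dvd_iff using non[of j i] that False by (simp add: insert_commute)
      then show ?thesis using non[OF that False] by (rule dvd_diff[rotated])
    qed
    ultimately show "\<exists>g. (\<forall>i. to_fract (vand i) * \<omega> $ i = to_fract (g i)) \<and>
      (\<forall>i j. i \<noteq> j \<longrightarrow> Var i - Var j dvd g i - g j) \<and>
      (\<forall>i j. i \<noteq> j \<and> {i, j} \<notin> E \<longrightarrow> Var i - Var j dvd g i)" by blast
  next
    assume "\<exists>g. (\<forall>i. to_fract (vand i) * \<omega> $ i = to_fract (g i)) \<and>
      (\<forall>i j. i \<noteq> j \<longrightarrow> Var i - Var j dvd g i - g j) \<and>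
      (\<forall>i j. i \<noteq> j \<and> {i, j} \<notin> E \<longrightarrow> Var i - Var j dvd g i)"
    then obtain g where g0: "(\<forall>i. to_fract (vand i) * \<omega> $ i = to_fract (g i)) \<and>
      (\<forall>i j. i \<noteq> j \<longrightarrow> Var i - Var j dvd g i - g j) \<and>
      (\<forall>i j. i \<noteq> j \<and> {i, j} \<notin> E \<longrightarrow> Var i - Var j dvd g i)" by (rule exE)
    have g1: "to_fract (vand i) * \<omega> $ i = to_fract (g i)" for i using g0 by blast
    have g2: "Var i - Var j dvd g i - g j" if "i \<noteq> j" for i j using g0 that by blast
    have g3: "Var i - Var j dvd g i" if "i \<noteq> j" "{i, j} \<notin> E" for i j using g0 that by blast
    have "vand i dvd ?Q * g i" for i
    proof (rule vand_dvd)
      fix j assume "j \<noteq> i"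
      then have ij: "i \<noteq> j" by simp
      show "Var i - Var j dvd ?Q * g i"
      proof (cases "{i, j} \<in> E")
        case True
        obtain Q' where "?Q = (Var i - Var j) * Q'" by (rule arr_poly_factor[OF simple True])
        then show ?thesis by simp
      next
        case False
        then show ?thesis using g3[OF ij] by (intro dvd_mult)
      qed
    qed
    then have "\<forall>i. \<exists>h. ?Q * g i = vand i * h" unfolding dvd_def by (rule allI)
    from choice[OF this] obtain h where "\<forall>i. ?Q * g i = vand i * h i" by (rule exE)
    then have h: "?Q * g i = vand i * h i" for i by (rule spec)
    define \<eta> where "\<eta> = vec_lambda h"
    have e: "\<eta> $ i * vand i = ?Q * g i" for i unfolding h \<eta>_def by (simp add: mult.commute)
    have "to_fract ?Q * \<omega> $ i = to_fract (\<eta> $ i)" for i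
    proof -
      have "to_fract (vand i) * (to_fract ?Q * \<omega> $ i) = to_fract ?Q * to_fract (g i)"
        unfolding g1[symmetric] by (rule mult.left_commute)
      also have "\<dots> = to_fract (vand i) * to_fract (\<eta> $ i)"
        using e[of i] by (simp only: to_fract_mult[symmetric] mult.commute)
      finally show ?thesis using vnz[of i] by (simp only: mult_cancel_left simp_thms)
    qed
    then have "form_scale ?Q \<omega> = (\<chi> i. to_fract (\<eta> $ i))" by (simp add: form_scale_def vec_eq_iff)
    moreover have "?w \<eta>"
    proof (intro allI impI conjI)
      fix u v assume uv: "{u, v} \<in> E"
      have ne: "u \<noteq> v" by (rule simple_graphD[OF simple uv])
      show "Var u - Var v dvd \<eta> $ u + \<eta> $ v" using edge[OF uv e] g2[OF ne] by blast
      fix i assume i: "i \<noteq> u \<and> i \<noteq> v"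
      obtain Q' where "?Q = (Var u - Var v) * Q'" by (rule arr_poly_factor[OF simple uv])
      then have "Var u - Var v dvd \<eta> $ i * vand i" unfolding e by simp
      moreover have "\<not> Var u - Var v dvd (vand i :: ('n, 'k) mpoly)"
        unfolding vand_def by (rule diff_Var_not_dvd_prod[OF ne]) (use i in \<open>auto simp: doubleton_eq_iff\<close>)
      ultimately show "Var u - Var v dvd \<eta> $ i"
        by (simp only: prime_elem_dvd_mult_iff[OF prime_elem_diff_Var[OF ne]]) blast
    qed
    ultimately show "\<omega> \<in> log_forms ?A" unfolding log_forms_def w by blast
  qed
qed

section \<open>Logarithmic forms as polynomials\<close>

text \<open>Equivalently, the complement of A is a clique of the graph.\<close>

definition covers :: "'n set set \<Rightarrow> 'n set set" where
  "covers E = {A. \<forall>u v. u \<noteq> v \<and> {u, v} \<notin> E \<longrightarrow> u \<in> A \<or> v \<in> A}"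

abbreviation proper :: "'n set set" where
  "proper \<equiv> {A. A \<noteq> UNIV}"

definition form_of :: "('n::{finite, linorder}, 'k::field) mpoly poly \<Rightarrow> ('n, 'k) mpoly fract ^ 'n::_" where
  "form_of f = (\<chi> i. to_fract (ev i f) / to_fract (vand i))"

text \<open>M_0[t] without grading, when \<S> consists of the proper vertex covers. With the flag
  off, the degree argument 0 is a dummy.\<close>

definition supp_polys :: "'n::finite set set \<Rightarrow> ('n, 'k::comm_ring_1) mpoly poly set" where
  "supp_polys \<S> = {f. \<forall>n. coeff f n \<in> mons \<S> False 0}"

lemma supp_polys_iff: "f \<in> supp_polys \<S> \<longleftrightarrow> (\<forall>n m. lookup (coeff f n) m \<noteq> 0 \<longrightarrow> keys m \<in> \<S>)"
  by (simp add: supp_polys_def mons_def Ball_def in_keys_iff)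

lemma downset_proper: "downset proper"
  by (auto simp: downset_def)

lemma upset_covers: "upset (covers E)"
  by (auto simp: upset_def covers_def)

lemma form_of_add: "form_of (f + g) = form_of f + form_of g"
  by (simp add: form_of_def vec_eq_iff add_divide_distrib)

lemma form_of_zero: "form_of 0 = 0"
  by (simp add: form_of_def vec_eq_iff)

lemma form_of_diff: "form_of (f - g) = form_of f - form_of g"
  using form_of_add[of "f - g" g] by (simp add: algebra_simps)

lemma form_of_sum: "form_of (\<Sum>x\<in>A. f x) = (\<Sum>x\<in>A. form_of (f x))"
  by (induction A rule: infinite_finite_induct) (simp_all add: form_of_add form_of_zero)

lemma form_of_smult: "form_of (smult (Const c) f) = form_scale (Const c) (form_of f)"
  by (simp add: form_of_def form_scale_def vec_eq_iff)

lemma psub_zero_factor: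
  fixes p :: "('n::{finite, linorder}, 'k::comm_ring_1) mpoly"
  assumes "\<And>m. m \<in> keys p \<Longrightarrow> \<exists>i\<in>keys m. x i = 0"
  shows "psub Const x p = 0"
  unfolding psub_def
proof (intro sum.neutral ballI)
  fix m assume "m \<in> keys p"
  with assms obtain i where i: "i \<in> keys m" "x i = 0" by blast
  have "0 < lookup m i" using i(1) by (simp add: in_keys_iff)
  then have "x i ^ lookup m i = 0" by (simp only: i(2) zero_power)
  then have "(\<Prod>i\<in>UNIV. x i ^ lookup m i) = 0" by (intro prod_zero finite bexI[of _ i] UNIV_I)
  then show "Const (lookup p m) * (\<Prod>i\<in>UNIV. x i ^ lookup m i) = 0" by simp
qed

text \<open>A truncated monomial contains y_i, which \<open>ysub i\<close> sends to 0, so truncation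
  is invisible to every evaluation.\<close>

lemma ysub_trunc_proper: "ysub i (trunc proper p) = ysub i p"
  for p :: "('n::{finite, linorder}, 'k::comm_ring_1) mpoly"
proof -
  have "ysub i (p - trunc proper p) = 0"
    unfolding ysub_def
  proof (rule psub_zero_factor)
    fix m assume "m \<in> keys (p - trunc proper p)"
    then have "keys m = UNIV" by (simp add: in_keys_iff lookup_minus lookup_trunc split: if_splits)
    then show "\<exists>j\<in>keys m. Var i - Var j = (0 :: ('n, 'k) mpoly)" by (intro bexI[of _ i]) simp_all
  qed
  then show ?thesis by simp
qed

lemma ev_map_poly_ymul: "ev i (map_poly (ymul proper k) f) = (Var i - Var k) * ev i f"
proof (induction f)
  case (pCons a f)
  have "ysub i (ymul proper k a) = (Var i - Var k) * ysub i a"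
    unfolding ymul_def ysub_trunc_proper by simp
  moreover have "ymul proper k 0 = (0 :: ('a, 'b) mpoly)"
    by (rule poly_mapping_eqI) (simp add: lookup_ymul)
  ultimately show ?case by (simp add: map_poly_pCons pCons.IH distrib_left mult.left_commute)
qed simp

text \<open>In the i-th component t - y_k is evaluated to x_i - (x_i - x_k) = x_k.\<close>

lemma form_of_polyop: "form_of (polyop (ymul proper) k f) = form_scale (Var k) (form_of f)"
proof -
  have "ev i (polyop (ymul proper) k f) = Var k * ev i f" for i
    by (simp add: polyop_def ev_map_poly_ymul algebra_simps)
  then show ?thesis by (simp add: form_of_def form_scale_def vec_eq_iff)
qed

lemma to_fract_vand_nonzero: "to_fract (vand i) \<noteq> (0 :: ('n::{finite, linorder}, 'k::field) mpoly fract)"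
  using vand_nonzero by simp

text \<open>Every monomial of f misses some y_u, and \<open>ev u f\<close> determines the
  coefficients of the monomials without y_u.\<close>

lemma form_of_eq_zero:
  fixes f :: "('n::{finite, linorder}, 'k::field) mpoly poly"
  assumes "form_of f = 0" "f \<in> supp_polys \<S>" "\<S> \<subseteq> proper"
  shows "f = 0"
proof -
  have "ev u f = 0" for u
  proof -
    have "form_of f $ u = 0" by (simp only: assms(1) zero_index)
    then show ?thesis using to_fract_vand_nonzero[of u, where 'k='k] by (simp add: form_of_def)
  qed
  then have k: "map_poly (kill {u}) f = 0" for u
    using unev_ev[of u "{u}" f] by simp
  have "lookup (coeff f n) m = 0" for n m
  proof (rule ccontr)
    assume nz: "lookup (coeff f n) m \<noteq> 0"
    then have "keys m \<noteq> UNIV" using assms(2,3) unfolding supp_polys_iff by blast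
    then obtain u where u: "u \<notin> keys m" by blast
    have "coeff (map_poly (kill {u}) f) n = kill {u} (coeff f n)" by (simp add: coeff_map_poly)
    then have "lookup (kill {u} (coeff f n)) m = 0" by (simp add: k)
    then show False using u nz by (simp add: lookup_kill)
  qed
  then show ?thesis by (intro poly_eqI poly_mapping_eqI) simp
qed

text \<open>At a missing edge uv both y_u and y_v vanish modulo x_u - x_v, so a monomial whose
  support covers uv gives a multiple of it. Conversely, if x_u - x_v divides the numerator at u,
  then setting y_u = y_v = 0 kills the interpolating polynomial, so none of its monomials avoids
  both.\<close>

lemma form_of_image:
  fixes E :: "'n::{finite, linorder} set set"
  assumes simple: "simple_graph E"
  shows "form_of ` supp_polys (covers E \<inter> proper) =
    (log_forms (graphic_arrangement E) :: (('n, 'k::field) mpoly fract ^ 'n::_) set)"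
proof (intro equalityI subsetI)
  fix \<omega> :: "('n, 'k) mpoly fract ^ 'n::_"
  assume "\<omega> \<in> form_of ` supp_polys (covers E \<inter> proper)"
  then obtain f where f: "\<omega> = form_of f" "f \<in> supp_polys (covers E \<inter> proper)" by (rule imageE)
  have "to_fract (vand i) * \<omega> $ i = to_fract (ev i f)" for i
    using to_fract_vand_nonzero[of i, where 'k='k] by (simp add: f(1) form_of_def)
  moreover have "Var u - Var v dvd ev u f - ev v f" for u v by (rule ev_cong)
  moreover have "Var u - Var v dvd ev u f" if uv: "u \<noteq> v \<and> {u, v} \<notin> E" for u v
    unfolding diff_Var_dvd_iff
  proof -
    have "glue u v (ysub u p) = psub Const (\<lambda>j. Var v - (if j = u then Var v else Var j)) p" for p :: "('n, 'k) mpoly"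
      by (induction p rule: mpoly_induct) (simp_all add: C.psub_add C.psub_mult)
    moreover have "psub Const (\<lambda>j. Var v - (if j = u then Var v else Var j)) (coeff f n) = (0 :: ('n, 'k) mpoly)" for n
    proof (rule psub_zero_factor)
      fix m assume "m \<in> keys (coeff f n)"
      then have "lookup (coeff f n) m \<noteq> 0" by (simp add: in_keys_iff)
      then have "keys m \<in> covers E" using f(2) unfolding supp_polys_iff by blast
      then have "u \<in> keys m \<or> v \<in> keys m" using uv unfolding covers_def by blast
      then show "\<exists>j\<in>keys m. Var v - (if j = u then Var v else Var j) = (0 :: ('n, 'k) mpoly)" by auto
    qed
    ultimately have "glue u v (ysub u (coeff f n)) = 0" for n by simp
    then show "glue u v (ev u f) = 0"
    proof (induction f)
      case (pCons a f)
      have "glue u v (ysub u a) = 0" using pCons.prems[of 0] by simp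
      moreover have "glue u v (ev u f) = 0" using pCons.prems[of "Suc n" for n] by (intro pCons.IH) simp
      ultimately show ?case by simp
    qed simp
  qed
  ultimately show "\<omega> \<in> log_forms (graphic_arrangement E)"
    unfolding log_forms_iff[OF simple] by (intro exI[of _ "\<lambda>i. ev i f"]) blast
next
  fix \<omega> :: "('n, 'k) mpoly fract ^ 'n::_"
  assume "\<omega> \<in> log_forms (graphic_arrangement E)"
  then obtain g where g0: "(\<forall>i. to_fract (vand i) * \<omega> $ i = to_fract (g i)) \<and>
      (\<forall>i j. i \<noteq> j \<longrightarrow> Var i - Var j dvd g i - g j) \<and>
      (\<forall>i j. i \<noteq> j \<and> {i, j} \<notin> E \<longrightarrow> Var i - Var j dvd g i)"
    unfolding log_forms_iff[OF simple] by (rule exE)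
  have g1: "to_fract (vand i) * \<omega> $ i = to_fract (g i)" for i using g0 by blast
  have g2: "Var i - Var j dvd g i - g j" if "i \<noteq> j" for i j using g0 that by blast
  have g3: "Var i - Var j dvd g i" if "i \<noteq> j" "{i, j} \<notin> E" for i j using g0 that by blast
  obtain f where f: "\<And>u. ev u f = g u" "\<And>n m. lookup (coeff f n) m \<noteq> 0 \<Longrightarrow> keys m \<noteq> UNIV"
    by (rule interpolation[OF g2]) (assumption | blast)+
  have "keys m \<in> covers E" if nz: "lookup (coeff f n) m \<noteq> 0" for n m
    unfolding covers_def
  proof (intro CollectI allI impI)
    fix u v assume uv: "u \<noteq> v \<and> {u, v} \<notin> E"
    obtain q where "g u = (Var u - Var v) * q" using g3[OF conjunct1[OF uv] conjunct2[OF uv]] by (elim dvdE)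
    then have "unev {u, v} (ev u f) = 0" by (simp add: f(1))
    then have "map_poly (kill {u, v}) f = 0" using unev_ev[of u "{u, v}" f] by simp
    moreover have "coeff (map_poly (kill {u, v}) f) n = kill {u, v} (coeff f n)" by (simp add: coeff_map_poly)
    ultimately have "lookup (kill {u, v} (coeff f n)) m = 0" by simp
    then show "u \<in> keys m \<or> v \<in> keys m" using nz unfolding lookup_kill by (auto split: if_splits)
  qed
  then have "f \<in> supp_polys (covers E \<inter> proper)" unfolding supp_polys_iff using f(2) by blast
  moreover have "\<omega> = form_of f"
    using g1 to_fract_vand_nonzero[where 'k='k and 'n='n]
    by (simp add: form_of_def vec_eq_iff f(1) nonzero_eq_divide_eq mult.commute)
  ultimately show "\<omega> \<in> form_of ` supp_polys (covers E \<inter> proper)" by (rule image_eqI[rotated])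
qed

section \<open>The grading of M_0[t], with t in degree one\<close>

definition pgr :: "int \<Rightarrow> ('n, 'k::comm_ring_1) mpoly poly \<Rightarrow> ('n, 'k) mpoly poly" where
  "pgr j f = (\<Sum>n\<le>degree f. monom (hpart (j - int n) (coeff f n)) n)"

lemma hpart_zero [simp]: "hpart d 0 = 0"
  by (simp add: hpart_def)

lemma coeff_pgr: "coeff (pgr j f) n = hpart (j - int n) (coeff f n)"
  by (auto simp: pgr_def coeff_sum coeff_eq_0 not_le)

lemma pgr_add: "pgr j (f + g) = pgr j f + pgr j g"
  by (rule poly_eqI) (simp add: coeff_pgr hpart_add)

lemma polygr_mons_iff: "f \<in> polygr (mons \<S> True) j \<longleftrightarrow>
    (\<forall>n m. lookup (coeff f n) m \<noteq> 0 \<longrightarrow> keys m \<in> \<S> \<and> int (mon_degree m) = j - int n)"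
  by (simp add: polygr_def mons_def Ball_def in_keys_iff)

lemma pgr_mem: "f \<in> supp_polys \<S> \<Longrightarrow> pgr j f \<in> polygr (mons \<S> True) j"
  by (simp add: polygr_mons_iff supp_polys_iff coeff_pgr lookup_hpart split: if_splits)

lemma pgr_of_polygr: "f \<in> polygr (mons \<S> True) i \<Longrightarrow> pgr j f = (if i = j then f else 0)"
proof (intro poly_eqI poly_mapping_eqI)
  fix n m assume f: "f \<in> polygr (mons \<S> True) i"
  show "lookup (coeff (pgr j f) n) m = lookup (coeff (if i = j then f else 0) n) m"
  proof (cases "lookup (coeff f n) m = 0")
    case False
    then have "int (mon_degree m) = i - int n" using f unfolding polygr_mons_iff by blast
    then show ?thesis by (simp add: coeff_pgr lookup_hpart)
  qed (simp add: coeff_pgr lookup_hpart)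
qed

lemma polygr_sub_supp_polys: "polygr (mons \<S> True) j \<subseteq> supp_polys \<S>"
  by (auto simp: polygr_mons_iff supp_polys_iff)

lemma lookup_coeff_pgr: "lookup (coeff (pgr j f) n) m = (if j = int n + int (mon_degree m) then lookup (coeff f n) m else 0)"
  by (auto simp: coeff_pgr lookup_hpart)

lemma pgr_finite: "finite {j. pgr j f \<noteq> 0}"
proof -
  have "{j. pgr j f \<noteq> 0} \<subseteq> (\<Union>n\<le>degree f. (\<lambda>m. int n + int (mon_degree m)) ` keys (coeff f n))"
  proof
    fix j assume "j \<in> {j. pgr j f \<noteq> 0}"
    then have "\<exists>n m. lookup (coeff (pgr j f) n) m \<noteq> 0"
      by (auto simp: poly_eq_iff poly_mapping_eq_iff fun_eq_iff)
    then obtain n m where "lookup (coeff (pgr j f) n) m \<noteq> 0" by blast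
    then have "j = int n + int (mon_degree m)" "lookup (coeff f n) m \<noteq> 0"
      unfolding lookup_coeff_pgr by (auto split: if_splits)
    moreover from this(2) have "n \<le> degree f" by (intro le_degree) auto
    ultimately show "j \<in> (\<Union>n\<le>degree f. (\<lambda>m. int n + int (mon_degree m)) ` keys (coeff f n))"
      by (intro UN_I[of n] image_eqI[of _ _ m]) (simp_all add: in_keys_iff)
  qed
  then show ?thesis by (rule finite_subset) simp
qed

lemma pgr_sum: "(\<Sum>j | pgr j f \<noteq> 0. pgr j f) = f"
  for f :: "('a, 'b::comm_ring_1) mpoly poly"
proof (intro poly_eqI poly_mapping_eqI)
  fix n and m :: "'a \<Rightarrow>\<^sub>0 nat"
  let ?A = "{j. pgr j f \<noteq> 0}" and ?d = "int n + int (mon_degree m)"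
  have "lookup (coeff (\<Sum>j\<in>?A. pgr j f) n) m = (\<Sum>j\<in>?A. if j = ?d then lookup (coeff f n) m else 0)"
    by (simp only: coeff_sum lookup_sum lookup_coeff_pgr)
  also have "\<dots> = (if ?d \<in> ?A then lookup (coeff f n) m else 0)"
    by (simp add: pgr_finite)
  also have "\<dots> = lookup (coeff f n) m"
  proof (cases "?d \<in> ?A")
    case False
    then have "lookup (coeff (pgr ?d f) n) m = 0" by simp
    then show ?thesis unfolding lookup_coeff_pgr by simp
  qed simp
  finally show "lookup (coeff (\<Sum>j\<in>?A. pgr j f) n) m = lookup (coeff f n) m" .
qed

lemma supp_polys_add: "f \<in> supp_polys \<S> \<Longrightarrow> g \<in> supp_polys \<S> \<Longrightarrow> f + g \<in> supp_polys \<S>"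
  unfolding supp_polys_iff by (auto simp: lookup_add) (metis add_0)

lemma supp_polys_uminus: "f \<in> supp_polys \<S> \<Longrightarrow> - f \<in> supp_polys \<S>"
  unfolding supp_polys_iff by simp

lemma polygr_mons_smult: "f \<in> polygr (mons \<S> True) j \<Longrightarrow> smult (Const c) f \<in> polygr (mons \<S> True) j"
  unfolding polygr_mons_iff
proof (intro allI impI)
  fix n m
  assume f: "\<forall>n m. lookup (coeff f n) m \<noteq> 0 \<longrightarrow> keys m \<in> \<S> \<and> int (mon_degree m) = j - int n"
    and "lookup (coeff (smult (Const c) f) n) m \<noteq> 0"
  then have "lookup (coeff f n) m \<noteq> 0" by (auto simp: lookup_Const_times)
  then show "keys m \<in> \<S> \<and> int (mon_degree m) = j - int n" using f by blast
qed

text \<open>When ks runs through all variables the support would be full, which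
  \<open>proper\<close> excludes; so the product of all the operators is zero.\<close>

lemma fold_ymul_support:
  assumes "\<And>m. lookup a m \<noteq> 0 \<Longrightarrow> keys m \<in> \<D>" "lookup (fold (ymul \<D>) ks a) m \<noteq> 0"
  shows "set ks \<subseteq> keys m \<and> keys m \<in> \<D>"
  using assms(2)
proof (induction ks arbitrary: m rule: rev_induct)
  case (snoc k ks)
  then have m: "keys m \<in> \<D>" "k \<in> keys m" "lookup (fold (ymul \<D>) ks a) (m - single k 1) \<noteq> 0"
    by (simp_all add: lookup_ymul split: if_splits)
  then show ?case using snoc.IH[OF m(3)] keys_diff_mon[of m "single k 1"] by auto
qed (use assms(1) in simp)

text \<open>No squarefree multidegree exceeds the number of variables.\<close>

lemma kexact_mons_high_degree:
  assumes "downset \<D>" "upset \<U>" "j > int CARD('n)"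
  shows "kexact (ymul \<D>) (mons (\<U> \<inter> \<D>) True :: int \<Rightarrow> ('n::{finite, linorder}, 'k::field) mpoly set) i j"
  unfolding kexact_ymul_iff[OF assms(1,2)]
proof (intro allI impI)
  fix \<tau> :: "'n set" assume "True \<longrightarrow> int (card \<tau>) = j"
  moreover have "card \<tau> \<le> CARD('n)" by (rule card_mono) simp_all
  ultimately show "cexact TYPE('k) {\<sigma>. \<sigma> \<subseteq> \<tau> \<and> \<tau> - \<sigma> \<in> \<U> \<inter> \<D>} i" using assms(3) by simp
qed

section \<open>Projective dimension of the module of logarithmic forms\<close>

context
  fixes E :: "'n::{finite, linorder} set set"
  assumes simple: "simple_graph E"
begin

abbreviation (input) cov_polys :: "('n, 'k::field) mpoly poly set" where
  "cov_polys \<equiv> supp_polys (covers E \<inter> proper)"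

abbreviation (input) cov_gr :: "int \<Rightarrow> ('n, 'k::field) mpoly poly set" where
  "cov_gr \<equiv> polygr (mons (covers E \<inter> proper) True)"

abbreviation (input) cov_log :: "(('n, 'k::field) mpoly fract ^ 'n::_) set" where
  "cov_log \<equiv> log_forms (graphic_arrangement E)"

lemma form_of_inj_on: "inj_on form_of (cov_polys :: ('n, 'k::field) mpoly poly set)"
proof (rule inj_onI)
  fix f g :: "('n, 'k) mpoly poly"
  assume fg: "f \<in> cov_polys" "g \<in> cov_polys" "form_of f = form_of g"
  have "f + - g \<in> cov_polys" by (intro supp_polys_add supp_polys_uminus fg)
  then have "f - g = 0"
    using fg(3) by (intro form_of_eq_zero[of "f - g" "covers E \<inter> proper"]) (simp_all add: form_of_diff)
  then show "f = g" by simp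
qed

lemma log_forms_subspace: "module.subspace form_scale (cov_log :: (('n, 'k::field) mpoly fract ^ 'n::_) set)"
proof -
  interpret fs: module "form_scale :: ('n, 'k) mpoly \<Rightarrow> _" by (rule module_form_scale)
  show ?thesis
    unfolding fs.subspace_def
  proof (intro conjI ballI allI)
    show "0 \<in> (cov_log :: (('n, 'k) mpoly fract ^ 'n::_) set)"
      unfolding log_forms_iff[OF simple] by (intro exI[of _ "\<lambda>_. 0"]) simp
  next
    fix x y :: "('n, 'k) mpoly fract ^ 'n::_" assume xy: "x \<in> cov_log" "y \<in> cov_log"
    show "x + y \<in> cov_log"
      using xy supp_polys_add unfolding form_of_image[OF simple, symmetric]
      by (elim imageE) (simp only: form_of_add[symmetric] imageI supp_polys_add)
  next
    fix p and x :: "('n, 'k) mpoly fract ^ 'n::_" assume "x \<in> cov_log"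
    then obtain g where g0: "(\<forall>i. to_fract (vand i) * x $ i = to_fract (g i)) \<and>
        (\<forall>i j. i \<noteq> j \<longrightarrow> Var i - Var j dvd g i - g j) \<and>
        (\<forall>i j. i \<noteq> j \<and> {i, j} \<notin> E \<longrightarrow> Var i - Var j dvd g i)"
      unfolding log_forms_iff[OF simple] by (rule exE)
    have "to_fract (vand i) * form_scale p x $ i = to_fract (p * g i)" for i
    proof -
      have "to_fract (vand i) * x $ i = to_fract (g i)" using g0 by blast
      then show ?thesis by (simp add: form_scale_def mult.left_commute)
    qed
    moreover have "Var i - Var j dvd p * g i - p * g j" if "i \<noteq> j" for i j
      using g0 that unfolding right_diff_distrib[symmetric] by (intro dvd_mult) blast
    moreover have "Var i - Var j dvd p * g i" if "i \<noteq> j \<and> {i, j} \<notin> E" for i j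
      using g0 that by (intro dvd_mult) blast
    ultimately show "form_scale p x \<in> cov_log"
      unfolding log_forms_iff[OF simple] by (intro exI[of _ "\<lambda>i. p * g i"]) blast
  qed
qed

lemma koszul_fam_cov: "koszul_fam (polyop (ymul proper)) (cov_gr :: int \<Rightarrow> ('n, 'k::field) mpoly poly set)"
  by (rule koszul_fam.koszul_fam_polygr[OF koszul_fam_mons[OF downset_proper upset_covers]])

text \<open>The grading is carried over from M_0[t] along the bijection \<open>form_of\<close>,
  inverted by \<open>inv_into\<close>.\<close>

lemma gmod_log_forms:
  "gmod form_scale cov_log (\<lambda>j. form_of ` cov_gr j)
    (\<lambda>j \<omega> :: ('n, 'k::field) mpoly fract ^ 'n::_. form_of (pgr j (inv_into cov_polys form_of \<omega>)))"
proof -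
  interpret fs: module "form_scale :: ('n, 'k) mpoly \<Rightarrow> _" by (rule module_form_scale)
  interpret K: koszul_fam "polyop (ymul proper)" "cov_gr :: int \<Rightarrow> ('n, 'k) mpoly poly set" by (rule koszul_fam_cov)
  let ?N = "cov_polys :: ('n, 'k) mpoly poly set"
  let ?L = "cov_log :: (('n, 'k) mpoly fract ^ 'n::_) set"
  let ?G = "\<lambda>j. form_of ` (cov_gr j :: ('n, 'k) mpoly poly set)"
  let ?i = "inv_into ?N form_of"
  have img: "form_of ` ?N = ?L" by (rule form_of_image[OF simple])
  have i1: "?i (form_of f) = f" if "f \<in> ?N" for f by (rule inv_into_f_f[OF form_of_inj_on that])
  have i2: "?i \<omega> \<in> ?N" "form_of (?i \<omega>) = \<omega>" if "\<omega> \<in> ?L" for \<omega>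
    using that unfolding img[symmetric] by (rule inv_into_into, rule f_inv_into_f)
  have sub: "cov_gr j \<subseteq> ?N" for j by (rule polygr_sub_supp_polys)
  show ?thesis
  proof unfold_locales
    fix a b :: "('n, 'k) mpoly fract ^ 'n::_" and i j :: int and c k
    show "fs.subspace ?L" by (rule log_forms_subspace)
    show "?G j \<subseteq> ?L" unfolding img[symmetric] by (rule image_mono[OF sub])
    show "0 \<in> ?G j"
      by (rule image_eqI[of _ _ 0]) (simp_all add: form_of_zero K.fam_zero)
    show "a + b \<in> ?G j" if "a \<in> ?G j" "b \<in> ?G j"
      using that by (elim imageE) (simp only: form_of_add[symmetric] imageI K.fam_add)
    show "form_scale (Const c) a \<in> ?G j" if "a \<in> ?G j"
      using that by (elim imageE) (simp only: form_of_smult[symmetric] imageI polygr_mons_smult)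
    show "form_scale (Var k) a \<in> ?G (j + 1)" if "a \<in> ?G j"
      using that by (elim imageE) (simp only: form_of_polyop[symmetric] imageI K.fam_op)
    show "form_of (pgr j (?i a)) \<in> ?G j" if "a \<in> ?L"
      by (intro imageI pgr_mem i2(1) that)
    show "form_of (pgr j (?i (a + b))) = form_of (pgr j (?i a)) + form_of (pgr j (?i b))"
      if a: "a \<in> ?L" and b: "b \<in> ?L"
    proof -
      have "?i (a + b) = ?i (form_of (?i a + ?i b))"
        by (simp only: form_of_add i2(2)[OF a] i2(2)[OF b])
      also have "\<dots> = ?i a + ?i b" by (intro i1 supp_polys_add i2(1) a b)
      finally show ?thesis by (simp only: pgr_add form_of_add)
    qed
    show "form_of (pgr j (?i a)) = (if i = j then a else 0)" if "a \<in> ?G i"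
    proof -
      obtain f where f: "a = form_of f" "f \<in> cov_gr i" using \<open>a \<in> ?G i\<close> by (rule imageE)
      have "?i a = f" unfolding f(1) by (rule i1) (use sub f(2) in blast)
      then show ?thesis using pgr_of_polygr[OF f(2), of j] f(1) by (simp add: form_of_zero)
    qed
    have z: "form_of (pgr j (?i a)) \<noteq> 0 \<longleftrightarrow> pgr j (?i a) \<noteq> 0" if a: "a \<in> ?L" for j
    proof -
      have "pgr j (?i a) \<in> ?N" using pgr_mem[OF i2(1)[OF a], of j] sub[of j] by blast
      then have "form_of (pgr j (?i a)) = 0 \<Longrightarrow> pgr j (?i a) = 0"
        by (rule form_of_eq_zero[rotated]) simp_all
      moreover have "form_of (pgr j (?i a)) = 0" if "pgr j (?i a) = 0"
        unfolding that by (rule form_of_zero)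
      ultimately show ?thesis by blast
    qed
    show "finite {j. form_of (pgr j (?i a)) \<noteq> 0}" if "a \<in> ?L"
      unfolding z[OF that] by (rule pgr_finite)
    show "(\<Sum>j | form_of (pgr j (?i a)) \<noteq> 0. form_of (pgr j (?i a))) = a" if "a \<in> ?L"
      unfolding z[OF that] form_of_sum[symmetric] pgr_sum by (rule i2(2)[OF that])
  qed
qed

text \<open>Adjoining t lowers the top degree of homology from \<open>Suc n\<close> to n. A list of
  all variables provides the zero product of operators, and its length enters the bound on internal
  degrees.\<close>

theorem proj_dim_log_forms:
  assumes above: "\<And>i j. i > Suc n \<Longrightarrow>
      kexact (ymul proper) (mons (covers E \<inter> proper) True :: int \<Rightarrow> ('n, 'k::field) mpoly set) i j"
    and at: "\<not> kexact (ymul proper) (mons (covers E \<inter> proper) True :: int \<Rightarrow> ('n, 'k) mpoly set) (Suc n) j0"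
  shows "proj_dim form_scale (cov_log :: (('n, 'k) mpoly fract ^ 'n::_) set) = enat n"
proof -
  interpret M0: koszul_fam "ymul proper" "mons (covers E \<inter> proper) True :: int \<Rightarrow> ('n, 'k) mpoly set"
    by (rule koszul_fam_mons[OF downset_proper upset_covers])
  interpret P: koszul_fam "polyop (ymul proper)" "cov_gr :: int \<Rightarrow> ('n, 'k) mpoly poly set" by (rule koszul_fam_cov)
  interpret L: gmod form_scale cov_log "\<lambda>j. form_of ` cov_gr j"
    "\<lambda>j \<omega> :: ('n, 'k::field) mpoly fract ^ 'n::_. form_of (pgr j (inv_into cov_polys form_of \<omega>))"
    by (rule gmod_log_forms)
  interpret h: koszul_epi "polyop (ymul proper)" "cov_gr :: int \<Rightarrow> ('n, 'k) mpoly poly set"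
    "\<lambda>k. form_scale (Var k)" "\<lambda>j. form_of ` cov_gr j" form_of
    by unfold_locales (simp_all add: form_of_add form_of_polyop)
  obtain ks :: "'n list" where ks: "set ks = UNIV" using finite_list[OF finite[of UNIV]] by (rule exE)
  have nil: "fold (ymul proper) ks a = 0" if "a \<in> mons (covers E \<inter> proper) True j" for j and a :: "('n, 'k) mpoly"
  proof (rule poly_mapping_eqI, rule ccontr)
    fix m assume "lookup (fold (ymul proper) ks a) m \<noteq> lookup 0 m"
    then have nz: "lookup (fold (ymul proper) ks a) m \<noteq> 0" by simp
    have "keys m' \<in> proper" if "lookup a m' \<noteq> 0" for m'
      using mons_memD[OF \<open>a \<in> mons (covers E \<inter> proper) True j\<close> that] by blast
    from fold_ymul_support[OF this nz] show False using ks by auto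
  qed
  let ?C = "cov_gr :: int \<Rightarrow> ('n, 'k) mpoly poly set"
  let ?G = "\<lambda>j. form_of ` ?C j"
  have iso: "kexact (\<lambda>k. form_scale (Var k)) (\<lambda>j. ?G j) i j \<longleftrightarrow>
      kexact (polyop (ymul proper)) ?C i j" for i j
  proof (rule h.kexact_iso)
    fix j and a :: "('n, 'k) mpoly poly" assume "a \<in> ?C j" "form_of a = 0"
    then show "a = 0" using polygr_sub_supp_polys form_of_eq_zero[of a "covers E \<inter> proper"] by blast
  qed
  have fd: "\<exists>B. finite B \<and> ?G j \<subseteq> L.kv.span B" for j
  proof -
    define B where "B = (\<Union>n\<le>nat j. (\<lambda>m. form_of (monom (single m (1 :: 'k)) n)) ` {m :: 'n \<Rightarrow>\<^sub>0 nat. mon_degree m = nat (j - int n)})"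
    have "finite B" by (simp add: B_def finite_mon_degree)
    moreover have "form_of f \<in> L.kv.span B" if "f \<in> ?C j" for f
    proof -
      note f = that[unfolded polygr_mons_iff]
      have "form_of (monom (coeff f n) n) \<in> L.kv.span B" for n
      proof -
        have "monom (coeff f n) n = (\<Sum>m\<in>keys (coeff f n). smult (Const (lookup (coeff f n) m)) (monom (single m 1) n))"
        proof -
          have "monom (\<Sum>x\<in>A. g x) n = (\<Sum>x\<in>A. monom (g x) n)" for A and g :: "('n \<Rightarrow>\<^sub>0 nat) \<Rightarrow> ('n, 'k) mpoly"
            by (induction A rule: infinite_finite_induct) (simp_all add: add_monom[symmetric])
          then have "monom (coeff f n) n = (\<Sum>m\<in>keys (coeff f n). monom (single m (lookup (coeff f n) m)) n)"
            by (metis poly_expand)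
          then show ?thesis by (simp add: smult_monom single_eq_Const_times[symmetric])
        qed
        then have "form_of (monom (coeff f n) n) =
            (\<Sum>m\<in>keys (coeff f n). form_scale (Const (lookup (coeff f n) m)) (form_of (monom (single m 1) n)))"
          by (simp only: form_of_sum form_of_smult)
        also have "\<dots> \<in> L.kv.span B"
        proof (intro L.kv.span_sum L.kv.span_scale L.kv.span_base)
          fix m assume "m \<in> keys (coeff f n)"
          then have d: "int (mon_degree m) = j - int n" using f by (simp add: in_keys_iff)
          then have "n \<le> nat j" "mon_degree m = nat (j - int n)" by simp_all
          then show "form_of (monom (single m 1) n) \<in> B" unfolding B_def by blast
        qed
        finally show ?thesis .
      qed
      then have "(\<Sum>n\<le>degree f. form_of (monom (coeff f n) n)) \<in> L.kv.span B" by (intro L.kv.span_sum)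
      then show ?thesis by (simp only: form_of_sum[symmetric] poly_as_sum_of_monoms)
    qed
    ultimately show ?thesis by blast
  qed
  have low: "?G j = {0}" if j: "j < 0" for j
  proof -
    have "?C j = {0}"
    proof (intro equalityI subsetI)
      fix f :: "('n, 'k) mpoly poly" assume "f \<in> ?C j"
      then have "pgr j f = f" using pgr_of_polygr[of f _ j j] by simp
      moreover have "pgr j f = 0" using j by (intro poly_eqI poly_mapping_eqI) (simp add: lookup_coeff_pgr)
      ultimately show "f \<in> {0}" by simp
    qed (simp add: P.fam_zero)
    then show ?thesis by (simp add: form_of_zero)
  qed
  show ?thesis
  proof (rule L.proj_dim_eq[OF fd low, of "int CARD('n) + int (length ks)"])
    show "kexact (\<lambda>k. form_scale (Var k)) (\<lambda>j. ?G j) i j"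
      if "j > int CARD('n) + int (length ks)" for i j
      unfolding iso
      by (rule M0.kexact_polyop_high_degree[OF nil kexact_mons_high_degree[OF downset_proper upset_covers] that])
    show ex: "kexact (\<lambda>k. form_scale (Var k)) (\<lambda>j. ?G j) i j" if "i > n" for i j
      unfolding iso by (rule M0.kexact_polyop[OF nil above]) (use that in simp_all)
    \<comment> \<open>Exactness of M_0[t] at \<open>Suc n\<close> lets the homology class of M_0 in
      degree j0 survive as one of M_0[t] at position n.\<close>
    have "kexact (polyop (ymul proper)) ?C (Suc n) j0"
      using ex[of "Suc n" j0] unfolding iso by simp
    from M0.not_kexact_polyop[OF at this]
    show "n = 0 \<or> (\<exists>j. \<not> kexact (\<lambda>k. form_scale (Var k)) (\<lambda>j. ?G j) n j)"
      unfolding iso by blast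
  qed
qed

end

section \<open>Edge ideals\<close>

lemma module_times: "module ((*) :: 'r::comm_ring_1 \<Rightarrow> 'r \<Rightarrow> 'r)"
  by unfold_locales (simp_all add: algebra_simps)

text \<open>The nonfaces of the clique complex: the supports of the monomials in the edge
  ideal.\<close>

definition dependent_sets :: "'n set set \<Rightarrow> 'n set set" where
  "dependent_sets E = {A. \<exists>u v. u \<noteq> v \<and> {u, v} \<notin> E \<and> u \<in> A \<and> v \<in> A}"

lemma upset_dependent_sets: "upset (dependent_sets E)"
  unfolding upset_def dependent_sets_def by blast

lemma downset_UNIV: "downset UNIV"
  by (simp add: downset_def)

lemma graph_complement_iff: "{u, v} \<in> graph_complement E \<longleftrightarrow> u \<noteq> v \<and> {u, v} \<notin> E"
  by (auto simp: graph_complement_def complete_graph_def card_insert_if)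

lemma times_mem_mons:
  fixes p :: "('n::{finite, linorder}, 'k::field) mpoly"
  assumes "upset \<U>" "f \<in> mons (\<U> \<inter> UNIV) False 0"
  shows "p * f \<in> mons (\<U> \<inter> UNIV) False 0"
  using assms(2)
proof (induction p arbitrary: f rule: mpoly_induct)
  case (Const c)
  show ?case
  proof (rule mons_memI)
    fix m assume "lookup (Const c * f) m \<noteq> 0"
    then have "lookup f m \<noteq> 0" by (auto simp: lookup_Const_times)
    from mons_memD[OF Const this] show "keys m \<in> \<U> \<inter> UNIV \<and> (False \<longrightarrow> int (mon_degree m) = 0)" by simp
  qed
next
  case (Var i)
  show ?case
  proof (rule mons_memI)
    fix m assume "lookup (Var i * f) m \<noteq> 0"
    then have "lookup f (m - single i 1) \<noteq> 0" by (simp add: lookup_Var_times split: if_splits)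
    from mons_memD[OF Var this] have "keys (m - single i 1) \<in> \<U>" by simp
    moreover have "keys (m - single i 1) \<subseteq> keys m" by (rule keys_diff_mon)
    ultimately show "keys m \<in> \<U> \<inter> UNIV \<and> (False \<longrightarrow> int (mon_degree m) = 0)"
      using assms(1) unfolding upset_def by blast
  qed
next
  case (add p q)
  show ?case
  proof (rule mons_memI)
    fix m assume "lookup ((p + q) * f) m \<noteq> 0"
    then have "lookup (p * f) m \<noteq> 0 \<or> lookup (q * f) m \<noteq> 0" by (auto simp: distrib_right lookup_add)
    then show "keys m \<in> \<U> \<inter> UNIV \<and> (False \<longrightarrow> int (mon_degree m) = 0)"
      using mons_memD[OF add.IH(1)[OF add.prems]] mons_memD[OF add.IH(2)[OF add.prems]] by blast
  qed
next
  case (mult p q)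
  show ?case unfolding mult.assoc by (intro mult.IH mult.prems)
qed

lemma mons_subspace:
  assumes "upset \<U>"
  shows "module.subspace (*) (mons (\<U> \<inter> UNIV) False 0 :: ('n::{finite, linorder}, 'k::field) mpoly set)"
proof -
  let ?I = "mons (\<U> \<inter> UNIV) False 0 :: ('n, 'k) mpoly set"
  interpret R: module "(*) :: ('n, 'k) mpoly \<Rightarrow> _" by (rule module_times)
  show ?thesis
    unfolding R.subspace_def
  proof (intro conjI ballI allI)
    show "0 \<in> ?I" by (simp add: mons_def)
    show "p * x \<in> ?I" if "x \<in> ?I" for p x by (rule times_mem_mons[OF assms that])
    fix x y assume xy: "x \<in> ?I" "y \<in> ?I"
    show "x + y \<in> ?I"
    proof (rule mons_memI)
      fix m assume "lookup (x + y) m \<noteq> 0"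
      then have "lookup x m \<noteq> 0 \<or> lookup y m \<noteq> 0" by (auto simp: lookup_add)
      then show "keys m \<in> \<U> \<inter> UNIV \<and> (False \<longrightarrow> int (mon_degree m) = 0)"
        using mons_memD[OF xy(1)] mons_memD[OF xy(2)] by blast
    qed
  qed
qed

lemma edge_ideal_eq_mons:
  "edge_ideal (graph_complement E) =
    (mons (dependent_sets E \<inter> UNIV) False 0 :: ('n::{finite, linorder}, 'k::field) mpoly set)"
proof -
  interpret R: module "(*) :: ('n, 'k) mpoly \<Rightarrow> _" by (rule module_times)
  let ?G = "{Var u * Var v | u v. {u, v} \<in> graph_complement E} :: ('n, 'k) mpoly set"
  let ?I = "mons (dependent_sets E \<inter> UNIV) False 0 :: ('n, 'k) mpoly set"
  have "R.subspace ?I" by (rule mons_subspace[OF upset_dependent_sets])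
  moreover have "?G \<subseteq> ?I"
  proof
    fix p assume "p \<in> ?G"
    then obtain u v where p: "p = Var u * Var v" and uv: "u \<noteq> v" "{u, v} \<notin> E"
      unfolding graph_complement_iff by blast
    show "p \<in> ?I"
    proof (rule mons_memI)
      fix m assume "lookup p m \<noteq> 0"
      then have "u \<in> keys m" "lookup (Var v :: ('n, 'k) mpoly) (m - single u 1) \<noteq> 0"
        by (simp_all add: p lookup_Var_times split: if_splits)
      moreover from this(2) have "m - single u 1 = single v 1"
        by (simp add: Var_def lookup_single when_def split: if_splits)
      then have "v \<in> keys (m - single u 1)" by simp
      then have "v \<in> keys m" using keys_diff_mon[of m "single u 1"] by blast
      ultimately show "keys m \<in> dependent_sets E \<inter> UNIV \<and> (False \<longrightarrow> int (mon_degree m) = 0)"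
        unfolding dependent_sets_def using uv by blast
    qed
  qed
  ultimately have "R.span ?G \<subseteq> ?I" by (intro R.span_minimal)
  moreover have "?I \<subseteq> R.span ?G"
  proof
    fix f assume f: "f \<in> ?I"
    have "single m (lookup f m) \<in> R.span ?G" if "m \<in> keys f" for m
    proof -
      have "lookup f m \<noteq> 0" using that by (simp add: in_keys_iff)
      then have "keys m \<in> dependent_sets E" using mons_memD[OF f] by blast
      then obtain u v where uv: "u \<noteq> v" "{u, v} \<notin> E" "u \<in> keys m" "v \<in> keys m"
        unfolding dependent_sets_def by blast
      have l: "lookup m u \<noteq> 0" "lookup (m - single u 1) v \<noteq> 0"
        using uv by (simp_all add: in_keys_iff lookup_minus lookup_single when_def)
      have "single m (lookup f m) = Var u * (Var v * single (m - single u 1 - single v 1) (lookup f m))"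
        unfolding Var_times_single mon_diff_add[OF l(2)] mon_diff_add[OF l(1)] ..
      also have "\<dots> = single (m - single u 1 - single v 1) (lookup f m) * (Var u * Var v)"
        by (simp only: mult_ac)
      also have "\<dots> \<in> R.span ?G"
        using uv(1,2) by (intro R.span_scale R.span_base) (auto simp: graph_complement_iff)
      finally show ?thesis .
    qed
    then have "(\<Sum>m\<in>keys f. single m (lookup f m)) \<in> R.span ?G" by (intro R.span_sum)
    then show "f \<in> R.span ?G" by (simp only: poly_expand[symmetric])
  qed
  ultimately show ?thesis unfolding edge_ideal_def by blast
qed

lemma mons_graded: "mons \<S> False 0 \<inter> homog j = mons \<S> True j"
  by (auto simp: mons_def homog_def)

lemma gmod_mons:
  assumes "upset \<U>"
  shows "gmod (*) (mons (\<U> \<inter> UNIV) False 0 :: ('n::{finite, linorder}, 'k::field) mpoly set)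
    (mons (\<U> \<inter> UNIV) True) hpart"
proof -
  let ?I = "mons (\<U> \<inter> UNIV) False 0 :: ('n, 'k) mpoly set"
  let ?g = "mons (\<U> \<inter> UNIV) True :: int \<Rightarrow> ('n, 'k) mpoly set"
  interpret R: module "(*) :: ('n, 'k) mpoly \<Rightarrow> _" by (rule module_times)
  interpret K: koszul_fam "ymul UNIV" ?g by (rule koszul_fam_mons[OF downset_UNIV assms])
  have I: "f \<in> ?I \<longleftrightarrow> (\<forall>m. lookup f m \<noteq> 0 \<longrightarrow> keys m \<in> \<U>)" for f
    by (simp add: mons_def Ball_def in_keys_iff)
  have g: "f \<in> ?g j \<longleftrightarrow> (\<forall>m. lookup f m \<noteq> 0 \<longrightarrow> keys m \<in> \<U> \<and> int (mon_degree m) = j)" for f j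
    by (simp add: mons_def Ball_def in_keys_iff)
  show ?thesis
  proof unfold_locales
    fix a b :: "('n, 'k) mpoly" and i j :: int and c :: 'k and k :: 'n
    show "R.subspace ?I" by (rule mons_subspace[OF assms])
    show "?g j \<subseteq> ?I" by (auto simp: mons_def)
    show "0 \<in> ?g j" by (rule K.fam_zero)
    show "a + b \<in> ?g j" if "a \<in> ?g j" "b \<in> ?g j" by (rule K.fam_add[OF that])
    show "Const c * a \<in> ?g j" if "a \<in> ?g j"
      unfolding g
    proof (intro allI impI)
      fix m assume "lookup (Const c * a) m \<noteq> 0"
      then have "lookup a m \<noteq> 0" by (auto simp: lookup_Const_times)
      then show "keys m \<in> \<U> \<and> int (mon_degree m) = j" using that unfolding g by blast
    qed
    show "Var k * a \<in> ?g (j + 1)" if "a \<in> ?g j"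
      using K.fam_op[OF that, of k] by (simp only: ymul_UNIV)
    show "hpart j (a + b) = hpart j a + hpart j b" by (rule hpart_add)
    show "hpart j a = (if i = j then a else 0)" if "a \<in> ?g i"
      by (rule hpart_of_homog) (use that in \<open>auto simp: mons_def homog_def\<close>)
    assume a: "a \<in> ?I"
    show "hpart j a \<in> ?g j"
      unfolding g
    proof (intro allI impI)
      fix m assume "lookup (hpart j a) m \<noteq> 0"
      then show "keys m \<in> \<U> \<and> int (mon_degree m) = j"
        using a unfolding I lookup_hpart by (auto split: if_splits)
    qed
    have sub: "{j. hpart j a \<noteq> 0} \<subseteq> (\<lambda>m. int (mon_degree m)) ` keys a"
    proof
      fix j assume "j \<in> {j. hpart j a \<noteq> 0}"
      then have "\<exists>m. lookup (hpart j a) m \<noteq> 0" by (auto simp: poly_mapping_eq_iff fun_eq_iff)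
      then obtain m where "lookup (hpart j a) m \<noteq> 0" by blast
      then have "int (mon_degree m) = j" "lookup a m \<noteq> 0" by (simp_all add: lookup_hpart split: if_splits)
      then show "j \<in> (\<lambda>m. int (mon_degree m)) ` keys a" by (intro image_eqI[of _ _ m]) (simp_all add: in_keys_iff)
    qed
    show fin: "finite {j. hpart j a \<noteq> 0}" by (rule finite_subset[OF sub]) simp
    show "(\<Sum>j | hpart j a \<noteq> 0. hpart j a) = a"
    proof (rule poly_mapping_eqI)
      fix m :: "'n \<Rightarrow>\<^sub>0 nat"
      let ?A = "{j. hpart j a \<noteq> 0}" and ?d = "int (mon_degree m)"
      have "lookup (\<Sum>j\<in>?A. hpart j a) m = (\<Sum>j\<in>?A. if j = ?d then lookup a m else 0)"
        unfolding lookup_sum lookup_hpart by (intro sum.cong refl) auto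
      also have "\<dots> = (if ?d \<in> ?A then lookup a m else 0)"
        using fin by simp
      also have "\<dots> = lookup a m"
      proof (cases "?d \<in> ?A")
        case False
        then have "lookup (hpart ?d a) m = 0" by simp
        then show ?thesis unfolding lookup_hpart by simp
      qed simp
      finally show "lookup (\<Sum>j\<in>?A. hpart j a) m = lookup a m" .
    qed
  qed
qed

text \<open>Betti numbers are read off Koszul homology in squarefree multidegrees. A graded free
  resolution exists because internal degrees above the number of variables are exact.\<close>

lemma betti_mons_nonzero_iff:
  assumes U: "upset \<U>"
  shows "betti (*) (mons (\<U> \<inter> UNIV) False 0 :: ('n::{finite, linorder}, 'k::field) mpoly set) (mons (\<U> \<inter> UNIV) True) i j \<noteq> 0 \<longleftrightarrow>
    (\<exists>\<tau>. int (card \<tau>) = j \<and> \<not> cexact TYPE('k) {\<sigma>. \<sigma> \<subseteq> \<tau> \<and> \<tau> - \<sigma> \<in> \<U>} i)"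
proof -
  let ?I = "mons (\<U> \<inter> UNIV) False 0 :: ('n, 'k) mpoly set"
  let ?g = "mons (\<U> \<inter> UNIV) True :: int \<Rightarrow> ('n, 'k) mpoly set"
  interpret gmod "(*)" ?I ?g hpart by (rule gmod_mons[OF U])
  have y: "(\<lambda>k p. Var k * p) = (ymul UNIV :: 'n \<Rightarrow> ('n, 'k) mpoly \<Rightarrow> _)" by (intro ext) (simp only: ymul_UNIV)
  have fd: "\<exists>B. finite B \<and> ?g j \<subseteq> kv.span B" for j
  proof (intro exI conjI subsetI)
    let ?B = "(\<lambda>m. single m (1 :: 'k)) ` {m :: 'n \<Rightarrow>\<^sub>0 nat. mon_degree m = nat j}"
    show "finite ?B" by (simp add: finite_mon_degree)
    fix f assume f: "f \<in> ?g j"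
    have "(\<Sum>m\<in>keys f. Const (lookup f m) * single m 1) \<in> kv.span ?B"
    proof (intro kv.span_sum kv.span_scale kv.span_base imageI CollectI)
      fix m assume "m \<in> keys f"
      then have "int (mon_degree m) = j" using f by (simp add: mons_def)
      then show "mon_degree m = nat j" by simp
    qed
    then show "f \<in> kv.span ?B" by (simp only: single_eq_Const_times[symmetric] poly_expand[symmetric])
  qed
  have low: "?g j = {0}" if "j < 0" for j
  proof -
    have "f = 0" if "f \<in> ?g j" for f
    proof (rule poly_mapping_eqI, rule ccontr)
      fix m assume "lookup f m \<noteq> lookup 0 m"
      then have "int (mon_degree m) = j" using mons_memD[OF \<open>f \<in> ?g j\<close>, of m] by simp
      then show False using \<open>j < 0\<close> by simp
    qed
    then show ?thesis using gr_zero by blast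
  qed
  have "\<exists>a d \<epsilon>. graded_free_resolution (*) ?I ?g a d \<epsilon> \<and>
    (\<forall>n. (\<forall>i>n. \<forall>j. kexact (\<lambda>k. (*) (Var k)) ?g i j) \<longrightarrow> (\<forall>i>n. a i = []))"
    by (rule graded_free_resolution_exists[OF fd low, of "int CARD('n)"])
      (use kexact_mons_high_degree[OF downset_UNIV U] y in \<open>simp_all\<close>)
  then obtain a d \<epsilon> where "graded_free_resolution (*) ?I ?g a d \<epsilon>" by blast
  from betti_nonzero_iff[OF this, of i j] show ?thesis
    unfolding y kexact_ymul_iff[OF downset_UNIV U] by simp
qed

section \<open>Comparison of projective dimension and regularity\<close>

text \<open>Exactness at i involves only sets of cardinality i - 1, i and i + 1.\<close>

lemma cexact_cong_high:
  fixes \<X> \<Y> :: "'n::{finite, linorder} set set"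
  assumes eq: "\<And>\<sigma>. i \<le> Suc (card \<sigma>) \<Longrightarrow> \<sigma> \<in> \<X> \<longleftrightarrow> \<sigma> \<in> \<Y>"
  shows "cexact TYPE('k::field) \<X> i \<longleftrightarrow> cexact TYPE('k) \<Y> i"
proof -
  have c: "cchain \<X> n = (cchain \<Y> n :: ('n set \<Rightarrow> 'k) set)" if "i \<le> n" for n
    unfolding cchain_def using eq that by (intro Collect_cong all_cong1 imp_cong refl) auto
  have b: "cbd \<X> c = cbd \<Y> c" if cn: "c \<in> cchain \<X> n" and n: "i \<le> n" for c :: "'n set \<Rightarrow> 'k" and n
  proof
    fix \<rho>
    show "cbd \<X> c \<rho> = cbd \<Y> c \<rho>"
    proof (cases "bd c \<rho> = 0")
      case True
      then show ?thesis by (simp add: cbd_def)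
    next
      case False
      obtain k where "k \<notin> \<rho>" "card (insert k \<rho>) = n" by (rule bd_nonzero[OF cn False])
      then have "\<rho> \<in> \<X> \<longleftrightarrow> \<rho> \<in> \<Y>" using n by (intro eq) simp
      then show ?thesis by (simp add: cbd_def)
    qed
  qed
  have ex: "(\<exists>e\<in>cchain \<X> (Suc i). cbd \<X> e = c) \<longleftrightarrow> (\<exists>e\<in>cchain \<Y> (Suc i). cbd \<Y> e = c)" for c :: "'n set \<Rightarrow> 'k"
  proof (rule bex_cong)
    show "cchain \<X> (Suc i) = (cchain \<Y> (Suc i) :: ('n set \<Rightarrow> 'k) set)" by (rule c) simp
    fix e :: "'n set \<Rightarrow> 'k" assume "e \<in> cchain \<Y> (Suc i)"
    then have "e \<in> cchain \<X> (Suc i)" unfolding c[OF le_SucI[OF order_refl]] .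
    then show "cbd \<X> e = c \<longleftrightarrow> cbd \<Y> e = c" by (simp only: b[OF _ le_SucI[OF order_refl]])
  qed
  show ?thesis
    unfolding cexact_def ex c[OF order_refl, symmetric]
    by (intro all_cong1 imp_cong refl) (simp only: b[OF _ order_refl])
qed

lemma cexact_above_card:
  fixes \<tau> :: "'n::{finite, linorder} set"
  assumes "\<X> \<subseteq> Pow \<tau>" "i > card \<tau>"
  shows "cexact TYPE('k::field) \<X> i"
  unfolding cexact_def
proof (intro allI impI)
  fix c :: "'n set \<Rightarrow> 'k" assume c: "c \<in> cchain \<X> i"
  have "c \<sigma> = 0" for \<sigma>
  proof (rule ccontr)
    assume "c \<sigma> \<noteq> 0"
    from cchainD[OF c this] have "\<sigma> \<subseteq> \<tau>" "card \<sigma> = i" using assms(1) by auto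
    then show False using card_mono[of \<tau> \<sigma>] assms(2) by simp
  qed
  then have "c = (\<lambda>_. 0)" by (intro ext)
  moreover have "cbd \<X> (\<lambda>_. 0 :: 'k) = (\<lambda>_. 0)"
    unfolding cbd_def cb.kd_zero by simp
  ultimately show "\<exists>e\<in>cchain \<X> (Suc i). cbd \<X> e = c" using cchain_zero by blast
qed

text \<open>A vertex is a cycle if the empty face is missing, but its augmentation is not zero.\<close>

lemma not_cexact_punctured:
  fixes \<X> :: "'n::{finite, linorder} set set"
  assumes "{} \<notin> \<X>" "{v} \<in> \<X>" and sing: "\<And>k e. k \<in> e \<Longrightarrow> e \<in> \<X> \<Longrightarrow> {k} \<in> \<X>"
  shows "\<not> cexact TYPE('k::field) \<X> 1"
proof
  assume L: "cexact TYPE('k) \<X> 1"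
  define c where "c = (\<lambda>\<sigma> :: 'n set. if \<sigma> = {v} then 1 else (0 :: 'k))"
  have c: "c \<in> cchain \<X> 1"
    by (rule cchainI) (use assms(2) in \<open>auto simp: c_def split: if_splits\<close>)
  have "cbd \<X> c \<rho> = 0" for \<rho>
  proof (cases "\<rho> = {}")
    case True
    then show ?thesis using assms(1) by (simp add: cbd_def)
  next
    case False
    have "bd c \<rho> = 0"
    proof (rule ccontr)
      assume "bd c \<rho> \<noteq> 0"
      then obtain k where "k \<notin> \<rho>" "card (insert k \<rho>) = 1" by (rule bd_nonzero[OF c])
      then show False using False by simp
    qed
    then show ?thesis by (simp add: cbd_def)
  qed
  then have "cbd \<X> c = (\<lambda>_. 0)" by (intro ext)
  with L c obtain e :: "'n set \<Rightarrow> 'k" where e: "e \<in> cchain \<X> (Suc 1)" "cbd \<X> e = c"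
    unfolding cexact_def by blast
  have be: "bd e = c"
  proof
    fix \<rho>
    show "bd e \<rho> = c \<rho>"
    proof (cases "\<rho> \<in> \<X>")
      case True
      then show ?thesis using fun_cong[OF e(2), of \<rho>] by (simp add: cbd_def)
    next
      case False
      have "bd e \<rho> = 0"
      proof (rule ccontr)
        assume "bd e \<rho> \<noteq> 0"
        then obtain k where k: "k \<notin> \<rho>" "insert k \<rho> \<in> \<X>" "card (insert k \<rho>) = Suc 1" by (rule bd_nonzero[OF e(1)])
        then have "card \<rho> = 1" by simp
        then obtain l where "\<rho> = {l}" by (rule card_1_singletonE)
        then show False using sing[of l "insert k \<rho>"] k(2) False by simp
      qed
      then show ?thesis using cchain_off[OF c False] by simp
    qed
  qed
  have "bd c {} = (\<Sum>k\<in>UNIV. if k = v then 1 else 0)"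
    unfolding kd_def by (intro sum.cong) (auto simp: c_def ksgn_def)
  then have "bd c {} = (1 :: 'k)" by simp
  moreover have "bd c {} = (0 :: 'k)" unfolding be[symmetric] cb.kd_kd by simp
  ultimately show False by simp
qed

theorem theorem7p19:
  fixes E :: "'n::{finite, linorder} set set"
  assumes "simple_graph E"
    and "E \<noteq> complete_graph"
  shows "ereal_of_enat
           (proj_dim form_scale (log_forms (graphic_arrangement E :: ('k::field ^ 'n::_) set set))) =
         ereal (real_of_int
           (ideal_regularity (edge_ideal (graph_complement E) :: ('n, 'k) mpoly set) - 2))"
proof -
  define \<Delta> where "\<Delta> = - dependent_sets E"
  have down: "downset \<Delta>"
    using upset_dependent_sets[of E] unfolding \<Delta>_def downset_def upset_def by blast
  have nonface: "A \<notin> \<Delta> \<longleftrightarrow> A \<in> dependent_sets E" for A by (simp add: \<Delta>_def)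
  let ?K = "\<lambda>\<tau>. {\<sigma>. \<sigma> \<subseteq> \<tau> \<and> \<tau> - \<sigma> \<notin> \<Delta>}"
  let ?M = "\<lambda>\<tau>. {\<sigma>. \<sigma> \<subseteq> \<tau> \<and> \<tau> - \<sigma> \<in> covers E \<inter> proper}"
  \<comment> \<open>The degrees whose maximum is the regularity: the Betti number at (i, i + j) is
    nonzero iff some \<tau> of cardinality i + j carries homology at index i.\<close>
  define J where "J = {j :: int. \<exists>i \<tau>. int (card \<tau>) = int i + j \<and> \<not> cexact TYPE('k) (?K \<tau>) i}"
  have reg: "ideal_regularity (edge_ideal (graph_complement E) :: ('n, 'k) mpoly set) = Max J"
    unfolding ideal_regularity_def regularity_def edge_ideal_eq_mons mons_graded
      betti_mons_nonzero_iff[OF upset_dependent_sets] J_def nonface ..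
  have "\<exists>e\<in>complete_graph. e \<notin> E" using assms unfolding simple_graph_def by blast
  then obtain u v :: 'n where uv: "u \<noteq> v" "{u, v} \<notin> E"
    unfolding complete_graph_def by (auto simp: card_2_iff)
  \<comment> \<open>The generator x_u x_v of a missing edge: in its multidegree only the empty set
    occurs, and it does not bound.\<close>
  have "\<not> cexact TYPE('k) (?K {u, v}) 0"
  proof
    assume L: "cexact TYPE('k) (?K {u, v}) 0"
    have K: "?K {u, v} = {{}}"
      using uv unfolding nonface dependent_sets_def by auto
    define c where "c = (\<lambda>\<sigma> :: 'n set. if \<sigma> = {} then 1 else (0 :: 'k))"
    have c: "c \<in> cchain {{}} 0" by (rule cchainI) (simp add: c_def split: if_splits)
    have "cbd {{}} c = (\<lambda>_. 0)" by (auto simp: cbd_def kd_def c_def)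
    with L c obtain e :: "'n set \<Rightarrow> 'k" where e: "e \<in> cchain {{}} (Suc 0)" "cbd {{}} e = c"
      unfolding cexact_def K by blast
    have "e (insert k {}) = 0" for k using cchain_off[OF e(1), of "insert k {}"] by simp
    then have "bd e {} = 0" unfolding kd_def by (intro sum.neutral ballI) simp
    then have "cbd {{}} e {} = 0" by (simp add: cbd_def)
    then show False unfolding e(2) by (simp add: c_def)
  qed
  then have J2: "2 \<in> J"
    using uv(1) unfolding J_def by (intro CollectI exI[of _ 0] exI[of _ "{u, v}"]) simp
  have "J \<subseteq> {0..int CARD('n)}"
  proof
    fix j assume "j \<in> J"
    then obtain i \<tau> where i: "int (card \<tau>) = int i + j" "\<not> cexact TYPE('k) (?K \<tau>) i"
      unfolding J_def by blast
    have "i \<le> card \<tau>"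
      using cexact_above_card[of "?K \<tau>" \<tau> i, where 'k='k] i(2) by (intro leI notI) blast
    moreover have "card \<tau> \<le> CARD('n)" by (rule card_mono) simp_all
    ultimately show "j \<in> {0..int CARD('n)}" using i(1) by auto
  qed
  then have fin: "finite J" by (rule finite_subset) simp
  \<comment> \<open>Since 2 belongs to J, the difference is nonnegative and the conversion loses
    nothing.\<close>
  define n where "n = nat (Max J - 2)"
  have r: "Max J = int (n + 2)" using Max_ge[OF fin J2] by (simp add: n_def)
  have rJ: "Max J \<in> J" using fin J2 by (intro Max_in) auto
  have exK: "cexact TYPE('k) (?K \<tau>) i" if "i + (n + 2) < card \<tau>" for \<tau> i
  proof (rule ccontr)
    assume "\<not> cexact TYPE('k) (?K \<tau>) i"
    then have "int (card \<tau>) - int i \<in> J" unfolding J_def by (intro CollectI exI[of _ i] exI[of _ \<tau>]) simp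
    from Max_ge[OF fin this] show False using that r by simp
  qed
  \<comment> \<open>Multidegree \<tau> gives the link of the complement of \<tau>. Excluding the
    full support removes a face only if \<tau> is the whole vertex set, and then only the empty
    face.\<close>
  have lkM: "?M \<tau> = {\<sigma> \<in> lk \<Delta> (- \<tau>) \<tau>. - \<tau> \<union> \<sigma> \<noteq> {}}" for \<tau>
    unfolding lk_def \<Delta>_def covers_def dependent_sets_def by auto
  have high: "cexact TYPE('k) (?M \<tau>) i \<longleftrightarrow> cexact TYPE('k) (lk \<Delta> (- \<tau>) (- (- \<tau>))) i" if "i \<ge> 2" for \<tau> i
  proof (rule cexact_cong_high)
    fix \<sigma> :: "'n set" assume "i \<le> Suc (card \<sigma>)"
    then have "\<sigma> \<noteq> {}" using that by auto
    then show "\<sigma> \<in> ?M \<tau> \<longleftrightarrow> \<sigma> \<in> lk \<Delta> (- \<tau>) (- (- \<tau>))" unfolding lkM by auto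
  qed
  \<comment> \<open>No Betti number lies beyond regularity n + 2, which by duality is exactness of
    the links from index n + 2 on.\<close>
  have lkex: "cexact TYPE('k) (lk \<Delta> F (- F)) i" if "i \<ge> n + 2" for F i
    using nonfaces_exact_iff_links_exact[OF down, of "n + 2", where 'k='k] exK that by simp
  have above: "kexact (ymul proper) (mons (covers E \<inter> proper) True :: int \<Rightarrow> ('n, 'k) mpoly set) i j"
    if i: "i > Suc n" for i j
  proof -
    have "cexact TYPE('k) (?M \<tau>) i" for \<tau>
    proof -
      have "i \<ge> 2" "i \<ge> n + 2" using i by simp_all
      then show ?thesis unfolding high[OF \<open>i \<ge> 2\<close>] by (intro lkex)
    qed
    then show ?thesis unfolding kexact_ymul_iff[OF downset_proper upset_covers] by blast
  qed
  \<comment> \<open>Index 1 still sees the missing empty face, so n = 0 stands apart: in the full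
    multidegree a vertex is a cycle that does not bound.\<close>
  have "\<exists>\<tau>. \<not> cexact TYPE('k) (?M \<tau>) (Suc n)"
  proof (cases "n = 0")
    case True
    have "\<not> cexact TYPE('k) (?M UNIV) 1"
    proof (rule not_cexact_punctured)
      show "{} \<notin> ?M UNIV" by simp
      show "{v} \<in> ?M UNIV" unfolding covers_def by auto
      show "{k} \<in> ?M UNIV" if "k \<in> e" "e \<in> ?M UNIV" for k e unfolding covers_def by auto
    qed
    then show ?thesis unfolding True One_nat_def by (rule exI)
  next
    case False
    show ?thesis
    proof (rule ccontr)
      \<comment> \<open>Exactness at \<open>Suc n\<close> as well would bound the regularity by n +
        1, against the maximum n + 2 attained in J.\<close>
      assume ex: "\<nexists>\<tau>. \<not> cexact TYPE('k) (?M \<tau>) (Suc n)"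
      have "cexact TYPE('k) (lk \<Delta> F (- F)) i" if i: "i \<ge> Suc n" for F i
      proof (cases "i = Suc n")
        case True
        have "i \<ge> 2" using i False by simp
        from high[OF this, of "- F"] show ?thesis using ex unfolding True by simp
      next
        case False
        then show ?thesis using i by (intro lkex) simp
      qed
      then have all: "cexact TYPE('k) (?K \<tau>) i" if "i + Suc n < card \<tau>" for \<tau> i
        using nonfaces_exact_iff_links_exact[OF down, of "Suc n", where 'k='k] that by simp
      obtain i \<tau> where i: "int (card \<tau>) = int i + Max J" "\<not> cexact TYPE('k) (?K \<tau>) i"
        using rJ unfolding J_def by blast
      show False using all[of i \<tau>] i r by simp
    qed
  qed
  then obtain \<tau> where "\<not> cexact TYPE('k) (?M \<tau>) (Suc n)" by blast
  then have "\<not> kexact (ymul proper) (mons (covers E \<inter> proper) True :: int \<Rightarrow> ('n, 'k) mpoly set) (Suc n) (int (card \<tau>))"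
    unfolding kexact_ymul_iff[OF downset_proper upset_covers] by blast
  from proj_dim_log_forms[OF assms(1) above this]
  show ?thesis unfolding reg r by simp
qed

end
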